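(* Let $n\ge 1$ and $G_{\rm gh}\in\{0,1\}$. Consider the coboundary operator $$\delta=\mathcal B+\hat{\mathcal W}^{\rm S}_{(\xi)}+\mathcal W^{\rm T}_{(\varepsilon)}+{\rm Tr}(u\hat{\mathcal G}+v\hat{\mathcal F})+\xi^\mu\frac{\partial}{\partial\varepsilon^\mu}+{\rm Tr}\Big(u\frac{\partial}{\partial v}\Big),\qquad \delta^2=0,$$ acting on the space of integrated local functionals of the ladder fields $\hat\phi^{(1)},\hat\phi^{(2)}$ on $\mathbb R^{n+2}$ and of the global ghosts $\xi,\varepsilon,u,v$ (see context). Then the cohomology of $\delta$ in ghost number $G_{\rm gh}$ is given by all linear superpositions of the functionals $$\Delta=\int_{\mathbb R^{n+2}}\frac1{(n+2)!}\,\nabla^{n+2}\prod_{k=1}^{K}{\rm Tr}\,c^{n_k},\qquad \sum_{k=1}^K n_k=n+2+G_{\rm gh},\quad n_k\ \text{odd},$$ where $c=\hat\phi^{(1)}_0$. That is: each such superposition is a $\delta$-cocycle; it is not a $\delta$-coboundary if the corresponding superposition of zero-forms $\prod_k{\rm Tr}\,c^{n_k}$ is non-zero; and every solution $\Delta'$ of $\delta\Delta'=0$ of ghost number $G_{\rm gh}$ equals such a superposition plus $\delta\Delta''$ for some $\Delta''$ of ghost number $G_{\rm gh}-1$ in the same space of functionals.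
   Context: Let $G$ be a simple Lie group with basis $T_a$ of its Lie algebra in the fundamental representation, ${\rm Tr}\,T_aT_b=\delta_{ab}$. The ladder fields $\hat\phi^{(A)}_p$, $A=1,2$, $0\le p\le n+2$, are Lie-algebra-valued $p$-forms on flat $\mathbb R^{n+2}$; $\hat\phi^{(1)}_p$ has ghost number $1-p$ and $\hat\phi^{(2)}_p$ has ghost number $n-p$. Write $c=\hat\phi^{(1)}_0$, $B^n_0=\hat\phi^{(2)}_0$. The grading of a form is the parity of (ghost number + form degree) and $[\cdot,\cdot]$ is the graded commutator. Forms whose degree is outside $0,\dots,n+2$ are zero. Global ghosts: constants $\xi^\mu,\varepsilon^\mu$ ($1\le\mu\le n+2$) and Lie-algebra-valued constants $u=u^aT_a$, $v=v^aT_a$, of ghost numbers $2,1,n,n-1$ respectively, with grading equal to the parity of their ghost number. Local functionals: integrals over $\mathbb R^{n+2}$ (i.e. modulo total derivatives) of $(n+2)$-forms which are polynomials, without field-independent term, in the fields, their derivatives and the global ghosts, with Poincaré invariance (in particular translation invariance). Operators on the ladder fields (extended as graded derivations): - $\mathcal B\hat\phi^{(1)}_p=d\hat\phi^{(1)}_{p-1}+\frac12\sum_{q}[\hat\phi^{(1)}_q,\hat\phi^{(1)}_{p-q}]$ and $\mathcal B\hat\phi^{(2)}_p=d\hat\phi^{(2)}_{p-1}+\sum_{q}[\hat\phi^{(1)}_q,\hat\phi^{(2)}_{p-q}]$. - $\hat{\mathcal W}^{\rm S}_{(\xi)}\hat\phi^{(A)}_p=-i_\xi\hat\phi^{(A)}_{p+1}$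 for $p\le n+1$, and $0$ for $p=n+2$. Write $\hat{\mathcal W}^{\rm S}_{(\xi)}=\xi^\mu\hat{\mathcal W}^{\rm S}_\mu$. - $\mathcal W^{\rm T}_{(\varepsilon)}\hat\phi^{(A)}_p=\mathcal L_\varepsilon\hat\phi^{(A)}_p$ (Lie derivative along the constant vector $\varepsilon$). - $\hat{\mathcal G}=\int_{\mathbb R^{n+2}}\frac{\delta}{\delta B^n_0}$ (constant Lie-algebra-valued shifts of $B^n_0$) and $\hat{\mathcal F}=\int_{\mathbb R^{n+2}}\sum_{p=0}^{n+2}\big[\hat\phi^{(1)}_p,\frac{\delta}{\delta\hat\phi^{(2)}_p}\big]$. In the graded sense these satisfy $\mathcal B^2=0$, $[\hat{\mathcal W}^{\rm S}_{(\xi)},\mathcal B]=\mathcal W^{\rm T}_{(\xi)}$, $[\mathcal W^{\rm T}_{(\varepsilon)},\mathcal B]=0$, $[\hat{\mathcal G},\mathcal B]=\hat{\mathcal F}$, $[\hat{\mathcal F},\mathcal B]=0$, and $\hat{\mathcal W}^{\rm S},\mathcal W^{\rm T},\hat{\mathcal G},\hat{\mathcal F}$ mutually (anti)commute; sign conventions are those making $\delta^2=0$. - The ladder climbing operator is the derivation $\nabla=dx^\mu\hat{\mathcal W}^{\rm S}_\mu$, acting by $\nabla\hat\phi^{(A)}_p=(p+1)\hat\phi^{(A)}_{p+1}$ for $0\le p\le n+1$ and $\nabla\hat\phi^{(A)}_{n+2}=0$; it commutes with $d$.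
   Formalization: Ghost numbers of u, v are corrected to n+1, n. "Every solution equals such a superposition plus δΔ''" is claimed only if products of Tr c^k span the invariants of degree n+2+G (fails e.g. for so(8), n=5, G=0) and not for G=0, n=1,2, where Tr(φ̂^(2)−v)^(4−n) gives an extra class. *)

theory Defs
  imports "HOL-Analysis.Analysis" "HOL-Library.Multiset" "HOL-Library.Poly_Mapping"
begin

section \<open>Free graded-commutative algebras over the complex numbers\<close>

class graded_generator =
  fixes is_odd :: "'a \<Rightarrow> bool"

text \<open>
  A monomial is a multiset of generators in which an odd generator occurs at most once.  It stands
  for the product of its factors with the odd ones written in increasing order with respect to an
  arbitrary linear order; another choice of order only changes signs of basis monomials.
\<close>

definition gen_order :: "('g \<times> 'g) set"
  where "gen_order = (SOME r. well_order_on UNIV r)"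

definition admissible :: "'g::graded_generator multiset \<Rightarrow> bool"
  where "admissible m \<longleftrightarrow> (\<forall>g. is_odd g \<longrightarrow> count m g \<le> 1)"

definition inversions :: "'g::graded_generator multiset \<Rightarrow> 'g multiset \<Rightarrow> nat"
  where "inversions m m' = (\<Sum>g\<in>#m. \<Sum>h\<in>#m'.
    (if is_odd g \<and> is_odd h \<and> g \<noteq> h \<and> (h, g) \<in> gen_order then 1 else 0))"

definition koszul :: "'g::graded_generator multiset \<Rightarrow> 'g multiset \<Rightarrow> complex"
  where "koszul m m' =
    (if \<exists>g. is_odd g \<and> g \<in># m \<and> g \<in># m' then 0 else (-1) ^ inversions m m')"

lemma koszul_empty [simp]: "koszul {#} m = 1" "koszul m {#} = 1"
  by (simp_all add: koszul_def inversions_def)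

lemma inversions_add:
  "inversions (m + m') k = inversions m k + inversions m' k"
  "inversions k (m + m') = inversions k m + inversions k m'"
  by (simp_all add: inversions_def sum_mset.distrib)

lemma koszul_assoc: "koszul a b * koszul (a + b) c = koszul b c * koszul a (b + c)"
  unfolding koszul_def by (auto simp: inversions_add power_add)

lemma admissible_add:
  assumes "admissible a" "admissible b" "koszul a b \<noteq> 0"
  shows "admissible (a + b)"
  unfolding admissible_def
proof (intro allI impI)
  fix g :: 'a assume g: "is_odd g"
  with assms(3) have "g \<notin># a \<or> g \<notin># b"
    by (auto simp: koszul_def split: if_splits)
  moreover have "count a g \<le> 1" "count b g \<le> 1"
    using assms(1,2) g by (auto simp: admissible_def)
  ultimately show "count (a + b) g \<le> 1"
    by (auto simp: not_in_iff)
qed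

definition raw_mult ::
  "('g::graded_generator multiset \<Rightarrow>\<^sub>0 complex) \<Rightarrow> ('g multiset \<Rightarrow>\<^sub>0 complex) \<Rightarrow> ('g multiset \<Rightarrow>\<^sub>0 complex)"
  where "raw_mult x y = (\<Sum>a\<in>Poly_Mapping.keys x. \<Sum>b\<in>Poly_Mapping.keys y.
    Poly_Mapping.single (a + b) (koszul a b * Poly_Mapping.lookup x a * Poly_Mapping.lookup y b))"

lemma raw_mult_superset:
  assumes "finite A" "finite B" "Poly_Mapping.keys x \<subseteq> A" "Poly_Mapping.keys y \<subseteq> B"
  shows "raw_mult x y = (\<Sum>a\<in>A. \<Sum>b\<in>B.
    Poly_Mapping.single (a + b) (koszul a b * Poly_Mapping.lookup x a * Poly_Mapping.lookup y b))"
proof -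
  have "raw_mult x y = (\<Sum>a\<in>Poly_Mapping.keys x. \<Sum>b\<in>B.
    Poly_Mapping.single (a + b) (koszul a b * Poly_Mapping.lookup x a * Poly_Mapping.lookup y b))"
    unfolding raw_mult_def
    by (intro sum.cong refl sum.mono_neutral_left) (use assms in \<open>auto simp: in_keys_iff\<close>)
  also have "\<dots> = (\<Sum>a\<in>A. \<Sum>b\<in>B.
    Poly_Mapping.single (a + b) (koszul a b * Poly_Mapping.lookup x a * Poly_Mapping.lookup y b))"
    by (intro sum.mono_neutral_left) (use assms in \<open>auto simp: in_keys_iff\<close>)
  finally show ?thesis .
qed

lemma raw_mult_add_left: "raw_mult (x + y) z = raw_mult x z + raw_mult y z"
proof -
  let ?A = "Poly_Mapping.keys x \<union> Poly_Mapping.keys y \<union> Poly_Mapping.keys (x + y)"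
  have "raw_mult w z = (\<Sum>a\<in>?A. \<Sum>b\<in>Poly_Mapping.keys z.
    Poly_Mapping.single (a + b) (koszul a b * Poly_Mapping.lookup w a * Poly_Mapping.lookup z b))"
    if "w \<in> {x, y, x + y}" for w
    by (rule raw_mult_superset) (use that in auto)
  then show ?thesis
    by (simp add: sum.distrib[symmetric] single_add[symmetric] lookup_add algebra_simps)
qed

lemma raw_mult_add_right: "raw_mult z (x + y) = raw_mult z x + raw_mult z y"
proof -
  let ?A = "Poly_Mapping.keys x \<union> Poly_Mapping.keys y \<union> Poly_Mapping.keys (x + y)"
  have "raw_mult z w = (\<Sum>a\<in>Poly_Mapping.keys z. \<Sum>b\<in>?A.
    Poly_Mapping.single (a + b) (koszul a b * Poly_Mapping.lookup z a * Poly_Mapping.lookup w b))"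
    if "w \<in> {x, y, x + y}" for w
    by (rule raw_mult_superset) (use that in auto)
  then show ?thesis
    by (simp add: sum.distrib[symmetric] single_add[symmetric] lookup_add algebra_simps)
qed

lemma raw_mult_zero [simp]: "raw_mult 0 x = 0" "raw_mult x 0 = 0"
  by (simp_all add: raw_mult_def)

lemma raw_mult_single:
  "raw_mult (Poly_Mapping.single a s) (Poly_Mapping.single b t) =
   Poly_Mapping.single (a + b) (koszul a b * s * t)"
  by (subst raw_mult_superset[of "{a}" "{b}"]) (auto split: if_splits)

lemma raw_mult_sum_left: "raw_mult (\<Sum>i\<in>I. f i) z = (\<Sum>i\<in>I. raw_mult (f i) z)"
  by (induction I rule: infinite_finite_induct) (auto simp: raw_mult_add_left)

lemma raw_mult_sum_right: "raw_mult z (\<Sum>i\<in>I. f i) = (\<Sum>i\<in>I. raw_mult z (f i))"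
  by (induction I rule: infinite_finite_induct) (auto simp: raw_mult_add_right)

lemma raw_expand:
  "(x :: 'k \<Rightarrow>\<^sub>0 complex) = (\<Sum>a\<in>Poly_Mapping.keys x. Poly_Mapping.single a (Poly_Mapping.lookup x a))"
  by (rule poly_mapping_eqI)
    (auto simp: lookup_sum lookup_single when_def in_keys_iff sum.delta)

lemma raw_mult_assoc: "raw_mult (raw_mult x y) z = raw_mult x (raw_mult y z)"
proof -
  have *: "raw_mult (raw_mult (Poly_Mapping.single a r) (Poly_Mapping.single b s)) (Poly_Mapping.single c t)
    = raw_mult (Poly_Mapping.single a r) (raw_mult (Poly_Mapping.single b s) (Poly_Mapping.single c t))"
    for a b c :: "'a multiset" and r s t
    using koszul_assoc[of a b c] by (simp add: raw_mult_single add.assoc algebra_simps)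
  let ?e = "\<lambda>w :: 'a multiset \<Rightarrow>\<^sub>0 complex.
    \<Sum>a\<in>Poly_Mapping.keys w. Poly_Mapping.single a (Poly_Mapping.lookup w a)"
  have "raw_mult (raw_mult (?e x) (?e y)) (?e z) = raw_mult (?e x) (raw_mult (?e y) (?e z))"
    by (simp only: raw_mult_sum_left raw_mult_sum_right *)
  then show ?thesis
    by (simp only: raw_expand[symmetric])
qed

lemma raw_mult_one [simp]:
  "raw_mult (Poly_Mapping.single {#} 1) x = x" "raw_mult x (Poly_Mapping.single {#} 1) = x"
proof -
  let ?e = "\<Sum>a\<in>Poly_Mapping.keys x. Poly_Mapping.single a (Poly_Mapping.lookup x a)"
  have "raw_mult (Poly_Mapping.single {#} 1) ?e = ?e" "raw_mult ?e (Poly_Mapping.single {#} 1) = ?e"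
    by (simp_all only: raw_mult_sum_left raw_mult_sum_right raw_mult_single koszul_empty
      mult_1_left mult_1_right add_0_left add_0_right)
  then show "raw_mult (Poly_Mapping.single {#} 1) x = x" "raw_mult x (Poly_Mapping.single {#} 1) = x"
    by (simp_all only: raw_expand[symmetric])
qed

lemma raw_mult_admissible:
  assumes x: "\<And>m. m \<in> Poly_Mapping.keys x \<Longrightarrow> admissible m"
    and y: "\<And>m. m \<in> Poly_Mapping.keys y \<Longrightarrow> admissible m"
    and m: "m \<in> Poly_Mapping.keys (raw_mult x y)"
  shows "admissible m"
proof -
  from m obtain a where a: "a \<in> Poly_Mapping.keys x" and "m \<in> Poly_Mapping.keys
      (\<Sum>b\<in>Poly_Mapping.keys y. Poly_Mapping.single (a + b)
        (koszul a b * Poly_Mapping.lookup x a * Poly_Mapping.lookup y b))"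
    unfolding raw_mult_def by (rule UN_E[OF subsetD[OF keys_sum]])
  from this(2) obtain b where b: "b \<in> Poly_Mapping.keys y" and ab: "m \<in> Poly_Mapping.keys
      (Poly_Mapping.single (a + b) (koszul a b * Poly_Mapping.lookup x a * Poly_Mapping.lookup y b))"
    by (rule UN_E[OF subsetD[OF keys_sum]])
  from ab have "m = a + b" "koszul a b \<noteq> 0"
    by (auto split: if_splits)
  then show ?thesis
    using admissible_add[OF x[OF a] y[OF b]] by simp
qed

typedef (overloaded) 'g salg =
  "{p :: 'g::graded_generator multiset \<Rightarrow>\<^sub>0 complex. \<forall>m\<in>Poly_Mapping.keys p. admissible m}"
  by (rule exI[of _ 0]) simp

setup_lifting type_definition_salg

instantiation salg :: (graded_generator) ring_1
begin

lift_definition zero_salg :: "'a salg" is 0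
  by simp

lift_definition one_salg :: "'a salg" is "Poly_Mapping.single {#} 1"
  by (simp add: admissible_def)

lift_definition plus_salg :: "'a salg \<Rightarrow> 'a salg \<Rightarrow> 'a salg" is "(+)"
  by (meson UnE keys_add subsetD)

lift_definition uminus_salg :: "'a salg \<Rightarrow> 'a salg" is uminus
  by simp

lift_definition minus_salg :: "'a salg \<Rightarrow> 'a salg \<Rightarrow> 'a salg" is "(-)"
  by (meson UnE keys_diff subsetD)

lift_definition times_salg :: "'a salg \<Rightarrow> 'a salg \<Rightarrow> 'a salg" is raw_mult
  by (rule raw_mult_admissible)

instance
proof
  note reps = Rep_salg_inject[symmetric] zero_salg.rep_eq one_salg.rep_eq plus_salg.rep_eq
    uminus_salg.rep_eq minus_salg.rep_eq times_salg.rep_eq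
  fix a b c :: "'a salg"
  show "a * b * c = a * (b * c)"
    unfolding reps by (rule raw_mult_assoc)
  show "1 * a = a" "a * 1 = a"
    unfolding reps by (rule raw_mult_one)+
  show "(a + b) * c = a * c + b * c"
    unfolding reps by (rule raw_mult_add_left)
  show "a * (b + c) = a * b + a * c"
    unfolding reps by (rule raw_mult_add_right)
  show "a + b + c = a + (b + c)"
    unfolding reps by (rule add.assoc)
  show "a + b = b + a"
    unfolding reps by (rule add.commute)
  show "0 + a = a"
    unfolding reps by (rule add_0_left)
  show "- a + a = 0"
    unfolding reps by (rule left_minus)
  show "a - b = a + - b"
    unfolding reps by (rule diff_conv_add_uminus)
  have "(0 :: 'a multiset \<Rightarrow>\<^sub>0 complex) \<noteq> Poly_Mapping.single {#} 1"
  proof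
    assume "(0 :: 'a multiset \<Rightarrow>\<^sub>0 complex) = Poly_Mapping.single {#} 1"
    from arg_cong[OF this, of "\<lambda>p. Poly_Mapping.lookup p {#}"] show False
      by simp
  qed
  then show "(0::'a salg) \<noteq> 1"
    unfolding reps .
qed

end

lift_definition coef :: "'g::graded_generator salg \<Rightarrow> 'g multiset \<Rightarrow> complex"
  is Poly_Mapping.lookup .

lift_definition supp :: "'g::graded_generator salg \<Rightarrow> 'g multiset set"
  is Poly_Mapping.keys .

lift_definition mon :: "'g::graded_generator multiset \<Rightarrow> 'g salg"
  is "\<lambda>m. if admissible m then Poly_Mapping.single m 1 else 0"
  by (simp split: if_splits)

lift_definition cst :: "complex \<Rightarrow> 'g::graded_generator salg"
  is "Poly_Mapping.single {#}"
  by (simp add: admissible_def split: if_splits)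

abbreviation gen :: "'g::graded_generator \<Rightarrow> 'g salg"
  where "gen g \<equiv> mon {#g#}"

text \<open>
  The graded derivation with values \<open>D g\<close> on the generators, in the form
  \<open>\<Sum>g. D g * \<partial>\<^sub>g\<close> with left partial derivatives \<open>\<partial>\<^sub>g\<close>; the sign \<open>koszul\<close> is the one picked up when \<open>g\<close>
  is moved to the front.  If \<open>D\<close> raises the parity of all generators by the same amount \<open>\<pi>\<close>, this is
  the derivation of parity \<open>\<pi>\<close>, \<open>D (x * y) = D x * y + (-1)^(\<pi> * \<bar>x\<bar>) * x * D y\<close>.
\<close>

definition der :: "('g::graded_generator \<Rightarrow> 'g salg) \<Rightarrow> 'g salg \<Rightarrow> 'g salg"
  where "der D x = (\<Sum>m\<in>supp x. \<Sum>g\<in>set_mset m.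
    cst (coef x m * of_nat (count m g) * koszul {#g#} (m - {#g#})) * D g * mon (m - {#g#}))"

definition partial :: "'g::graded_generator \<Rightarrow> 'g salg \<Rightarrow> 'g salg"
  where "partial g = der (\<lambda>h. if h = g then 1 else 0)"

section \<open>Jets of the ladder fields and global ghosts\<close>

text \<open>
  Space-time indices range over the finite type \<open>'m\<close>, so that the space-time dimension is
  \<open>n + 2 = CARD('m)\<close>; Lie algebra indices range over the finite type \<open>'a\<close>.
  \<open>Jet A a I S\<close> is the derivative \<open>\<partial>\<^sub>I\<close> of the component of \<open>\<phi>\<^sup>(\<^sup>A\<^sup>)\<close> along \<open>T\<^sub>a\<close> and
  along the basis \<open>p\<close>-form with index set \<open>S\<close>, \<open>p = card S\<close>.
\<close>

datatype ladder = One | Two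

datatype ('m, 'a) symb =
  Dx 'm | Jet ladder 'a "'m multiset" "'m set" | Xi 'm | Eps 'm | U 'a | V 'a

text \<open>
  Since the shift \<open>B\<^sub>0 \<mapsto> u\<close> and the derivation \<open>u \<partial>/\<partial>v\<close> have to raise the ghost number by one,
  \<open>u\<close> and \<open>v\<close> carry ghost numbers \<open>n + 1\<close> and \<open>n\<close>.
\<close>

fun gh :: "('m, 'a) symb \<Rightarrow> int" where
  "gh (Dx _) = 0"
| "gh (Jet One _ _ S) = 1 - int (card S)"
| "gh (Jet Two _ _ S) = int CARD('m) - 2 - int (card S)"
| "gh (Xi _) = 2"
| "gh (Eps _) = 1"
| "gh (U _) = int CARD('m) - 1"
| "gh (V _) = int CARD('m) - 2"

fun is_dx :: "('m, 'a) symb \<Rightarrow> bool" where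
  "is_dx (Dx _) = True"
| "is_dx _ = False"

fun is_field :: "('m, 'a) symb \<Rightarrow> bool" where
  "is_field (Jet _ _ _ _) = True"
| "is_field _ = False"

text \<open>Total parity: ghost number plus form degree.\<close>

instantiation symb :: (type, type) graded_generator
begin

definition is_odd_symb :: "('a, 'b) symb \<Rightarrow> bool"
  where "is_odd_symb g \<longleftrightarrow> odd (gh g + (if is_dx g then 1 else 0))"

instance ..

end

type_synonym ('m, 'a) loc = "('m, 'a) symb salg"

section \<open>Exterior calculus\<close>

definition dx_set :: "'m::finite set \<Rightarrow> ('m, 'a) loc"
  where "dx_set S = mon (image_mset Dx (mset_set S))"

text \<open>\<open>cof S x\<close> is the \<open>dx\<close>-free cofactor in \<open>x = (\<Sum>S. dx_set S * cof S x)\<close>.\<close>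

definition cof :: "'m::finite set \<Rightarrow> ('m, 'a) loc \<Rightarrow> ('m, 'a) loc"
  where "cof S x =
    (\<Sum>m | m \<in> supp x \<and> filter_mset is_dx m = image_mset Dx (mset_set S).
      cst (coef x m * koszul (filter_mset is_dx m) (filter_mset (\<lambda>g. \<not> is_dx g) m)) *
      mon (filter_mset (\<lambda>g. \<not> is_dx g) m))"

definition tderiv :: "'m \<Rightarrow> ('m, 'a) loc \<Rightarrow> ('m, 'a) loc"
  where "tderiv \<mu> = der (\<lambda>g. case g of Jet A a I S \<Rightarrow> gen (Jet A a (add_mset \<mu> I) S) | _ \<Rightarrow> 0)"

definition dext :: "('m::finite, 'a) loc \<Rightarrow> ('m, 'a) loc"
  where "dext x = (\<Sum>\<mu>\<in>UNIV. gen (Dx \<mu>) * tderiv \<mu> x)"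

definition interior_eps :: "('m::finite, 'a) loc \<Rightarrow> ('m, 'a) loc"
  where "interior_eps x = (\<Sum>\<mu>\<in>UNIV. gen (Eps \<mu>) * partial (Dx \<mu>) x)"

text \<open>
  Graded commutator of \<open>d\<close> (odd) with the interior product along \<open>\<epsilon>\<close> (even, as \<open>\<epsilon>\<close> is odd);
  this order of the commutator is the one for which the coboundary operator below is nilpotent.
\<close>

definition lie_eps :: "('m::finite, 'a) loc \<Rightarrow> ('m, 'a) loc"
  where "lie_eps x = dext (interior_eps x) - interior_eps (dext x)"

definition ladder_form :: "ladder \<Rightarrow> nat \<Rightarrow> 'a \<Rightarrow> ('m::finite, 'a) loc"
  where "ladder_form A p a = (\<Sum>S | card S = p. dx_set S * gen (Jet A a {#} S))"

text \<open>
  The odd derivation \<open>D\<close> that annihilates \<open>dx\<close> and the global ghosts, commutes with the total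
  derivatives and takes the value \<open>R A p a\<close>, a \<open>p\<close>-form, on \<open>ladder_form A p a\<close>.  It
  anticommutes with \<open>dx\<close>, whence the sign in its value on the components.
\<close>

definition field_der :: "(ladder \<Rightarrow> nat \<Rightarrow> 'a \<Rightarrow> ('m::finite, 'a) loc)
    \<Rightarrow> ('m, 'a) loc \<Rightarrow> ('m, 'a) loc"
  where "field_der R = der (\<lambda>g. case g of
      Jet A a I S \<Rightarrow> fold_mset tderiv
        ((-1) ^ card S * cof S (R A (card S) a)) I
    | _ \<Rightarrow> 0)"

section \<open>The gauge algebra\<close>

definition lie_elem :: "('a::finite \<Rightarrow> complex^'N^'N) \<Rightarrow> ('a \<Rightarrow> complex) \<Rightarrow> complex^'N^'N"
  where "lie_elem T z = (\<chi> i j. \<Sum>a\<in>UNIV. z a * T a $ i $ j)"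

definition commutator :: "complex^'N^'N \<Rightarrow> complex^'N^'N \<Rightarrow> complex^'N^'N"
  where "commutator X Y = X ** Y - Y ** X"

definition lie_ideal :: "(complex^'N^'N) set \<Rightarrow> (complex^'N^'N) set \<Rightarrow> bool"
  where "lie_ideal I L \<longleftrightarrow> I \<subseteq> L \<and> 0 \<in> I \<and> (\<forall>X\<in>I. \<forall>Y\<in>I. X + Y \<in> I) \<and>
    (\<forall>z. \<forall>X\<in>I. (\<chi> i j. z * X $ i $ j) \<in> I) \<and> (\<forall>X\<in>L. \<forall>Y\<in>I. commutator X Y \<in> I)"

text \<open>
  The matrices \<open>T a\<close> form a basis of a simple (complexified) Lie algebra of matrices,
  orthonormal for the trace form; orthonormality implies linear independence.
\<close>

definition simple_lie_basis :: "('a::finite \<Rightarrow> complex^'N^'N) \<Rightarrow> bool"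
  where "simple_lie_basis T \<longleftrightarrow>
    (\<forall>a b. trace (T a ** T b) = (if a = b then 1 else 0)) \<and>
    (\<forall>a b. commutator (T a) (T b) \<in> range (lie_elem T)) \<and>
    (\<exists>a b. commutator (T a) (T b) \<noteq> 0) \<and>
    (\<forall>I. lie_ideal I (range (lie_elem T)) \<longrightarrow> I = {0} \<or> I = range (lie_elem T))"

definition struct_const :: "('a::finite \<Rightarrow> complex^'N^'N) \<Rightarrow> 'a \<Rightarrow> 'a \<Rightarrow> 'a \<Rightarrow> complex"
  where "struct_const T a b e = trace (commutator (T a) (T b) ** T e)"

text \<open>
  Graded commutator of Lie-algebra-valued forms: for homogeneous \<open>X = X\<^sup>a T\<^sub>a\<close> and \<open>Y = Y\<^sup>b T\<^sub>b\<close>,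
  \<open>X Y - (-1)^(\<bar>X\<bar> \<bar>Y\<bar>) Y X = X\<^sup>a Y\<^sup>b [T\<^sub>a, T\<^sub>b]\<close>.
\<close>

definition bracket :: "('a::finite \<Rightarrow> complex^'N^'N) \<Rightarrow> ('a \<Rightarrow> ('m, 'a) loc) \<Rightarrow> ('a \<Rightarrow> ('m, 'a) loc)
    \<Rightarrow> 'a \<Rightarrow> ('m, 'a) loc"
  where "bracket T X Y e = (\<Sum>a\<in>UNIV. \<Sum>b\<in>UNIV. cst (struct_const T a b e) * X a * Y b)"

section \<open>The coboundary operator\<close>

definition d_lower :: "ladder \<Rightarrow> nat \<Rightarrow> 'a \<Rightarrow> ('m::finite, 'a) loc"
  where "d_lower A p a = (case p of 0 \<Rightarrow> 0 | Suc q \<Rightarrow> dext (ladder_form A q a))"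

fun brs_value :: "('a::finite \<Rightarrow> complex^'N^'N) \<Rightarrow> ladder \<Rightarrow> nat \<Rightarrow> 'a \<Rightarrow> ('m::finite, 'a) loc" where
  "brs_value T One p a = d_lower One p a +
    cst (1 / 2) * (\<Sum>q\<le>p. bracket T (ladder_form One q) (ladder_form One (p - q)) a)"
| "brs_value T Two p a = d_lower Two p a +
    (\<Sum>q\<le>p. bracket T (ladder_form One q) (ladder_form Two (p - q)) a)"

definition brs_op :: "('a::finite \<Rightarrow> complex^'N^'N) \<Rightarrow> ('m::finite, 'a) loc \<Rightarrow> ('m, 'a) loc"
  where "brs_op T = field_der (brs_value T)"

text \<open>
  The component \<open>W\<^sub>\<mu>\<close> of the vector supersymmetry \<open>\<xi>\<^sup>\<mu> W\<^sub>\<mu>\<close>, acting by \<open>\<phi>\<^sub>p \<mapsto> - i\<^sub>\<mu> \<phi>\<^sub>p\<^sub>+\<^sub>1\<close>.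
  As \<open>ladder_form A p a = 0\<close> for \<open>p > n + 2\<close>, this covers the case \<open>p = n + 2\<close> as well.
\<close>

definition susy_comp :: "'m \<Rightarrow> ('m::finite, 'a) loc \<Rightarrow> ('m, 'a) loc"
  where "susy_comp \<mu> = field_der (\<lambda>A p a. - partial (Dx \<mu>) (ladder_form A (Suc p) a))"

definition susy_op :: "('m::finite, 'a) loc \<Rightarrow> ('m, 'a) loc"
  where "susy_op x = (\<Sum>\<mu>\<in>UNIV. gen (Xi \<mu>) * susy_comp \<mu> x)"

definition transl_op :: "('m::finite, 'a) loc \<Rightarrow> ('m, 'a) loc"
  where "transl_op = field_der (\<lambda>A p a. lie_eps (ladder_form A p a))"

text \<open>
  \<open>Tr (u G + v F)\<close>: the constant shift of \<open>B\<^sub>0\<close> by \<open>u\<close> and the rotation of \<open>\<phi>\<^sup>(\<^sup>2\<^sup>)\<close> into \<open>\<phi>\<^sup>(\<^sup>1\<^sup>)\<close> by \<open>v\<close>.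
  The sign \<open>- [\<phi>\<^sup>(\<^sup>1\<^sup>), v] = (-1)^n [v, \<phi>\<^sup>(\<^sup>1\<^sup>)]\<close> is forced by nilpotency of the coboundary operator.
\<close>

fun shift_value :: "('a::finite \<Rightarrow> complex^'N^'N) \<Rightarrow> ladder \<Rightarrow> nat \<Rightarrow> 'a \<Rightarrow> ('m::finite, 'a) loc" where
  "shift_value T One p a = 0"
| "shift_value T Two p a = (if p = 0 then gen (U a) else 0) -
    bracket T (ladder_form One p) (\<lambda>b. gen (V b)) a"

definition shift_op :: "('a::finite \<Rightarrow> complex^'N^'N) \<Rightarrow> ('m::finite, 'a) loc \<Rightarrow> ('m, 'a) loc"
  where "shift_op T = field_der (shift_value T)"

definition coboundary :: "('a::finite \<Rightarrow> complex^'N^'N) \<Rightarrow> ('m::finite, 'a) loc \<Rightarrow> ('m, 'a) loc"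
  where "coboundary T x = brs_op T x + susy_op x + transl_op x + shift_op T x +
    (\<Sum>\<mu>\<in>UNIV. gen (Xi \<mu>) * partial (Eps \<mu>) x) + (\<Sum>a\<in>UNIV. gen (U a) * partial (V a) x)"

section \<open>Integrated local functionals\<close>

definition homogeneous_gh :: "int \<Rightarrow> ('m, 'a) loc \<Rightarrow> bool"
  where "homogeneous_gh k x \<longleftrightarrow> (\<forall>m\<in>supp x. (\<Sum>g\<in>#m. gh g) = k)"

definition field_free :: "('m, 'a) loc \<Rightarrow> bool"
  where "field_free x \<longleftrightarrow> (\<forall>m\<in>supp x. \<forall>g\<in>#m. \<not> is_field g)"

text \<open>
  Equality of the functionals with integrands \<open>x\<close> and \<open>y\<close>: modulo total derivatives and
  modulo field-independent terms (which the coboundary operator may produce, through \<open>B\<^sub>0 \<mapsto> u\<close>,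
  but which do not belong to the space of functionals).
\<close>

definition eq_functional :: "('m::finite, 'a) loc \<Rightarrow> ('m, 'a) loc \<Rightarrow> bool"  (infix \<open>\<simeq>\<close> 50)
  where "x \<simeq> y \<longleftrightarrow> (\<exists>\<eta> z. field_free z \<and> x - y = dext \<eta> + z)"

text \<open>
  Infinitesimal Lorentz transformation of all vector and form indices by the matrix \<open>\<Lambda>\<close>.
  On the components of the fields it is determined by the invariance of the forms
  \<open>ladder_form A p a\<close>, on derivatives by the invariance of \<open>d\<close>.  The orbital part is a total
  derivative on integrands that do not depend explicitly on the coordinates.
\<close>

definition rotate_dx :: "('m::finite \<Rightarrow> 'm \<Rightarrow> real) \<Rightarrow> ('m, 'a) loc \<Rightarrow> ('m, 'a) loc"
  where "rotate_dx \<Lambda> = der (\<lambda>g. case g of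
    Dx \<mu> \<Rightarrow> \<Sum>\<nu>\<in>UNIV. cst (of_real (\<Lambda> \<mu> \<nu>)) * gen (Dx \<nu>) | _ \<Rightarrow> 0)"

definition lorentz_op :: "('m::finite \<Rightarrow> 'm \<Rightarrow> real) \<Rightarrow> ('m, 'a) loc \<Rightarrow> ('m, 'a) loc"
  where "lorentz_op \<Lambda> = der (\<lambda>g. case g of
      Dx \<mu> \<Rightarrow> \<Sum>\<nu>\<in>UNIV. cst (of_real (\<Lambda> \<mu> \<nu>)) * gen (Dx \<nu>)
    | Xi \<mu> \<Rightarrow> \<Sum>\<nu>\<in>UNIV. cst (of_real (\<Lambda> \<mu> \<nu>)) * gen (Xi \<nu>)
    | Eps \<mu> \<Rightarrow> \<Sum>\<nu>\<in>UNIV. cst (of_real (\<Lambda> \<mu> \<nu>)) * gen (Eps \<nu>)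
    | Jet A a I S \<Rightarrow>
        - fold_mset tderiv (cof S (rotate_dx \<Lambda> (ladder_form A (card S) a))) I
        - (\<Sum>\<mu>\<in>#I. \<Sum>\<nu>\<in>UNIV. cst (of_real (\<Lambda> \<nu> \<mu>)) * gen (Jet A a (add_mset \<nu> (I - {#\<mu>#})) S))
    | _ \<Rightarrow> 0)"

definition lorentz_algebra :: "('m \<Rightarrow> real) \<Rightarrow> ('m \<Rightarrow> 'm \<Rightarrow> real) set"
  where "lorentz_algebra \<eta> = {\<Lambda>. \<forall>\<mu> \<nu>. \<eta> \<mu> * \<Lambda> \<mu> \<nu> + \<eta> \<nu> * \<Lambda> \<nu> \<mu> = 0}"

text \<open>
  Integrands of Poincare-invariant functionals without field-independent term, for the flat
  metric \<open>diag \<eta>\<close>.  Translation invariance is built in: integrands do not depend explicitly on the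
  coordinates.
\<close>

definition local_functional :: "('m::finite \<Rightarrow> real) \<Rightarrow> ('m, 'a) loc \<Rightarrow> bool"
  where "local_functional \<eta> x \<longleftrightarrow>
    (\<forall>m\<in>supp x. size (filter_mset is_dx m) = CARD('m) \<and> (\<exists>g\<in>#m. is_field g)) \<and>
    (\<forall>\<Lambda>\<in>lorentz_algebra \<eta>. lorentz_op \<Lambda> x \<simeq> 0)"

section \<open>Traces of the ghost and the ladder functionals\<close>

definition c_matrix :: "('a::finite \<Rightarrow> complex^'N^'N) \<Rightarrow> ('m::finite, 'a) loc^'N^'N"
  where "c_matrix T = (\<chi> i j. \<Sum>a\<in>UNIV. cst (T a $ i $ j) * ladder_form One 0 a)"

definition trace_power :: "('a::finite \<Rightarrow> complex^'N^'N) \<Rightarrow> nat \<Rightarrow> ('m::finite, 'a) loc"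
  where "trace_power T k = trace (((\<lambda>X. c_matrix T ** X) ^^ k) (mat 1))"

definition trace_product :: "('a::finite \<Rightarrow> complex^'N^'N) \<Rightarrow> nat list \<Rightarrow> ('m::finite, 'a) loc"
  where "trace_product T ns = prod_list (map (trace_power T) ns)"

definition odd_compositions :: "nat \<Rightarrow> nat list set"
  where "odd_compositions k = {ns. (\<forall>i\<in>set ns. odd i) \<and> sum_list ns = k}"

lemma finite_odd_compositions: "finite (odd_compositions k)"
proof (rule finite_subset)
  have "length ns \<le> sum_list ns" if "\<forall>i\<in>set ns. odd i" for ns :: "nat list"
    using that by (induction ns) (auto elim!: oddE)
  moreover have "set ns \<subseteq> {..sum_list ns}" for ns :: "nat list"
    by (auto intro: member_le_sum_list)
  ultimately show "odd_compositions k \<subseteq> {ns. set ns \<subseteq> {..k} \<and> length ns \<le> k}"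
    by (auto simp: odd_compositions_def subset_iff)
qed (rule finite_lists_length_le, simp)

definition trace_superposition ::
    "('a::finite \<Rightarrow> complex^'N^'N) \<Rightarrow> nat \<Rightarrow> (nat list \<Rightarrow> complex) \<Rightarrow> ('m::finite, 'a) loc"
  where "trace_superposition T k \<alpha> = (\<Sum>ns\<in>odd_compositions k. cst (\<alpha> ns) * trace_product T ns)"

text \<open>
  The ladder climbing operator \<open>\<nabla>\<close>.  With \<open>W\<^sub>\<mu> dx\<^sup>\<nu> = - dx\<^sup>\<nu> W\<^sub>\<mu>\<close> and the total parity used here, the
  rule \<open>\<nabla> \<phi>\<^sub>p = (p + 1) \<phi>\<^sub>p\<^sub>+\<^sub>1\<close> requires the overall sign in front of \<open>dx\<^sup>\<mu> W\<^sub>\<mu>\<close>.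
\<close>

definition climb :: "('m::finite, 'a) loc \<Rightarrow> ('m, 'a) loc"
  where "climb x = - (\<Sum>\<mu>\<in>UNIV. gen (Dx \<mu>) * susy_comp \<mu> x)"

definition ladder_superposition ::
    "('a::finite \<Rightarrow> complex^'N^'N) \<Rightarrow> nat \<Rightarrow> (nat list \<Rightarrow> complex) \<Rightarrow> ('m::finite, 'a) loc"
  where "ladder_superposition T k \<alpha> = (\<Sum>ns\<in>odd_compositions k.
    cst (\<alpha> ns) * (cst (1 / fact CARD('m)) * (climb ^^ CARD('m)) (trace_product T ns)))"

text \<open>
  Invariants of degree \<open>k\<close> in the exterior algebra over the dual of the Lie algebra, as
  polynomials in the undifferentiated ghost \<open>c\<close>.
\<close>

definition c_invariant :: "('a::finite \<Rightarrow> complex^'N^'N) \<Rightarrow> nat \<Rightarrow> ('m::finite, 'a) loc \<Rightarrow> bool"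
  where "c_invariant T k x \<longleftrightarrow>
    (\<forall>m\<in>supp x. size m = k \<and> (\<forall>g\<in>#m. \<exists>a. g = Jet One a {#} {})) \<and>
    (\<forall>e. der (\<lambda>g. case g of
        Jet One a I S \<Rightarrow> \<Sum>b\<in>UNIV. cst (struct_const T e b a) * gen (Jet One b I S)
      | _ \<Rightarrow> 0) x = 0)"

end

theory Submission
 imports Defs "HOL-Computational_Algebra.Fundamental_Theorem_Algebra"
begin

text \<open>Proof idea. Write \<open>D = \<delta> + d\<close> for the total differential on local forms. Let \<open>Z\<close> be the vector
 supersymmetry with parameter \<open>\<epsilon>\<close> shifted by \<open>dx\<close>, plus the shift of \<open>B\<^sub>0\<close> by \<open>v\<close>. Conjugation with \<open>e\<^sup>Z\<close> turns \<open>D\<close> into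
 \<open>D\<^sub>0 = \<B> + \<xi> \<partial>/\<partial>\<epsilon> + u \<partial>/\<partial>v\<close>. All jets other than \<open>c\<close> and \<open>B\<^sub>0\<close>, and the global ghosts, form \<open>D\<^sub>0\<close>-doublets, so
 \<open>D\<^sub>0\<close> contracts onto polynomials in \<open>c\<close>, \<open>B\<^sub>0\<close>, \<open>dx\<close> with a Chevalley-Eilenberg differential, whose cohomology
 consists of the invariants of the semisimple gauge algebra: its Casimir operator is exact and, by Cartan's criterion,
 invertible off the invariants. Lorentz invariance and the low degree exclude \<open>B\<^sub>0\<close> and \<open>dx\<close>.
 The algebraic Poincare lemma and descent identify \<open>\<delta>\<close>-cocycles modulo \<open>d\<close> among the top forms with \<open>D\<close>-cocycles;
 the top form of \<open>e\<^sup>-\<^sup>Z P\<close> is the ladder over \<open>P\<close>.\<close>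

text \<open>Lorentz invariance has to survive every inversion of an operator, and no averaging over
  a group is used. Inverses are therefore polynomials in the operator itself: the spectral
  decomposition is stated relative to an invariant subspace, which the solutions never leave. At the
  start invariance holds only modulo total derivatives; the representative in the kernel of
  \<open>Xiop\<close> is invariant strictly. Field-independent terms are absent from the functionals
  but arise from the shift of B_0 by u, so they are split off at each stage. The delicate point is
  the exclusion of B_0. Counting in total degree n + 2 + G leaves a few monomials: squares of B_0
  for n up to 3, cubes and quartics for n = 1. For odd n the square vanishes because an invariant
  bilinear form is symmetric; the quartic for n = G = 1 is carried by an sl(2) to a quartic in c,
  where invariants are products of odd traces by hypothesis and Tr c = 0. The cube and the square
  that survive for G = 0 are the exceptional cases in the statement.\<close>

no_notation suminf (binder "\<Sum>" 10)
no_syntax "_Sum_any" :: "pttrn \<Rightarrow> 'a \<Rightarrow> 'a::comm_monoid_add" (\<open>(\<open>indent=2 notation=\<open>binder \<Sum>\<close>\<close>\<Sum>_. _)\<close> [0, 10] 10)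
text \<open>Space-time and Lie algebra indices range over finite types, so a sum without range runs
  over the whole type.\<close>

abbreviation (input) sum_all (binder "\<Sum>" 10) where "sum_all f \<equiv> sum f UNIV"

subsection \<open>Spectral decomposition of locally finite operators\<close>

text \<open>The same spectral theory is applied to three spaces: graded polynomials, finitely
  supported matrices and coordinate vectors of the gauge algebra. As these may be
  infinite-dimensional, it rests on annihilation of the single vector at hand by a polynomial in the
  operator.\<close>

locale cvs = vector_space scale
 for scale :: "complex \<Rightarrow> 'b \<Rightarrow> 'b::ab_group_add" (infixr "*\<^sub>V" 75)
begin

definition linop :: "('b \<Rightarrow> 'b) \<Rightarrow> bool"
 where "linop A \<longleftrightarrow> (\<forall>x y. A (x + y) = A x + A y) \<and> (\<forall>c x. A (c *\<^sub>V x) = c *\<^sub>V A x)"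

lemma linop_simps:
 assumes "linop A"
 shows "A (x + y) = A x + A y" "A (c *\<^sub>V x) = c *\<^sub>V A x" "A 0 = 0" "A (- x) = - A x" "A (x - y) = A x - A y"
  "A (sum f I) = (\<Sum>i\<in>I. A (f i))"
proof -
 show a: "A (x + y) = A x + A y" for x y using assms by (simp add: linop_def)
 show s: "A (c *\<^sub>V x) = c *\<^sub>V A x" for c x using assms by (simp add: linop_def)
 show z: "A 0 = 0" using s[of 0 0] by simp
 show m: "A (- x) = - A x" for x using a[of x "- x"] z by (simp add: eq_neg_iff_add_eq_0 add.commute)
 show "A (x - y) = A x - A y" using a[of x "- y"] m by simp
 show "A (sum f I) = (\<Sum>i\<in>I. A (f i))"
  by (induction I rule: infinite_finite_induct) (simp_all add: a z)
qed

text \<open>The solutions obtained below are polynomials in \<open>A\<close> applied to the given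
  vector. Recording this as membership in an arbitrary invariant subspace \<open>S\<close> lets
  degree, closedness or Lorentz invariance pass to them by a suitable choice of
  \<open>S\<close>.\<close>

definition inv_space :: "('b \<Rightarrow> 'b) \<Rightarrow> 'b set \<Rightarrow> bool"
 where "inv_space A S \<longleftrightarrow> 0 \<in> S \<and> (\<forall>x\<in>S. \<forall>y\<in>S. x + y \<in> S) \<and> (\<forall>c. \<forall>x\<in>S. c *\<^sub>V x \<in> S) \<and> (\<forall>x\<in>S. A x \<in> S)"

lemma inv_spaceD:
 assumes "inv_space A S"
 shows "0 \<in> S" "x \<in> S \<Longrightarrow> y \<in> S \<Longrightarrow> x + y \<in> S" "x \<in> S \<Longrightarrow> c *\<^sub>V x \<in> S" "x \<in> S \<Longrightarrow> A x \<in> S"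
  "x \<in> S \<Longrightarrow> y \<in> S \<Longrightarrow> x - y \<in> S" "(\<And>i. i \<in> I \<Longrightarrow> f i \<in> S) \<Longrightarrow> sum f I \<in> S"
proof -
 show z: "0 \<in> S" using assms by (simp add: inv_space_def)
 show a: "x \<in> S \<Longrightarrow> y \<in> S \<Longrightarrow> x + y \<in> S" for x y using assms by (simp add: inv_space_def)
 show s: "x \<in> S \<Longrightarrow> c *\<^sub>V x \<in> S" for c x using assms by (simp add: inv_space_def)
 show "x \<in> S \<Longrightarrow> A x \<in> S" using assms by (simp add: inv_space_def)
 show "x \<in> S \<Longrightarrow> y \<in> S \<Longrightarrow> x - y \<in> S" using a[of x "- y"] s[of y "-1"] by simp
 show "(\<And>i. i \<in> I \<Longrightarrow> f i \<in> S) \<Longrightarrow> sum f I \<in> S"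
  by (induction I rule: infinite_finite_induct) (auto simp: z a)
qed

definition shift :: "('b \<Rightarrow> 'b) \<Rightarrow> complex \<Rightarrow> 'b \<Rightarrow> 'b"
 where "shift A c x = A x - c *\<^sub>V x"

lemma linop_shift: "linop A \<Longrightarrow> linop (shift A c)"
 by (simp add: linop_def shift_def algebra_simps)

lemma linop_funpow: "linop A \<Longrightarrow> linop (A ^^ k)"
 by (induction k) (simp_all add: linop_def)

lemma shift_comm: "linop A \<Longrightarrow> shift A c (shift A d x) = shift A d (shift A c x)"
 by (simp add: shift_def linop_simps algebra_simps)

text \<open>The product of the factors \<open>A - c\<close>, with multiplicities given by repetition
  in the list. A list keeps the roots of an annihilating polynomial in a form suited to
  induction.\<close>

fun prodop :: "('b \<Rightarrow> 'b) \<Rightarrow> complex list \<Rightarrow> 'b \<Rightarrow> 'b" where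
 "prodop A [] x = x"
| "prodop A (c # cs) x = prodop A cs (shift A c x)"

lemma linop_prodop: "linop A \<Longrightarrow> linop (prodop A cs)"
proof (induction cs)
 case Nil thus ?case by (simp add: linop_def)
next
 case (Cons c cs)
 hence "linop (prodop A cs)" "linop (shift A c)" by (auto intro: linop_shift)
 thus ?case by (simp add: linop_def)
qed

lemma prodop_append: "prodop A (cs @ ds) x = prodop A ds (prodop A cs x)"
 by (induction cs arbitrary: x) auto

lemma shift_prodop: "linop A \<Longrightarrow> shift A c (prodop A cs x) = prodop A cs (shift A c x)"
 by (induction cs arbitrary: x) (simp_all add: shift_comm)

lemma prodop_comm: "linop A \<Longrightarrow> prodop A cs (prodop A ds x) = prodop A ds (prodop A cs x)"
 by (induction cs arbitrary: x) (simp_all add: shift_prodop)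

lemma prodop_zero: "linop A \<Longrightarrow> prodop A cs 0 = 0"
 by (rule linop_simps(3)[OF linop_prodop])

lemma prodop_add_kernel:
 assumes "linop A" "prodop A cs x = 0" "prodop A ds y = 0"
 shows "prodop A (cs @ ds) (x + y) = 0"
 using assms(1) assms by (auto simp: prodop_append linop_simps linop_prodop prodop_comm prodop_zero)

lemma shift_inv_space: "inv_space A S \<Longrightarrow> x \<in> S \<Longrightarrow> shift A c x \<in> S"
 unfolding shift_def by (intro inv_spaceD(5)[of A] inv_spaceD(3)[of A] inv_spaceD(4)[of A])

text \<open>Induction on the annihilating product: if (A - c) y = (A - d) x, then (A - c)(x - y) =
  (d - c) x, and division by d - c finishes.\<close>

lemma shift_solve:
 assumes "linop A" "inv_space A S" "prodop A cs x = 0" "c \<notin> set cs" "x \<in> S"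
 shows "\<exists>y\<in>S. shift A c y = x"
 using assms(3-5)
proof (induction cs arbitrary: x)
 case Nil
 thus ?case using inv_spaceD(1)[OF assms(2)]
  by (intro bexI[of _ 0]) (simp_all add: shift_def linop_simps[OF assms(1)])
next
 case (Cons d cs)
 then obtain y where y: "y \<in> S" "shift A c y = shift A d x"
  using shift_inv_space[OF assms(2)] by fastforce
 have "d - c \<noteq> 0" using Cons.prems by auto
 let ?z = "(1 / (d - c)) *\<^sub>V (x - y)"
 have "?z \<in> S" using y Cons.prems by (intro inv_spaceD[OF assms(2)])
 moreover have "shift A c ?z = x"
 proof -
  have "shift A c (x - y) = shift A c x - shift A d x"
   using y linop_simps(5)[OF linop_shift[OF assms(1)]] by simp
  also have "\<dots> = (d - c) *\<^sub>V x" by (simp add: shift_def algebra_simps)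
  finally show ?thesis using \<open>d - c \<noteq> 0\<close>
   by (simp add: linop_simps(2)[OF linop_shift[OF assms(1)]])
 qed
 ultimately show ?case by blast
qed

lemma prodop_replicate: "prodop A (replicate k c) x = (shift A c ^^ k) x"
 by (induction k arbitrary: x) (simp_all add: funpow_swap1)

text \<open>By induction (A - d) x already splits. Its components at eigenvalues other than d lift
  through A - d without leaving their generalised eigenspace, because A - d is invertible there; the
  rest of x becomes the component at d.\<close>

lemma spectral_decomposition:
 assumes "linop A" "inv_space A S" "prodop A cs x = 0" "x \<in> S"
 shows "\<exists>f. (\<forall>c. f c \<in> S) \<and> x = (\<Sum>c\<in>set cs. f c) \<and> (\<forall>c. (shift A c ^^ count_list cs c) (f c) = 0)"
 using assms(3,4)
proof (induction cs arbitrary: x)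
 case Nil
 thus ?case using inv_spaceD(1)[OF assms(2)] by (intro exI[of _ "\<lambda>_. 0"]) simp
next
 case (Cons d cs)
 let ?k = "count_list cs"
 note L = linop_simps[OF linop_shift[OF assms(1)]]
 have "shift A d x \<in> S" using shift_inv_space[OF assms(2)] Cons.prems by blast
 with Cons obtain f where f: "\<And>c. f c \<in> S" "shift A d x = (\<Sum>c\<in>set cs. f c)"
  "\<And>c. (shift A c ^^ ?k c) (f c) = 0" by fastforce
 have "\<exists>y. y \<in> S \<and> (shift A c ^^ ?k c) y = 0 \<and> (c \<noteq> d \<longrightarrow> shift A d y = f c)" for c
 proof (cases "c = d")
  case True
  thus ?thesis using inv_spaceD(1)[OF assms(2)]
   by (intro exI[of _ 0]) (simp add: linop_simps[OF linop_funpow[OF linop_shift[OF assms(1)]]])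
 next
  case False
  let ?S = "{y \<in> S. (shift A c ^^ ?k c) y = 0}"
  note K = linop_simps[OF linop_funpow[OF linop_shift[OF assms(1), of c]]]
  have comm: "(shift A c ^^ k) (A y) = A ((shift A c ^^ k) y)" for k y
   by (induction k arbitrary: y) (simp_all add: shift_def linop_simps[OF assms(1)])
  have "inv_space A ?S"
   unfolding inv_space_def
   using inv_spaceD[OF assms(2)] by (auto simp: K comm linop_simps[OF assms(1)])
  hence "\<exists>y\<in>?S. shift A d y = f c"
   using False f by (intro shift_solve[OF assms(1), of _ "replicate (?k c) c"])
    (auto simp: prodop_replicate)
  thus ?thesis by auto
 qed
 then obtain g where g: "\<And>c. g c \<in> S" "\<And>c. (shift A c ^^ ?k c) (g c) = 0"
  "\<And>c. c \<noteq> d \<Longrightarrow> shift A d (g c) = f c" by metis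
 \<comment> \<open>The remainder at \<open>d\<close> is mapped by A - d to \<open>f d\<close>, or to
   zero if \<open>d\<close> is new, so one more power annihilates it.\<close>
 define h where "h = g(d := x - (\<Sum>c\<in>set cs - {d}. g c))"
 have "h c \<in> S" for c
  unfolding h_def using g Cons.prems by (auto intro!: inv_spaceD[OF assms(2)])
 moreover have "x = (\<Sum>c\<in>set (d # cs). h c)"
  by (simp add: sum.insert_remove h_def)
 moreover have "(shift A c ^^ count_list (d # cs) c) (h c) = 0" for c
 proof (cases "c = d")
  case True
  have "(\<Sum>c\<in>set cs - {d}. shift A d (g c)) = (\<Sum>c\<in>set cs - {d}. f c)"
   using g by (intro sum.cong) auto
  hence "shift A d (h d) = (if d \<in> set cs then f d else 0)"
   by (simp add: h_def L f(2) sum.remove)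
  hence "(shift A d ^^ ?k d) (shift A d (h d)) = 0"
   using f(3) by (simp add: linop_simps[OF linop_funpow[OF linop_shift[OF assms(1)]]])
  thus ?thesis using True by (simp add: funpow_swap1)
 qed (simp add: h_def g)
 ultimately show ?case by blast
qed

text \<open>For z = (A - b)^l x with (A - b) z = 0, the operator A - a acts on z as multiplication
  by b - a, yet one of its powers kills z. So z = 0, and the exponent l can be lowered.\<close>

lemma coprime_kernels:
 assumes "linop A" "(shift A a ^^ k) x = 0" "(shift A b ^^ l) x = 0" "a \<noteq> b"
 shows "x = 0"
 using assms(3)
proof (induction l)
 case (Suc l)
 let ?z = "(shift A b ^^ l) x"
 have lin: "linop (shift A b ^^ l)" "linop (shift A a)" for a by (intro linop_funpow linop_shift assms(1))+
 have comm1: "(shift A b ^^ l) (shift A a y) = shift A a ((shift A b ^^ l) y)" for y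
  by (induction l arbitrary: y) (simp_all add: shift_comm[OF assms(1)])
 have comm: "(shift A b ^^ l) ((shift A a ^^ k) y) = (shift A a ^^ k) ((shift A b ^^ l) y)" for y
  by (induction k arbitrary: y) (simp_all add: comm1)
 have "shift A b ?z = 0" using Suc.prems by simp
 hence "shift A a ?z = (b - a) *\<^sub>V ?z" by (simp add: shift_def algebra_simps)
 hence "(shift A a ^^ j) ?z = (b - a) ^ j *\<^sub>V ?z" for j
  by (induction j) (simp_all add: linop_simps[OF lin(2)])
 moreover have "(shift A a ^^ k) ?z = 0"
  using assms(2) comm[of x] by (simp add: linop_simps[OF lin(1)])
 ultimately have "?z = 0" using assms(4) by (simp add: scale_eq_0_iff)
 thus ?case by (rule Suc.IH)
qed simp

definition polyop :: "('b \<Rightarrow> 'b) \<Rightarrow> complex poly \<Rightarrow> 'b \<Rightarrow> 'b"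
 where "polyop A p x = (\<Sum>i\<le>degree p. coeff p i *\<^sub>V (A ^^ i) x)"

lemma polyop_superset: "degree p \<le> n \<Longrightarrow> polyop A p x = (\<Sum>i\<le>n. coeff p i *\<^sub>V (A ^^ i) x)"
 unfolding polyop_def by (rule sum.mono_neutral_left) (auto simp: coeff_eq_0)

lemma polyop_linear_factor:
 assumes "linop A"
 shows "polyop A ([:- c, 1:] * p) x = polyop A p (shift A c x)"
proof -
 let ?n = "Suc (degree p)"
 have cf: "coeff ([:- c, 1:] * p) i = coeff (pCons 0 p) i - c * coeff p i" for i
  by simp
 have "degree ([:- c, 1:] * p) \<le> ?n"
  by (rule order_trans[OF degree_mult_le]) simp
 hence "polyop A ([:- c, 1:] * p) x = (\<Sum>i\<le>?n. coeff ([:- c, 1:] * p) i *\<^sub>V (A ^^ i) x)"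
  by (rule polyop_superset)
 also have "\<dots> = (\<Sum>i\<le>?n. coeff (pCons 0 p) i *\<^sub>V (A ^^ i) x) - (\<Sum>i\<le>?n. (c * coeff p i) *\<^sub>V (A ^^ i) x)"
  by (simp only: cf scale_left_diff_distrib sum_subtractf)
 also have "(\<Sum>i\<le>?n. coeff (pCons 0 p) i *\<^sub>V (A ^^ i) x) = (\<Sum>i\<le>degree p. coeff p i *\<^sub>V (A ^^ i) (A x))"
  by (subst sum.atMost_Suc_shift) (simp add: funpow_swap1)
 also have "(\<Sum>i\<le>?n. (c * coeff p i) *\<^sub>V (A ^^ i) x) = (\<Sum>i\<le>degree p. coeff p i *\<^sub>V (A ^^ i) (c *\<^sub>V x))"
  by (simp add: coeff_eq_0 linop_simps[OF linop_funpow[OF assms]] mult.commute)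
 also have "(\<Sum>i\<le>degree p. coeff p i *\<^sub>V (A ^^ i) (A x)) - (\<Sum>i\<le>degree p. coeff p i *\<^sub>V (A ^^ i) (c *\<^sub>V x))
   = polyop A p (shift A c x)"
  by (simp add: polyop_def shift_def linop_simps[OF linop_funpow[OF assms]] scale_right_diff_distrib
    sum_subtractf)
 finally show ?thesis .
qed

text \<open>Here the complex numbers enter: the fundamental theorem of algebra splits an
  annihilating polynomial into linear factors.\<close>

lemma polyop_factor:
 assumes "linop A" "p \<noteq> 0" "polyop A p x = 0"
 shows "\<exists>cs. prodop A cs x = 0"
 using assms(2,3)
proof (induction "degree p" arbitrary: p x)
 case 0
 then obtain a where "p = [:a:]" "a \<noteq> 0" by (metis degree_eq_zeroE pCons_0_0)
 hence "x = 0" using 0 by (simp add: polyop_def)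
 thus ?case by (intro exI[of _ "[]"]) simp
next
 case (Suc d)
 hence "\<not> constant (poly p)" by (simp add: constant_degree)
 then obtain c where "poly p c = 0" using fundamental_theorem_of_algebra by blast
 then obtain q where q: "p = [:- c, 1:] * q" using poly_eq_0_iff_dvd dvdE by metis
 hence "q \<noteq> 0" using Suc.prems by auto
 hence "degree q = d" using Suc.hyps(2) unfolding q by (subst (asm) degree_mult_eq) auto
 moreover have "polyop A q (shift A c x) = 0" using Suc.prems polyop_linear_factor[OF assms(1)] q by metis
 ultimately obtain cs where "prodop A cs (shift A c x) = 0" using Suc.hyps(1) \<open>q \<noteq> 0\<close> by blast
 thus ?case by (intro exI[of _ "c # cs"]) simp
qed

text \<open>More iterates than spanning vectors are linearly dependent, and the coefficients of the
  relation form an annihilating polynomial.\<close>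

lemma locally_finite_annihilated:
 assumes "linop A" "finite B" "\<And>i. (A ^^ i) x \<in> span B"
 shows "\<exists>cs. prodop A cs x = 0"
proof -
 let ?v = "\<lambda>i. (A ^^ i) x"
 let ?d = "Suc (card B)"
 have "\<exists>p. p \<noteq> 0 \<and> polyop A p x = 0"
 \<comment> \<open>Linear dependence of a set ignores repetitions, so two equal iterates are treated
   apart; they give the polynomial t^j - t^i.\<close>
 proof (cases "inj_on ?v {..<?d}")
  case False
  then obtain i j where ij: "i < j" "?v i = ?v j" unfolding inj_on_def by (metis nat_neq_iff)
  let ?p = "monom 1 j - monom 1 i :: complex poly"
  have "coeff ?p j = 1" using ij by simp
  hence "?p \<noteq> 0" by (metis coeff_0 zero_neq_one)
  moreover have "polyop A ?p x = 0"
  proof -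
   have "degree ?p \<le> j" by (rule degree_diff_le) (use ij in \<open>auto simp: degree_monom_eq\<close>)
   hence "polyop A ?p x = (\<Sum>k\<le>j. coeff ?p k *\<^sub>V ?v k)" by (rule polyop_superset)
   also have "\<dots> = (\<Sum>k\<le>j. (if k = j then ?v j else 0)) - (\<Sum>k\<le>j. (if k = i then ?v i else 0))"
    unfolding sum_subtractf[symmetric] by (rule sum.cong) auto
   also have "\<dots> = ?v j - ?v i" using ij by simp
   finally show ?thesis using ij by simp
  qed
  ultimately show ?thesis by blast
 next
  case True
  have "\<not> independent (?v ` {..<?d})"
  proof
   assume i: "independent (?v ` {..<?d})"
   have "card (?v ` {..<?d}) \<le> card B"
    using independent_span_bound[OF assms(2) i] assms(3) by auto
   thus False using card_image[OF True] by simp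
  qed
  then obtain u where u: "\<exists>v\<in>?v ` {..<?d}. u v \<noteq> 0" "(\<Sum>v\<in>?v ` {..<?d}. u v *\<^sub>V v) = 0"
   using dependent_finite[of "?v ` {..<?d}"] by auto
  define p where "p = (\<Sum>i<?d. monom (u (?v i)) i)"
  have c: "coeff p k = (if k < ?d then u (?v k) else 0)" for k
  proof -
   have "coeff p k = (\<Sum>i<?d. if i = k then u (?v i) else 0)"
    unfolding p_def coeff_sum by (rule sum.cong) auto
   thus ?thesis by (simp only: sum.delta finite_lessThan lessThan_iff)
  qed
  obtain i where i: "i < ?d" "u (?v i) \<noteq> 0" using u(1) by blast
  hence "coeff p i \<noteq> 0" using c[of i] by metis
  hence "p \<noteq> 0" by auto
  have "degree p \<le> card B" by (rule degree_le) (simp add: c)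
  hence "polyop A p x = (\<Sum>i\<le>card B. coeff p i *\<^sub>V ?v i)" by (rule polyop_superset)
  also have "\<dots> = (\<Sum>i<?d. u (?v i) *\<^sub>V ?v i)"
   unfolding lessThan_Suc_atMost by (rule sum.cong) (auto simp: c)
  also have "\<dots> = (\<Sum>v\<in>?v ` {..<?d}. u v *\<^sub>V v)"
   by (subst sum.reindex[OF True]) (simp only: o_def)
  finally have "polyop A p x = 0" using u(2) by simp
  with \<open>p \<noteq> 0\<close> show ?thesis by blast
 qed
 thus ?thesis using polyop_factor[OF assms(1)] by blast
qed

text \<open>Fitting decomposition: the component at eigenvalue 0 is the nilpotent part, and
  \<open>A\<close> is invertible on the other components.\<close>

lemma fitting:
 assumes "linop A" "inv_space A S" "prodop A cs x = 0" "x \<in> S"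
 shows "\<exists>x0\<in>S. \<exists>x'\<in>S. x = x0 + A x' \<and> (A ^^ count_list cs 0) x0 = 0"
proof -
 have s0: "shift A 0 = A" by (simp add: shift_def fun_eq_iff)
 obtain f where f: "\<And>c. f c \<in> S" "x = (\<Sum>c\<in>set cs. f c)" "\<And>c. (shift A c ^^ count_list cs c) (f c) = 0"
  using spectral_decomposition[OF assms] by blast
 have "\<exists>y\<in>S. A y = f c" if "c \<noteq> 0" for c
  using shift_solve[OF assms(1,2), of "replicate (count_list cs c) c" "f c" 0] f that s0
  by (auto simp: prodop_replicate)
 then obtain g where g: "\<And>c. c \<noteq> 0 \<Longrightarrow> g c \<in> S \<and> A (g c) = f c" by metis
 let ?x' = "\<Sum>c\<in>set cs - {0}. g c"
 let ?x0 = "if 0 \<in> set cs then f 0 else 0"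
 have "A ?x' = (\<Sum>c\<in>set cs - {0}. f c)" using g by (auto simp: linop_simps[OF assms(1)])
 hence "x = ?x0 + A ?x'" using f(2) by (simp add: sum.remove)
 moreover have "?x' \<in> S" "?x0 \<in> S" using g f(1) by (auto intro!: inv_spaceD[OF assms(2)])
 moreover have "(A ^^ count_list cs 0) ?x0 = 0"
  using f(3)[of 0] s0 linop_simps(3)[OF linop_funpow[OF assms(1)]] by auto
 ultimately show ?thesis by blast
qed

end

section \<open>Coefficients, supports and monomials of the graded-commutative algebra\<close>

lemma salg_eqI: "(\<And>m. coef x m = coef y m) \<Longrightarrow> x = y"
 by transfer (auto intro: poly_mapping_eqI)

lemma coef_zero [simp]: "coef 0 m = 0" by transfer simp
lemma coef_add [simp]: "coef (x + y) m = coef x m + coef y m" by transfer (simp add: lookup_add)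
lemma coef_diff [simp]: "coef (x - y) m = coef x m - coef y m" by transfer (simp add: lookup_minus)
lemma coef_uminus [simp]: "coef (- x) m = - coef x m" by transfer simp
lemma coef_sum [simp]: "coef (sum f A) m = (\<Sum>i\<in>A. coef (f i) m)"
 by (induction A rule: infinite_finite_induct) auto
lemma coef_mon: "coef (mon k) m = (if admissible k \<and> k = m then 1 else 0)"
 by transfer (auto simp: lookup_single when_def)
lemma coef_one: "coef 1 m = (if m = {#} then 1 else 0)"
 by (auto simp: coef.rep_eq one_salg.rep_eq lookup_one)
lemma coef_not_admissible: "\<not> admissible m \<Longrightarrow> coef x m = 0"
 by transfer (auto simp: in_keys_iff)
lemma supp_iff: "m \<in> supp x \<longleftrightarrow> coef x m \<noteq> 0"
 by transfer (auto simp: in_keys_iff)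
lemma finite_supp [simp]: "finite (supp x)" by transfer simp
lemma supp_admissible: "m \<in> supp x \<Longrightarrow> admissible m"
 using coef_not_admissible supp_iff by blast
lemma supp_zero [simp]: "supp 0 = {}" by (auto simp: supp_iff)

lemma admissible_empty [simp]: "admissible {#}" by (simp add: admissible_def)
lemma admissible_single [simp]: "admissible {#g#}" by (simp add: admissible_def)
lemma admissible_mono: "m \<subseteq># k \<Longrightarrow> admissible k \<Longrightarrow> admissible m"
 unfolding admissible_def by (meson mset_subset_eq_count order_trans)
lemma admissible_diff [simp]: "admissible k \<Longrightarrow> admissible (k - m)"
 by (rule admissible_mono[of _ k]) auto

lemma mon_empty: "mon {#} = 1"
 by (rule salg_eqI) (simp add: coef_mon coef_one)
lemma mon_not_admissible: "\<not> admissible m \<Longrightarrow> mon m = 0"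
 by (rule salg_eqI) (simp add: coef_mon)

text \<open>Scalars act through central constants; as a separate operation they make the algebra a
  complex vector space and can be moved out of products by simplification.\<close>

definition smult :: "complex \<Rightarrow> 'g::graded_generator salg \<Rightarrow> 'g salg" (infixr "*:" 75)
 where "c *: x = cst c * x"

lemma raw_mult_const_left:
 "raw_mult (Poly_Mapping.single {#} c) x = Poly_Mapping.map ((*) c) x"
proof -
 have "Poly_Mapping.lookup (raw_mult (Poly_Mapping.single {#} c) x) m = c * Poly_Mapping.lookup x m" for m
  by (subst raw_mult_superset[of "{{#}}" "Poly_Mapping.keys x"])
   (auto simp: lookup_sum lookup_single when_def in_keys_iff split: if_splits)
 thus ?thesis
  by (intro poly_mapping_eqI) (simp add: map.rep_eq when_def)
qed

lemma raw_mult_const_right: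
 "raw_mult x (Poly_Mapping.single {#} c) = Poly_Mapping.map ((*) c) x"
proof -
 have "Poly_Mapping.lookup (raw_mult x (Poly_Mapping.single {#} c)) m = c * Poly_Mapping.lookup x m" for m
  by (subst raw_mult_superset[of "Poly_Mapping.keys x" "{{#}}"])
   (auto simp: lookup_sum lookup_single when_def in_keys_iff split: if_splits)
 thus ?thesis
  by (intro poly_mapping_eqI) (simp add: map.rep_eq when_def)
qed

lemma coef_smult [simp]: "coef (c *: x) m = c * coef x m"
 unfolding smult_def by transfer (simp add: raw_mult_const_left map.rep_eq when_def)

lemma mult_cst: "x * cst c = c *: x"
 unfolding smult_def by transfer (simp add: raw_mult_const_left raw_mult_const_right)

lemma smult_simps [simp]:
 "0 *: x = 0" "c *: 0 = 0" "1 *: x = x" "a *: b *: x = (a * b) *: x"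
 "(- c) *: x = - (c *: x)" "c *: (- x) = - (c *: x)"
 by (rule salg_eqI; simp)+

lemma smult_dist:
 "c *: (x + y) = c *: x + c *: y" "c *: (x - y) = c *: x - c *: y"
 "(c + d) *: x = c *: x + d *: x" "(c - d) *: x = c *: x - d *: x"
 by (rule salg_eqI; simp add: algebra_simps)+

lemma smult_mult_left [simp]: "(c *: x) * y = c *: (x * y)"
 by (simp add: smult_def mult.assoc)

lemma smult_mult_right [simp]: "x * (c *: y) = c *: (x * y)"
proof -
 have "x * (c *: y) = (x * cst c) * y" by (simp add: smult_def mult.assoc)
 thus ?thesis by (simp add: mult_cst)
qed

lemma cst_mult_conv [simp]: "cst c * x = c *: x" by (simp add: smult_def)

lemma smult_sum_right: "c *: sum f A = (\<Sum>i\<in>A. c *: f i)"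
 by (rule salg_eqI) (simp add: sum_distrib_left)
lemma smult_sum_left: "sum f A *: x = (\<Sum>i\<in>A. f i *: x)"
 by (rule salg_eqI) (simp add: sum_distrib_right)

lemma smult_eq_0_iff [simp]: "c *: x = 0 \<longleftrightarrow> c = 0 \<or> x = 0"
proof
 assume h: "c *: x = 0"
 hence "c * coef x m = 0" for m by (metis coef_smult coef_zero)
 thus "c = 0 \<or> x = 0" by (cases "c = 0") (auto intro: salg_eqI)
qed auto

lemma two_smult: "x + x = 2 *: (x::'g::graded_generator salg)"
 by (rule salg_eqI) simp

lemma salg_expand: "x = (\<Sum>m\<in>supp x. coef x m *: mon m)"
proof (rule salg_eqI)
 fix k
 have "coef (\<Sum>m\<in>supp x. coef x m *: mon m) k = (\<Sum>m\<in>supp x. if m = k then coef x m else 0)"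
  unfolding coef_sum by (intro sum.cong) (auto simp: coef_mon supp_admissible)
 also have "\<dots> = coef x k" by (auto simp: supp_iff)
 finally show "coef x k = coef (\<Sum>m\<in>supp x. coef x m *: mon m) k" by simp
qed

lemma mon_mult:
 assumes "admissible a" "admissible b"
 shows "mon a * mon b = koszul a b *: mon (a + b)"
proof -
 have "mon a * mon b = koszul a b *: mon (a + b)" if "koszul a b \<noteq> 0"
 proof -
  have "admissible (a + b)" using admissible_add assms that by blast
  thus ?thesis using assms unfolding smult_def
   by transfer (simp add: raw_mult_single)
 qed
 moreover have "mon a * mon b = 0" if "koszul a b = 0"
  using assms that by transfer (simp add: raw_mult_single)
 ultimately show ?thesis by (cases "koszul a b = 0") auto
qed

subsection \<open>Linear maps and induction\<close>

definition lin :: "('g::graded_generator salg \<Rightarrow> 'h::graded_generator salg) \<Rightarrow> bool"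
 where "lin f \<longleftrightarrow> (\<forall>x y. f (x + y) = f x + f y) \<and> (\<forall>c x. f (c *: x) = c *: f x)"

lemma linI: "(\<And>x y. f (x + y) = f x + f y) \<Longrightarrow> (\<And>c x. f (c *: x) = c *: f x) \<Longrightarrow> lin f"
 by (simp add: lin_def)
lemma lin_add: "lin f \<Longrightarrow> f (x + y) = f x + f y" by (simp add: lin_def)
lemma lin_smult: "lin f \<Longrightarrow> f (c *: x) = c *: f x" by (simp add: lin_def)
lemma lin_zero: "lin f \<Longrightarrow> f 0 = 0" using lin_smult[of f 0 0] by simp
lemma lin_uminus: "lin f \<Longrightarrow> f (- x) = - f x" using lin_smult[of f "-1" x] by simp
lemma lin_diff: "lin f \<Longrightarrow> f (x - y) = f x - f y"
 using lin_add[of f x "- y"] by (simp add: lin_uminus)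
lemma lin_sum: "lin f \<Longrightarrow> f (sum g A) = (\<Sum>i\<in>A. f (g i))"
 by (induction A rule: infinite_finite_induct) (auto simp: lin_zero lin_add)
lemmas lin_simps = lin_add lin_smult lin_zero lin_uminus lin_diff lin_sum

lemma lin_ident: "lin (\<lambda>x. x)" by (simp add: lin_def)
lemma lin_plus: "lin f \<Longrightarrow> lin g \<Longrightarrow> lin (\<lambda>x. f x + g x)"
 by (simp add: lin_def smult_dist)
lemma lin_minus: "lin f \<Longrightarrow> lin g \<Longrightarrow> lin (\<lambda>x. f x - g x)"
 by (simp add: lin_def smult_dist)
lemma lin_neg: "lin f \<Longrightarrow> lin (\<lambda>x. - f x)" by (simp add: lin_def)
lemma lin_scale: "lin f \<Longrightarrow> lin (\<lambda>x. c *: f x)"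
 by (simp add: lin_def smult_dist mult.commute)
lemma lin_summ: "(\<And>i. i \<in> A \<Longrightarrow> lin (f i)) \<Longrightarrow> lin (\<lambda>x. \<Sum>i\<in>A. f i x)"
 by (simp add: lin_def sum.distrib smult_sum_right)
lemma lin_multl: "lin f \<Longrightarrow> lin (\<lambda>x. y * f x)"
 by (simp add: lin_def distrib_left)
lemma lin_multr: "lin f \<Longrightarrow> lin (\<lambda>x. f x * y)"
 by (simp add: lin_def distrib_right)
lemma lin_comp: "lin f \<Longrightarrow> lin g \<Longrightarrow> lin (\<lambda>x. f (g x))"
 by (simp add: lin_def)
lemma lin_funpow: "lin (f :: 'g::graded_generator salg \<Rightarrow> 'g salg) \<Longrightarrow> lin (f ^^ k)"
proof (induction k)
 case 0 show ?case by (simp add: lin_def)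
next
 case (Suc k) thus ?case by (simp add: lin_def)
qed
lemma lin_eq_mon:
 assumes "lin f" "lin g" "\<And>m. m \<in> supp x \<Longrightarrow> f (mon m) = g (mon m)"
 shows "f x = g x"
proof -
 have "f x = (\<Sum>m\<in>supp x. coef x m *: f (mon m))"
  by (subst salg_expand) (simp add: lin_simps assms)
 also have "\<dots> = (\<Sum>m\<in>supp x. coef x m *: g (mon m))" using assms(3) by simp
 also have "\<dots> = g x"
  by (subst (3) salg_expand) (simp add: lin_simps assms)
 finally show ?thesis .
qed

lemma koszul_single_nonzero:
 "koszul {#g#} m \<noteq> 0 \<longleftrightarrow> \<not> (is_odd g \<and> g \<in># m)"
 by (auto simp: koszul_def)

lemma koszul_sq: "koszul a b \<noteq> 0 \<Longrightarrow> koszul a b * koszul a b = 1"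
 unfolding koszul_def
 by (auto split: if_splits simp: power_add[symmetric] mult_2[symmetric] power_mult)

lemma admissible_add_mset:
 "admissible (add_mset g m) \<longleftrightarrow> admissible m \<and> \<not> (is_odd g \<and> g \<in># m)"
proof -
 have "count (add_mset g m) h \<le> 1 \<longleftrightarrow> count m h \<le> 1 \<and> \<not> (h = g \<and> g \<in># m)" for h
 proof (cases "h = g")
  case True
  have "count m g \<noteq> 0 \<longleftrightarrow> g \<in># m" by simp
  thus ?thesis using True by (cases "count m g") simp_all
 qed simp
 hence "admissible (add_mset g m) \<longleftrightarrow>
   (\<forall>h. is_odd h \<longrightarrow> count m h \<le> 1 \<and> \<not> (h = g \<and> g \<in># m))"
  unfolding admissible_def by presburger
 thus ?thesis unfolding admissible_def by blast
qed

lemma gen_mult_mon: "admissible m \<Longrightarrow> gen g * mon m = koszul {#g#} m *: mon (add_mset g m)"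
 using mon_mult[of "{#g#}" m] by simp

lemma mon_mult_gen: "admissible m \<Longrightarrow> mon m * gen g = koszul m {#g#} *: mon (add_mset g m)"
 using mon_mult[of m "{#g#}"] by simp

lemma mon_pull:
 assumes "admissible (add_mset g m)"
 shows "mon (add_mset g m) = koszul {#g#} m *: (gen g * mon m)"
 using assms by (auto simp: koszul_single_nonzero admissible_add_mset koszul_sq gen_mult_mon)

lemma mon_pull':
 assumes "admissible m" "g \<in># m"
 shows "mon m = koszul {#g#} (m - {#g#}) *: (gen g * mon (m - {#g#}))"
 using mon_pull[of g "m - {#g#}"] assms by simp

text \<open>Every monomial arises from 1 by multiplying with generators from the left; the Koszul
  sign of moving one to the front is absorbed by the scalar case. Restricting to generators that
  occur in \<open>z\<close> makes the induction available for subalgebras.\<close>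

lemma mon_induct [case_names zero add smult one mult]:
 assumes "P 0" "\<And>x y. P x \<Longrightarrow> P y \<Longrightarrow> P (x + y)" "\<And>c x. P x \<Longrightarrow> P (c *: x)" "P 1"
  and "\<And>g x. (\<exists>m\<in>supp z. g \<in># m) \<Longrightarrow> P x \<Longrightarrow> P (gen g * x)"
 shows "P z"
proof -
 have mon: "(\<forall>g\<in>#m. \<exists>k\<in>supp z. g \<in># k) \<Longrightarrow> admissible m \<Longrightarrow> P (mon m)" for m
 proof (induction m)
  case empty thus ?case using assms(4) by (simp add: mon_empty)
 next
  case (add g m)
  thus ?case using mon_pull[of g m] assms(3,5) by (simp add: admissible_add_mset)
 qed
 have "P (\<Sum>m\<in>A. coef z m *: mon m)" if "A \<subseteq> supp z" for A
 proof -
  have "finite A" using that finite_subset finite_supp by blast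
  thus ?thesis using that
   by (induction A) (auto intro!: assms(1,2,3) mon supp_admissible)
 qed
 from this[of "supp z"] show ?thesis by (simp add: salg_expand[symmetric])
qed

subsection \<open>Diagonal operators\<close>

lift_definition diag :: "('g::graded_generator multiset \<Rightarrow> complex) \<Rightarrow> 'g salg \<Rightarrow> 'g salg"
 is "\<lambda>\<phi>. Poly_Mapping.mapp (\<lambda>k c. \<phi> k * c)"
 by (meson keys_mapp_subset subsetD)

lemma coef_diag [simp]: "coef (diag \<phi> x) m = \<phi> m * coef x m"
 by transfer (simp add: lookup_mapp when_def in_keys_iff)

lemma lin_diag: "lin (diag \<phi>)"
 by (auto intro!: linI salg_eqI simp: algebra_simps)

lemmas diag_simps = lin_simps[OF lin_diag]

lemma diag_mon: "diag \<phi> (mon m) = \<phi> m *: mon m"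
 by (rule salg_eqI) (simp add: coef_mon)

definition oddn :: "'g::graded_generator multiset \<Rightarrow> nat"
 where "oddn m = size (filter_mset is_odd m)"

definition parity :: "'g::graded_generator salg \<Rightarrow> 'g salg"
 where "parity = diag (\<lambda>m. (-1) ^ oddn m)"

lemma lin_parity: "lin parity" unfolding parity_def by (rule lin_diag)
lemmas parity_lin [simp] = lin_simps[OF lin_parity]

lemma parity_parity [simp]: "parity (parity x) = x"
 by (rule salg_eqI) (simp add: parity_def)

lemma parity_one [simp]: "parity 1 = 1"
 by (rule salg_eqI) (simp add: parity_def oddn_def coef_one)

text \<open>Parities of generators and operators are truth values, so signs are indexed by them;
  \<open>p \<noteq> q\<close> is then the sum of two parities.\<close>

definition sgo :: "bool \<Rightarrow> complex" where "sgo b = (if b then -1 else 1)"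

lemma sgo_simps [simp]: "sgo True = -1" "sgo False = 1" "sgo b * sgo b = 1" "sgo b * (sgo b * x) = x"
 by (auto simp: sgo_def)

lemma parity_gen [simp]: "parity (gen g) = sgo (is_odd g) *: gen g"
 by (simp add: parity_def diag_mon oddn_def)

lemma parity_mon: "parity (mon m) = (-1) ^ oddn m *: mon m"
 by (simp add: parity_def diag_mon)

lemma diag_mult_gen:
 assumes "\<And>m. \<phi> (add_mset g m) = c * \<phi> m"
 shows "diag \<phi> (gen g * x) = c *: (gen g * diag \<phi> x)"
proof (rule lin_eq_mon[of "\<lambda>x. diag \<phi> (gen g * x)"])
 fix m assume "m \<in> supp x"
 hence "admissible m" by (rule supp_admissible)
 thus "diag \<phi> (gen g * mon m) = c *: (gen g * diag \<phi> (mon m))"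
  by (simp add: gen_mult_mon diag_mon diag_simps assms mult_ac)
qed (rule lin_comp[OF lin_diag lin_multl[OF lin_ident]] lin_scale[OF lin_multl[OF lin_diag]])+

lemma parity_gen_mult: "parity (gen g * x) = sgo (is_odd g) *: (gen g * parity x)"
 unfolding parity_def by (rule diag_mult_gen) (simp add: oddn_def)

lemma parity_mult: "parity (x * y) = parity x * parity y"
proof (induction x rule: mon_induct)
 case (mult g x)
 thus ?case by (simp add: mult.assoc parity_gen_mult)
qed (simp_all add: distrib_right)

text \<open>The order of the odd generators is arbitrary but total: each odd factor of
  \<open>m\<close> different from \<open>g\<close> forms an inversion with \<open>g\<close> in
  exactly one of the two arrangements, so the two numbers of inversions add up to the number of odd
  factors.\<close>

lemma koszul_swap:
 assumes "admissible m"
 shows "koszul {#g#} m = (if is_odd g then (-1) ^ oddn m else 1) * koszul m {#g#}"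
proof (cases "is_odd g \<and> g \<in># m")
 case True thus ?thesis by (simp add: koszul_def)
next
 case False
 have lin: "(g, h) \<in> gen_order \<longleftrightarrow> (h, g) \<notin> gen_order" if "g \<noteq> h" for h
 proof -
  have wo: "well_order_on UNIV (gen_order :: ('a \<times> 'a) set)"
   unfolding gen_order_def using well_order_on[of UNIV] by (rule someI_ex)
  thus ?thesis using that
   unfolding well_order_on_def linear_order_on_def partial_order_on_def total_on_def antisym_def by blast
 qed
 show ?thesis
 proof (cases "is_odd g")
  case odd: True
  hence gm: "g \<notin># m" using False by simp
  have "inversions {#g#} m + inversions m {#g#} = oddn m"
   using gm
  proof (induction m)
   case empty thus ?case by (simp add: inversions_def oddn_def)
  next
   case (add h m)
   hence "g \<noteq> h" by auto
   thus ?case using add odd lin[of h] by (simp add: inversions_def oddn_def)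
  qed
  hence "(-1) ^ inversions {#g#} m * (-1) ^ inversions m {#g#} = ((-1) ^ oddn m :: complex)"
   by (metis power_add)
  moreover have "(-1) ^ k * (-1) ^ k = (1 :: complex)" for k :: nat
   by simp
  ultimately have "(-1) ^ inversions {#g#} m = ((-1) ^ oddn m * (-1) ^ inversions m {#g#} :: complex)"
   by (metis mult.assoc mult.right_neutral)
  thus ?thesis using odd gm by (auto simp: koszul_def)
 next
  case False
  thus ?thesis by (simp add: koszul_def inversions_def)
 qed
qed

lemma gen_odd_comm: "is_odd g \<Longrightarrow> gen g * x = parity x * gen g"
 by (rule lin_eq_mon[of "\<lambda>x. gen g * x"]; (auto simp: lin_eq_mon supp_admissible gen_mult_mon mon_mult_gen parity_mon koszul_swap lin_multl lin_ident lin_multr lin_parity))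

lemma gen_even_comm: "\<not> is_odd g \<Longrightarrow> gen g * x = x * gen g"
 by (rule lin_eq_mon[of "\<lambda>x. gen g * x"]; (auto simp: lin_eq_mon supp_admissible gen_mult_mon mon_mult_gen koszul_swap lin_multl lin_ident lin_multr))

lemma gen_odd_sq: "is_odd g \<Longrightarrow> gen g * (gen g * x) = 0"
proof -
 assume g: "is_odd g"
 have "gen g * gen g = 0"
  using g by (simp add: gen_mult_mon mon_not_admissible admissible_add_mset)
 thus ?thesis by (simp add: mult.assoc[symmetric])
qed

subsection \<open>Graded derivations\<close>

definition gparity :: "bool \<Rightarrow> 'g::graded_generator salg \<Rightarrow> 'g salg"
 where "gparity p x = (if p then parity x else x)"

lemma gparity_simps [simp]: "gparity True x = parity x" "gparity False x = x"
 by (simp_all add: gparity_def)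

lemma lin_gparity: "lin (gparity p)"
 by (cases p) (simp_all add: lin_parity lin_ident gparity_def[abs_def])

text \<open>The last clause says that \<open>f\<close> itself is homogeneous of parity
  \<open>p\<close>. It is what makes graded commutators of such operators derivations again.\<close>

definition drv :: "bool \<Rightarrow> ('g::graded_generator salg \<Rightarrow> 'g salg) \<Rightarrow> bool"
 where "drv p f \<longleftrightarrow> lin f \<and> (\<forall>x y. f (x * y) = f x * y + gparity p x * f y) \<and>
  (\<forall>x. f (parity x) = sgo p *: parity (f x))"

lemma der_superset:
 assumes "finite A" "supp x \<subseteq> A"
 shows "der D x = (\<Sum>m\<in>A. \<Sum>g\<in>set_mset m.
  (coef x m * of_nat (count m g) * koszul {#g#} (m - {#g#})) *: (D g * mon (m - {#g#})))"
 unfolding der_def cst_mult_conv smult_mult_left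
 by (rule sum.mono_neutral_left) (use assms in \<open>auto simp: supp_iff\<close>)

lemma lin_der: "lin (der D)"
proof (rule linI)
 fix x y :: "'a salg"
 let ?A = "supp x \<union> supp y \<union> supp (x + y)"
 show "der D (x + y) = der D x + der D y"
  by (subst (1 2 3) der_superset[of ?A])
   (auto simp: sum.distrib[symmetric] smult_dist algebra_simps)
next
 fix c and x :: "'a salg"
 let ?A = "supp x \<union> supp (c *: x)"
 show "der D (c *: x) = c *: der D x"
  by (subst (1 2) der_superset[of ?A]) (auto simp: smult_sum_right mult_ac)
qed

lemma der_mon: "admissible m \<Longrightarrow> der D (mon m) = (\<Sum>g\<in>set_mset m.
  (of_nat (count m g) * koszul {#g#} (m - {#g#})) *: (D g * mon (m - {#g#})))"
 by (subst der_superset[of "{m}"]) (auto simp: supp_iff coef_mon split: if_splits)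

lemma der_gen [simp]: "der D (gen g) = D g"
 by (simp add: der_mon mon_empty)

lemma der_one [simp]: "der D 1 = 0"
 using der_mon[of "{#}" D] by (simp add: mon_empty)

lemma koszul_single_add: "koszul {#g#} (add_mset h m) = koszul {#g#} {#h#} * koszul {#g#} m"
 by (auto simp: koszul_def inversions_def)

lemma koszul_single_swap:
 "g \<noteq> h \<Longrightarrow> koszul {#g#} {#h#} * koszul {#h#} {#g#} = (if is_odd g \<and> is_odd h then -1 else 1)"
 using koszul_swap[of "{#h#}" g] koszul_sq[of "{#h#}" "{#g#}"]
 by (auto simp: oddn_def koszul_single_nonzero)

text \<open>With values of a common parity shift \<open>p\<close>, the operator \<open>der D\<close>
  obeys the graded Leibniz rule.\<close>

locale graded_values =
 fixes p :: bool and D :: "'g::graded_generator \<Rightarrow> 'g salg"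
 assumes parity_value: "parity (D g) = sgo (p \<noteq> is_odd g) *: D g"
begin

lemma gen_value: "gen g * D h = (if is_odd g then sgo (p \<noteq> is_odd h) else 1) *: (D h * gen g)"
 by (simp add: gen_odd_comm gen_even_comm parity_value)

lemma gen_value_mult:
 "gen g * (D h * x) = (if is_odd g then sgo (p \<noteq> is_odd h) else 1) *: (D h * (gen g * x))"
 using arg_cong[OF gen_value[of g h], of "\<lambda>y. y * x"] by (simp add: mult.assoc)

text \<open>If \<open>g\<close> is odd and already occurs in \<open>m\<close>, the product is zero,
  and on the right only the term differentiating that factor survives; it cancels the first term.
  Otherwise the sums are compared term by term: moving \<open>h\<close> past \<open>g\<close> yields
  the Koszul sign, and the term with \<open>h = g\<close> accounts for the extra
  \<open>D g * mon m\<close>.\<close>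

lemma der_gen_mult_mon:
 assumes m: "admissible m"
 shows "der D (gen g * mon m) = D g * mon m + sgo (p \<and> is_odd g) *: (gen g * der D (mon m))"
proof (cases "is_odd g \<and> g \<in># m")
 case True
 hence "koszul {#g#} m = 0" by (simp add: koszul_def)
 hence lhs: "der D (gen g * mon m) = 0" using m by (simp add: gen_mult_mon lin_simps[OF lin_der])
 let ?t = "\<lambda>h. (of_nat (count m h) * koszul {#h#} (m - {#h#})) *: (gen g * (D h * mon (m - {#h#})))"
 have "gen g * der D (mon m) = (\<Sum>h\<in>set_mset m. ?t h)"
  by (simp add: der_mon[OF m] sum_distrib_left)
 also have "\<dots> = ?t g + (\<Sum>h\<in>set_mset m - {g}. ?t h)"
  using True by (intro sum.remove) auto
 also have "(\<Sum>h\<in>set_mset m - {g}. ?t h) = 0"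
 proof (rule sum.neutral, rule ballI)
  fix h assume "h \<in> set_mset m - {g}"
  hence h: "h \<in># m" "h \<noteq> g" by auto
  have "g \<in># m - {#h#}" using h True by (simp add: in_diff_count) 
  hence "gen g * mon (m - {#h#}) = 0" using True m by (simp add: gen_mult_mon koszul_def)
  hence "gen g * (D h * mon (m - {#h#})) = 0"
   by (simp add: gen_value_mult)
  thus "?t h = 0" by simp
 qed
 also have "count m g = 1" using m True by (metis admissible_def count_greater_eq_one_iff le_antisym)
 hence "?t g = (sgo (p \<noteq> True) * koszul {#g#} (m - {#g#})) *: (D g * (gen g * mon (m - {#g#})))"
  using True by (simp add: gen_value_mult mult_ac)
 also have "\<dots> = sgo (p \<noteq> True) *: (D g * mon m)"
  using True by (subst mon_pull'[OF m, of g]) auto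
 finally show ?thesis using True lhs by (cases p) auto
next
 case False
 hence adm: "admissible (add_mset g m)" using m by (simp add: admissible_add_mset)
 have K: "koszul {#g#} m * koszul {#g#} m = 1"
  using False by (intro koszul_sq) (simp add: koszul_single_nonzero)
 let ?M = "add_mset g m"
 let ?c = "\<lambda>m h. (of_nat (count m h) * koszul {#h#} (m - {#h#}))"
 have lhs: "der D (gen g * mon m) = (\<Sum>h\<in>set_mset ?M. (koszul {#g#} m * ?c ?M h) *: (D h * mon (?M - {#h#})))"
  using m by (simp add: gen_mult_mon lin_simps[OF lin_der] der_mon[OF adm] smult_sum_right)
 have tm: "(koszul {#g#} m * ?c ?M h) *: (D h * mon (?M - {#h#}))
   = ?c m h *: (sgo (p \<and> is_odd g) *: (gen g * (D h * mon (m - {#h#}))))"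
  if h: "h \<in># m" "h \<noteq> g" for h
 proof -
  let ?m = "m - {#h#}"
  have M: "?M - {#h#} = add_mset g ?m" using h by simp
  have adm': "admissible (add_mset g ?m)" using adm M admissible_diff by metis
  have m': "m = add_mset h ?m" using h by simp
  have Kg: "koszul {#g#} m = koszul {#g#} {#h#} * koszul {#g#} ?m"
   by (subst m') (rule koszul_single_add)
  have Ksq: "koszul {#g#} ?m * koszul {#g#} ?m = 1"
   using adm' by (intro koszul_sq) (simp add: koszul_single_nonzero admissible_add_mset)
  have "(koszul {#g#} m * ?c ?M h) *: (D h * mon (?M - {#h#}))
   = (koszul {#g#} {#h#} * koszul {#g#} ?m * (of_nat (count m h) * (koszul {#h#} {#g#} * koszul {#h#} ?m)) * koszul {#g#} ?m)
    *: (D h * (gen g * mon ?m))"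
   using h unfolding M koszul_single_add[of h g ?m] Kg mon_pull[OF adm'] by simp
  also have "(koszul {#g#} {#h#} * koszul {#g#} ?m * (of_nat (count m h) * (koszul {#h#} {#g#} * koszul {#h#} ?m)) * koszul {#g#} ?m)
    = (koszul {#g#} {#h#} * koszul {#h#} {#g#}) * (koszul {#g#} ?m * koszul {#g#} ?m) * ?c m h"
   by simp
  also have "\<dots> = (if is_odd g \<and> is_odd h then -1 else 1) * ?c m h"
   using koszul_single_swap[of g h] h Ksq by auto
  finally have e: "(koszul {#g#} m * ?c ?M h) *: (D h * mon (?M - {#h#}))
   = ((if is_odd g \<and> is_odd h then -1 else 1) * ?c m h) *: (D h * (gen g * mon ?m))" .
  have "gen g * (D h * mon ?m) = (if is_odd g then sgo (p \<noteq> is_odd h) else 1) *: (D h * (gen g * mon ?m))"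
   by (rule gen_value_mult)
  thus ?thesis unfolding e by (cases p; cases "is_odd g"; cases "is_odd h") auto
 qed
 have tg: "(koszul {#g#} m * ?c ?M g) *: (D g * mon (?M - {#g#}))
   = D g * mon m + ?c m g *: (sgo (p \<and> is_odd g) *: (gen g * (D g * mon (m - {#g#}))))"
 proof -
  have "(koszul {#g#} m * ?c ?M g) = (of_nat (count m g) + 1) * (koszul {#g#} m * koszul {#g#} m)"
   by simp
  hence l: "(koszul {#g#} m * ?c ?M g) *: (D g * mon (?M - {#g#})) = (of_nat (count m g) + 1) *: (D g * mon m)"
   using K by simp
  show ?thesis
  proof (cases "g \<in># m")
   case True
   hence ev: "\<not> is_odd g" using False by simp
   have "?c m g *: (gen g * (D g * mon (m - {#g#}))) = of_nat (count m g) *: (D g * mon m)"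
    by (subst mon_pull'[OF m True]) (use ev in \<open>auto simp: gen_value_mult mult_ac\<close>)
   thus ?thesis using ev l by (simp add: smult_dist)
  next
   case False
   hence "count m g = 0" by (simp add: not_in_iff)
   thus ?thesis using l by simp
  qed
 qed
 have rhs: "sgo (p \<and> is_odd g) *: (gen g * der D (mon m)) =
   (\<Sum>h\<in>set_mset m. ?c m h *: (sgo (p \<and> is_odd g) *: (gen g * (D h * mon (m - {#h#})))))"
  by (simp add: der_mon[OF m] sum_distrib_left smult_sum_right mult_ac)
 have fin: "(\<Sum>h\<in>insert g (set_mset m). f h) = f g + (\<Sum>h\<in>set_mset m - {g}. f h)" for f :: "'g \<Rightarrow> 'g salg"
  by (rule sum.insert_remove) simp
 have fin': "(\<Sum>h\<in>set_mset m. f h) = f g + (\<Sum>h\<in>set_mset m - {g}. f h)" if "g \<notin># m \<Longrightarrow> f g = 0" for f :: "'g \<Rightarrow> 'g salg"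
  using that by (cases "g \<in># m") (auto simp: sum.remove)
 have "(\<Sum>h\<in>set_mset m - {g}. (koszul {#g#} m * ?c ?M h) *: (D h * mon (?M - {#h#})))
   = (\<Sum>h\<in>set_mset m - {g}. ?c m h *: (sgo (p \<and> is_odd g) *: (gen g * (D h * mon (m - {#h#})))))"
  by (rule sum.cong[OF refl], rule tm) auto
 thus ?thesis
  unfolding lhs rhs set_mset_add_mset_insert fin tg
  by (subst fin') (auto simp: add.assoc)
qed

lemma der_gen_mult:
 "der D (gen g * x) = D g * x + sgo (p \<and> is_odd g) *: (gen g * der D x)"
 by (rule lin_eq_mon[of "\<lambda>x. der D (gen g * x)"])
  (rule lin_comp[OF lin_der lin_multl[OF lin_ident]] lin_plus[OF lin_multl[OF lin_ident] lin_scale[OF lin_multl[OF lin_der]]]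
    der_gen_mult_mon supp_admissible | assumption)+

lemma drv_der: "drv p (der D)"
 unfolding drv_def
proof (intro conjI allI lin_der)
 show "der D (x * y) = der D x * y + gparity p x * der D y" for x y
 proof (induction x rule: mon_induct)
  case (mult g x)
  show ?case
   by (cases p; cases "is_odd g")
    (simp_all add: mult.assoc der_gen_mult mult parity_gen_mult algebra_simps)
 qed (simp_all add: lin_simps[OF lin_der] lin_simps[OF lin_gparity] algebra_simps smult_dist, simp add: gparity_def)
 show "der D (parity x) = sgo p *: parity (der D x)" for x
 proof (induction x rule: mon_induct)
  case (mult g x)
  thus ?case
   by (cases p; cases "is_odd g")
    (simp_all add: der_gen_mult parity_mult parity_value lin_simps[OF lin_der] algebra_simps)
 qed (simp_all add: lin_simps[OF lin_der] smult_dist mult_ac)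
qed

end

global_interpretation salg: cvs "smult :: complex \<Rightarrow> 'g::graded_generator salg \<Rightarrow> 'g salg"
 by unfold_locales (simp_all add: smult_dist)

lemma linop_lin: "salg.linop f = lin f"
 by (simp add: salg.linop_def lin_def)

lemma drv_lin: "drv p f \<Longrightarrow> lin f" by (simp add: drv_def)
lemma drv_mult: "drv p f \<Longrightarrow> f (x * y) = f x * y + gparity p x * f y" by (simp add: drv_def)
lemma drv_even_mult: "drv False f \<Longrightarrow> f (x * y) = f x * y + x * f y" by (simp add: drv_def)
lemma drv_odd_mult: "drv True f \<Longrightarrow> f (x * y) = f x * y + parity x * f y" by (simp add: drv_def)
lemma drv_parity: "drv p f \<Longrightarrow> f (parity x) = sgo p *: parity (f x)" by (simp add: drv_def)
lemmas drv_simps = lin_simps[OF drv_lin]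
lemma drv_one: "drv p f \<Longrightarrow> f 1 = 0"
 using drv_mult[of p f 1 1] by (cases p) simp_all

lemma gparity_one [simp]: "gparity p 1 = 1" by (simp add: gparity_def)
lemma gparity_gen: "gparity p (gen g) = sgo (p \<and> is_odd g) *: gen g"
 by (simp add: gparity_def)

lemma drv_gen_mult: "drv p f \<Longrightarrow> f (gen g * x) = f (gen g) * x + sgo (p \<and> is_odd g) *: (gen g * f x)"
 by (simp add: drv_mult gparity_gen)

section \<open>Subalgebras generated by a set of generators\<close>

definition over :: "'g::graded_generator set \<Rightarrow> 'g salg \<Rightarrow> bool"
 where "over G x \<longleftrightarrow> (\<forall>m\<in>supp x. set_mset m \<subseteq> G)"

lemma over_iff: "over G x \<longleftrightarrow> (\<forall>m. coef x m \<noteq> 0 \<longrightarrow> set_mset m \<subseteq> G)"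
 by (auto simp: over_def supp_iff)
lemma over_UNIV [simp]: "over UNIV x" by (simp add: over_def)
lemma over_zero [simp]: "over G 0" by (simp add: over_def)
lemma over_one [simp]: "over G 1" by (simp add: over_iff coef_one)
lemma over_add: "over G x \<Longrightarrow> over G y \<Longrightarrow> over G (x + y)"
 unfolding over_iff by (metis coef_add add.right_neutral)
lemma over_smult: "over G x \<Longrightarrow> over G (c *: x)"
 unfolding over_iff by simp
lemma over_uminus: "over G x \<Longrightarrow> over G (- x)"
 using over_smult[of G x "-1"] by simp
lemma over_diff: "over G x \<Longrightarrow> over G y \<Longrightarrow> over G (x - y)"
 using over_add[of G x "- y"] by (simp add: over_uminus)
lemma over_sum: "(\<And>i. i \<in> A \<Longrightarrow> over G (f i)) \<Longrightarrow> over G (sum f A)"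
 by (induction A rule: infinite_finite_induct) (auto intro: over_add)
lemma over_sum_mset: "(\<And>i. i \<in># A \<Longrightarrow> over G (f i)) \<Longrightarrow> over G (\<Sum>i\<in>#A. f i)"
 by (induction A) (auto intro: over_add)
lemma over_mon: "set_mset m \<subseteq> G \<Longrightarrow> over G (mon m)"
 unfolding over_iff by (simp add: coef_mon)
lemma over_gen: "g \<in> G \<Longrightarrow> over G (gen g)" by (rule over_mon) simp
lemma over_mono: "over G x \<Longrightarrow> G \<subseteq> H \<Longrightarrow> over H x" unfolding over_def by blast

lemma over_gen_mult: assumes "g \<in> G" "over G x" shows "over G (gen g * x)"
proof -
 have "over G (gen g * mon m)" if "m \<in> supp x" for m
  unfolding gen_mult_mon[OF supp_admissible[OF that]]
  using that assms by (intro over_smult over_mon) (auto simp: over_def)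
 hence "over G (\<Sum>m\<in>supp x. coef x m *: (gen g * mon m))" by (intro over_sum over_smult)
 hence "over G (gen g * (\<Sum>m\<in>supp x. coef x m *: mon m))" by (simp add: sum_distrib_left)
 thus ?thesis by (simp add: salg_expand[symmetric])
qed

lemma over_induct [consumes 1, case_names zero add smult one mult]:
 assumes "over G z" "P 0" "\<And>x y. P x \<Longrightarrow> P y \<Longrightarrow> P (x + y)" "\<And>c x. P x \<Longrightarrow> P (c *: x)" "P 1"
  and "\<And>g x. g \<in> G \<Longrightarrow> P x \<Longrightarrow> P (gen g * x)"
 shows "P z"
proof (rule mon_induct[of P])
 fix g x assume "\<exists>m\<in>supp z. g \<in># m" "P x"
 thus "P (gen g * x)" using assms(1,6) unfolding over_def by blast
qed (use assms in blast)+

lemma over_mult: "over G x \<Longrightarrow> over G y \<Longrightarrow> over G (x * y)"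
 by (induction x rule: over_induct) (auto simp: distrib_right mult.assoc intro: over_add over_smult over_gen_mult)

lemma over_parity: "over G x \<Longrightarrow> over G (parity x)"
 unfolding over_iff parity_def by simp

lemma drv_over:
 assumes "drv p f" "\<And>g. g \<in> G \<Longrightarrow> over H (f (gen g))" "over G x" "G \<subseteq> H"
 shows "over H (f x)"
proof -
 have "over H (f x) \<and> over G x" using assms(3)
 proof (induction x rule: over_induct)
  case (mult g x)
  hence "over H (f (gen g))" "over H x" "g \<in> H" using assms(2,4) over_mono by auto
  thus ?case using mult
   by (simp add: drv_gen_mult[OF assms(1)] over_add over_smult over_gen_mult over_mult)
 qed (auto simp: drv_simps[OF assms(1)] drv_one[OF assms(1)] intro: over_add over_smult)
 thus ?thesis by simp
qed

text \<open>Identities between operators are proved throughout by this principle: both sides are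
  derivations of the same parity, so their values on generators decide.\<close>

lemma drv_eq_over:
 assumes "drv p f" "drv p g" "\<And>h. h \<in> G \<Longrightarrow> f (gen h) = g (gen h)" "over G x"
 shows "f x = g x"
 using assms(4)
 by (induction x rule: over_induct)
  (simp_all add: drv_simps[OF assms(1)] drv_simps[OF assms(2)] drv_one[OF assms(1)] drv_one[OF assms(2)]
   drv_gen_mult[OF assms(1)] drv_gen_mult[OF assms(2)] assms(3))

lemma drv_eq: "drv p f \<Longrightarrow> drv p g \<Longrightarrow> (\<And>h. f (gen h) = g (gen h)) \<Longrightarrow> f x = g x"
 by (rule drv_eq_over[of p f g UNIV]) auto

lemma drv_zero: "drv p (\<lambda>x. 0)" by (simp add: drv_def lin_def)
lemma drv_zero_over: "drv p f \<Longrightarrow> (\<And>h. h \<in> G \<Longrightarrow> f (gen h) = 0) \<Longrightarrow> over G x \<Longrightarrow> f x = 0"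
 by (rule drv_eq_over[OF _ drv_zero])
lemma drv_zero_eq: "drv p f \<Longrightarrow> (\<And>h. f (gen h) = 0) \<Longrightarrow> f x = 0"
 by (rule drv_eq[OF _ drv_zero])

lemma drv_add: "drv p f \<Longrightarrow> drv p g \<Longrightarrow> drv p (\<lambda>x. f x + g x)"
 by (auto simp: drv_def algebra_simps intro: lin_plus)
lemma drv_neg: "drv p f \<Longrightarrow> drv p (\<lambda>x. - f x)"
 by (auto simp: drv_def algebra_simps intro: lin_neg)
lemma drv_diff: "drv p f \<Longrightarrow> drv p g \<Longrightarrow> drv p (\<lambda>x. f x - g x)"
 using drv_add[OF _ drv_neg] by fastforce
lemma drv_smult: "drv p f \<Longrightarrow> drv p (\<lambda>x. c *: f x)"
 by (auto simp: drv_def smult_dist intro: lin_scale)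
lemma drv_sum: "(\<And>i. i \<in> A \<Longrightarrow> drv p (f i)) \<Longrightarrow> drv p (\<lambda>x. \<Sum>i\<in>A. f i x)"
 by (induction A rule: infinite_finite_induct) (auto intro: drv_add drv_zero)

lemma drv_gen:
 assumes "drv p f" shows "drv (p \<noteq> is_odd g) (\<lambda>x. gen g * f x)"
proof -
 have "gen g * f (x * y) = gen g * f x * y + gparity (p \<noteq> is_odd g) x * (gen g * f y)" for x y
 proof (cases "is_odd g")
  case True
  hence "gen g * (gparity p x * f y) = parity (gparity p x) * (gen g * f y)"
   using gen_odd_comm[OF True, of "gparity p x"] by (metis mult.assoc)
  thus ?thesis using True assms by (cases p) (simp_all add: drv_def algebra_simps)
 next
  case False
  hence "gen g * (gparity p x * f y) = gparity p x * (gen g * f y)"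
   using gen_even_comm[OF False, of "gparity p x"] by (simp add: mult.assoc[symmetric])
  thus ?thesis using False assms by (cases p) (simp_all add: drv_def algebra_simps)
 qed
 moreover have "gen g * f (parity x) = sgo (p \<noteq> is_odd g) *: parity (gen g * f x)" for x
  using drv_parity[OF assms] by (cases p; cases "is_odd g") (simp_all add: parity_gen_mult)
 ultimately show ?thesis using drv_lin[OF assms] lin_multl unfolding drv_def by blast
qed

lemma drv_gen_odd: "drv p f \<Longrightarrow> is_odd g \<Longrightarrow> drv (\<not> p) (\<lambda>x. gen g * f x)"
 using drv_gen[of p f g] by simp
lemma drv_gen_even: "drv p f \<Longrightarrow> \<not> is_odd g \<Longrightarrow> drv p (\<lambda>x. gen g * f x)"
 using drv_gen[of p f g] by simp

lemma drv_evenI: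
 "lin f \<Longrightarrow> (\<And>x y. f (x * y) = f x * y + x * f y) \<Longrightarrow> (\<And>x. f (parity x) = parity (f x)) \<Longrightarrow> drv False f"
 by (simp add: drv_def)
lemma drv_oddI:
 "lin f \<Longrightarrow> (\<And>x y. f (x * y) = f x * y + parity x * f y) \<Longrightarrow> (\<And>x. f (parity x) = - parity (f x)) \<Longrightarrow> drv True f"
 by (simp add: drv_def)
lemma drv_even_parity: "drv False f \<Longrightarrow> f (parity x) = parity (f x)" by (simp add: drv_def)
lemma drv_odd_parity: "drv True f \<Longrightarrow> f (parity x) = - parity (f x)" by (simp add: drv_def)

lemma parity_drv_odd: "drv True f \<Longrightarrow> parity (f x) = - f (parity x)" by (simp add: drv_def)

lemma drv_comm_even_even:
 assumes "drv False f" "drv False g"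
 shows "drv False (\<lambda>x. f (g x) - g (f x))"
 by (rule drv_evenI)
  (simp_all add: lin_minus lin_comp drv_lin[OF assms(1)] drv_lin[OF assms(2)] drv_even_mult[OF assms(1)] drv_even_mult[OF assms(2)]
   drv_simps[OF assms(1)] drv_simps[OF assms(2)] drv_even_parity[OF assms(1)] drv_even_parity[OF assms(2)]
   distrib_left distrib_right left_diff_distrib right_diff_distrib)

lemma drv_comm_even_odd:
 assumes "drv False f" "drv True g"
 shows "drv True (\<lambda>x. f (g x) - g (f x))"
 by (rule drv_oddI)
  (simp_all add: lin_minus lin_comp drv_lin[OF assms(1)] drv_lin[OF assms(2)] drv_even_mult[OF assms(1)] drv_odd_mult[OF assms(2)]
   drv_simps[OF assms(1)] drv_simps[OF assms(2)] drv_even_parity[OF assms(1)] drv_odd_parity[OF assms(2)]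
   distrib_left distrib_right left_diff_distrib right_diff_distrib)

lemma drv_comm_odd_even: "drv True f \<Longrightarrow> drv False g \<Longrightarrow> drv True (\<lambda>x. f (g x) - g (f x))"
 using drv_neg[OF drv_comm_even_odd[of g f]] by simp

lemma drv_comm_odd_odd:
 assumes "drv True f" "drv True g"
 shows "drv False (\<lambda>x. f (g x) + g (f x))"
 by (rule drv_evenI)
  (simp_all add: lin_plus lin_comp drv_lin[OF assms(1)] drv_lin[OF assms(2)] drv_odd_mult[OF assms(1)] drv_odd_mult[OF assms(2)]
   drv_simps[OF assms(1)] drv_simps[OF assms(2)] drv_odd_parity[OF assms(1)] drv_odd_parity[OF assms(2)]
   distrib_left distrib_right)

lemma drv_comm_even:
 assumes "drv False f" "drv p g"
 shows "drv p (\<lambda>x. f (g x) - g (f x))"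
 using assms drv_comm_even_even drv_comm_even_odd by (cases p) auto

lemma drv_odd_square: "drv True f \<Longrightarrow> drv False (\<lambda>x. f (f x))"
 by (rule drv_evenI) (simp_all add: lin_comp drv_lin drv_odd_mult drv_simps drv_odd_parity)

subsection \<open>Gradings\<close>

definition wt :: "('g \<Rightarrow> int) \<Rightarrow> 'g multiset \<Rightarrow> int"
 where "wt w m = (\<Sum>g\<in>#m. w g)"

lemma wt_simps [simp]: "wt w {#} = 0" "wt w (add_mset g m) = w g + wt w m"
 by (simp_all add: wt_def)

text \<open>The Euler operator of the weight \<open>w\<close>. Homogeneity becomes an eigenvalue
  equation (\<open>hom_num\<close>), so the degree of an operator can be read off from its
  commutator with this derivation.\<close>

definition num :: "('g::graded_generator \<Rightarrow> int) \<Rightarrow> 'g salg \<Rightarrow> 'g salg"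
 where "num w = diag (\<lambda>m. of_int (wt w m))"

lemma lin_num: "lin (num w)" by (simp add: num_def lin_diag)
lemma num_mon: "num w (mon m) = of_int (wt w m) *: mon m" by (simp add: num_def diag_mon)
lemma num_gen [simp]: "num w (gen g) = of_int (w g) *: gen g" by (simp add: num_mon)
lemma num_one: "num w 1 = 0" by (simp add: mon_empty[symmetric] num_mon)
lemmas num_lin [simp] = lin_simps[OF lin_num]

lemma num_gen_mult: "num w (gen g * x) = of_int (w g) *: (gen g * x) + gen g * num w x"
proof (rule lin_eq_mon[of "\<lambda>x. num w (gen g * x)"])
 fix m assume "m \<in> supp x"
 hence "admissible m" by (rule supp_admissible)
 thus "num w (gen g * mon m) = of_int (w g) *: (gen g * mon m) + gen g * num w (mon m)"
  by (simp add: gen_mult_mon num_mon smult_dist distrib_left distrib_right mult.commute)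
qed (rule lin_comp[OF lin_num lin_multl[OF lin_ident]]
   lin_plus[OF lin_scale[OF lin_multl[OF lin_ident]] lin_multl[OF lin_num]])+

lemma num_parity: "num w (parity x) = parity (num w x)"
 by (rule salg_eqI) (simp add: num_def parity_def)

lemma drv_num: "drv False (num w)"
proof -
 have "num w (x * y) = num w x * y + x * num w y" for x y
  by (induction x rule: mon_induct)
   (simp_all add: num_one num_gen_mult mult.assoc algebra_simps smult_dist)
 thus ?thesis by (simp add: drv_def lin_num num_parity)
qed

definition hom :: "('g::graded_generator \<Rightarrow> int) \<Rightarrow> int \<Rightarrow> 'g salg \<Rightarrow> bool"
 where "hom w k x \<longleftrightarrow> (\<forall>m\<in>supp x. wt w m = k)"

lemma hom_num: "hom w k x \<longleftrightarrow> num w x = of_int k *: x"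
proof
 assume "hom w k x"
 thus "num w x = of_int k *: x"
  by (intro salg_eqI) (auto simp: hom_def num_def supp_iff)
next
 assume h: "num w x = of_int k *: x"
 have "of_int (wt w m) * coef x m = of_int k * coef x m" for m
  using arg_cong[OF h, of "\<lambda>x. coef x m"] by (simp add: num_def)
 hence "of_int (wt w m) = (of_int k :: complex)" if "coef x m \<noteq> 0" for m
  using that by (metis mult_right_cancel)
 thus "hom w k x" by (simp add: hom_def supp_iff)
qed

lemma hom_zero [simp]: "hom w k 0" by (simp add: hom_def)
lemma hom_one [simp]: "hom w 0 1" by (simp add: hom_num num_one)
lemma hom_gen: "hom w (w g) (gen g)" by (simp add: hom_num)
lemma hom_gen': "k = w g \<Longrightarrow> hom w k (gen g)" by (simp add: hom_gen)
lemma hom_add: "hom w k x \<Longrightarrow> hom w k y \<Longrightarrow> hom w k (x + y)"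
 by (simp add: hom_num smult_dist)
lemma hom_smult: "hom w k x \<Longrightarrow> hom w k (c *: x)"
 by (simp add: hom_num)
lemma hom_uminus: "hom w k x \<Longrightarrow> hom w k (- x)"
 by (simp add: hom_num)
lemma hom_diff: "hom w k x \<Longrightarrow> hom w k y \<Longrightarrow> hom w k (x - y)"
 by (simp add: hom_num smult_dist)
lemma hom_sum: "(\<And>i. i \<in> A \<Longrightarrow> hom w k (f i)) \<Longrightarrow> hom w k (sum f A)"
 by (induction A rule: infinite_finite_induct) (auto intro: hom_add)
lemma hom_mult: "hom w k x \<Longrightarrow> hom w l y \<Longrightarrow> hom w (k + l) (x * y)"
 by (simp add: hom_num drv_even_mult[OF drv_num] smult_dist)
lemma hom_gen_mult: "hom w k x \<Longrightarrow> l = w g + k \<Longrightarrow> hom w l (gen g * x)"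
 using hom_mult[OF hom_gen] by blast
lemma drv_num_comm:
 assumes "drv p f" "\<And>g. hom w (w g + s) (f (gen g))"
 shows "num w (f x) = f (num w x) + of_int s *: f x"
proof -
 have d: "drv p (\<lambda>x. num w (f x) - f (num w x))"
  by (rule drv_comm_even[OF drv_num assms(1)])
 have "num w (f x) - f (num w x) = of_int s *: f x"
  by (rule drv_eq[OF d drv_smult[OF assms(1)]])
   (use assms in \<open>simp add: hom_num num_gen drv_simps[OF assms(1)] smult_dist\<close>)
 thus ?thesis by (simp add: algebra_simps)
qed

lemma drv_hom:
 assumes "drv p f" "\<And>g. hom w (w g + s) (f (gen g))" "hom w k x" "l = k + s"
 shows "hom w l (f x)"
 using assms(3,4) drv_num_comm[OF assms(1,2)]
 by (simp add: hom_num drv_simps[OF assms(1)] smult_dist)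

section \<open>Projections to homogeneous components\<close>

definition flt :: "('g::graded_generator multiset \<Rightarrow> bool) \<Rightarrow> 'g salg \<Rightarrow> 'g salg"
 where "flt P = diag (\<lambda>m. if P m then 1 else 0)"

lemma coef_flt [simp]: "coef (flt P x) m = (if P m then coef x m else 0)" by (simp add: flt_def)
lemma lin_flt: "lin (flt P)" by (simp add: flt_def lin_diag)
lemmas flt_simps [simp] = lin_simps[OF lin_flt]
lemma flt_id: "(\<And>m. m \<in> supp x \<Longrightarrow> P m) \<Longrightarrow> flt P x = x"
 by (rule salg_eqI) (auto simp: supp_iff)
lemma flt_null: "(\<And>m. m \<in> supp x \<Longrightarrow> \<not> P m) \<Longrightarrow> flt P x = 0"
 by (rule salg_eqI) (auto simp: supp_iff)
lemma supp_flt: "supp (flt P x) = {m \<in> supp x. P m}" by (auto simp: supp_iff split: if_splits)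
definition gpart :: "('g::graded_generator \<Rightarrow> int) \<Rightarrow> int \<Rightarrow> 'g salg \<Rightarrow> 'g salg"
 where "gpart w k = flt (\<lambda>m. wt w m = k)"

lemma lin_comp': "lin (gpart w k)" by (simp add: gpart_def lin_flt)
lemmas comp_simps [simp] = lin_simps[OF lin_comp']
lemma coef_comp [simp]: "coef (gpart w k x) m = (if wt w m = k then coef x m else 0)" by (simp add: gpart_def)
lemma hom_comp: "hom w k (gpart w k x)" by (auto simp: hom_def gpart_def supp_flt)
lemma comp_hom: "hom w k x \<Longrightarrow> gpart w k x = x" unfolding gpart_def hom_def by (rule flt_id) simp
lemma comp_hom_other: "hom w k x \<Longrightarrow> l \<noteq> k \<Longrightarrow> gpart w l x = 0"
 unfolding gpart_def hom_def by (rule flt_null) simp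
lemma comp_hom_if: "hom w k x \<Longrightarrow> gpart w l x = (if l = k then x else 0)"
 by (simp add: comp_hom comp_hom_other)
lemma hom_comp_other: "hom w k x \<Longrightarrow> hom w k (flt P x)" by (auto simp: hom_def supp_flt)
lemma over_flt: "over G x \<Longrightarrow> over G (flt P x)" by (auto simp: over_def supp_flt)

lemma sum_comp:
 assumes "finite K" "wt w ` supp x \<subseteq> K" shows "x = (\<Sum>k\<in>K. gpart w k x)"
proof (rule salg_eqI)
 fix m
 have "wt w m \<in> K" if "coef x m \<noteq> 0" using that assms(2) by (auto simp: supp_iff)
 thus "coef x m = coef (\<Sum>k\<in>K. gpart w k x) m" using assms(1) by (auto simp: sum.delta')
qed

text \<open>A homogeneous operator sends components of different degree to different degrees, so
  taking components commutes with it up to the shift \<open>s\<close>.\<close>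

lemma lin_comp_comm:
 assumes "lin f" "\<And>k x. hom w k x \<Longrightarrow> hom w (k + s) (f x)"
 shows "f (gpart w k x) = gpart w (k + s) (f x)"
proof -
 let ?K = "insert k (wt w ` supp x)"
 have x: "x = (\<Sum>l\<in>?K. gpart w l x)" by (rule sum_comp) auto
 have h: "hom w (l + s) (f (gpart w l x))" for l by (rule assms(2)[OF hom_comp])
 have "gpart w (k + s) (f x) = gpart w (k + s) (f (\<Sum>l\<in>?K. gpart w l x))" by (subst x) (rule refl)
 also have "\<dots> = (\<Sum>l\<in>?K. gpart w (k + s) (f (gpart w l x)))" by (simp add: lin_simps[OF assms(1)])
 also have "\<dots> = (\<Sum>l\<in>?K. if l = k then f (gpart w k x) else 0)"
  by (rule sum.cong) (use comp_hom_if[OF h] in auto)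
 also have "\<dots> = f (gpart w k x)" by simp
 finally show ?thesis by simp
qed

lemma drv_comp_comm:
 assumes "drv p f" "\<And>g. hom w (w g + s) (f (gen g))"
 shows "f (gpart w k x) = gpart w (k + s) (f x)"
 by (rule lin_comp_comm[OF drv_lin[OF assms(1)]]) (rule drv_hom[OF assms], auto)

subsection \<open>Exponentials of locally nilpotent operators\<close>

definition lnil :: "('g::graded_generator salg \<Rightarrow> 'g salg) \<Rightarrow> bool"
 where "lnil Z \<longleftrightarrow> (\<forall>x. \<exists>k. (Z ^^ k) x = 0)"

text \<open>The exponential series breaks off at an order that depends on \<open>x\<close>; the
  least exponent that kills \<open>x\<close> bounds the sum.\<close>

definition expo :: "('g::graded_generator salg \<Rightarrow> 'g salg) \<Rightarrow> complex \<Rightarrow> 'g salg \<Rightarrow> 'g salg"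
 where "expo Z t x = (\<Sum>k<(LEAST n. (Z ^^ n) x = 0). (t ^ k / fact k) *: (Z ^^ k) x)"

context
 fixes Z :: "'g::graded_generator salg \<Rightarrow> 'g salg"
 assumes lin_Z: "lin Z"
begin

lemma funpow_zero_mono: "(Z ^^ k) x = 0 \<Longrightarrow> k \<le> n \<Longrightarrow> (Z ^^ n) x = 0"
proof -
 assume "(Z ^^ k) x = 0" "k \<le> n"
 hence "(Z ^^ n) x = (Z ^^ (n - k)) ((Z ^^ k) x)" by (metis comp_apply funpow_add le_add_diff_inverse2)
 thus ?thesis using \<open>(Z ^^ k) x = 0\<close> by (simp add: lin_simps[OF lin_funpow[OF lin_Z]])
qed

lemma expo_eq: "(Z ^^ n) x = 0 \<Longrightarrow> expo Z t x = (\<Sum>k<n. (t ^ k / fact k) *: (Z ^^ k) x)"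
 unfolding expo_def
proof (rule sum.mono_neutral_left)
 assume h: "(Z ^^ n) x = 0"
 let ?l = "LEAST n. (Z ^^ n) x = 0"
 have l: "(Z ^^ ?l) x = 0" using h by (rule LeastI)
 show "{..<?l} \<subseteq> {..<n}" using h by (auto intro: less_le_trans Least_le)
 show "\<forall>i\<in>{..<n} - {..<?l}. (t ^ i / fact i) *: (Z ^^ i) x = 0"
  using funpow_zero_mono[OF l] by auto
qed simp

context
 assumes nil_Z: "lnil Z"
begin

lemma lnil_common:
 assumes "finite A" shows "\<exists>n. \<forall>x\<in>A. (Z ^^ n) x = 0"
 using assms
proof induction
 case (insert x A)
 then obtain n where n: "\<forall>x\<in>A. (Z ^^ n) x = 0" by blast
 obtain k where "(Z ^^ k) x = 0" using nil_Z unfolding lnil_def by blast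
 thus ?case using n by (intro exI[of _ "max n k"]) (auto intro: funpow_zero_mono)
qed simp

lemma lin_expo: "lin (expo Z t)"
proof (rule linI)
 fix x y
 obtain n where "\<forall>z\<in>{x, y, x + y}. (Z ^^ n) z = 0" using lnil_common[of "{x, y, x + y}"] by blast
 thus "expo Z t (x + y) = expo Z t x + expo Z t y"
  by (simp add: expo_eq[of n] lin_simps[OF lin_funpow[OF lin_Z]] smult_dist sum.distrib)
next
 fix c x
 obtain n where "\<forall>z\<in>{x, c *: x}. (Z ^^ n) z = 0" using lnil_common[of "{x, c *: x}"] by blast
 thus "expo Z t (c *: x) = c *: expo Z t x"
  by (simp add: expo_eq[of n] lin_simps[OF lin_funpow[OF lin_Z]] smult_sum_right mult_ac)
qed

lemma expo_kernel: "Z x = 0 \<Longrightarrow> expo Z t x = x"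
 by (subst expo_eq[of 1]) auto

lemma expo_comm:
 assumes "lin f" "\<And>x. f (Z x) = Z (f x)"
 shows "f (expo Z t x) = expo Z t (f x)"
proof -
 have p: "f ((Z ^^ k) x) = (Z ^^ k) (f x)" for k x
  by (induction k) (simp_all add: assms(2))
 obtain n where "(Z ^^ n) x = 0" using nil_Z unfolding lnil_def by blast
 moreover from this have "(Z ^^ n) (f x) = 0" using p[of n x] by (simp add: lin_zero[OF assms(1)])
 ultimately show ?thesis by (simp add: expo_eq[of n] lin_simps[OF assms(1)] p)
qed

text \<open>Collecting the double sum by total order r gives the binomial expansion of (t + (-t))^r
  / r!, which vanishes unless r = 0.\<close>

lemma expo_inverse: "expo Z (- t) (expo Z t x) = x"
proof -
 obtain n where n: "(Z ^^ n) x = 0" using nil_Z unfolding lnil_def by blast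
 note L = lin_simps[OF lin_funpow[OF lin_Z]] lin_simps[OF lin_expo]
 have e: "expo Z (- t) ((Z ^^ k) x) = (\<Sum>j<n. ((- t) ^ j / fact j) *: (Z ^^ (j + k)) x)" for k
  using n funpow_zero_mono[OF n, of "n + k"]
  by (subst expo_eq[of n]) (simp_all add: funpow_add)
 have "expo Z (- t) (expo Z t x) = (\<Sum>k<n. \<Sum>j<n. ((t ^ k / fact k) * ((- t) ^ j / fact j)) *: (Z ^^ (j + k)) x)"
  using n by (simp add: expo_eq[of n x] L e smult_sum_right)
 also have "\<dots> = (\<Sum>(k, j)\<in>{..<n} \<times> {..<n}. ((t ^ k / fact k) * ((- t) ^ j / fact j)) *: (Z ^^ (j + k)) x)"
  by (simp add: sum.cartesian_product)
 also have "\<dots> = (\<Sum>(k, j)\<in>{(k, j). k + j < n}. ((t ^ k / fact k) * ((- t) ^ j / fact j)) *: (Z ^^ (j + k)) x)"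
 proof (rule sum.mono_neutral_right)
  have "(Z ^^ (j + k)) x = 0" if "\<not> k + j < n" for k j
   using that funpow_zero_mono[OF n, of "j + k"] by linarith
  thus "\<forall>i\<in>{..<n} \<times> {..<n} - {(k, j). k + j < n}.
    (case i of (k, j) \<Rightarrow> ((t ^ k / fact k) * ((- t) ^ j / fact j)) *: (Z ^^ (j + k)) x) = 0"
   by fastforce
 qed auto
 also have "\<dots> = (\<Sum>r<n. \<Sum>k\<le>r. ((t ^ k / fact k) * ((- t) ^ (r - k) / fact (r - k))) *: (Z ^^ r) x)"
  by (subst sum.triangle_reindex) simp
 also have "\<dots> = (\<Sum>r<n. (if r = 0 then x else 0))"
 proof (rule sum.cong[OF refl])
  fix r
  have "(\<Sum>k\<le>r. (t ^ k / fact k) * ((- t) ^ (r - k) / fact (r - k)))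
    = (\<Sum>k\<le>r. of_nat (r choose k) * t ^ k * (- t) ^ (r - k)) / fact r"
   unfolding sum_divide_distrib
   by (rule sum.cong) (auto simp: binomial_fact)
  also have "\<dots> = (t + (- t)) ^ r / fact r" by (subst binomial_ring) simp
  also have "\<dots> = (if r = 0 then 1 else 0)" by simp
  finally show "(\<Sum>k\<le>r. ((t ^ k / fact k) * ((- t) ^ (r - k) / fact (r - k))) *: (Z ^^ r) x) = (if r = 0 then x else 0)"
   by (simp add: smult_sum_left[symmetric])
 qed
 also have "\<dots> = x" using n by (cases n) auto
 finally show ?thesis .
qed

text \<open>Since F = [E, Z] commutes with Z, one has E Z^k = Z^k E + k Z^(k-1) F. The factor k
  cancels against the factorial and shifts the index, so conjugation stops after the first
  commutator.\<close>

lemma expo_conj: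
 assumes "lin E" "lin F" "\<And>x. E (Z x) = Z (E x) + F x" "\<And>x. F (Z x) = Z (F x)"
 shows "E (expo Z t x) = expo Z t (E x) + t *: expo Z t (F x)"
proof -
 have FZ: "F ((Z ^^ k) x) = (Z ^^ k) (F x)" for k x by (induction k) (simp_all add: assms(4))
 have EZ: "E ((Z ^^ Suc k) x) = (Z ^^ Suc k) (E x) + of_nat (Suc k) *: (Z ^^ k) (F x)" for k x
 proof (induction k)
  case (Suc k)
  have "E ((Z ^^ Suc (Suc k)) x) = Z (E ((Z ^^ Suc k) x)) + F ((Z ^^ Suc k) x)" by (simp add: assms(3))
  thus ?case unfolding Suc FZ
   by (simp add: lin_simps[OF lin_Z] algebra_simps two_smult)
 qed (simp add: assms(3))
 obtain n where n: "\<forall>z\<in>{x, E x, F x}. (Z ^^ n) z = 0" using lnil_common[of "{x, E x, F x}"] by blast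
 have n': "(Z ^^ Suc n) x = 0" "(Z ^^ Suc n) (E x) = 0" "(Z ^^ n) (F x) = 0"
  using n by (auto simp: lin_simps[OF lin_Z])
 have "E (expo Z t x) = E x + (\<Sum>k<n. (t ^ Suc k / fact (Suc k)) *: E ((Z ^^ Suc k) x))"
  by (subst expo_eq[OF n'(1)]) (simp only: lin_simps[OF assms(1)] sum.lessThan_Suc_shift, simp)
 also have "\<dots> = (E x + (\<Sum>k<n. (t ^ Suc k / fact (Suc k)) *: (Z ^^ Suc k) (E x)))
   + (\<Sum>k<n. (t ^ Suc k / fact (Suc k) * of_nat (Suc k)) *: (Z ^^ k) (F x))"
  by (simp only: EZ smult_dist sum.distrib smult_simps add.assoc)
 also have "E x + (\<Sum>k<n. (t ^ Suc k / fact (Suc k)) *: (Z ^^ Suc k) (E x)) = expo Z t (E x)"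
  by (subst expo_eq[OF n'(2)]) (simp only: sum.lessThan_Suc_shift, simp)
 also have "(\<Sum>k<n. (t ^ Suc k / fact (Suc k) * of_nat (Suc k)) *: (Z ^^ k) (F x)) = t *: expo Z t (F x)"
 proof -
  have "t ^ Suc k / fact (Suc k) * of_nat (Suc k) = t * (t ^ k / fact k)" for k
   by (simp add: fact_Suc[of k] del: of_nat_Suc fact_Suc)
  thus ?thesis by (simp add: expo_eq[OF n'(3)] smult_sum_right del: of_nat_Suc fact_Suc power_Suc)
 qed
 finally show ?thesis .
qed

end
end

text \<open>By the Leibniz rule Z^n applied to a product xy is a sum of products of Z^i x and Z^j y
  with i + j = n, so the exponents of the factors add. Local nilpotency on generators is therefore
  enough.\<close>

lemma drv_lnil:
 assumes "drv False Z" "\<And>g. \<exists>k. (Z ^^ k) (gen g) = 0"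
 shows "lnil Z"
 unfolding lnil_def
proof
 note L = lin_simps[OF lin_funpow[OF drv_lin[OF assms(1)]]]
 have prod: "\<exists>k. (Z ^^ k) (x * y) = 0" if "(Z ^^ k) x = 0" "(Z ^^ l) y = 0" for x y k l
 proof -
  have "(Z ^^ i) x' = 0 \<and> (Z ^^ j) y' = 0 \<and> i + j \<le> n \<Longrightarrow> (Z ^^ n) (x' * y') = 0" for n i j x' y'
  proof (induction n arbitrary: i j x' y')
   case (Suc n)
   show ?case
   proof (cases "i = 0 \<or> j = 0")
    case True
    hence "x' * y' = 0" using Suc.prems by auto
    thus ?thesis using L(3)[of "Suc n"] by metis
   next
    case False
    then obtain i' j' where ij: "i = Suc i'" "j = Suc j'" by (auto simp: gr0_conv_Suc)
    have "(Z ^^ n) (Z x' * y') = 0" using Suc.IH[of i' "Z x'" j y'] Suc.prems ij by (simp add: funpow_swap1)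
    moreover have "(Z ^^ n) (x' * Z y') = 0" using Suc.IH[of i x' j' "Z y'"] Suc.prems ij by (simp add: funpow_swap1)
    ultimately show ?thesis by (simp add: funpow_Suc_right drv_even_mult[OF assms(1)] L del: funpow.simps)
   qed
  qed auto
  thus ?thesis using that by blast
 qed
 fix x
 show "\<exists>k. (Z ^^ k) x = 0"
 proof (induction x rule: mon_induct)
  case (add x y)
  then obtain k l where "(Z ^^ k) x = 0" "(Z ^^ l) y = 0" by blast
  hence "(Z ^^ max k l) x = 0" "(Z ^^ max k l) y = 0"
   using funpow_zero_mono[OF drv_lin[OF assms(1)]] by (metis max.cobounded1 max.cobounded2)+
  thus ?case by (intro exI[of _ "max k l"]) (simp add: L)
 next
  case (mult g x) thus ?case using prod assms(2)[of g] by blast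
 next
  case one show ?case by (intro exI[of _ 1]) (simp add: drv_one[OF assms(1)])
 qed (auto simp: L)
qed

subsection \<open>Differential forms\<close>

lemma is_odd_simps [simp]:
 "is_odd (Dx \<mu> :: ('m, 'a) symb)" "is_odd (Eps \<mu> :: ('m, 'a) symb)" "\<not> is_odd (Xi \<mu> :: ('m, 'a) symb)"
 "is_odd (Jet One a I S :: ('m, 'a) symb) \<longleftrightarrow> even (card S)"
 "is_odd (Jet Two a I S :: ('m, 'a) symb) \<longleftrightarrow> odd (CARD('m) + card S)"
 "is_odd (U a :: ('m, 'a) symb) \<longleftrightarrow> even (CARD('m))"
 "is_odd (V a :: ('m, 'a) symb) \<longleftrightarrow> odd (CARD('m))"
 by (auto simp: is_odd_symb_def)

abbreviation dxm :: "'m set \<Rightarrow> ('m, 'a) symb multiset"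
 where "dxm S \<equiv> image_mset Dx (mset_set S)"

abbreviation dx_free :: "('m, 'a) loc \<Rightarrow> bool"
 where "dx_free \<equiv> over {g. \<not> is_dx g}"

definition fdeg :: "('m, 'a) symb \<Rightarrow> int"
 where "fdeg g = (if is_dx g then 1 else 0)"

lemma fdeg_simps [simp]: "fdeg (Dx \<mu>) = 1" "\<not> is_dx g \<Longrightarrow> fdeg g = 0"
 by (simp_all add: fdeg_def)

lemma wt_form: "wt fdeg m = int (size (filter_mset is_dx m))"
 by (induction m) (auto simp: fdeg_def)

lemma inj_Dx [simp]: "inj_on Dx S" by (rule inj_onI) simp

lemma dxm_eq: "dxm S = mset_set (Dx ` S)" by (simp add: image_mset_mset_set)

lemma count_dxm: "count (dxm (S :: 'm::finite set) :: ('m, 'a) symb multiset) g = (if g \<in> Dx ` S then 1 else 0)"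
 unfolding dxm_eq by simp

lemma set_dxm [simp]: "set_mset (dxm (S :: 'm::finite set)) = Dx ` S" by simp

lemma dxm_inj: "(dxm S :: ('m::finite, 'a) symb multiset) = dxm R \<longleftrightarrow> S = R"
proof
 assume e: "(dxm S :: ('m, 'a) symb multiset) = dxm R"
 have "(Dx ` S :: ('m, 'a) symb set) = Dx ` R" using arg_cong[OF e, of set_mset] by simp
 thus "S = R" by (simp add: inj_image_eq_iff)
qed simp

lemma size_dxm [simp]: "size (dxm S) = card S" by simp

lemma admissible_dxm [simp]: "admissible (dxm (S :: 'm::finite set))"
 unfolding admissible_def count_dxm by simp

lemma filter_dxm: "filter_mset is_dx (dxm S) = dxm S" "filter_mset (\<lambda>g. \<not> is_dx g) (dxm S) = {#}"
 by (induction "mset_set S") (auto simp: filter_mset_eq_conv)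

lemma filter_dxm_add:
 assumes "\<forall>g\<in>#k. \<not> is_dx g"
 shows "filter_mset is_dx (dxm S + k) = dxm S" "filter_mset (\<lambda>g. \<not> is_dx g) (dxm S + k) = k"
 using assms by (auto simp: filter_dxm filter_mset_eq_conv)

lemma admissible_split:
 assumes "admissible (m :: ('m::finite, 'a) symb multiset)"
 obtains S k where "m = dxm S + k" "\<forall>g\<in>#k. \<not> is_dx g" "admissible k" "admissible (dxm S + k)"
proof -
 let ?S = "{\<mu>. Dx \<mu> \<in># m}"
 have "filter_mset is_dx m = dxm ?S"
 proof (rule multiset_eqI)
  fix g
  show "count (filter_mset is_dx m) g = count (dxm ?S) g"
  proof (cases g)
   case (Dx \<mu>)
   have "count m (Dx \<mu>) \<le> 1" using assms unfolding admissible_def by simp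
   moreover have "count m (Dx \<mu>) = 0 \<longleftrightarrow> Dx \<mu> \<notin># m" by (rule count_eq_zero_iff)
   ultimately have "count m (Dx \<mu>) = (if Dx \<mu> \<in># m then 1 else 0)" by (metis le_antisym less_one not_le)
   thus ?thesis using Dx unfolding count_dxm by auto
  qed (auto simp: count_dxm)
 qed
 hence e: "dxm ?S + filter_mset (\<lambda>g. \<not> is_dx g) m = m" by (metis multiset_partition)
 show ?thesis
 proof (rule that)
  show "m = dxm ?S + filter_mset (\<lambda>g. \<not> is_dx g) m" by (rule e[symmetric])
  show "\<forall>g\<in>#filter_mset (\<lambda>g. \<not> is_dx g) m. \<not> is_dx g" by simp
  show "admissible (filter_mset (\<lambda>g. \<not> is_dx g) m)" by (rule admissible_mono[OF _ assms]) simp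
  show "admissible (dxm ?S + filter_mset (\<lambda>g. \<not> is_dx g) m)" unfolding e by (rule assms)
 qed
qed

lemma koszul_dxm:
 assumes "\<forall>g\<in>#k. \<not> is_dx g"
 shows "koszul (dxm (S :: 'm::finite set)) k \<noteq> 0" "koszul (dxm S) k * koszul (dxm S) k = 1"
 using assms by (auto simp: koszul_def koszul_sq)

lemma admissible_dxm_add:
 assumes "\<forall>g\<in>#k. \<not> is_dx g" "admissible k"
 shows "admissible (dxm (S :: 'm::finite set) + k)"
 by (rule admissible_add[OF admissible_dxm assms(2) koszul_dxm(1)[OF assms(1)]])

lemma dx_set_mult_mon:
 assumes "\<forall>g\<in>#k. \<not> is_dx g" "admissible k"
 shows "dx_set (S :: 'm::finite set) * mon k = koszul (dxm S) k *: mon (dxm S + k)"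
 unfolding dx_set_def by (rule mon_mult[OF admissible_dxm assms(2)])

text \<open>The Koszul sign between the \<open>dx\<close> part and the rest is never zero and is its
  own inverse, so cofactors can be compared coefficient by coefficient.\<close>

lemma coef_cof: "coef (cof (S :: 'm::finite set) x) k =
  (if \<forall>g\<in>#k. \<not> is_dx g then coef x (dxm S + k) * koszul (dxm S) k else 0)"
proof -
 let ?d = "filter_mset is_dx" and ?n = "filter_mset (\<lambda>g. \<not> is_dx g)"
 let ?M = "{m \<in> supp x. ?d m = dxm S}"
 have "coef (cof S x) k = (\<Sum>m\<in>?M. coef x m * koszul (?d m) (?n m) * coef (mon (?n m)) k)"
  unfolding cof_def cst_mult_conv by simp
 also have "\<dots> = (\<Sum>m\<in>?M. if m = dxm S + k \<and> (\<forall>g\<in>#k. \<not> is_dx g) then coef x (dxm S + k) * koszul (dxm S) k else 0)"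
 proof (rule sum.cong[OF refl])
  fix m assume m: "m \<in> ?M"
  have "admissible (?n m)" by (rule admissible_mono[of _ m]) (use m supp_admissible in auto)
  have "?n m = k \<longleftrightarrow> m = dxm S + k \<and> (\<forall>g\<in>#k. \<not> is_dx g)"
   using m multiset_partition[of m is_dx] filter_dxm_add(2)[of k S] by auto
  show "coef x m * koszul (?d m) (?n m) * coef (mon (?n m)) k
    = (if m = dxm S + k \<and> (\<forall>g\<in>#k. \<not> is_dx g) then coef x (dxm S + k) * koszul (dxm S) k else 0)"
  proof (cases "m = dxm S + k \<and> (\<forall>g\<in>#k. \<not> is_dx g)")
   case True
   hence "?n m = k" "?d m = dxm S" using filter_dxm_add by auto
   thus ?thesis using True \<open>admissible (?n m)\<close> by (simp add: coef_mon)
  next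
   case False
   hence "?n m \<noteq> k" using \<open>(?n m = k) = (m = dxm S + k \<and> (\<forall>g\<in>#k. \<not> is_dx g))\<close> by blast
   hence "coef (mon (?n m)) k = 0" by (simp add: coef_mon)
   thus ?thesis using False by (simp only: if_False mult_zero_right)
  qed
 qed
 also have "\<dots> = (if \<forall>g\<in>#k. \<not> is_dx g then coef x (dxm S + k) * koszul (dxm S) k else 0)"
 proof (cases "\<forall>g\<in>#k. \<not> is_dx g")
  case True
  have "finite ?M" by simp
  hence "(\<Sum>m\<in>?M. if m = dxm S + k then coef x (dxm S + k) * koszul (dxm S) k else 0)
    = (if dxm S + k \<in> ?M then coef x (dxm S + k) * koszul (dxm S) k else 0)"
   by (rule sum.delta)
  moreover have "dxm S + k \<in> ?M \<longleftrightarrow> coef x (dxm S + k) \<noteq> 0"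
   unfolding mem_Collect_eq filter_dxm_add(1)[OF True] by (simp add: supp_iff)
  ultimately show ?thesis using True by simp
 next
  case False
  thus ?thesis by (simp only: simp_thms if_False sum.neutral_const)
 qed
 finally show ?thesis .
qed

lemma lin_cof: "lin (cof (S :: 'm::finite set))"
 by (rule linI; rule salg_eqI) (simp_all add: coef_cof algebra_simps)
lemmas cof_lin [simp] = lin_simps[OF lin_cof]

lemma dx_free_iff: "dx_free x \<longleftrightarrow> (\<forall>m. coef x m \<noteq> 0 \<longrightarrow> (\<forall>g\<in>#m. \<not> is_dx g))"
 by (auto simp: over_iff)

lemma dx_free_cof: "dx_free (cof (S :: 'm::finite set) x)"
 unfolding dx_free_iff by (simp add: coef_cof)

lemma lin_eq_over_mon:
 assumes "lin f" "lin g" "over G x" "\<And>m. admissible m \<Longrightarrow> set_mset m \<subseteq> G \<Longrightarrow> f (mon m) = g (mon m)"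
 shows "f x = g x"
 by (rule lin_eq_mon[OF assms(1,2)]) (rule assms(4), use assms(3) in \<open>auto simp: over_def intro: supp_admissible\<close>)

lemma cof_dx_set:
 assumes "dx_free y"
 shows "cof S (dx_set R * y) = (if R = (S :: 'm::finite set) then y else 0)"
proof -
 have "cof S (dx_set R * y) = (if R = S then 1 else 0) *: y"
 proof (rule lin_eq_over_mon[of "\<lambda>y. cof S (dx_set R * y)" "\<lambda>y. (if R = S then 1 else 0) *: y", OF _ _ assms])
  fix k :: "('m, 'b) symb multiset"
  assume k: "admissible k" "set_mset k \<subseteq> {g. \<not> is_dx g}"
  hence kd: "\<forall>g\<in>#k. \<not> is_dx g" by auto
  have "dxm R + k = dxm S + j \<longleftrightarrow> R = S \<and> k = j" if "\<forall>g\<in>#j. \<not> is_dx g" for j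
  proof
   assume e: "dxm R + k = dxm S + j"
   have "dxm R = (dxm S :: ('m, 'b) symb multiset)" "k = j"
    using arg_cong[OF e, of "filter_mset is_dx"] arg_cong[OF e, of "filter_mset (\<lambda>g. \<not> is_dx g)"]
    unfolding filter_dxm_add[OF kd] filter_dxm_add[OF that] by simp_all
   thus "R = S \<and> k = j" by (simp add: dxm_inj)
  qed simp
  thus "cof S (dx_set R * mon k) = (if R = S then 1 else 0) *: mon k"
   using k koszul_dxm(2)[OF kd, of S] admissible_dxm_add[OF kd k(1), of R]
   by (intro salg_eqI) (auto simp: dx_set_mult_mon[OF kd k(1)] coef_cof coef_mon dxm_inj)
 qed (rule lin_comp[OF lin_cof lin_multl[OF lin_ident]] lin_scale[OF lin_ident])+
 thus ?thesis by simp
qed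

text \<open>Together with the uniqueness of cofactors (\<open>cof_dx_set\<close>) this makes forms a
  free module over the basis forms; equations between forms can then be checked cofactor by
  cofactor.\<close>

lemma form_expand: "x = (\<Sum>S. dx_set (S :: 'm::finite set) * cof S x)"
proof -
 show ?thesis
 proof (rule lin_eq_mon[of "\<lambda>x. x" "\<lambda>x. \<Sum>S. dx_set (S :: 'm set) * cof S x"])
  fix m assume "m \<in> supp x"
  hence "admissible m" by (rule supp_admissible)
  then obtain S :: "'m set" and k where m: "m = dxm S + k" and k: "\<forall>g\<in>#k. \<not> is_dx g" "admissible k"
   by (rule admissible_split)
  have e: "mon m = koszul (dxm S) k *: (dx_set S * mon k)"
   using koszul_dxm(2)[OF k(1), of S] by (simp add: dx_set_mult_mon[OF k] m)
  have d: "dx_free (mon k)" by (rule over_mon) (use k in auto)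
  have "(\<Sum>R. dx_set R * cof R (mon m)) = (\<Sum>R. if R = S then mon m else 0)"
   by (rule sum.cong) (auto simp: e cof_dx_set[OF d])
  also have "\<dots> = mon m" by (simp add: sum.delta)
  finally show "mon m = (\<Sum>R. dx_set R * cof R (mon m))" by (rule sym)
 qed (intro lin_ident lin_summ lin_multl lin_cof)+
qed

lemma form_eqI: "(\<And>S. cof (S :: 'm::finite set) x = cof S y) \<Longrightarrow> x = y"
 using form_expand[of x] form_expand[of y] by simp

lemma cof_sum_dx_set:
 assumes "\<And>S. dx_free (y S)"
 shows "cof S (\<Sum>R. dx_set (R :: 'm::finite set) * y R) = y S"
 by (simp add: cof_dx_set[OF assms])

lemma parity_dx_set: "parity (dx_set S) = (-1) ^ card S *: (dx_set S :: ('m::finite, 'a) loc)"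
proof -
 have "filter_mset is_odd (dxm S) = (dxm S :: ('m, 'a) symb multiset)"
  by (auto simp: filter_mset_eq_conv)
 hence "oddn (dxm S :: ('m, 'a) symb multiset) = card S"
  unfolding oddn_def by (simp only: size_dxm)
 thus ?thesis by (simp add: dx_set_def parity_mon)
qed

lemma parity_cof: "parity (cof S x) = (-1) ^ card S *: cof (S :: 'm::finite set) (parity x)"
proof -
 have "parity x = (\<Sum>R. dx_set R * ((-1) ^ card R *: parity (cof R x)))"
  by (subst form_expand) (simp add: parity_mult parity_dx_set)
 hence "cof S (parity x) = cof S (\<Sum>R. dx_set R * ((-1) ^ card R *: parity (cof R x)))" by simp
 also have "\<dots> = (-1) ^ card S *: parity (cof S x)"
  by (rule cof_sum_dx_set) (intro over_smult over_parity dx_free_cof)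
 finally show ?thesis by simp
qed

lemma over_dx_set: "over (Dx ` (S :: 'm::finite set)) (dx_set S)"
 unfolding dx_set_def by (rule over_mon) simp

lemma drv_dx_set_mult:
 assumes "drv p f" "\<And>\<mu>. f (gen (Dx \<mu>)) = 0"
 shows "f (dx_set S * y) = (if p then (-1) ^ card S else 1) *: (dx_set (S :: 'm::finite set) * f y)"
proof -
 have "f (dx_set S) = 0" by (rule drv_zero_over[OF assms(1) _ over_dx_set]) (auto simp: assms(2))
 thus ?thesis by (simp add: drv_mult[OF assms(1)] parity_dx_set)
qed

lemma hom_form_dx_free: "dx_free x \<Longrightarrow> hom fdeg 0 x"
proof -
 assume x: "dx_free x"
 have "wt fdeg m = 0" if "m \<in> supp x" for m
 proof -
  have "\<forall>g\<in>#m. \<not> is_dx g" using x that by (auto simp: over_def)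
  thus ?thesis by (induction m) auto
 qed
 thus ?thesis by (simp add: hom_def)
qed

lemma hom_dx_set: "hom fdeg (int (card S)) (dx_set (S :: 'm::finite set))"
 unfolding dx_set_def hom_def
 by (auto simp: supp_iff coef_mon wt_form filter_dxm split: if_splits)

lemma hom_dx_set_mult: "dx_free y \<Longrightarrow> hom fdeg (int (card S)) (dx_set (S :: 'm::finite set) * y)"
 using hom_mult[OF hom_dx_set hom_form_dx_free] by fastforce

lemma comp_form: "gpart fdeg k x = (\<Sum>S | int (card S) = k. dx_set (S :: 'm::finite set) * cof S x)"
proof -
 have "gpart fdeg k x = (\<Sum>S. gpart fdeg k (dx_set (S :: 'm set) * cof S x))"
  by (subst form_expand) simp
 also have "\<dots> = (\<Sum>S. if int (card S) = k then dx_set S * cof S x else 0)"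
 proof (rule sum.cong[OF refl])
  fix S :: "'m set"
  show "gpart fdeg k (dx_set S * cof S x) = (if int (card S) = k then dx_set S * cof S x else 0)"
   using comp_hom_if[OF hom_dx_set_mult[OF dx_free_cof], of k S S x] by auto
 qed
 also have "\<dots> = (\<Sum>S | int (card S) = k. dx_set S * cof S x)"
  by (simp add: sum.If_cases)
 finally show ?thesis .
qed

lemma cof_comp: "cof S (gpart fdeg k x) = (if int (card S) = k then cof (S :: 'm::finite set) x else 0)"
proof -
 have "gpart fdeg k x = (\<Sum>R. dx_set R * (if int (card R) = k then cof R x else 0))"
  unfolding comp_form by (rule sum.mono_neutral_cong_left) auto
 thus ?thesis using cof_sum_dx_set[of "\<lambda>R. if int (card R) = k then cof R x else 0" S]
  by (auto simp: dx_free_cof)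
qed

lemma comp_form_neg: "k < 0 \<Longrightarrow> gpart fdeg k x = (0 :: ('m::finite, 'a) loc)"
 unfolding comp_form by (rule sum.neutral) auto

lemma comp_form_mult:
 "gpart fdeg (int p) (x * y :: ('m::finite, 'a) loc) =
  (\<Sum>q\<le>p. gpart fdeg (int q) x * gpart fdeg (int (p - q)) y)"
proof -
 \<comment> \<open>Large enough for all form degrees that occur and for every
   \<open>p - q\<close>.\<close>
 let ?N = "max p (CARD('m))"
 have e: "z = (\<Sum>q\<le>?N. gpart fdeg (int q) z)" for z :: "('m, 'a) loc"
 proof -
  have "wt fdeg m \<in> int ` {..?N}" if m: "m \<in> supp z" for m
  proof -
   have "admissible m" using m by (rule supp_admissible)
   then obtain S :: "'m set" and k where "m = dxm S + k" "\<forall>g\<in>#k. \<not> is_dx g" by (rule admissible_split)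
   hence "size (filter_mset is_dx m) = card S" using filter_dxm_add(1)[of k S] by simp
   moreover have "card S \<le> CARD('m)" by (rule card_mono) auto
   ultimately show ?thesis by (simp add: wt_form)
  qed
  hence "z = (\<Sum>k\<in>int ` {..?N}. gpart fdeg k z)" by (intro sum_comp) auto
  thus ?thesis by (simp add: sum.reindex)
 qed
 have "gpart fdeg (int p) (x * y) =
   (\<Sum>q\<le>?N. \<Sum>r\<le>?N. gpart fdeg (int p) (gpart fdeg (int q) x * gpart fdeg (int r) y))"
  by (subst e[of x], subst e[of y]) (simp add: sum_product)
 also have "\<dots> = (\<Sum>q\<le>?N. \<Sum>r\<le>?N. if q + r = p then gpart fdeg (int q) x * gpart fdeg (int r) y else 0)"
 proof (intro sum.cong refl)
  fix q r :: nat
  have "hom fdeg (int q + int r) (gpart fdeg (int q) x * gpart fdeg (int r) y)"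
   by (intro hom_mult hom_comp)
  from comp_hom_if[OF this, of "int p"] show "gpart fdeg (int p) (gpart fdeg (int q) x * gpart fdeg (int r) y)
    = (if q + r = p then gpart fdeg (int q) x * gpart fdeg (int r) y else 0)" by auto
 qed
 also have "\<dots> = (\<Sum>q\<le>?N. if q \<le> p then gpart fdeg (int q) x * gpart fdeg (int (p - q)) y else 0)"
 proof (rule sum.cong[OF refl])
  fix q assume "q \<in> {..?N}"
  have "p - q \<le> ?N" by simp
  have "(\<Sum>r\<le>?N. if q + r = p then gpart fdeg (int q) x * gpart fdeg (int r) y else 0)
    = (\<Sum>r\<le>?N. if r = p - q then (if q \<le> p then gpart fdeg (int q) x * gpart fdeg (int (p - q)) y else 0) else 0)"
   by (rule sum.cong) auto
  thus "(\<Sum>r\<le>?N. if q + r = p then gpart fdeg (int q) x * gpart fdeg (int r) y else 0)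
    = (if q \<le> p then gpart fdeg (int q) x * gpart fdeg (int (p - q)) y else 0)"
   using \<open>p - q \<le> ?N\<close> by simp
 qed
 also have "\<dots> = (\<Sum>q\<le>p. gpart fdeg (int q) x * gpart fdeg (int (p - q)) y)"
  by (rule sum.mono_neutral_cong_right) auto
 finally show ?thesis .
qed

subsection \<open>Total derivatives and operators compatible with them\<close>

lemma is_odd_Jet_index: "is_odd (Jet A a I S :: ('m, 'a) symb) = is_odd (Jet A b J S :: ('m, 'a) symb)"
 by (cases A) simp_all

lemma drv_tderiv: "drv False (tderiv \<mu> :: ('m, 'a) loc \<Rightarrow> _)"
 unfolding tderiv_def
 by (rule graded_values.drv_der, unfold_locales)
  (auto split: symb.split intro!: arg_cong[of _ _ sgo] is_odd_Jet_index)
lemmas tderiv_lin [simp] = drv_simps[OF drv_tderiv]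

lemma tderiv_Jet [simp]: "tderiv \<mu> (gen (Jet A a I S)) = gen (Jet A a (add_mset \<mu> I) S)"
 by (simp add: tderiv_def)
lemma tderiv_other [simp]: "\<not> is_field g \<Longrightarrow> tderiv \<mu> (gen g) = 0"
 by (cases g) (simp_all add: tderiv_def)

lemma tderiv_comm: "tderiv \<mu> (tderiv \<nu> x) = tderiv \<nu> (tderiv \<mu> (x :: ('m, 'a) loc))"
proof -
 have "tderiv \<mu> (tderiv \<nu> x) - tderiv \<nu> (tderiv \<mu> x) = 0"
 proof (rule drv_zero_eq[OF drv_comm_even_even[OF drv_tderiv drv_tderiv]])
  fix h :: "('m, 'a) symb"
  show "tderiv \<mu> (tderiv \<nu> (gen h)) - tderiv \<nu> (tderiv \<mu> (gen h)) = 0"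
   by (cases h) (simp_all add: add_mset_commute)
 qed
 thus ?thesis by simp
qed

abbreviation tderivs :: "'m multiset \<Rightarrow> ('m, 'a) loc \<Rightarrow> ('m, 'a) loc"
 where "tderivs I x \<equiv> fold_mset tderiv x I"

interpretation tderiv: comp_fun_commute "tderiv :: 'm \<Rightarrow> ('m, 'a) loc \<Rightarrow> ('m, 'a) loc"
 by unfold_locales (auto simp: tderiv_comm)

lemma tderivs_Jet: "tderivs I (gen (Jet A a J S)) = gen (Jet A a (I + J) S)"
 by (induction I) simp_all

lemma lin_tderivs: "lin (tderivs I)"
 by (induction I) (simp_all add: lin_ident lin_comp[OF drv_lin[OF drv_tderiv]])

lemma tderivs_comm:
 assumes "\<And>\<mu> x. f (tderiv \<mu> x) = tderiv \<mu> (f x)"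
 shows "f (tderivs I x) = tderivs I (f x)"
 by (induction I) (simp_all add: assms)

lemma dx_free_tderiv: "dx_free x \<Longrightarrow> dx_free (tderiv \<mu> x)"
 by (rule drv_over[OF drv_tderiv])
  (auto simp: tderiv_def intro!: over_gen split: symb.split)

lemma dx_free_tderivs: "dx_free x \<Longrightarrow> dx_free (tderivs I x)"
 by (induction I) (simp_all add: dx_free_tderiv)

section \<open>Interior products and evolutionary derivations\<close>

abbreviation ix :: "'m \<Rightarrow> ('m, 'a) loc \<Rightarrow> ('m, 'a) loc"
 where "ix \<mu> \<equiv> partial (Dx \<mu>)"

lemma drv_partial: "drv (is_odd g) (partial g)"
 unfolding partial_def
 by (rule graded_values.drv_der, unfold_locales) auto
lemmas partial_lin [simp] = drv_simps[OF drv_partial]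

lemma drv_ix: "drv True (ix \<mu> :: ('m, 'a) loc \<Rightarrow> _)"
 using drv_partial[of "Dx \<mu> :: ('m, 'a) symb"] by simp
lemmas ix_lin [simp] = drv_simps[OF drv_ix]

lemma partial_gen [simp]: "partial g (gen h) = (if h = g then 1 else 0)"
 by (simp add: partial_def)

lemma ix_dx_free: "dx_free x \<Longrightarrow> ix \<mu> x = 0"
 by (rule drv_zero_over[OF drv_ix]) auto

lemma ix_tderiv: "ix \<mu> (tderiv \<nu> x) = tderiv \<nu> (ix \<mu> (x :: ('m, 'a) loc))"
proof -
 have "ix \<mu> (tderiv \<nu> x) - tderiv \<nu> (ix \<mu> x) = 0"
 proof (rule drv_zero_eq[OF drv_comm_odd_even[OF drv_ix drv_tderiv]])
  fix h :: "('m, 'a) symb"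
  show "ix \<mu> (tderiv \<nu> (gen h)) - tderiv \<nu> (ix \<mu> (gen h)) = 0"
   by (cases h) (simp_all add: drv_one[OF drv_tderiv])
 qed
 thus ?thesis by simp
qed

lemma ix_ix: "ix \<mu> (ix \<nu> x) + ix \<nu> (ix \<mu> x) = (0 :: ('m, 'a) loc)"
 by (rule drv_zero_eq[OF drv_comm_odd_odd[OF drv_ix drv_ix]]) (simp add: drv_one[OF drv_ix])

lemma drv_dext: "drv True (dext :: ('m::finite, 'a) loc \<Rightarrow> _)"
 unfolding dext_def by (intro drv_sum drv_gen_odd[of False, simplified] drv_tderiv) simp
lemmas dext_lin [simp] = drv_simps[OF drv_dext]

lemma hom_form_tderiv: "hom fdeg k x \<Longrightarrow> hom fdeg k (tderiv \<mu> (x :: ('m, 'a) loc))"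
proof (rule drv_hom[OF drv_tderiv])
 show "hom fdeg (fdeg g + 0) (tderiv \<mu> (gen g))" for g :: "('m, 'a) symb"
  by (cases g) (auto intro!: hom_gen')
qed auto

lemma hom_form_dext: "hom fdeg k x \<Longrightarrow> hom fdeg (k + 1) (dext (x :: ('m::finite, 'a) loc))"
 unfolding dext_def by (intro hom_sum hom_gen_mult hom_form_tderiv) auto

lemma hom_form_ix: "hom fdeg k x \<Longrightarrow> hom fdeg (k - 1) (ix \<mu> (x :: ('m, 'a) loc))"
 by (rule drv_hom[OF drv_ix, of _ "-1"]) auto

lemma gpart_dext: "dext (gpart fdeg k x) = gpart fdeg (k + 1) (dext (x :: ('m::finite, 'a) loc))"
 by (rule lin_comp_comm[OF drv_lin[OF drv_dext] hom_form_dext])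

lemma gpart_ix: "ix \<mu> (gpart fdeg k x) = gpart fdeg (k - 1) (ix \<mu> (x :: ('m, 'a) loc))"
 using lin_comp_comm[OF drv_lin[OF drv_ix], of fdeg "-1"] hom_form_ix by fastforce

text \<open>Cartan's formula for a constant coordinate vector field, whose Lie derivative is the
  total derivative because the frame \<open>dx\<close> is constant.\<close>

lemma ix_dext: "ix \<mu> (dext x) + dext (ix \<mu> x) = tderiv \<mu> (x :: ('m::finite, 'a) loc)"
proof (rule drv_eq[OF drv_comm_odd_odd[OF drv_ix drv_dext] drv_tderiv])
 fix h :: "('m, 'a) symb"
 have "(\<Sum>\<nu>. ix \<mu> (gen (Dx \<nu>) * gen (Jet A a (add_mset \<nu> I) S))) = gen (Jet A a (add_mset \<mu> I) S)" for A a I S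
 proof -
  have "ix \<mu> (gen (Dx \<nu>) * gen (Jet A a (add_mset \<nu> I) S)) = (if \<nu> = \<mu> then gen (Jet A a (add_mset \<mu> I) S) else 0)" for \<nu> :: 'm
   by (simp add: drv_odd_mult[OF drv_ix])
  thus ?thesis by (simp add: sum.delta)
 qed
 thus "ix \<mu> (dext (gen h)) + dext (ix \<mu> (gen h)) = tderiv \<mu> (gen h)"
  by (cases h) (simp_all add: dext_def drv_one[OF drv_tderiv])
qed

text \<open>Evolutionary derivations, prolonged to derivatives of the fields by commuting with the
  total derivatives. Their values on \<open>superfield\<close> and on the constants determine them
  (\<open>vder_eqI\<close>), so component calculations are avoided.\<close>

definition vder :: "bool \<Rightarrow> (('m, 'a) loc \<Rightarrow> ('m, 'a) loc) \<Rightarrow> bool"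
 where "vder p f \<longleftrightarrow> drv p f \<and> (\<forall>\<mu> x. f (tderiv \<mu> x) = tderiv \<mu> (f x)) \<and>
  (\<forall>\<mu>. f (gen (Dx \<mu>)) = 0) \<and> (\<forall>x. dx_free x \<longrightarrow> dx_free (f x))"

lemma vder_drv: "vder p f \<Longrightarrow> drv p f" by (simp add: vder_def)
lemma vder_tderiv: "vder p f \<Longrightarrow> f (tderiv \<mu> x) = tderiv \<mu> (f x)" by (simp add: vder_def)
lemma vder_Dx: "vder p f \<Longrightarrow> f (gen (Dx \<mu>)) = 0" by (simp add: vder_def)
lemma vder_dx_free: "vder p f \<Longrightarrow> dx_free x \<Longrightarrow> dx_free (f x)" by (simp add: vder_def)

lemma vder_zero: "vder p (\<lambda>x. 0)"
 by (simp add: vder_def drv_zero)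

lemma vder_tderiv_self: "vder False (tderiv \<mu>)"
 by (simp add: vder_def drv_tderiv tderiv_comm dx_free_tderiv)

lemma vder_comm_odd_odd: "vder True f \<Longrightarrow> vder True g \<Longrightarrow> vder False (\<lambda>x. f (g x) + g (f x))"
 unfolding vder_def
 by (auto simp: drv_simps intro!: drv_comm_odd_odd over_add)

lemma vder_dext: "vder p f \<Longrightarrow> f (dext x) = sgo p *: dext (f x)"
 by (simp add: dext_def drv_simps[OF vder_drv] drv_gen_mult[OF vder_drv] vder_Dx vder_tderiv smult_sum_right)

lemma vder_ix:
 assumes "vder p f" shows "f (ix \<mu> x) = sgo p *: ix \<mu> (f (x :: ('m, 'a) loc))"
proof -
 note L = drv_simps[OF vder_drv[OF assms]] drv_one[OF vder_drv[OF assms]] ix_lin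
 have z: "ix \<mu> (f (gen h)) = 0" for h :: "('m, 'a) symb"
 proof (cases "is_dx h")
  case True thus ?thesis by (cases h) (simp_all add: vder_Dx[OF assms] L)
 next
  case False
  hence "dx_free (gen h)" by (intro over_gen) simp
  thus ?thesis by (intro ix_dx_free vder_dx_free[OF assms])
 qed
 have g: "f (ix \<mu> (gen h)) = 0" for h :: "('m, 'a) symb" by (simp add: L)
 show ?thesis
 proof (cases p)
  case True
  hence d: "drv True f" using vder_drv[OF assms] by simp
  have "f (ix \<mu> x) + ix \<mu> (f x) = 0"
   by (rule drv_zero_eq[OF drv_comm_odd_odd[OF d drv_ix]]) (simp only: z g add_0)
  thus ?thesis using True by (simp add: eq_neg_iff_add_eq_0)
 next
  case False
  hence d: "drv False f" using vder_drv[OF assms] by simp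
  have "f (ix \<mu> x) - ix \<mu> (f x) = 0"
   by (rule drv_zero_eq[OF drv_comm_even_odd[OF d drv_ix]]) (simp only: z g diff_0_right)
  thus ?thesis using False by simp
 qed
qed

text \<open>The sum of all forms of a ladder. In it the ladder of transformation rules becomes a
  single equation, whose component of form degree p is the rule for the p-form.\<close>

definition superfield :: "ladder \<Rightarrow> 'a \<Rightarrow> ('m::finite, 'a) loc"
 where "superfield A a = (\<Sum>S. dx_set S * gen (Jet A a {#} S))"

lemma dx_free_Jet [simp]: "dx_free (gen (Jet A a I S))" by (rule over_gen) simp

lemma cof_superfield: "cof S (superfield A a) = gen (Jet A a {#} S)"
 unfolding superfield_def by (rule cof_sum_dx_set) simp

lemma ladder_form_gpart: "ladder_form A p a = gpart fdeg (int p) (superfield A a)"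
 by (simp add: comp_form cof_superfield ladder_form_def)

text \<open>The sign comes from moving an odd derivation past the basis form of degree
  \<open>card S\<close>; it is the sign in \<open>field_der\<close>.\<close>

lemma vder_superfield:
 assumes "vder p f"
 shows "cof S (f (superfield A a)) = (if p then (-1) ^ card S else 1) *: f (gen (Jet A a {#} S))"
proof -
 have "f (superfield A a) = (\<Sum>S. dx_set S * ((if p then (-1) ^ card S else 1) *: f (gen (Jet A a {#} S))))"
  unfolding superfield_def
  by (simp add: drv_simps[OF vder_drv[OF assms]] drv_dx_set_mult[OF vder_drv[OF assms] vder_Dx[OF assms]])
 thus ?thesis
  using cof_sum_dx_set[of "\<lambda>S. (if p then (-1) ^ card S else 1) *: f (gen (Jet A a {#} S))" S]
   vder_dx_free[OF assms, of "gen (Jet A a {#} _)"] by (simp add: over_smult)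
qed

lemma vder_eqI:
 assumes "vder p f" "vder p g"
  and "\<And>A a. f (superfield A a) = g (superfield A a)"
  and "\<And>h. \<not> is_field h \<Longrightarrow> \<not> is_dx h \<Longrightarrow> f (gen h) = g (gen h)"
 shows "f x = g (x :: ('m::finite, 'a) loc)"
proof (rule drv_eq[OF vder_drv[OF assms(1)] vder_drv[OF assms(2)]])
 fix h :: "('m, 'a) symb"
 have "f (gen (Jet A a {#} S)) = g (gen (Jet A a {#} S))" for A a S
 proof -
  define c :: complex where "c = (if p then (-1) ^ card S else 1)"
  have "c *: f (gen (Jet A a {#} S)) = c *: g (gen (Jet A a {#} S))"
   unfolding c_def vder_superfield[OF assms(1), symmetric] vder_superfield[OF assms(2), symmetric] assms(3) ..
  hence "c *: (f (gen (Jet A a {#} S)) - g (gen (Jet A a {#} S))) = 0"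
   by (simp add: smult_dist)
  moreover have "c \<noteq> 0" by (simp add: c_def)
  ultimately show ?thesis unfolding smult_eq_0_iff by simp
 qed
 hence "f (gen (Jet A a I S)) = g (gen (Jet A a I S))" for A a I S
  using tderivs_Jet[where I = I and A = A and a = a and J = "{#}" and S = S] tderivs_comm[where f = f and I = I and x = "gen (Jet A a {#} S)", OF vder_tderiv[OF assms(1)]]
   tderivs_comm[where f = g and I = I and x = "gen (Jet A a {#} S)", OF vder_tderiv[OF assms(2)]] by simp
 thus "f (gen h) = g (gen h)"
  by (cases h) (simp_all add: vder_Dx[OF assms(1)] vder_Dx[OF assms(2)] assms(4))
qed

definition field_odd :: "'m itself \<Rightarrow> ladder \<Rightarrow> bool"
 where "field_odd M A = (case A of One \<Rightarrow> True | Two \<Rightarrow> odd (CARD('m)))"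

lemma is_odd_Jet: "is_odd (Jet A a I S :: ('m, 'a) symb) \<longleftrightarrow> field_odd TYPE('m) A \<noteq> odd (card S)"
 by (cases A) (auto simp: field_odd_def)

lemma parity_superfield: "parity (superfield A a :: ('m::finite, 'a) loc) = sgo (field_odd TYPE('m) A) *: superfield A a"
proof -
 have "parity (dx_set S * gen (Jet A a {#} S)) = sgo (field_odd TYPE('m) A) *: (dx_set S * gen (Jet A a {#} S) :: ('m, 'a) loc)" for S
  unfolding parity_mult parity_dx_set parity_gen is_odd_Jet
  by (cases "odd (card S)"; cases "field_odd TYPE('m) A") simp_all
 thus ?thesis unfolding superfield_def by (simp add: smult_sum_right)
qed

text \<open>Links transformation rules given degree by degree with one inhomogeneous form
  \<open>Q\<close>. The parity condition says that the resulting derivation is odd.\<close>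

locale field_der_values =
 fixes R :: "ladder \<Rightarrow> nat \<Rightarrow> 'a \<Rightarrow> ('m::finite, 'a) loc" and Q :: "ladder \<Rightarrow> 'a \<Rightarrow> ('m, 'a) loc"
 assumes R_eq: "\<And>A p a. R A p a = gpart fdeg (int p) (Q A a)"
  and parity_Q: "\<And>A a. parity (Q A a) = sgo (\<not> field_odd TYPE('m) A) *: Q A a"
begin

lemma value_eq: "(-1) ^ card S * cof S (R A (card S) a) = (-1) ^ card S *: cof S (Q A a)"
proof -
 have "(-1) ^ k * x = (-1) ^ k *: x" for k and x :: "('m, 'a) loc"
  by (induction k) (simp_all add: mult.assoc)
 thus ?thesis by (simp add: R_eq cof_comp)
qed

lemma drv_field_der: "drv True (field_der R)"
 unfolding field_der_def
proof (rule graded_values.drv_der, unfold_locales)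
 fix g :: "('m, 'a) symb"
 have "parity (tderivs I ((-1) ^ card S *: cof S (Q A a))) =
   sgo (True \<noteq> is_odd (Jet A a I S :: ('m, 'a) symb)) *: tderivs I ((-1) ^ card S *: cof S (Q A a))" for A a I S
  using tderivs_comm[where f = parity and I = I and x = "(-1) ^ card S *: cof S (Q A a)",
   OF drv_even_parity[OF drv_tderiv, symmetric]]
  unfolding is_odd_Jet
  by (cases "odd (card S)"; cases "field_odd TYPE('m) A")
   (simp_all add: parity_cof parity_Q lin_simps[OF lin_tderivs])
 thus "parity (case g of Jet A a I S \<Rightarrow> tderivs I ((-1) ^ card S * cof S (R A (card S) a)) | _ \<Rightarrow> 0)
   = sgo (True \<noteq> is_odd g) *: (case g of Jet A a I S \<Rightarrow> tderivs I ((-1) ^ card S * cof S (R A (card S) a)) | _ \<Rightarrow> 0)"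
  unfolding value_eq by (cases g) simp_all
qed

lemma field_der_Jet: "field_der R (gen (Jet A a I S)) = tderivs I ((-1) ^ card S *: cof S (Q A a))"
 by (simp add: field_der_def value_eq)

lemma field_der_other: "\<not> is_field g \<Longrightarrow> field_der R (gen g) = 0"
 by (cases g) (simp_all add: field_der_def)

lemma vder_field_der: "vder True (field_der R)"
 unfolding vder_def
proof (intro conjI allI impI)
 show "drv True (field_der R)" by (rule drv_field_der)
 show "field_der R (gen (Dx \<mu>)) = 0" for \<mu> by (simp add: field_der_other)
 show "field_der R (tderiv \<mu> x) = tderiv \<mu> (field_der R x)" for \<mu> x
 proof -
  have "field_der R (tderiv \<mu> x) - tderiv \<mu> (field_der R x) = 0"
  proof (rule drv_zero_eq[OF drv_comm_odd_even[OF drv_field_der drv_tderiv]])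
   fix h :: "('m, 'a) symb"
   show "field_der R (tderiv \<mu> (gen h)) - tderiv \<mu> (field_der R (gen h)) = 0"
    by (cases h) (simp_all add: field_der_Jet field_der_other 
     drv_simps[OF drv_field_der] tderiv.fold_mset_add_mset)
  qed
  thus ?thesis by simp
 qed
 show "dx_free (field_der R x)" if "dx_free x" for x
 proof (rule drv_over[OF drv_field_der _ that])
  fix g :: "('m, 'a) symb"
  show "dx_free (field_der R (gen g))"
   by (cases g) (simp_all add: field_der_Jet field_der_other dx_free_tderivs over_smult dx_free_cof)
 qed simp
qed

lemma field_der_superfield: "field_der R (superfield A a) = Q A a"
proof (rule form_eqI)
 fix S
 show "cof S (field_der R (superfield A a)) = cof S (Q A a)"
  using vder_superfield[OF vder_field_der, of S A a]
  by (simp add: field_der_Jet)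
qed

end

subsection \<open>The operators of the coboundary\<close>

lemma bracket_eq: "bracket T X Y e = (\<Sum>a b. struct_const T a b e *: (X a * Y b))"
 by (simp add: bracket_def)

lemma lin_bracket_cong:
 "lin f \<Longrightarrow> f (bracket T X Y e) = (\<Sum>a b. struct_const T a b e *: f (X a * Y b))"
 by (simp add: bracket_eq lin_simps)

lemma bracket_gpart:
 "gpart fdeg (int p) (bracket T X Y e :: ('m::finite, 'a::finite) loc) =
  (\<Sum>q\<le>p. bracket T (\<lambda>a. gpart fdeg (int q) (X a)) (\<lambda>b. gpart fdeg (int (p - q)) (Y b)) e)"
proof -
 have "gpart fdeg (int p) (bracket T X Y e) = (\<Sum>a b. \<Sum>q\<le>p.
   struct_const T a b e *: (gpart fdeg (int q) (X a) * gpart fdeg (int (p - q)) (Y b)))"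
  by (subst lin_bracket_cong[OF lin_comp']) (simp only: comp_form_mult smult_sum_right)
 also have "\<dots> = (\<Sum>a. \<Sum>q\<le>p. \<Sum>b. 
   struct_const T a b e *: (gpart fdeg (int q) (X a) * gpart fdeg (int (p - q)) (Y b)))"
  by (intro sum.cong refl sum.swap)
 also have "\<dots> = (\<Sum>q\<le>p. \<Sum>a b. 
   struct_const T a b e *: (gpart fdeg (int q) (X a) * gpart fdeg (int (p - q)) (Y b)))"
  by (rule sum.swap)
 finally show ?thesis by (simp add: bracket_eq)
qed

lemma gpart_mult_dx_free:
 assumes "dx_free y" shows "gpart fdeg k (x * y) = gpart fdeg k x * y"
 using lin_comp_comm[of "\<lambda>x. x * y" fdeg 0 k x, OF lin_multr[OF lin_ident]]
  hom_mult[OF _ hom_form_dx_free[OF assms]] by simp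

lemma gpart_dx_free: "dx_free y \<Longrightarrow> gpart fdeg k y = (if k = 0 then y else 0)"
 using comp_hom_if[OF hom_form_dx_free, of y k] by auto

lemma d_lower_gpart: "d_lower A p a = gpart fdeg (int p) (dext (superfield A a))"
proof (cases p)
 case 0
 have "gpart fdeg (-1 + 1) (dext (superfield A a)) = 0"
  unfolding gpart_dext[symmetric] by (simp add: comp_form_neg)
 thus ?thesis using 0 by (simp add: d_lower_def)
next
 case (Suc q)
 thus ?thesis by (simp add: d_lower_def ladder_form_gpart gpart_dext add.commute)
qed

text \<open>The curvature of the superfield connection for \<open>One\<close>, and the covariant
  derivative of the second superfield for \<open>Two\<close>.\<close>

definition brs_total :: "('a::finite \<Rightarrow> complex^'N^'N) \<Rightarrow> ladder \<Rightarrow> 'a \<Rightarrow> ('m::finite, 'a) loc"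
 where "brs_total T A a = dext (superfield A a) +
  (case A of One \<Rightarrow> 1/2 | Two \<Rightarrow> 1) *: bracket T (superfield One) (superfield A) a"

lemma parity_bracket:
 assumes "\<And>a. parity (X a) = s *: X a" "\<And>a. parity (Y a) = t *: Y a"
 shows "parity (bracket T X Y e) = (s * t) *: bracket T X Y e"
 by (subst lin_bracket_cong[OF lin_parity]) (simp add: parity_mult assms bracket_eq smult_sum_right mult_ac)

lemma brs_values: "field_der_values (brs_value T) (brs_total T :: _ \<Rightarrow> _ \<Rightarrow> ('m::finite, 'a::finite) loc)"
proof
 fix A p and a :: 'a
 show "brs_value T A p a = gpart fdeg (int p) (brs_total T A a :: ('m, 'a) loc)"
  unfolding brs_total_def
  by (cases A) (simp_all add: d_lower_gpart bracket_gpart ladder_form_gpart[abs_def])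
next
 fix A and a :: 'a
 have "parity (bracket T (superfield One) (superfield A) a :: ('m, 'a) loc) =
  (- 1 * sgo (field_odd TYPE('m) A)) *: bracket T (superfield One) (superfield A) a"
  by (rule parity_bracket) (simp_all add: parity_superfield, simp add: field_odd_def)
 thus "parity (brs_total T A a :: ('m, 'a) loc) = sgo (\<not> field_odd TYPE('m) A) *: brs_total T A a"
  using parity_drv_odd[OF drv_dext, of "superfield A a :: ('m, 'a) loc"]
  by (cases "field_odd TYPE('m) A")
   (simp_all add: brs_total_def parity_superfield smult_dist mult.commute)
qed

lemmas vder_brs = field_der_values.vder_field_der[OF brs_values, folded brs_op_def]
lemmas brs_superfield [simp] = field_der_values.field_der_superfield[OF brs_values, folded brs_op_def]
lemmas brs_other [simp] = field_der_values.field_der_other[OF brs_values, folded brs_op_def]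
lemmas brs_Jet = field_der_values.field_der_Jet[OF brs_values, folded brs_op_def]

lemma susy_values: "field_der_values (\<lambda>A p a. - ix \<mu> (ladder_form A (Suc p) a))
  (\<lambda>A a. - ix \<mu> (superfield A a) :: ('m::finite, 'a::finite) loc)"
proof
 fix A p and a :: 'a
 show "- ix \<mu> (ladder_form A (Suc p) a) = gpart fdeg (int p) (- ix \<mu> (superfield A a))"
  by (simp add: ladder_form_gpart gpart_ix)
next
 fix A and a :: 'a
 show "parity (- ix \<mu> (superfield A a) :: ('m, 'a) loc) = sgo (\<not> field_odd TYPE('m) A) *: (- ix \<mu> (superfield A a))"
  using parity_drv_odd[OF drv_ix, of \<mu> "superfield A a"]
  by (cases "field_odd TYPE('m) A") (simp_all add: parity_superfield)
qed

lemmas vder_susy = field_der_values.vder_field_der[OF susy_values, folded susy_comp_def]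
lemmas susy_superfield [simp] = field_der_values.field_der_superfield[OF susy_values, folded susy_comp_def]
lemmas susy_other [simp] = field_der_values.field_der_other[OF susy_values, folded susy_comp_def]

text \<open>Cartan's formula again; the sign arises because d anticommutes with the odd ghosts
  \<open>Eps\<close>.\<close>

lemma lie_eps_eq: "lie_eps x = - (\<Sum>\<mu>. gen (Eps \<mu>) * tderiv \<mu> (x :: ('m::finite, 'a::finite) loc))"
proof -
 have z: "dext (gen (Eps \<mu>)) = (0)" for \<mu> by (simp add: dext_def)
 have "lie_eps x = - (\<Sum>\<mu>. gen (Eps \<mu>) * (ix \<mu> (dext x) + dext (ix \<mu> x)))"
  by (simp add: lie_eps_def interior_eps_def drv_gen_mult[OF drv_dext] z
   distrib_left sum.distrib sum_negf)
 thus ?thesis by (simp add: ix_dext)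
qed

lemma drv_eps_tderiv: "drv True (\<lambda>x :: ('m::finite, 'a::finite) loc. - (\<Sum>\<mu>. gen (Eps \<mu>) * tderiv \<mu> x))"
 by (intro drv_neg drv_sum drv_gen_odd[of False, simplified] drv_tderiv) simp

lemma transl_values: "field_der_values (\<lambda>A p a. lie_eps (ladder_form A p a))
  (\<lambda>A a. lie_eps (superfield A a) :: ('m::finite, 'a::finite) loc)"
proof
 fix A p and a :: 'a
 have "hom fdeg k x \<Longrightarrow> hom fdeg (k + 0) (lie_eps x)" for k and x :: "('m, 'a) loc"
  unfolding lie_eps_eq by (intro hom_uminus hom_sum hom_gen_mult hom_form_tderiv) auto
 moreover have "lin (lie_eps :: ('m, 'a) loc \<Rightarrow> _)"
  unfolding lie_eps_eq[abs_def] by (rule drv_lin[OF drv_eps_tderiv])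
 ultimately show "lie_eps (ladder_form A p a) = gpart fdeg (int p) (lie_eps (superfield A a) :: ('m, 'a) loc)"
  unfolding ladder_form_gpart using lin_comp_comm[of lie_eps fdeg 0 "int p" "superfield A a :: ('m, 'a) loc"] by simp
next
 fix A and a :: 'a
 show "parity (lie_eps (superfield A a) :: ('m, 'a) loc) = sgo (\<not> field_odd TYPE('m) A) *: lie_eps (superfield A a)"
  using parity_drv_odd[OF drv_eps_tderiv, of "superfield A a :: ('m, 'a) loc"]
  unfolding lie_eps_eq
  by (cases "field_odd TYPE('m) A") (simp_all add: parity_superfield sum_negf)
qed

lemma vder_eps_tderiv: "vder True (\<lambda>x :: ('m::finite, 'a::finite) loc. - (\<Sum>\<mu>. gen (Eps \<mu>) * tderiv \<mu> x))"
 unfolding vder_def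
 by (intro conjI allI impI; (auto simp: drv_eps_tderiv drv_even_mult drv_tderiv tderiv_comm over_uminus over_sum over_gen_mult dx_free_tderiv))

lemma transl_op_eq: "transl_op x = - (\<Sum>\<mu>. gen (Eps \<mu>) * tderiv \<mu> (x :: ('m::finite, 'a::finite) loc))"
proof (rule vder_eqI[OF _ vder_eps_tderiv])
 note V = transl_values[where 'm = 'm and 'a = 'a]
 show "vder True (transl_op :: ('m, 'a) loc \<Rightarrow> _)"
  unfolding transl_op_def by (rule field_der_values.vder_field_der[OF V])
 show "transl_op (superfield A a) = - (\<Sum>\<mu>. gen (Eps \<mu>) * tderiv \<mu> (superfield A a :: ('m, 'a) loc))" for A a
  unfolding transl_op_def field_der_values.field_der_superfield[OF V] by (rule lie_eps_eq)
 show "transl_op (gen h) = - (\<Sum>\<mu>. gen (Eps \<mu>) * tderiv \<mu> (gen h))" if "\<not> is_field h" for h :: "('m, 'a) symb"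
  unfolding transl_op_def using field_der_values.field_der_other[OF V that] that by simp
qed

definition shift_total :: "('a::finite \<Rightarrow> complex^'N^'N) \<Rightarrow> ladder \<Rightarrow> 'a \<Rightarrow> ('m::finite, 'a) loc"
 where "shift_total T A a = (case A of One \<Rightarrow> 0
  | Two \<Rightarrow> gen (U a) - bracket T (superfield One) (\<lambda>b. gen (V b)) a)"

lemma shift_values: "field_der_values (shift_value T) (shift_total T :: _ \<Rightarrow> _ \<Rightarrow> ('m::finite, 'a::finite) loc)"
proof
 fix A p and a :: 'a
 have "gpart fdeg (int p) (bracket T (superfield One) (\<lambda>b. gen (V b)) a :: ('m, 'a) loc)
   = bracket T (ladder_form One p) (\<lambda>b. gen (V b)) a"
  by (subst lin_bracket_cong[OF lin_comp']) (simp add: gpart_mult_dx_free over_gen bracket_eq ladder_form_gpart)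
 thus "shift_value T A p a = gpart fdeg (int p) (shift_total T A a :: ('m, 'a) loc)"
  by (cases A) (simp_all add: shift_total_def gpart_dx_free over_gen)
next
 fix A and a :: 'a
 have "parity (bracket T (superfield One) (\<lambda>b. gen (V b)) a :: ('m, 'a) loc) =
  (- 1 * sgo (odd CARD('m))) *: bracket T (superfield One) (\<lambda>b. gen (V b)) a"
  by (rule parity_bracket) (simp_all add: parity_superfield , simp add: field_odd_def)
 thus "parity (shift_total T A a :: ('m, 'a) loc) = sgo (\<not> field_odd TYPE('m) A) *: shift_total T A a"
  by (cases A; cases "odd CARD('m)") (simp_all add: shift_total_def field_odd_def)
qed

lemmas vder_shift = field_der_values.vder_field_der[OF shift_values, folded shift_op_def]
lemmas shift_superfield [simp] = field_der_values.field_der_superfield[OF shift_values, folded shift_op_def]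
lemmas shift_other [simp] = field_der_values.field_der_other[OF shift_values, folded shift_op_def]
lemmas shift_Jet = field_der_values.field_der_Jet[OF shift_values, folded shift_op_def]

lemma cof_empty_superfield: "cof {} (x :: ('m::finite, 'a) loc) = gpart fdeg 0 x"
 by (auto simp: comp_form dx_set_def mon_empty)

abbreviation ghost :: "'a \<Rightarrow> ('m, 'a) loc" where "ghost a \<equiv> gen (Jet One a {#} {})"
abbreviation bfield :: "'a \<Rightarrow> ('m, 'a) loc" where "bfield a \<equiv> gen (Jet Two a {#} {})"

lemma gpart_superfield_0: "gpart fdeg 0 (superfield A a) = gen (Jet A a {#} {})"
 unfolding cof_empty_superfield[symmetric] cof_superfield ..

lemma gpart_dext_0: "gpart fdeg 0 (dext (x :: ('m::finite, 'a) loc)) = 0"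
proof -
 have "gpart fdeg (-1 + 1) (dext x) = 0"
  unfolding gpart_dext[symmetric] by (simp add: comp_form_neg)
 thus ?thesis by simp
qed

lemma brs_ghost: "brs_op T (gen (Jet A a {#} {}) :: ('m::finite, 'a::finite) loc) = (case A of One \<Rightarrow> 1/2 | Two \<Rightarrow> 1) *: bracket T ghost (\<lambda>b. gen (Jet A b {#} {})) a"
 using bracket_gpart[of 0 T "superfield One" "superfield A :: _ \<Rightarrow> ('m, 'a) loc" a]
 by (simp add: brs_Jet cof_empty_superfield brs_total_def gpart_dext_0 gpart_superfield_0)

lemma shift_ghost: "shift_op T (ghost a) = 0"
 by (simp add: shift_Jet shift_total_def)

lemma shift_bfield: "shift_op T (bfield a :: ('m::finite, 'a::finite) loc) = gen (U a) - bracket T ghost (\<lambda>b. gen (V b)) a"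
 using bracket_gpart[of 0 T "superfield One" "\<lambda>b. gen (V b) :: ('m, 'a) loc" a]
 by (simp add: shift_Jet cof_empty_superfield shift_total_def gpart_superfield_0 gpart_dx_free over_gen)

subsection \<open>The vector supersymmetry algebra\<close>

lemma susy_anticomm: "susy_comp \<mu> (susy_comp \<nu> x) + susy_comp \<nu> (susy_comp \<mu> x) = (0 :: ('m::finite, 'a::finite) loc)"
proof (rule vder_eqI[OF vder_comm_odd_odd[OF vder_susy vder_susy] vder_zero])
 fix A and a :: 'a
 show "susy_comp \<mu> (susy_comp \<nu> (superfield A a)) + susy_comp \<nu> (susy_comp \<mu> (superfield A a)) = (0)"
  using ix_ix[of \<nu> \<mu> "superfield A a :: ('m, 'a) loc"]
  by (simp add: drv_simps[OF vder_drv[OF vder_susy]] vder_ix[OF vder_susy]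
   neg_eq_iff_add_eq_0)
qed (simp add: drv_simps[OF vder_drv[OF vder_susy]])

text \<open>The derivation i_mu + W_mu annihilates both superfields and the constants
  \<open>V\<close>, hence also their brackets (\<open>bracket_kernel\<close>). So the bracket terms
  drop out of the anticommutators with \<open>susy_comp\<close>.\<close>

lemma drv_ix_susy: "drv True (\<lambda>x :: ('m::finite, 'a::finite) loc. ix \<mu> x + susy_comp \<mu> x)"
 by (intro drv_add drv_ix vder_drv[OF vder_susy])

lemma bracket_kernel:
 assumes "drv True f" "\<And>a. f (X a) = 0" "\<And>a. f (Y a) = 0"
 shows "f (bracket T X Y e) = 0"
 by (simp add: lin_bracket_cong[OF drv_lin[OF assms(1)]] drv_odd_mult[OF assms(1)] assms(2,3))

lemma brs_susy: "brs_op T (susy_comp \<mu> x) + susy_comp \<mu> (brs_op T x) = tderiv \<mu> (x :: ('m::finite, 'a::finite) loc)"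
proof (rule vder_eqI[OF vder_comm_odd_odd[OF vder_brs vder_susy] vder_tderiv_self])
 fix A and a :: 'a
 let ?X = "superfield A a :: ('m, 'a) loc"
 let ?b = "bracket T (superfield One) (superfield A) a"
 have k: "ix \<mu> ?b + susy_comp \<mu> ?b = 0"
  by (rule bracket_kernel[OF drv_ix_susy]) simp_all
 have "brs_op T (susy_comp \<mu> ?X) = ix \<mu> (brs_total T A a)"
  by (simp add: drv_simps[OF vder_drv[OF vder_brs]] vder_ix[OF vder_brs])
 moreover have "susy_comp \<mu> (dext ?X) = dext (ix \<mu> ?X)"
  by (simp add: vder_dext[OF vder_susy])
 ultimately have "brs_op T (susy_comp \<mu> ?X) + susy_comp \<mu> (brs_op T ?X)
   = (ix \<mu> (dext ?X) + dext (ix \<mu> ?X)) + (case A of One \<Rightarrow> 1/2 | Two \<Rightarrow> 1) *: (ix \<mu> ?b + susy_comp \<mu> ?b)"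
  by (simp add: brs_total_def drv_simps[OF vder_drv[OF vder_susy]] smult_dist)
 thus "brs_op T (susy_comp \<mu> ?X) + susy_comp \<mu> (brs_op T ?X) = tderiv \<mu> ?X"
  by (simp add: k ix_dext)
qed (simp add: drv_simps[OF vder_drv[OF vder_susy]] drv_simps[OF vder_drv[OF vder_brs]])

lemma shift_susy: "shift_op T (susy_comp \<mu> x) + susy_comp \<mu> (shift_op T x) = (0 :: ('m::finite, 'a::finite) loc)"
proof (rule vder_eqI[OF vder_comm_odd_odd[OF vder_shift vder_susy] vder_zero])
 fix A and a :: 'a
 let ?X = "superfield A a :: ('m, 'a) loc"
 have "ix \<mu> (bracket T (superfield One) (\<lambda>b. gen (V b)) a)
   + susy_comp \<mu> (bracket T (superfield One) (\<lambda>b. gen (V b)) a) = 0"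
  by (rule bracket_kernel[OF drv_ix_susy]) simp_all
 hence "ix \<mu> (shift_total T A a :: ('m, 'a) loc) + susy_comp \<mu> (shift_total T A a) = 0"
  by (cases A) (simp_all add: shift_total_def drv_simps[OF vder_drv[OF vder_susy]],
   simp add: add_eq_0_iff)
 thus "shift_op T (susy_comp \<mu> ?X) + susy_comp \<mu> (shift_op T ?X) = 0"
  by (simp add: drv_simps[OF vder_drv[OF vder_shift]] vder_ix[OF vder_shift])
qed (simp add: drv_simps[OF vder_drv[OF vder_susy]] drv_simps[OF vder_drv[OF vder_shift]])

lemma ix_dx_set:
 assumes "\<mu> \<notin> S"
 shows "\<exists>t. t * t = 1 \<and> ix \<mu> (dx_set (insert \<mu> S)) = t *: (dx_set S :: ('m::finite, 'a) loc)"
proof -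
 have m: "dxm (insert \<mu> S) = add_mset (Dx \<mu>) (dxm S :: ('m, 'a) symb multiset)" using assms by simp
 have adm: "admissible (add_mset (Dx \<mu>) (dxm S :: ('m, 'a) symb multiset))"
  unfolding m[symmetric] by (rule admissible_dxm)
 have nz: "koszul {#Dx \<mu>#} (dxm S :: ('m, 'a) symb multiset) \<noteq> 0"
  using assms by (auto simp: koszul_single_nonzero)
 have "ix \<mu> (dx_set (insert \<mu> S)) = koszul {#Dx \<mu>#} (dxm S :: ('m, 'a) symb multiset) *: (ix \<mu> (gen (Dx \<mu>) * dx_set S) :: ('m, 'a) loc)"
  unfolding dx_set_def m mon_pull[OF adm] by simp
 also have "ix \<mu> (gen (Dx \<mu>) * dx_set S) = (dx_set S :: ('m, 'a) loc)"
 proof -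
  have "ix \<mu> (dx_set S) = (0 :: ('m, 'a) loc)"
   by (rule drv_zero_over[OF drv_ix _ over_dx_set]) (use assms in auto)
  thus ?thesis by (simp add: drv_odd_mult[OF drv_ix])
 qed
 finally show ?thesis using koszul_sq[OF nz] by blast
qed

text \<open>W_mu adds the index mu to a form component, up to a sign that is left undetermined: only
  the fact that its square is 1 matters below.\<close>

lemma susy_Jet:
 assumes "\<mu> \<notin> S"
 shows "\<exists>t. t * t = 1 \<and> susy_comp \<mu> (gen (Jet A a I S)) = t *: (gen (Jet A a I (insert \<mu> S)) :: ('m::finite, 'a::finite) loc)"
proof -
 obtain t where t: "t * t = 1" "ix \<mu> (dx_set (insert \<mu> S)) = t *: (dx_set S :: ('m, 'a) loc)"
  using ix_dx_set[OF assms] by blast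
 let ?J = "\<lambda>R. gen (Jet A a {#} R) :: ('m, 'a) loc"
 have term0: "ix \<mu> (dx_set R * ?J R) = ix \<mu> (dx_set R) * ?J R" for R
  using drv_odd_mult[OF drv_ix, of \<mu> "dx_set R" "?J R"] by simp
 have "cof S (ix \<mu> (dx_set R * ?J R)) = (if R = insert \<mu> S then t *: ?J R else 0)" for R
 proof (cases "\<mu> \<in> R")
  case True
  then obtain R' where R: "R = insert \<mu> R'" "\<mu> \<notin> R'" by (meson Set.set_insert)
  obtain s where s: "ix \<mu> (dx_set (insert \<mu> R')) = s *: (dx_set R' :: ('m, 'a) loc)"
   using ix_dx_set[OF R(2)] by blast
  show ?thesis
  proof (cases "R' = S")
   case True thus ?thesis unfolding term0 R(1) by (simp add: t cof_dx_set)
  next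
   case False
   hence "R \<noteq> insert \<mu> S" using R assms by (metis insert_ident)
   thus ?thesis using False unfolding term0 R(1) s by (simp add: cof_dx_set)
  qed
 next
  case False
  hence "ix \<mu> (dx_set R) = (0 :: ('m, 'a) loc)"
   by (intro drv_zero_over[OF drv_ix _ over_dx_set]) auto
  thus ?thesis using False unfolding term0 by auto
 qed
 hence "cof S (ix \<mu> (superfield A a)) = t *: ?J (insert \<mu> S)"
  unfolding superfield_def by simp
 moreover have "cof S (susy_comp \<mu> (superfield A a)) = (-1) ^ card S *: susy_comp \<mu> (?J S)"
  using vder_superfield[OF vder_susy, of S \<mu> A a] by simp
 ultimately have e: "(-1) ^ card S *: susy_comp \<mu> (?J S) = - (t *: ?J (insert \<mu> S))"
  by simp
 have "susy_comp \<mu> (?J S) = (-1) ^ card S *: ((-1) ^ card S *: susy_comp \<mu> (?J S))"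
  by simp
 hence J: "susy_comp \<mu> (?J S) = (- ((-1) ^ card S * t)) *: ?J (insert \<mu> S)" unfolding e by simp
 have "susy_comp \<mu> (gen (Jet A a I S)) = tderivs I (susy_comp \<mu> (?J S))"
  using tderivs_comm[where f = "susy_comp \<mu>" and I = I and x = "?J S", OF vder_tderiv[OF vder_susy]]
  by (simp add: tderivs_Jet)
 also have "\<dots> = (- ((-1) ^ card S * t)) *: gen (Jet A a I (insert \<mu> S))"
  by (simp add: J lin_simps[OF lin_tderivs] tderivs_Jet)
 finally have "susy_comp \<mu> (gen (Jet A a I S)) = (- ((-1) ^ card S * t)) *: gen (Jet A a I (insert \<mu> S))" .
 moreover have "(- ((-1) ^ card S * t)) * (- ((-1) ^ card S * t)) = 1"
  using t(1) by (simp add: mult_ac)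
 ultimately show ?thesis by blast
qed

text \<open>Such a component is itself an image under W_mu up to sign, and the square of W_mu
  vanishes by \<open>susy_anticomm\<close>.\<close>

lemma susy_Jet_in:
 assumes "\<mu> \<in> S"
 shows "susy_comp \<mu> (gen (Jet A a I S)) = (0 :: ('m::finite, 'a::finite) loc)"
proof -
 obtain R where R: "S = insert \<mu> R" "\<mu> \<notin> R" using assms by (meson Set.set_insert)
 obtain t where t: "t * t = 1" "susy_comp \<mu> (gen (Jet A a I R)) = t *: (gen (Jet A a I S))"
  using susy_Jet[OF R(2)] R(1) by blast
 have "t *: (2 *: susy_comp \<mu> (gen (Jet A a I S) :: ('m, 'a) loc)) = 0"
  using susy_anticomm[of \<mu> \<mu> "gen (Jet A a I R) :: ('m, 'a) loc"] t
  by (simp add: drv_simps[OF vder_drv[OF vder_susy]] two_smult)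
 moreover have "t \<noteq> 0" using t(1) by auto
 ultimately show ?thesis by simp
qed

text \<open>Form indices are created by \<open>susy_comp\<close> and derivatives by
  \<open>tderiv\<close>, so all jets of a ladder come from its zero-form. Operators with known
  commutators with these two need to be examined only on c, B_0 and the constants
  (\<open>drv_zero_jets\<close>).\<close>

lemma jet_induct [case_names base susy tderiv smult]:
 fixes P :: "('m::finite, 'a::finite) loc \<Rightarrow> bool"
 assumes "P (gen (Jet A a {#} {}))"
  and "\<And>\<mu> S I. \<mu> \<notin> S \<Longrightarrow> P (gen (Jet A a I S)) \<Longrightarrow> P (susy_comp \<mu> (gen (Jet A a I S)))"
  and "\<And>\<mu> S I. P (gen (Jet A a I S)) \<Longrightarrow> P (tderiv \<mu> (gen (Jet A a I S)))"
  and "\<And>c x. P x \<Longrightarrow> P (c *: x)"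
 shows "P (gen (Jet A a I S))"
proof (induction I)
 case empty
 have "finite S" by simp
 thus ?case
 proof (induction S)
  case (insert \<mu> S)
  obtain t where t: "t * t = 1" "susy_comp \<mu> (gen (Jet A a {#} S)) = t *: (gen (Jet A a {#} (insert \<mu> S)) :: ('m, 'a) loc)"
   using susy_Jet[OF insert(2)] by blast
  have "P (t *: susy_comp \<mu> (gen (Jet A a {#} S)))" by (intro assms(4) assms(2) insert)
  thus ?case using t by simp
 qed (rule assms(1))
next
 case (add \<mu> I)
 thus ?case using assms(3)[of I S \<mu>] by simp
qed

lemma drv_zero_jets:
 fixes f :: "('m::finite, 'a::finite) loc \<Rightarrow> ('m, 'a) loc"
 assumes "drv p f"
  and "\<And>h. \<not> is_field h \<Longrightarrow> f (gen h) = 0" "\<And>A a. f (gen (Jet A a {#} {})) = 0"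
  and "\<And>\<mu> x. f x = 0 \<Longrightarrow> f (susy_comp \<mu> x) = 0" "\<And>\<mu> x. f x = 0 \<Longrightarrow> f (tderiv \<mu> x) = 0"
 shows "f x = 0"
proof (rule drv_zero_eq[OF assms(1)])
 fix h :: "('m, 'a) symb"
 have "f (gen (Jet A a I S)) = 0" for A a I S
  by (rule jet_induct[of "\<lambda>x. f x = 0"]) (auto intro: assms(3-5) simp: drv_simps[OF assms(1)] simp del: tderiv_Jet)
 thus "f (gen h) = 0" by (cases h) (auto simp: assms(2))
qed

subsection \<open>The gauge algebra\<close>

lemma lie_elem_eq: "lie_elem T z $ i $ j = (\<Sum>a. z a * T a $ i $ j)"
 by (simp add: lie_elem_def)

lemma matrix_sub_distribs:
 fixes A :: "'r::ring_1^'n^'m" and C :: "'r^'k^'n"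
 shows matrix_sub_rdistrib: "(A - B) ** C = A ** C - B ** C"
  and matrix_sub_ldistrib: "A ** (C - D) = A ** C - A ** D"
 by (vector matrix_matrix_mult_def sum_subtractf left_diff_distrib right_diff_distrib)+

lemma trace_commutator: "trace (commutator X Y ** Z) = trace (X ** (Y ** Z)) - trace (Y ** (X ** Z))"
 for X :: "complex^'N^'N"
 by (simp add: commutator_def trace_sub matrix_mul_assoc matrix_sub_rdistrib)

lemma trace_lie_elem: "trace (lie_elem T z ** X) = (\<Sum>a. z a * trace (T a ** X))"
proof -
 have "trace (lie_elem T z ** X) = (\<Sum>i k a. z a * (T a $ i $ k * X $ k $ i))"
  by (simp add: trace_def matrix_matrix_mult_def lie_elem_eq sum_distrib_right mult.assoc)
 also have "\<dots> = (\<Sum>i a k. z a * (T a $ i $ k * X $ k $ i))"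
  by (intro sum.cong refl sum.swap)
 also have "\<dots> = (\<Sum>a i k. z a * (T a $ i $ k * X $ k $ i))"
  by (rule sum.swap)
 finally show ?thesis by (simp add: trace_def matrix_matrix_mult_def sum_distrib_left)
qed

locale gauge_algebra =
 fixes T :: "'a::finite \<Rightarrow> complex^'N^'N"
 assumes simple: "simple_lie_basis T"
begin

abbreviation f where "f \<equiv> struct_const T"

lemma trace_TT: "trace (T a ** T b) = (if a = b then 1 else 0)"
 using simple by (simp add: simple_lie_basis_def)

lemma trace_elem_T: "trace (lie_elem T z ** T a) = z a"
 by (simp add: trace_lie_elem trace_TT if_distrib cong: if_cong)

lemma commutator_T: "commutator (T a) (T b) = lie_elem T (f a b)"
proof -
 obtain z where z: "commutator (T a) (T b) = lie_elem T z"
  using simple unfolding simple_lie_basis_def by blast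
 have "f a b = z" unfolding struct_const_def z by (rule ext) (rule trace_elem_T)
 thus ?thesis using z by simp
qed

lemma f_antisym: "f b a e = - f a b e"
 by (simp add: struct_const_def trace_commutator)

text \<open>Cyclicity of the trace; with \<open>f_antisym\<close> it makes the structure constants
  totally antisymmetric.\<close>

lemma f_cyclic: "f a b e = f b e a"
proof -
 have "trace (T a ** (T b ** T e)) = trace (T b ** (T e ** T a))"
  by (subst trace_mul_sym) (simp add: matrix_mul_assoc)
 moreover have "trace (T b ** (T a ** T e)) = trace (T e ** (T b ** T a))"
  by (subst trace_mul_sym, subst matrix_mul_assoc[symmetric], subst trace_mul_sym) (simp add: matrix_mul_assoc)
 ultimately show ?thesis by (simp add: struct_const_def trace_commutator)
qed

lemma f_antisym': "f a e b = - f a b e"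
 by (metis f_antisym f_cyclic)

lemma f_diag [simp]: "f a a e = 0"
 using f_antisym[of a a e] by simp

lemma f_jacobi: "(\<Sum>d. f a b d * f d e g) = (\<Sum>d. f b e d * f a d g) - (\<Sum>d. f a e d * f b d g)"
proof -
 have "trace (commutator (lie_elem T z) (T e) ** T g) = (\<Sum>d. z d * f d e g)" for z e g
 proof -
  have "trace (T e ** (lie_elem T z ** T g)) = trace (lie_elem T z ** (T g ** T e))"
   by (subst trace_mul_sym) (simp add: matrix_mul_assoc)
  moreover have "trace (T e ** (T d ** T g)) = trace (T d ** (T g ** T e))" for d
   by (subst trace_mul_sym) (simp add: matrix_mul_assoc)
  ultimately show ?thesis
   by (simp add: trace_commutator trace_lie_elem struct_const_def right_diff_distrib sum_subtractf)
 qed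
 note t = this
 have t': "trace (commutator (T e) (lie_elem T z) ** T g) = (\<Sum>d. z d * f e d g)" for z e g
 proof -
  have "trace (commutator (T e) (lie_elem T z) ** T g) = - trace (commutator (lie_elem T z) (T e) ** T g)"
   by (simp add: trace_commutator)
  thus ?thesis by (simp add: t f_antisym[of _ e] sum_negf)
 qed
 have "commutator (commutator (T a) (T b)) (T e) =
   commutator (T a) (commutator (T b) (T e)) - commutator (T b) (commutator (T a) (T e))"
  by (simp add: commutator_def matrix_sub_ldistrib matrix_sub_rdistrib matrix_mul_assoc)
 hence "trace (commutator (commutator (T a) (T b)) (T e) ** T g) =
   trace (commutator (T a) (commutator (T b) (T e)) ** T g) - trace (commutator (T b) (commutator (T a) (T e)) ** T g)"
  by (simp add: matrix_sub_rdistrib trace_sub)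
 thus ?thesis by (simp add: commutator_T t t')
qed

end

subsection \<open>The total differential\<close>

lemma hom_nonneg_over:
 assumes "\<And>g. w g \<ge> 0"
 shows "hom w 0 x \<longleftrightarrow> over {g. w g = 0} x"
proof -
 have nn: "wt w m \<ge> 0" for m by (induction m) (auto intro: add_nonneg_nonneg assms)
 have "wt w m = 0 \<longleftrightarrow> (\<forall>g\<in>#m. w g = 0)" for m
 proof (induction m)
  case (add g m)
  thus ?case using assms[of g] nn[of m] by auto
 qed simp
 thus ?thesis by (auto simp: hom_def over_def)
qed

lemma lin_diag_comm:
 assumes "lin f" "\<And>k x. hom w k x \<Longrightarrow> hom w k (f x)"
 shows "f (diag (\<lambda>m. \<phi> (wt w m)) x) = diag (\<lambda>m. \<phi> (wt w m)) (f x)"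
proof -
 have d: "diag (\<lambda>m. \<phi> (wt w m)) y = \<phi> k *: y" if "hom w k y" for k y
  using that by (intro salg_eqI) (auto simp: hom_def supp_iff)
 let ?K = "wt w ` supp x"
 have x: "x = (\<Sum>k\<in>?K. gpart w k x)" by (rule sum_comp) auto
 show ?thesis
  by (subst (1 2) x) (simp add: lin_simps[OF assms(1)] diag_simps d[OF hom_comp] d[OF assms(2)[OF hom_comp]])
qed

definition ghost_der :: "('m::finite, 'a::finite) loc \<Rightarrow> ('m, 'a) loc"
 where "ghost_der x = (\<Sum>\<mu>. gen (Xi \<mu>) * partial (Eps \<mu>) x) + (\<Sum>a. gen (U a) * partial (V a) x)"

lemma drv_ghost_der: "drv True (ghost_der :: ('m::finite, 'a::finite) loc \<Rightarrow> _)"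
proof -
 have "drv True (\<lambda>x. gen (Xi \<mu>) * partial (Eps \<mu>) (x :: ('m, 'a) loc))" for \<mu>
  using drv_gen[OF drv_partial, of "Eps \<mu> :: ('m, 'a) symb" "Xi \<mu>"] by simp
 moreover have "drv True (\<lambda>x. gen (U a) * partial (V a) (x :: ('m, 'a) loc))" for a
  using drv_gen[OF drv_partial, of "V a :: ('m, 'a) symb" "U a"] by simp
 ultimately show ?thesis unfolding ghost_der_def by (intro drv_add drv_sum)
qed

lemma ghost_der_gen: "ghost_der (gen g) = (case g of Eps \<mu> \<Rightarrow> gen (Xi \<mu>) | V a \<Rightarrow> gen (U a) | _ \<Rightarrow> 0)"
 by (cases g) (simp_all add: ghost_der_def if_distrib[of "\<lambda>x. _ * x"] cong: if_cong)

definition D0 :: "('a::finite \<Rightarrow> complex^'N^'N) \<Rightarrow> ('m::finite, 'a) loc \<Rightarrow> ('m, 'a) loc"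
 where "D0 T x = brs_op T x + ghost_der x"

lemma drv_D0: "drv True (D0 T)"
 unfolding D0_def by (intro drv_add drv_ghost_der vder_drv[OF vder_brs])

lemmas drv_susy = vder_drv[OF vder_susy]
lemmas susy_lin [simp] = drv_simps[OF drv_susy]
lemmas D0_lin [simp] = drv_simps[OF drv_D0]

lemma susy_tderiv: "susy_comp \<mu> (tderiv \<nu> x) = tderiv \<nu> (susy_comp \<mu> (x :: ('m::finite, 'a::finite) loc))"
 by (rule vder_tderiv[OF vder_susy])

lemma over_susy_Jet: "over {g. is_field g} (susy_comp \<mu> (gen (Jet A a I S)) :: ('m::finite, 'a::finite) loc)"
proof (cases "\<mu> \<in> S")
 case False
 thus ?thesis using susy_Jet[of \<mu> S A a I] by (auto intro!: over_smult over_gen)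
qed (simp add: susy_Jet_in)

lemma ghost_der_susy: "ghost_der (susy_comp \<mu> x) = - susy_comp \<mu> (ghost_der (x :: ('m::finite, 'a::finite) loc))"
proof -
 have "ghost_der (susy_comp \<mu> x) + susy_comp \<mu> (ghost_der x) = 0"
 proof (rule drv_zero_eq[OF drv_comm_odd_odd[OF drv_ghost_der drv_susy]])
  fix h :: "('m, 'a) symb"
  have "ghost_der (susy_comp \<mu> (gen (Jet A a I S))) = 0" for A and a :: 'a and I and S :: "'m set"
   by (rule drv_zero_over[OF drv_ghost_der _ over_susy_Jet]) (auto simp: ghost_der_gen split: symb.split)
  thus "ghost_der (susy_comp \<mu> (gen h)) + susy_comp \<mu> (ghost_der (gen h)) = 0"
   by (cases h) (simp_all add: ghost_der_gen drv_simps[OF drv_ghost_der])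
 qed
 thus ?thesis by (simp add: add_eq_0_iff2)
qed

lemma ghost_der_tderiv: "ghost_der (tderiv \<mu> x) = tderiv \<mu> (ghost_der (x :: ('m::finite, 'a::finite) loc))"
proof -
 have "ghost_der (tderiv \<mu> x) - tderiv \<mu> (ghost_der x) = 0"
 proof (rule drv_zero_eq[OF drv_comm_odd_even[OF drv_ghost_der drv_tderiv]])
  fix h :: "('m, 'a) symb"
  show "ghost_der (tderiv \<mu> (gen h)) - tderiv \<mu> (ghost_der (gen h)) = 0"
   by (cases h) (simp_all add: ghost_der_gen drv_simps[OF drv_ghost_der])
 qed
 thus ?thesis by simp
qed

lemma D0_susy: "D0 T (susy_comp \<mu> x) = tderiv \<mu> x - susy_comp \<mu> (D0 T x)"
 using brs_susy[of T \<mu> x] by (simp add: D0_def ghost_der_susy algebra_simps)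

lemma D0_tderiv: "D0 T (tderiv \<mu> x) = tderiv \<mu> (D0 T x)"
 by (simp add: D0_def ghost_der_tderiv vder_tderiv[OF vder_brs])

lemma D0_gen: "\<not> is_field g \<Longrightarrow> D0 T (gen g) = (case g of Eps \<mu> \<Rightarrow> gen (Xi \<mu>) | V a \<Rightarrow> gen (U a) | _ \<Rightarrow> 0)"
 by (simp add: D0_def ghost_der_gen)

lemma D0_ghost [simp]: "D0 T (gen (Jet A a {#} {})) = (case A of One \<Rightarrow> 1/2 | Two \<Rightarrow> 1) *: bracket T ghost (\<lambda>b. gen (Jet A b {#} {})) a"
 by (simp add: D0_def brs_ghost ghost_der_gen)

lemma ghost_comm: "ghost a * x = parity x * (ghost a :: ('m::finite, 'a) loc)"
 by (rule gen_odd_comm) simp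

context gauge_algebra begin

lemma bracket_smult: "bracket T X (\<lambda>b. c *: Y b) e = c *: bracket T X Y e"
 "bracket T (\<lambda>b. c *: X b) Y e = c *: bracket T X Y e"
 by (simp_all add: bracket_eq smult_sum_right mult_ac)

text \<open>The product of two anticommuting ghosts antisymmetrises the structure constants; by the
  Jacobi identity this gives the double action twice, and the 1/2 in \<open>s\<close>
  compensates.\<close>

lemma jacobi_action:
 fixes y :: "'a \<Rightarrow> ('m::finite, 'a) loc"
 defines "s \<equiv> \<lambda>a. (1/2) *: bracket T ghost ghost a"
 shows "bracket T s y e = bracket T ghost (bracket T ghost y) e"
proof -
 have anti: "ghost p * (ghost q * x) = - (ghost q * (ghost p * x))" for p q and x :: "('m, 'a) loc"
 proof -
  have "ghost p * ghost q = - (ghost q * (ghost p :: ('m, 'a) loc))"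
   using ghost_comm[of p "ghost q :: ('m, 'a) loc"] by simp
  from arg_cong[OF this, of "\<lambda>z. z * x"] show ?thesis by (simp add: mult.assoc)
 qed
 define Q where "Q p q b = ghost p * (ghost q * y b)" for p q b
 have Q: "Q q p b = - Q p q b" for p q b unfolding Q_def by (rule anti)
 define R where "R p q b = (\<Sum>a. f q b a * f p a e)" for p q b
 have "bracket T s y e = (1/2) *: (\<Sum>a b. \<Sum>p q. (f p q a * f a b e) *: Q p q b)"
  by (simp add: bracket_eq s_def smult_sum_right sum_distrib_right mult.assoc Q_def mult_ac)
 also have "(\<Sum>a b. \<Sum>p q. (f p q a * f a b e) *: Q p q b)
   = (\<Sum>b p. \<Sum>q a. (f p q a * f a b e) *: Q p q b)"
  by (rule trans[OF sum.swap], rule sum.cong[OF refl], rule trans[OF sum.swap], rule sum.cong[OF refl], rule sum.swap)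
 also have "\<dots> = (\<Sum>b p q. (R p q b - R q p b) *: Q p q b)"
  unfolding R_def f_jacobi[symmetric] by (simp add: smult_sum_left)
 also have "\<dots> = (\<Sum>b p q. R p q b *: Q p q b) - (\<Sum>b p q. R q p b *: Q p q b)"
  by (simp add: smult_dist sum_subtractf)
 also have "(\<Sum>b p q. R q p b *: Q p q b) = - (\<Sum>b p q. R p q b *: Q p q b)"
  unfolding sum_negf[symmetric]
  by (rule sum.cong[OF refl], rule trans[OF sum.swap], rule sum.cong[OF refl], rule sum.cong[OF refl]) (metis Q smult_simps(6))
 also have "(\<Sum>b p q. R p q b *: Q p q b) = (\<Sum>p a. \<Sum>q b. (f q b a * f p a e) *: Q p q b)"
 proof -
  have "(\<Sum>b p q. R p q b *: Q p q b) = (\<Sum>b p. \<Sum>q a. (f q b a * f p a e) *: Q p q b)"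
   by (simp add: R_def smult_sum_left)
  also have "\<dots> = (\<Sum>p b. \<Sum>a q. (f q b a * f p a e) *: Q p q b)"
   by (rule trans[OF sum.swap], rule sum.cong[OF refl], rule sum.cong[OF refl], rule sum.swap)
  also have "\<dots> = (\<Sum>p a. \<Sum>b q. (f q b a * f p a e) *: Q p q b)"
   by (rule sum.cong[OF refl], rule sum.swap)
  also have "\<dots> = (\<Sum>p a. \<Sum>q b. (f q b a * f p a e) *: Q p q b)"
   by (rule sum.cong[OF refl], rule sum.cong[OF refl], rule sum.swap)
  finally show ?thesis .
 qed
 also have "\<dots> = bracket T ghost (bracket T ghost y) e"
  by (simp add: bracket_eq sum_distrib_left smult_sum_right Q_def mult_ac)
 finally show ?thesis by (simp add: two_smult)
qed

lemma D0_bracket_ghost: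
 assumes "\<And>b. D0 T (y b) = bracket T ghost y b"
 shows "D0 T (bracket T ghost y e :: ('m::finite, 'a) loc) = 0"
proof -
 have "D0 T (bracket T ghost y e) = bracket T (\<lambda>a. (1/2) *: bracket T ghost ghost a) y e - bracket T ghost (bracket T ghost y) e"
  by (subst lin_bracket_cong[OF drv_lin[OF drv_D0]])
   (simp add: drv_odd_mult[OF drv_D0] assms bracket_eq smult_dist sum_subtractf)
 thus ?thesis by (simp add: jacobi_action)
qed

lemma bracket_swap:
 assumes "\<And>a b. X a * Y b = Y b * X a"
 shows "bracket T X Y e = - bracket T Y X e"
proof -
 have "bracket T X Y e = (\<Sum>b a. f a b e *: (X a * Y b))"
  unfolding bracket_eq by (rule sum.swap)
 also have "\<dots> = (\<Sum>b a. - (f b a e *: (Y b * X a)))"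
 proof (intro sum.cong refl)
  fix a b
  show "f a b e *: (X a * Y b) = - (f b a e *: (Y b * X a))"
   using f_antisym[of b a e] by (simp add: assms)
 qed
 finally show ?thesis by (simp add: bracket_eq sum_negf)
qed

lemma D0_D0: "D0 T (D0 T x) = (0 :: ('m::finite, 'a) loc)"
proof (rule drv_zero_jets[OF drv_odd_square[OF drv_D0]])
 fix A and a :: 'a
 show "D0 T (D0 T (gen (Jet A a {#} {}))) = (0 :: ('m, 'a) loc)"
 proof (cases A)
  case Two
  have "D0 T (bracket T ghost bfield a) = (0 :: ('m, 'a) loc)"
   by (rule D0_bracket_ghost) simp
  thus ?thesis using Two by simp
 next
  case One
  let ?s = "\<lambda>a. (1/2) *: bracket T ghost ghost a :: ('m, 'a) loc"
  have ps: "parity (bracket T ghost ghost a) = (bracket T ghost ghost a :: ('m, 'a) loc)" for a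
   using parity_bracket[of "ghost :: _ \<Rightarrow> ('m, 'a) loc" "-1" "ghost :: _ \<Rightarrow> ('m, 'a) loc" "-1" T a] by simp
  have D: "D0 T (bracket T ghost ghost a) = bracket T ?s ghost a - bracket T ghost ?s a"
   by (subst lin_bracket_cong[OF drv_lin[OF drv_D0]])
    (simp add: drv_odd_mult[OF drv_D0] bracket_eq smult_dist sum_subtractf)
  have 1: "bracket T ghost ?s a = - bracket T ?s ghost a"
   by (rule bracket_swap) (simp add: ghost_comm ps)
  have 2: "bracket T ?s ghost a = 2 *: bracket T ghost ?s a"
   unfolding jacobi_action by (simp add: bracket_smult)
  \<comment> \<open>Both relations together say that 3 [c, s] = 0, the Jacobi identity for an odd
    element.\<close>
  have "bracket T ghost ?s a = - (2 *: bracket T ghost ?s a)" using 1 2 by simp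
  hence "3 *: bracket T ghost ?s a = 0"
   using smult_dist(3)[of 1 2 "bracket T ghost ?s a"] by (simp add: eq_neg_iff_add_eq_0)
  hence "D0 T (bracket T ghost ghost a) = (0 :: ('m, 'a) loc)" unfolding D using 1 by simp
  thus ?thesis using One by simp
 qed
next
 show "D0 T (D0 T (gen h)) = 0" if "\<not> is_field h" for h :: "('m, 'a) symb"
  using that by (cases h) (simp_all add: D0_gen)
qed (simp_all add: D0_susy D0_tderiv)

end

subsection \<open>Trivialising the global symmetries\<close>

text \<open>Derivatives of B_0 are not shifted, because the parameter v is constant. This makes the
  operator commute with \<open>tderiv\<close> and with \<open>susy_comp\<close>.\<close>

definition b_shift :: "('m::finite, 'a::finite) loc \<Rightarrow> ('m, 'a) loc"
 where "b_shift = der (\<lambda>g. case g of Jet Two a I S \<Rightarrow> if I = {#} \<and> S = {} then gen (V a) else 0 | _ \<Rightarrow> 0)"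

lemma drv_b_shift: "drv False (b_shift :: ('m::finite, 'a::finite) loc \<Rightarrow> _)"
 unfolding b_shift_def
 by (rule graded_values.drv_der, unfold_locales)
  (auto split: symb.split ladder.split)

lemma b_shift_gen [simp]:
 "b_shift (gen (Jet Two a I S)) = (if I = {#} \<and> S = {} then gen (V a) else 0)"
 "b_shift (gen (Jet One a I S)) = 0"
 "\<not> is_field g \<Longrightarrow> b_shift (gen g) = 0"
 by (cases g; simp add: b_shift_def)+

lemmas b_shift_lin [simp] = drv_simps[OF drv_b_shift]

lemma b_shift_jets: "I \<noteq> {#} \<or> S \<noteq> {} \<Longrightarrow> b_shift (gen (Jet A a I S)) = 0"
 by (cases A) auto

lemma b_shift_tderiv: "b_shift (tderiv \<mu> x) = tderiv \<mu> (b_shift (x :: ('m::finite, 'a::finite) loc))"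
proof -
 have "b_shift (tderiv \<mu> x) - tderiv \<mu> (b_shift x) = 0"
 proof (rule drv_zero_eq[OF drv_comm_even_even[OF drv_b_shift drv_tderiv]])
  fix h :: "('m, 'a) symb"
  have "tderiv \<mu> (b_shift (gen h)) = 0"
   by (cases h) (auto simp: b_shift_def split: ladder.split)
  thus "b_shift (tderiv \<mu> (gen h)) - tderiv \<mu> (b_shift (gen h)) = 0"
   by (cases h) (simp_all add: b_shift_jets)
 qed
 thus ?thesis by simp
qed

lemma b_shift_susy: "b_shift (susy_comp \<mu> x) = susy_comp \<mu> (b_shift (x :: ('m::finite, 'a::finite) loc))"
proof -
 have "b_shift (susy_comp \<mu> x) - susy_comp \<mu> (b_shift x) = 0"
 proof (rule drv_zero_eq[OF drv_comm_even_odd[OF drv_b_shift drv_susy]])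
  fix h :: "('m, 'a) symb"
  have 1: "susy_comp \<mu> (b_shift (gen h)) = 0"
   by (cases h) (auto simp: b_shift_def split: ladder.split)
  have "b_shift (susy_comp \<mu> (gen (Jet A a I S))) = 0" for A and a :: 'a and I S
  proof (cases "\<mu> \<in> S")
   case False
   then obtain t where "susy_comp \<mu> (gen (Jet A a I S)) = t *: (gen (Jet A a I (insert \<mu> S)))"
    using susy_Jet by blast
   thus ?thesis by (simp add: b_shift_jets)
  qed (simp add: susy_Jet_in)
  thus "b_shift (susy_comp \<mu> (gen h)) - susy_comp \<mu> (b_shift (gen h)) = 0"
   unfolding 1 by (cases h) simp_all
 qed
 thus ?thesis by simp
qed

text \<open>In \<open>Dtot\<close> the translations and the exterior derivative combine into minus
  this combination contracted with the total derivatives.\<close>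

abbreviation eps' :: "'m \<Rightarrow> ('m, 'a) loc" where "eps' \<mu> \<equiv> gen (Eps \<mu>) - gen (Dx \<mu>)"

definition Zop :: "('m::finite, 'a::finite) loc \<Rightarrow> ('m, 'a) loc"
 where "Zop x = (\<Sum>\<mu>. eps' \<mu> * susy_comp \<mu> x) + b_shift x"

lemma drv_Zop: "drv False (Zop :: ('m::finite, 'a::finite) loc \<Rightarrow> _)"
 unfolding Zop_def left_diff_distrib
 by (intro drv_add drv_sum drv_diff drv_b_shift drv_gen_odd[of True, simplified] drv_susy) simp_all

lemmas Zop_lin [simp] = drv_simps[OF drv_Zop]

lemma drv_eps': "drv p f \<Longrightarrow> f (eps' \<mu> * x) = (f (gen (Eps \<mu>)) - f (gen (Dx \<mu>))) * x + sgo p *: (eps' \<mu> * f x)"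
 by (cases p) (simp_all add: drv_mult drv_simps algebra_simps)

lemma Zop_gen: "\<not> is_field g \<Longrightarrow> Zop (gen g) = 0"
 by (simp add: Zop_def)

lemma Zop_eps': "Zop (eps' \<mu> * x) = eps' \<mu> * Zop x"
 by (simp add: drv_eps'[OF drv_Zop] Zop_gen)

lemma Zop_eps'_funpow: "(Zop ^^ k) (eps' \<mu> * x) = eps' \<mu> * (Zop ^^ k) x"
 by (induction k) (simp_all add: Zop_eps')

text \<open>Each W_mu in \<open>Zop\<close> enlarges the set of form indices, so a jet is killed
  after one step more than the number of missing indices; the shift leads to \<open>V\<close>, which
  is annihilated. The coefficients \<open>eps'\<close> pass through \<open>Zop\<close>
  unchanged.\<close>

lemma lnil_Zop: "lnil (Zop :: ('m::finite, 'a::finite) loc \<Rightarrow> _)"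
proof (rule drv_lnil[OF drv_Zop])
 fix g :: "('m, 'a) symb"
 note L = lin_simps[OF lin_funpow[OF drv_lin[OF drv_Zop]]]
 have z: "(Zop ^^ Suc k) (gen (V a)) = (0 :: ('m, 'a) loc)" for k a
  by (induction k) (simp_all add: Zop_gen)
 have "(Zop ^^ (Suc (card (UNIV - S)))) (gen (Jet A a I S)) = (0 :: ('m, 'a) loc)" for A a I S
 proof (induction "card (UNIV - S)" arbitrary: S)
  case 0
  hence "S = UNIV" by auto
  thus ?case by (simp add: Zop_def susy_Jet_in b_shift_jets)
 next
  case (Suc r)
  have "(Zop ^^ Suc r) (susy_comp \<mu> (gen (Jet A a I S))) = (0)" for \<mu>
  proof (cases "\<mu> \<in> S")
   case True
   thus ?thesis using L(3)[of "Suc r"] by (metis susy_Jet_in)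
  next
   case False
   obtain t where t: "susy_comp \<mu> (gen (Jet A a I S)) = t *: (gen (Jet A a I (insert \<mu> S)))"
    using susy_Jet[OF False] by blast
   have "r = card (UNIV - insert \<mu> S)" using Suc.hyps(2) False
    by (subst Diff_insert) simp
   from Suc.hyps(1)[OF this] this show ?thesis unfolding t L(2) by simp
  qed
  moreover have "(Zop ^^ Suc r) (b_shift (gen (Jet A a I S))) = (0 :: ('m, 'a) loc)"
   using L(3)[of "Suc r"] z by (cases A) auto
  ultimately have "(Zop ^^ Suc r) (Zop (gen (Jet A a I S))) = (0)"
   unfolding Zop_def[of "gen (Jet A a I S)"] L(1,6) Zop_eps'_funpow by simp
  thus ?case unfolding Suc.hyps(2)[symmetric] by (simp only: funpow_Suc_right o_apply)
 qed
 moreover have "(Zop ^^ 1) (gen g) = 0" if "\<not> is_field g" using that by (simp add: Zop_gen)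
 ultimately show "\<exists>k. (Zop ^^ k) (gen g) = 0" by (cases g) (blast | fastforce)+
qed

definition Dtot :: "('a::finite \<Rightarrow> complex^'N^'N) \<Rightarrow> ('m::finite, 'a) loc \<Rightarrow> ('m, 'a) loc"
 where "Dtot T x = coboundary T x + dext x"

text \<open>The commutator of \<open>D0\<close> with \<open>Zop\<close> (\<open>D0_Zop\<close>): all
  terms of \<open>Dtot\<close> from the global symmetries, apart from the pairs of global ghosts. It
  commutes with \<open>Zop\<close> (\<open>D1_Zop\<close>).\<close>

definition D1 :: "('a::finite \<Rightarrow> complex^'N^'N) \<Rightarrow> ('m::finite, 'a) loc \<Rightarrow> ('m, 'a) loc"
 where "D1 T x = susy_op x - (\<Sum>\<mu>. eps' \<mu> * tderiv \<mu> x) + shift_op T x"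

lemma Dtot_eq: "Dtot T x = D0 T x + D1 T x"
 by (simp add: Dtot_def coboundary_def D0_def D1_def transl_op_eq ghost_der_def dext_def left_diff_distrib sum_subtractf algebra_simps)

lemma drv_susy_op: "drv True (susy_op :: ('m::finite, 'a::finite) loc \<Rightarrow> _)"
 unfolding susy_op_def by (intro drv_sum drv_gen_even[of True] drv_susy) simp

lemma drv_D1: "drv True (D1 T)"
 unfolding D1_def left_diff_distrib
 by (intro drv_add drv_sum drv_diff drv_susy_op vder_drv[OF vder_shift] drv_gen_odd[of False, simplified] drv_tderiv) simp_all

lemmas shift_lin [simp] = drv_simps[OF vder_drv[OF vder_shift]]

lemma drv_Dtot: "drv True (Dtot T)"
 unfolding Dtot_eq by (intro drv_add drv_D0 drv_D1)
lemmas Dtot_lin [simp] = drv_simps[OF drv_Dtot]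

lemma drv_coboundary: "drv True (coboundary T :: ('m::finite, 'a::finite) loc \<Rightarrow> _)"
proof -
 have "coboundary T = (\<lambda>x :: ('m, 'a) loc. Dtot T x - dext x)" by (simp add: Dtot_def)
 moreover have "drv True (\<lambda>x :: ('m, 'a) loc. Dtot T x - dext x)" by (rule drv_diff[OF drv_Dtot drv_dext])
 ultimately show ?thesis by (simp only:)
qed
lemmas coboundary_lin [simp] = drv_simps[OF drv_coboundary]

lemma bracket_even_kernel:
 assumes "drv False f" "\<And>a. f (X a) = 0"
 shows "f (bracket T X Y e) = bracket T X (\<lambda>b. f (Y b)) e"
 by (subst lin_bracket_cong[OF drv_lin[OF assms(1)]]) (simp add: drv_even_mult[OF assms(1)] assms(2) bracket_eq)

lemma D0_b_shift: "D0 T (b_shift x) = b_shift (D0 T x) + shift_op T (x :: ('m::finite, 'a::finite) loc)"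
proof -
 have "(D0 T (b_shift x) - b_shift (D0 T x)) - shift_op T x = 0"
 proof (rule drv_zero_jets[OF drv_diff[OF drv_comm_odd_even[OF drv_D0 drv_b_shift] vder_drv[OF vder_shift]]])
  fix A and a :: 'a
  have "b_shift (bracket T ghost (\<lambda>b. gen (Jet A b {#} {})) a) = (bracket T ghost (\<lambda>b. b_shift (gen (Jet A b {#} {}))) a :: ('m, 'a) loc)"
   by (rule bracket_even_kernel[OF drv_b_shift]) simp
  thus "(D0 T (b_shift (gen (Jet A a {#} {}))) - b_shift (D0 T (gen (Jet A a {#} {})))) - shift_op T (gen (Jet A a {#} {})) = (0 :: ('m, 'a) loc)"
   by (cases A) (simp_all add: shift_ghost shift_bfield D0_gen bracket_eq)
 next
  fix h :: "('m, 'a) symb" assume "\<not> is_field h"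
  thus "(D0 T (b_shift (gen h)) - b_shift (D0 T (gen h))) - shift_op T (gen h) = 0"
   by (cases h) (simp_all add: D0_gen)
 next
  fix \<mu> and x :: "('m, 'a) loc"
  assume "(D0 T (b_shift x) - b_shift (D0 T x)) - shift_op T x = 0"
  from arg_cong[OF this, of "susy_comp \<mu>"]
  show "(D0 T (b_shift (susy_comp \<mu> x)) - b_shift (D0 T (susy_comp \<mu> x))) - shift_op T (susy_comp \<mu> x) = 0"
   using shift_susy[of T \<mu> x, unfolded add_eq_0_iff2]
   by (simp add: D0_susy b_shift_susy b_shift_tderiv algebra_simps)
 next
  fix \<mu> and x :: "('m, 'a) loc"
  assume "(D0 T (b_shift x) - b_shift (D0 T x)) - shift_op T x = 0"
  from arg_cong[OF this, of "tderiv \<mu>"]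
  show "(D0 T (b_shift (tderiv \<mu> x)) - b_shift (D0 T (tderiv \<mu> x))) - shift_op T (tderiv \<mu> x) = 0"
   by (simp add: D0_tderiv b_shift_tderiv vder_tderiv[OF vder_shift])
 qed
 thus ?thesis by (simp add: algebra_simps)
qed

lemma D0_Zop: "D0 T (Zop x) = Zop (D0 T x) + D1 T (x :: ('m::finite, 'a::finite) loc)"
 by (simp add: Zop_def D1_def susy_op_def drv_eps'[OF drv_D0] D0_gen D0_susy D0_b_shift
   right_diff_distrib sum.distrib sum_subtractf sum_negf)

lemma shift_shift: "shift_op T (b_shift x) = b_shift (shift_op T (x :: ('m::finite, 'a::finite) loc))"
proof -
 have "shift_op T (b_shift x) - b_shift (shift_op T x) = 0"
 proof (rule drv_zero_jets[OF drv_comm_odd_even[OF vder_drv[OF vder_shift] drv_b_shift]])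
  fix A and a :: 'a
  have "b_shift (bracket T ghost (\<lambda>b. gen (V b)) a) = (bracket T ghost (\<lambda>b. b_shift (gen (V b))) a :: ('m, 'a) loc)"
   by (rule bracket_even_kernel[OF drv_b_shift]) simp
  thus "shift_op T (b_shift (gen (Jet A a {#} {}))) - b_shift (shift_op T (gen (Jet A a {#} {}))) = (0 :: ('m, 'a) loc)"
   by (cases A) (simp_all add: shift_ghost shift_bfield bracket_eq)
 next
  fix h :: "('m, 'a) symb" assume "\<not> is_field h"
  thus "shift_op T (b_shift (gen h)) - b_shift (shift_op T (gen h)) = 0"
   by simp
 next
  fix \<mu> and x :: "('m, 'a) loc"
  assume "shift_op T (b_shift x) - b_shift (shift_op T x) = 0"
  from arg_cong[OF this, of "susy_comp \<mu>"]
  show "shift_op T (b_shift (susy_comp \<mu> x)) - b_shift (shift_op T (susy_comp \<mu> x)) = 0"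
   using shift_susy[of T \<mu> x, unfolded add_eq_0_iff2] shift_susy[of T \<mu> "b_shift x", unfolded add_eq_0_iff2]
   by (simp add: b_shift_susy)
 next
  fix \<mu> and x :: "('m, 'a) loc"
  assume "shift_op T (b_shift x) - b_shift (shift_op T x) = 0"
  thus "shift_op T (b_shift (tderiv \<mu> x)) - b_shift (shift_op T (tderiv \<mu> x)) = 0"
   by (simp add: b_shift_tderiv vder_tderiv[OF vder_shift])
 qed
 thus ?thesis by simp
qed

lemma Zop_Xi: "Zop (gen (Xi \<mu>) * x) = gen (Xi \<mu>) * Zop (x :: ('m::finite, 'a::finite) loc)"
 by (simp add: drv_even_mult[OF drv_Zop] Zop_gen)

lemma Zop_susy: "Zop (susy_comp \<mu> x) = susy_comp \<mu> (Zop (x :: ('m::finite, 'a::finite) loc))"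
proof -
 have "susy_comp \<nu> (susy_comp \<mu> x) = - susy_comp \<mu> (susy_comp \<nu> x)" for \<nu>
  using susy_anticomm[of \<nu> \<mu> x] by (simp add: add_eq_0_iff2)
 thus ?thesis
  by (simp add: Zop_def drv_eps'[OF drv_susy] b_shift_susy sum_negf)
qed

lemma Zop_tderiv: "Zop (tderiv \<mu> x) = tderiv \<mu> (Zop (x :: ('m::finite, 'a::finite) loc))"
 by (simp add: Zop_def drv_eps'[OF drv_tderiv] susy_tderiv b_shift_tderiv)

lemma Zop_shift: "Zop (shift_op T x) = shift_op T (Zop (x :: ('m::finite, 'a::finite) loc))"
 using shift_susy[of T _ x, unfolded add_eq_0_iff2]
 by (simp add: Zop_def drv_eps'[OF vder_drv[OF vder_shift]] shift_shift)

lemma D1_Zop: "D1 T (Zop x) = Zop (D1 T (x :: ('m::finite, 'a::finite) loc))"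
 by (simp add: D1_def susy_op_def Zop_Xi Zop_susy Zop_eps' Zop_tderiv Zop_shift)

abbreviation expZ :: "complex \<Rightarrow> ('m::finite, 'a::finite) loc \<Rightarrow> ('m, 'a) loc"
 where "expZ \<equiv> expo Zop"

lemma lin_expZ: "lin (expZ t)"
 by (rule lin_expo[OF drv_lin[OF drv_Zop] lnil_Zop])
lemmas expZ_lin [simp] = lin_simps[OF lin_expZ]

lemma expZ_inverse: "expZ (-1) (expZ 1 x) = x" "expZ 1 (expZ (-1) x) = x"
 using expo_inverse[OF drv_lin[OF drv_Zop] lnil_Zop, of 1 x] expo_inverse[OF drv_lin[OF drv_Zop] lnil_Zop, of "-1" x] by simp_all

text \<open>As \<open>D1\<close> commutes with \<open>Zop\<close>, the first commutator is the whole
  conjugation series, and \<open>D0\<close> plus \<open>D1\<close> is \<open>Dtot\<close>.\<close>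

lemma D0_expZ: "D0 T (expZ 1 x) = expZ 1 (Dtot T x)"
proof -
 have "D0 T (expZ 1 x) = expZ 1 (D0 T x) + 1 *: expZ 1 (D1 T x)"
  by (rule expo_conj[OF drv_lin[OF drv_Zop] lnil_Zop drv_lin[OF drv_D0] drv_lin[OF drv_D1]])
   (rule D0_Zop, rule D1_Zop)
 thus ?thesis by (simp add: Dtot_eq)
qed

lemma Dtot_expZ: "Dtot T (expZ (-1) x) = expZ (-1) (D0 T x)"
 using arg_cong[OF D0_expZ[of T "expZ (-1) x"], of "expZ (-1)"] by (simp add: expZ_inverse)

text \<open>Nilpotency is inherited from \<open>D0\<close> by conjugation. Its components of fixed
  form degree later yield the anticommutation of \<open>coboundary\<close> with
  \<open>dext\<close>.\<close>

lemma (in gauge_algebra) Dtot_Dtot: "Dtot T (Dtot T x) = (0 :: ('m::finite, 'a) loc)"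
proof -
 have "expZ 1 (Dtot T (Dtot T x)) = 0" by (simp add: D0_expZ[symmetric] D0_D0)
 thus ?thesis using expZ_inverse(1)[of "Dtot T (Dtot T x)"] by simp
qed

subsection \<open>Contraction onto the ghosts\<close>

text \<open>Chosen so that weight 0 leaves only dx, c and B_0, and so that \<open>D0\<close>
  preserves the weight: \<open>tderiv\<close> and \<open>susy_comp\<close> both raise it by one, and
  \<open>D0\<close> exchanges a form index for a derivative.\<close>

definition jdeg :: "('m, 'a) symb \<Rightarrow> int"
 where "jdeg g = (case g of Dx _ \<Rightarrow> 0 | Jet _ _ I S \<Rightarrow> int (size I + card S) | _ \<Rightarrow> 1)"

text \<open>Contracting homotopy for the pairs exchanged by \<open>D0\<close>: a derivative of a
  form component against the component with one more form index, \<open>Xi\<close> against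
  \<open>Eps\<close>, and \<open>U\<close> against \<open>V\<close>.\<close>

definition hop :: "('m::finite, 'a::finite) loc \<Rightarrow> ('m, 'a) loc"
 where "hop = der (\<lambda>g. case g of
   Jet A a I S \<Rightarrow> (\<Sum>\<mu>\<in>#I. susy_comp \<mu> (gen (Jet A a (I - {#\<mu>#}) S)))
  | Xi \<mu> \<Rightarrow> gen (Eps \<mu>) | U a \<Rightarrow> gen (V a) | _ \<Rightarrow> 0)"

lemma lin_sum_mset: "lin f \<Longrightarrow> f (\<Sum>i\<in>#I. g i) = (\<Sum>i\<in>#I. f (g i))"
 by (induction I) (simp_all add: lin_simps)

lemma drv_hop: "drv True (hop :: ('m::finite, 'a::finite) loc \<Rightarrow> _)"
 unfolding hop_def
proof (rule graded_values.drv_der, unfold_locales)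
 fix g :: "('m, 'a) symb"
 have "parity (\<Sum>\<mu>\<in>#I. susy_comp \<mu> (gen (Jet A a (I - {#\<mu>#}) S)))
   = sgo (True \<noteq> is_odd (Jet A a I S :: ('m, 'a) symb)) *: (\<Sum>\<mu>\<in>#I. susy_comp \<mu> (gen (Jet A a (I - {#\<mu>#}) S)) :: ('m, 'a) loc)" for A a I S
 proof -
  have "parity (susy_comp \<mu> (gen (Jet A a (I - {#\<mu>#}) S))) = sgo (True \<noteq> is_odd (Jet A a I S :: ('m, 'a) symb)) *: (susy_comp \<mu> (gen (Jet A a (I - {#\<mu>#}) S)) :: ('m, 'a) loc)" for \<mu>
   using is_odd_Jet_index[of A a "I - {#\<mu>#}" S a "I :: 'm multiset"]
   by (cases "is_odd (Jet A a I S :: ('m, 'a) symb)") (simp_all add: parity_drv_odd[OF drv_susy])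
  thus ?thesis
   by (simp add: lin_sum_mset[OF lin_parity] lin_sum_mset[OF lin_scale[OF lin_ident]])
 qed
 thus "parity (case g of Jet A a I S \<Rightarrow> (\<Sum>\<mu>\<in>#I. susy_comp \<mu> (gen (Jet A a (I - {#\<mu>#}) S)))
   | Xi \<mu> \<Rightarrow> gen (Eps \<mu>) | U a \<Rightarrow> gen (V a) | _ \<Rightarrow> 0)
  = sgo (True \<noteq> is_odd g) *: (case g of Jet A a I S \<Rightarrow> (\<Sum>\<mu>\<in>#I. susy_comp \<mu> (gen (Jet A a (I - {#\<mu>#}) S)))
   | Xi \<mu> \<Rightarrow> gen (Eps \<mu>) | U a \<Rightarrow> gen (V a) | _ \<Rightarrow> 0)"
  by (cases g) simp_all
qed

lemma hop_Jet: "hop (gen (Jet A a I S)) = (\<Sum>\<mu>\<in>#I. susy_comp \<mu> (gen (Jet A a (I - {#\<mu>#}) S)))"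
 by (simp add: hop_def)
lemma hop_gen: "\<not> is_field g \<Longrightarrow> hop (gen g) = (case g of Xi \<mu> \<Rightarrow> gen (Eps \<mu>) | U a \<Rightarrow> gen (V a) | _ \<Rightarrow> 0)"
 by (cases g) (simp_all add: hop_def)

lemmas hop_lin [simp] = drv_simps[OF drv_hop]

lemma hop_tderiv: "hop (tderiv \<nu> x) = tderiv \<nu> (hop x) + susy_comp \<nu> (x :: ('m::finite, 'a::finite) loc)"
proof -
 have "(hop (tderiv \<nu> x) - tderiv \<nu> (hop x)) - susy_comp \<nu> x = 0"
 proof (rule drv_zero_eq[OF drv_diff[OF drv_comm_odd_even[OF drv_hop drv_tderiv] drv_susy]])
  fix h :: "('m, 'a) symb"
  have "hop (gen (Jet A a (add_mset \<nu> I) S)) = susy_comp \<nu> (gen (Jet A a I S)) + tderiv \<nu> (hop (gen (Jet A a I S)))"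
   for A and a :: 'a and I S
  proof -
   have "(\<Sum>\<mu>\<in>#I. susy_comp \<mu> (gen (Jet A a (add_mset \<nu> I - {#\<mu>#}) S)))
     = (\<Sum>\<mu>\<in>#I. tderiv \<nu> (susy_comp \<mu> (gen (Jet A a (I - {#\<mu>#}) S))) :: ('m, 'a) loc)"
    by (rule arg_cong[of _ _ sum_mset], rule image_mset_cong)
     (simp add: susy_tderiv[symmetric] add_mset_diff_bothsides)
   thus ?thesis by (simp add: hop_Jet lin_sum_mset[OF drv_lin[OF drv_tderiv]])
  qed
  thus "(hop (tderiv \<nu> (gen h)) - tderiv \<nu> (hop (gen h))) - susy_comp \<nu> (gen h) = 0"
   by (cases h) (simp_all add: hop_gen)
 qed
 thus ?thesis by (simp add: algebra_simps)
qed

lemma hop_susy: "hop (susy_comp \<nu> x) = - susy_comp \<nu> (hop (x :: ('m::finite, 'a::finite) loc))"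
proof -
 have "hop (susy_comp \<nu> x) + susy_comp \<nu> (hop x) = 0"
 proof (rule drv_zero_eq[OF drv_comm_odd_odd[OF drv_hop drv_susy]])
  fix h :: "('m, 'a) symb"
  have "hop (susy_comp \<nu> (gen (Jet A a I S))) + susy_comp \<nu> (hop (gen (Jet A a I S))) = 0" for A and a :: 'a and I S
  proof (induction I)
   case empty
   show ?case
   proof (cases "\<nu> \<in> S")
    case False
    then obtain t where "susy_comp \<nu> (gen (Jet A a {#} S)) = t *: (gen (Jet A a {#} (insert \<nu> S)) :: ('m, 'a) loc)"
     using susy_Jet by blast
    thus ?thesis by (simp add: hop_Jet)
   qed (simp add: susy_Jet_in hop_Jet)
  next
   case (add \<mu> I)
   let ?J = "gen (Jet A a I S) :: ('m, 'a) loc"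
   have "hop (susy_comp \<nu> (tderiv \<mu> ?J)) + susy_comp \<nu> (hop (tderiv \<mu> ?J))
     = tderiv \<mu> (hop (susy_comp \<nu> ?J) + susy_comp \<nu> (hop ?J)) + (susy_comp \<mu> (susy_comp \<nu> ?J) + susy_comp \<nu> (susy_comp \<mu> ?J))"
    unfolding susy_tderiv hop_tderiv susy_lin tderiv_lin by (simp add: algebra_simps)
   thus ?case by (simp add: add.IH susy_anticomm)
  qed
  thus "hop (susy_comp \<nu> (gen h)) + susy_comp \<nu> (hop (gen h)) = 0"
   by (cases h) (simp_all add: hop_gen)
 qed
 thus ?thesis by (simp add: add_eq_0_iff2)
qed

lemma num_tderiv: "num jdeg (tderiv \<mu> x) = tderiv \<mu> (num jdeg x) + tderiv \<mu> (x :: ('m, 'a) loc)"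
proof -
 have "(num jdeg (tderiv \<mu> x) - tderiv \<mu> (num jdeg x)) - tderiv \<mu> x = 0"
 proof (rule drv_zero_eq[OF drv_diff[OF drv_comm_even_even[OF drv_num drv_tderiv] drv_tderiv]])
  fix h :: "('m, 'a) symb"
  show "(num jdeg (tderiv \<mu> (gen h)) - tderiv \<mu> (num jdeg (gen h))) - tderiv \<mu> (gen h) = 0"
   by (cases h) (simp_all add: jdeg_def smult_dist)
 qed
 thus ?thesis by (simp add: algebra_simps)
qed

lemma num_susy: "num jdeg (susy_comp \<mu> x) = susy_comp \<mu> (num jdeg x) + susy_comp \<mu> (x :: ('m::finite, 'a::finite) loc)"
proof -
 have "(num jdeg (susy_comp \<mu> x) - susy_comp \<mu> (num jdeg x)) - susy_comp \<mu> x = 0"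
 proof (rule drv_zero_eq[OF drv_diff[OF drv_comm_even_odd[OF drv_num drv_susy] drv_susy]])
  fix h :: "('m, 'a) symb"
  have "(num jdeg (susy_comp \<mu> (gen (Jet A a I S))) - susy_comp \<mu> (num jdeg (gen (Jet A a I S)))) - susy_comp \<mu> (gen (Jet A a I S)) = 0"
   for A and a :: 'a and I S
  proof (cases "\<mu> \<in> S")
   case False
   then obtain t where t: "susy_comp \<mu> (gen (Jet A a I S)) = t *: (gen (Jet A a I (insert \<mu> S)) :: ('m, 'a) loc)"
    using susy_Jet by blast
   have "num jdeg (gen (Jet A a I (insert \<mu> S))) = of_int (int (size I + card S) + 1) *: gen (Jet A a I (insert \<mu> S))"
    using False by (simp add: jdeg_def)
   moreover have "num jdeg (gen (Jet A a I S)) = of_int (int (size I + card S)) *: gen (Jet A a I S)"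
    by (simp add: jdeg_def)
   ultimately show ?thesis by (simp add: t algebra_simps)
  qed (simp add: susy_Jet_in)
  thus "(num jdeg (susy_comp \<mu> (gen h)) - susy_comp \<mu> (num jdeg (gen h))) - susy_comp \<mu> (gen h) = 0"
   by (cases h) (simp_all add:)
 qed
 thus ?thesis by (simp add: algebra_simps)
qed

text \<open>Both sides are derivations with the same commutators with \<open>susy_comp\<close> and
  \<open>tderiv\<close>, so it suffices to look at c and B_0, where both vanish, and at the
  constants.\<close>

lemma D0_hop: "D0 T (hop x) + hop (D0 T x) = num jdeg (x :: ('m::finite, 'a::finite) loc)"
proof -
 have "(D0 T (hop x) + hop (D0 T x)) - num jdeg x = 0"
 proof (rule drv_zero_jets[OF drv_diff[OF drv_comm_odd_odd[OF drv_D0 drv_hop] drv_num]])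
  fix A and a :: 'a
  have "hop (bracket T ghost (\<lambda>b. gen (Jet A b {#} {})) a) = (0 :: ('m, 'a) loc)"
   by (rule bracket_kernel[OF drv_hop]) (simp_all add: hop_Jet)
  thus "(D0 T (hop (gen (Jet A a {#} {}))) + hop (D0 T (gen (Jet A a {#} {})))) - num jdeg (gen (Jet A a {#} {})) = (0 :: ('m, 'a) loc)"
   by (simp add: hop_Jet jdeg_def)
 next
  fix h :: "('m, 'a) symb" assume "\<not> is_field h"
  thus "(D0 T (hop (gen h)) + hop (D0 T (gen h))) - num jdeg (gen h) = 0"
   by (cases h) (simp_all add: hop_gen D0_gen jdeg_def)
 next
  fix \<mu> and x :: "('m, 'a) loc"
  assume "(D0 T (hop x) + hop (D0 T x)) - num jdeg x = 0"
  from arg_cong[OF this, of "susy_comp \<mu>"]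
  show "(D0 T (hop (susy_comp \<mu> x)) + hop (D0 T (susy_comp \<mu> x))) - num jdeg (susy_comp \<mu> x) = 0"
   by (simp add: hop_susy D0_susy num_susy hop_tderiv algebra_simps)
 next
  fix \<mu> and x :: "('m, 'a) loc"
  assume "(D0 T (hop x) + hop (D0 T x)) - num jdeg x = 0"
  from arg_cong[OF this, of "tderiv \<mu>"]
  show "(D0 T (hop (tderiv \<mu> x)) + hop (D0 T (tderiv \<mu> x))) - num jdeg (tderiv \<mu> x) = 0"
   by (simp add: hop_tderiv D0_tderiv num_tderiv D0_susy algebra_simps)
 qed
 thus ?thesis by simp
qed

abbreviation ghost_alg :: "('m::finite, 'a::finite) loc \<Rightarrow> bool"
 where "ghost_alg \<equiv> over {g. jdeg g = 0}"

lemma jdeg_nonneg: "jdeg g \<ge> 0"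
 by (cases g) (simp_all add: jdeg_def)

lemma jdeg_0: "jdeg (g :: ('m::finite, 'a) symb) = 0 \<longleftrightarrow> is_dx g \<or> (\<exists>A a. g = Jet A a {#} {})"
 by (cases g) (auto simp: jdeg_def simp flip: of_nat_add)

lemma hom_jet_weight_0: "hom jdeg 0 x \<longleftrightarrow> ghost_alg x"
 by (rule hom_nonneg_over[OF jdeg_nonneg])

context gauge_algebra begin

lemma D0_num: "D0 T (num jdeg x) = num jdeg (D0 T (x :: ('m::finite, 'a) loc))"
 unfolding D0_hop[of T, symmetric] by (simp add: D0_D0)

lemma hom_D0: "hom jdeg k x \<Longrightarrow> hom jdeg k (D0 T (x :: ('m::finite, 'a) loc))"
 unfolding hom_num D0_num[symmetric] by simp

lemma D0_gpart: "D0 T (gpart jdeg k x) = gpart jdeg k (D0 T (x :: ('m::finite, 'a) loc))"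
 using lin_comp_comm[of "D0 T" jdeg 0, OF drv_lin[OF drv_D0], unfolded add_0_right, OF hom_D0] .

end

definition inv_weight :: "('m::finite, 'a::finite) loc \<Rightarrow> ('m, 'a) loc"
 where "inv_weight = diag (\<lambda>m. (\<lambda>k. if k = 0 then 0 else 1 / of_int k) (wt jdeg m))"

lemma num_inv_weight: "num jdeg (inv_weight x) = x - gpart jdeg 0 x"
 by (rule salg_eqI) (simp add: num_def inv_weight_def)

lemma inv_weight_comm:
 fixes f :: "('m::finite, 'a::finite) loc \<Rightarrow> ('m, 'a) loc"
 assumes "lin f" "\<And>k x. hom jdeg k x \<Longrightarrow> hom jdeg k (f x)"
 shows "f (inv_weight x) = inv_weight (f x)"
 unfolding inv_weight_def by (rule lin_diag_comm[where \<phi> = "\<lambda>k. if k = 0 then 0 else 1 / of_int k", OF assms])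

text \<open>Division by the weight inverts the homotopy formula away from weight 0;
  \<open>inv_weight\<close> commutes with \<open>D0\<close> since \<open>D0\<close> preserves the
  weight.\<close>

lemma (in gauge_algebra) contraction:
 "x = gpart jdeg 0 x + D0 T (hop (inv_weight x)) + hop (inv_weight (D0 T (x)))"
 using D0_hop[of T "inv_weight x"] inv_weight_comm[of "D0 T" x, OF drv_lin[OF drv_D0] hom_D0]
 by (simp add: num_inv_weight algebra_simps)

subsection \<open>Lorentz covariance\<close>

context
 fixes \<Lambda> :: "'m::finite \<Rightarrow> 'm \<Rightarrow> real"
begin

abbreviation lor :: "('m, 'a::finite) loc \<Rightarrow> ('m, 'a) loc" where "lor \<equiv> lorentz_op \<Lambda>"
abbreviation L :: "'m \<Rightarrow> 'm \<Rightarrow> complex" where "L \<mu> \<nu> \<equiv> of_real (\<Lambda> \<mu> \<nu>)"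

lemma drv_rotate_dx: "drv False (rotate_dx \<Lambda> :: ('m, 'a::finite) loc \<Rightarrow> _)"
 unfolding rotate_dx_def
 by (rule graded_values.drv_der, unfold_locales)
  (auto simp: sum_negf split: symb.split)

lemma rotate_dx_gen: "rotate_dx \<Lambda> (gen (Dx \<mu>)) = (\<Sum>\<nu>. L \<mu> \<nu> *: gen (Dx \<nu>))"
 "\<not> is_dx g \<Longrightarrow> rotate_dx \<Lambda> (gen g) = 0"
 by (simp_all add: rotate_dx_def) (cases g; simp)

lemma gpart_rotate_dx: "rotate_dx \<Lambda> (gpart fdeg k x) = gpart fdeg k (rotate_dx \<Lambda> (x :: ('m, 'a::finite) loc))"
proof -
 have "hom fdeg (fdeg g + 0) (rotate_dx \<Lambda> (gen g))" for g :: "('m, 'a) symb"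
  by (cases g) (auto simp: rotate_dx_gen intro!: hom_sum hom_smult hom_gen')
 from drv_comp_comm[OF drv_rotate_dx this] show ?thesis by simp
qed

lemma lorentz_value:
 "cof S (rotate_dx \<Lambda> (ladder_form A (card S) a)) = cof S (rotate_dx \<Lambda> (superfield A a :: ('m, 'a::finite) loc))"
 by (simp add: ladder_form_gpart gpart_rotate_dx cof_comp)

lemma drv_lor: "drv False (lor :: ('m, 'a::finite) loc \<Rightarrow> _)"
 unfolding lorentz_op_def
proof (rule graded_values.drv_der, unfold_locales)
 fix g :: "('m, 'a) symb"
 let ?J = "\<lambda>A a I S. - tderivs I (cof S (rotate_dx \<Lambda> (ladder_form A (card S) a)))
    - (\<Sum>\<mu>\<in>#I. \<Sum>\<nu>. cst (of_real (\<Lambda> \<nu> \<mu>)) * gen (Jet A a (add_mset \<nu> (I - {#\<mu>#})) S))"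
 have "parity (?J A a I S) = sgo (is_odd (Jet A a I S :: ('m, 'a) symb)) *: ?J A a I S" for A a I S
 proof -
  let ?s = "sgo (is_odd (Jet A a I S :: ('m, 'a) symb))"
  have 1: "parity (gen (Jet A a K S)) = ?s *: (gen (Jet A a K S) :: ('m, 'a) loc)" for K
   using is_odd_Jet_index[of A a "K :: 'm multiset" S a I] by simp
  have "parity (rotate_dx \<Lambda> (superfield A a)) = sgo (field_odd TYPE('m) A) *: (rotate_dx \<Lambda> (superfield A a))"
   by (simp add: drv_even_parity[OF drv_rotate_dx, symmetric] parity_superfield drv_simps[OF drv_rotate_dx])
  hence "parity (cof S (rotate_dx \<Lambda> (superfield A a))) = ?s *: (cof S (rotate_dx \<Lambda> (superfield A a)))"
   unfolding parity_cof is_odd_Jet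
   by (cases "odd (card S)"; cases "field_odd TYPE('m) A") simp_all
  hence 2: "parity (tderivs I (cof S (rotate_dx \<Lambda> (superfield A a)))) = ?s *: (tderivs I (cof S (rotate_dx \<Lambda> (superfield A a))) :: ('m, 'a) loc)"
   using tderivs_comm[where f = parity and I = I and x = "cof S (rotate_dx \<Lambda> (superfield A a)) :: ('m, 'a) loc", OF drv_even_parity[OF drv_tderiv, symmetric]]
   by (simp add: lin_simps[OF lin_tderivs])
  show ?thesis
   unfolding lorentz_value cst_mult_conv
   by (simp del: parity_gen add: 1 2 lin_sum_mset[OF lin_parity] smult_dist lin_sum_mset[OF lin_scale[OF lin_ident]]
    smult_sum_right mult.commute)
 qed
 thus "parity (case g of Dx \<mu> \<Rightarrow> \<Sum>\<nu>. cst (of_real (\<Lambda> \<mu> \<nu>)) * gen (Dx \<nu>)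
  | Xi \<mu> \<Rightarrow> \<Sum>\<nu>. cst (of_real (\<Lambda> \<mu> \<nu>)) * gen (Xi \<nu>)
  | Eps \<mu> \<Rightarrow> \<Sum>\<nu>. cst (of_real (\<Lambda> \<mu> \<nu>)) * gen (Eps \<nu>)
  | Jet A a I S \<Rightarrow> ?J A a I S | _ \<Rightarrow> 0)
  = sgo (False \<noteq> is_odd g) *: (case g of Dx \<mu> \<Rightarrow> \<Sum>\<nu>. cst (of_real (\<Lambda> \<mu> \<nu>)) * gen (Dx \<nu>)
  | Xi \<mu> \<Rightarrow> \<Sum>\<nu>. cst (of_real (\<Lambda> \<mu> \<nu>)) * gen (Xi \<nu>)
  | Eps \<mu> \<Rightarrow> \<Sum>\<nu>. cst (of_real (\<Lambda> \<mu> \<nu>)) * gen (Eps \<nu>)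
  | Jet A a I S \<Rightarrow> ?J A a I S | _ \<Rightarrow> 0)"
  by (cases g) (simp_all add: sum_negf del: parity_lin(5))
qed

lemmas lor_lin [simp] = drv_simps[OF drv_lor]

lemma lor_Jet: "lor (gen (Jet A a I S)) = - tderivs I (cof S (rotate_dx \<Lambda> (superfield A a)))
  - (\<Sum>\<mu>\<in>#I. \<Sum>\<nu>. L \<nu> \<mu> *: gen (Jet A a (add_mset \<nu> (I - {#\<mu>#})) S))"
 by (simp add: lorentz_op_def lorentz_value)

lemma lor_gen [simp]: "\<not> is_field g \<Longrightarrow> lor (gen g) = (case g of
   Dx \<mu> \<Rightarrow> \<Sum>\<nu>. L \<mu> \<nu> *: gen (Dx \<nu>) | Xi \<mu> \<Rightarrow> \<Sum>\<nu>. L \<mu> \<nu> *: gen (Xi \<nu>)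
  | Eps \<mu> \<Rightarrow> \<Sum>\<nu>. L \<mu> \<nu> *: gen (Eps \<nu>) | _ \<Rightarrow> 0)"
 by (cases g) (simp_all add: lorentz_op_def)

lemma lor_ghost [simp]: "lor (gen (Jet A a {#} {})) = 0"
 by (simp add: lor_Jet cof_empty_superfield gpart_rotate_dx[symmetric] gpart_superfield_0 rotate_dx_gen)

text \<open>A lower index transforms contragrediently to that of \<open>dx\<close>, so contractions
  with \<open>dx\<close>, \<open>Eps\<close> or \<open>Xi\<close> are covariant
  (\<open>lor_contract\<close>).\<close>

lemma lor_tderiv: "lor (tderiv \<mu> x) = tderiv \<mu> (lor x) - (\<Sum>\<nu>. L \<nu> \<mu> *: tderiv \<nu> (x :: ('m, 'a::finite) loc))"
proof -
 have "(lor (tderiv \<mu> x) - tderiv \<mu> (lor x)) + (\<Sum>\<nu>. L \<nu> \<mu> *: tderiv \<nu> x) = 0"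
 proof (rule drv_zero_eq[OF drv_add[OF drv_comm_even_even[OF drv_lor drv_tderiv] drv_sum[OF drv_smult[OF drv_tderiv]]]])
  fix h :: "('m, 'a) symb"
  have "(lor (gen (Jet A a (add_mset \<mu> I) S)) - tderiv \<mu> (lor (gen (Jet A a I S)))) + (\<Sum>\<nu>. L \<nu> \<mu> *: gen (Jet A a (add_mset \<nu> I) S)) = 0"
   for A and a :: 'a and I S
  proof -
   have "(\<Sum>\<rho>\<in>#I. \<Sum>\<nu>. L \<nu> \<rho> *: gen (Jet A a (add_mset \<nu> (add_mset \<mu> I - {#\<rho>#})) S))
    = (\<Sum>\<rho>\<in>#I. \<Sum>\<nu>. L \<nu> \<rho> *: gen (Jet A a (add_mset \<mu> (add_mset \<nu> (I - {#\<rho>#}))) S) :: ('m, 'a) loc)"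
    by (rule arg_cong[of _ _ sum_mset], rule image_mset_cong) (simp add: add_mset_commute)
   thus ?thesis
    by (simp add: lor_Jet lin_sum_mset[OF drv_lin[OF drv_tderiv]])
  qed
  thus "(lor (tderiv \<mu> (gen h)) - tderiv \<mu> (lor (gen h))) + (\<Sum>\<nu>. L \<nu> \<mu> *: tderiv \<nu> (gen h)) = 0"
   by (cases h) simp_all
 qed
 thus ?thesis by (simp add: algebra_simps)
qed

lemma dx_free_lor_Jet: "dx_free (lor (gen (Jet A a I S)) :: ('m, 'a::finite) loc)"
 by (auto simp: lor_Jet over_diff over_uminus dx_free_tderivs dx_free_cof over_sum_mset over_sum over_smult dx_free_Jet)

lemma lor_ix: "lor (ix \<mu> x) = ix \<mu> (lor x) - (\<Sum>\<nu>. L \<nu> \<mu> *: ix \<nu> (x :: ('m, 'a::finite) loc))"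
proof -
 have "(lor (ix \<mu> x) - ix \<mu> (lor x)) + (\<Sum>\<nu>. L \<nu> \<mu> *: ix \<nu> x) = 0"
 proof (rule drv_zero_eq[OF drv_add[OF drv_comm_even_odd[OF drv_lor drv_ix] drv_sum[OF drv_smult[OF drv_ix]]]])
  fix h :: "('m, 'a) symb"
  have "ix \<mu> (lor (gen (Jet A a I S))) = 0" for A and a :: 'a and I S
   by (intro ix_dx_free dx_free_lor_Jet)
  thus "(lor (ix \<mu> (gen h)) - ix \<mu> (lor (gen h))) + (\<Sum>\<nu>. L \<nu> \<mu> *: ix \<nu> (gen h)) = 0"
   by (cases h) (simp_all add: drv_one[OF drv_lor] if_distrib sum.delta sum.delta' cong: if_cong)
 qed
 thus ?thesis by (simp add: algebra_simps)
qed

lemma dx_free_lor: "dx_free x \<Longrightarrow> dx_free (lor (x :: ('m, 'a::finite) loc))"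
proof (rule drv_over[OF drv_lor])
 show "dx_free (lor (gen g))" if "g \<in> {g. \<not> is_dx g}" for g :: "('m, 'a) symb"
  using that by (cases g) (auto simp: dx_free_lor_Jet intro!: over_sum over_smult over_gen)
qed auto

text \<open>By definition the components are rotated against the basis forms, so the two
  contributions cancel.\<close>

lemma lor_superfield: "lor (superfield A a) = (0 :: ('m, 'a::finite) loc)"
proof -
 let ?R = "rotate_dx \<Lambda> (superfield A a)"
 have "lor (dx_set S) = (rotate_dx \<Lambda> (dx_set S) :: ('m, 'a) loc)" for S
  by (rule drv_eq_over[OF drv_lor drv_rotate_dx _ over_dx_set]) (auto simp: rotate_dx_gen)
 hence "lor (dx_set S * gen (Jet A a {#} S)) = rotate_dx \<Lambda> (dx_set S) * gen (Jet A a {#} S) - dx_set S * cof S ?R" for S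
  by (simp add: drv_even_mult[OF drv_lor] lor_Jet)
 hence "lor (superfield A a) = (\<Sum>S. rotate_dx \<Lambda> (dx_set S) * gen (Jet A a {#} S)) - (\<Sum>S. dx_set S * cof S ?R)"
  unfolding superfield_def[of A a] lor_lin by (simp only: sum_subtractf)
 also have "(\<Sum>S. rotate_dx \<Lambda> (dx_set S) * gen (Jet A a {#} S)) = ?R"
  by (simp add: superfield_def drv_simps[OF drv_rotate_dx] drv_even_mult[OF drv_rotate_dx] rotate_dx_gen)
 finally show ?thesis using form_expand[of ?R] by simp
qed

lemma lor_susy: "lor (susy_comp \<mu> x) = susy_comp \<mu> (lor x) - (\<Sum>\<nu>. L \<nu> \<mu> *: susy_comp \<nu> (x :: ('m, 'a::finite) loc))"
proof -
 let ?f = "\<lambda>x :: ('m, 'a) loc. (lor (susy_comp \<mu> x) - susy_comp \<mu> (lor x)) + (\<Sum>\<nu>. L \<nu> \<mu> *: susy_comp \<nu> x)"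
 have "?f x = 0"
 proof (rule vder_eqI[of True ?f "\<lambda>x. 0" x, OF _ vder_zero])
  show "vder True ?f"
   unfolding vder_def
  proof (intro conjI allI impI)
   show "drv True ?f"
    by (intro drv_add drv_comm_even_odd drv_lor drv_sum drv_smult drv_susy)
   show "?f (tderiv \<rho> x) = tderiv \<rho> (?f x)" for \<rho> x
    by (simp add: susy_tderiv lor_tderiv algebra_simps)
   show "?f (gen (Dx \<rho>)) = 0" for \<rho> by simp
   show "dx_free (?f x)" if "dx_free x" for x
    using that by (intro over_add over_diff over_sum over_smult dx_free_lor vder_dx_free[OF vder_susy])
  qed
  show "?f (superfield A a) = 0" for A a
   by (simp add: lor_ix lor_superfield sum_negf)
  show "?f (gen h) = 0" if "\<not> is_field h" for h :: "('m, 'a) symb"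
   using that by (cases h) simp_all
 qed
 thus ?thesis by (simp add: algebra_simps)
qed

lemma lor_contract:
 fixes Op :: "'m \<Rightarrow> ('m, 'a::finite) loc \<Rightarrow> ('m, 'a) loc"
 assumes "\<And>\<mu>. lor (G \<mu>) = (\<Sum>\<nu>. L \<mu> \<nu> *: G \<nu>)"
  and "\<And>\<mu>. lor (Op \<mu> x) = Op \<mu> (lor x) - (\<Sum>\<nu>. L \<nu> \<mu> *: Op \<nu> x)"
 shows "lor (\<Sum>\<mu>. G \<mu> * Op \<mu> x) = (\<Sum>\<mu>. G \<mu> * Op \<mu> (lor x))"
proof -
 have "(\<Sum>\<mu> \<nu>. L \<mu> \<nu> *: (G \<nu> * Op \<mu> x)) = (\<Sum>\<mu> \<nu>. L \<nu> \<mu> *: (G \<mu> * Op \<nu> x))"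
  by (rule sum.swap)
 thus ?thesis
  by (simp add: drv_even_mult[OF drv_lor] assms sum.distrib right_diff_distrib sum_distrib_left sum_distrib_right sum_subtractf)
qed

lemma lor_dext: "lor (dext x) = dext (lor (x :: ('m, 'a::finite) loc))"
 unfolding dext_def by (rule lor_contract) (simp_all add: lor_tderiv)

lemma lor_climb: "lor (climb x) = climb (lor (x :: ('m, 'a::finite) loc))"
proof -
 have "lor (\<Sum>\<mu>. gen (Dx \<mu>) * susy_comp \<mu> x) = (\<Sum>\<mu>. gen (Dx \<mu>) * susy_comp \<mu> (lor x))"
  by (rule lor_contract) (simp_all add: lor_susy)
 thus ?thesis unfolding climb_def lor_lin(4) by simp
qed

lemma lor_brs: "lor (brs_op T x) = brs_op T (lor (x :: ('m, 'a::finite) loc))"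
proof -
 note B = drv_simps[OF vder_drv[OF vder_brs]]
 have bs: "brs_op T (susy_comp \<mu> y) = tderiv \<mu> y - susy_comp \<mu> (brs_op T y)" for \<mu> and y :: "('m, 'a) loc"
  using brs_susy[of T \<mu> y] by (simp add: algebra_simps)
 have "lor (brs_op T x) - brs_op T (lor x) = 0"
 proof (rule drv_zero_jets[OF drv_comm_even_odd[OF drv_lor vder_drv[OF vder_brs]]])
  show "lor (brs_op T (gen (Jet A a {#} {}))) - brs_op T (lor (gen (Jet A a {#} {}))) = (0 :: ('m, 'a) loc)" for A a
   using bracket_even_kernel[OF drv_lor, of ghost T "\<lambda>b. gen (Jet A b {#} {})" a]
   by (simp add: brs_ghost B) (simp add: bracket_eq)
  show "lor (brs_op T (gen h)) - brs_op T (lor (gen h)) = 0" if "\<not> is_field h" for h :: "('m, 'a) symb"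
   using that by (cases h) (simp_all add: B)
 next
  fix \<mu> and x :: "('m, 'a) loc"
  assume "lor (brs_op T x) - brs_op T (lor x) = 0"
  from arg_cong[OF this, of "susy_comp \<mu>"]
  show "lor (brs_op T (susy_comp \<mu> x)) - brs_op T (lor (susy_comp \<mu> x)) = 0"
   by (simp add: bs lor_susy lor_tderiv B sum_subtractf smult_dist)
 next
  fix \<mu> and x :: "('m, 'a) loc"
  assume "lor (brs_op T x) - brs_op T (lor x) = 0"
  from arg_cong[OF this, of "tderiv \<mu>"]
  show "lor (brs_op T (tderiv \<mu> x)) - brs_op T (lor (tderiv \<mu> x)) = 0"
   by (simp add: vder_tderiv[OF vder_brs] lor_tderiv B)
 qed
 thus ?thesis by simp
qed

lemma lor_hop: "lor (hop x) = hop (lor (x :: ('m, 'a::finite) loc))"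
proof -
 have "lor (hop x) - hop (lor x) = 0"
 proof (rule drv_zero_jets[OF drv_comm_even_odd[OF drv_lor drv_hop]])
  show "lor (hop (gen (Jet A a {#} {}))) - hop (lor (gen (Jet A a {#} {}))) = (0 :: ('m, 'a) loc)" for A a
   by (simp add: hop_Jet)
  show "lor (hop (gen h)) - hop (lor (gen h)) = 0" if "\<not> is_field h" for h :: "('m, 'a) symb"
   using that by (cases h) (simp_all add: hop_gen)
 next
  fix \<mu> and x :: "('m, 'a) loc"
  assume "lor (hop x) - hop (lor x) = 0"
  from arg_cong[OF this, of "susy_comp \<mu>"]
  show "lor (hop (susy_comp \<mu> x)) - hop (lor (susy_comp \<mu> x)) = 0"
   by (simp add: hop_susy lor_susy sum_negf)
 next
  fix \<mu> and x :: "('m, 'a) loc"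
  assume "lor (hop x) - hop (lor x) = 0"
  from arg_cong[OF this, of "tderiv \<mu>"]
  show "lor (hop (tderiv \<mu> x)) - hop (lor (tderiv \<mu> x)) = 0"
   by (simp add: hop_tderiv lor_susy lor_tderiv sum.distrib smult_dist)
 qed
 thus ?thesis by simp
qed

lemma lor_ghost_der: "lor (ghost_der x) = ghost_der (lor (x :: ('m, 'a::finite) loc))"
proof -
 note G = drv_simps[OF drv_ghost_der]
 have "lor (ghost_der x) - ghost_der (lor x) = 0"
 proof (rule drv_zero_jets[OF drv_comm_even_odd[OF drv_lor drv_ghost_der]])
  show "lor (ghost_der (gen h)) - ghost_der (lor (gen h)) = 0" if "\<not> is_field h" for h :: "('m, 'a) symb"
   using that by (cases h) (simp_all add: ghost_der_gen G)
 qed (simp_all add: ghost_der_gen ghost_der_susy ghost_der_tderiv lor_susy lor_tderiv G sum_negf)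
 thus ?thesis by simp
qed

lemma lor_b_shift: "lor (b_shift x) = b_shift (lor (x :: ('m, 'a::finite) loc))"
proof -
 have "lor (b_shift x) - b_shift (lor x) = 0"
 proof (rule drv_zero_jets[OF drv_comm_even_even[OF drv_lor drv_b_shift]])
  show "lor (b_shift (gen (Jet A a {#} {}))) - b_shift (lor (gen (Jet A a {#} {}))) = (0 :: ('m, 'a) loc)" for A a
   by (cases A) simp_all
  show "lor (b_shift (gen h)) - b_shift (lor (gen h)) = 0" if "\<not> is_field h" for h :: "('m, 'a) symb"
   using that by (cases h) simp_all
 qed (simp_all add: b_shift_susy b_shift_tderiv lor_susy lor_tderiv)
 thus ?thesis by simp
qed

lemma lor_Zop: "lor (Zop x) = Zop (lor (x :: ('m, 'a::finite) loc))"
proof -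
 have "lor (\<Sum>\<mu>. eps' \<mu> * susy_comp \<mu> x) = (\<Sum>\<mu>. eps' \<mu> * susy_comp \<mu> (lor x))"
  by (rule lor_contract) (simp_all add: lor_susy smult_dist sum_subtractf)
 thus ?thesis by (simp add: Zop_def lor_b_shift)
qed

lemma lor_D0: "lor (D0 T x) = D0 T (lor (x :: ('m, 'a::finite) loc))"
 by (simp add: D0_def lor_brs lor_ghost_der)

lemma lor_expZ: "lor (expZ t x) = expZ t (lor (x :: ('m, 'a::finite) loc))"
 by (rule expo_comm[OF drv_lin[OF drv_Zop] lnil_Zop drv_lin[OF drv_lor]]) (rule lor_Zop)

lemma lor_Dtot: "lor (Dtot T x) = Dtot T (lor (x :: ('m, 'a::finite) loc))"
proof -
 have e: "Dtot T y = expZ (-1) (D0 T (expZ 1 y))" for y :: "('m, 'a) loc" by (simp add: D0_expZ expZ_inverse)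
 show ?thesis unfolding e by (simp add: lor_expZ lor_D0)
qed

lemma lor_num:
 fixes w :: "('m, 'a::finite) symb \<Rightarrow> int"
 assumes "\<And>\<mu> x. num w (susy_comp \<mu> x) = susy_comp \<mu> (num w x) + s *: susy_comp \<mu> x"
  and "\<And>\<mu> x. num w (tderiv \<mu> x) = tderiv \<mu> (num w x) + r *: tderiv \<mu> x"
  and "\<And>\<mu> \<nu>. w (Dx \<mu>) = w (Dx \<nu>)" "\<And>\<mu> \<nu>. w (Xi \<mu>) = w (Xi \<nu>)" "\<And>\<mu> \<nu>. w (Eps \<mu>) = w (Eps \<nu>)"
 shows "lor (num w x) = num w (lor x)"
proof -
 note N = num_lin
 have "lor (num w x) - num w (lor x) = 0"
 proof (rule drv_zero_jets[OF drv_comm_even_even[OF drv_lor drv_num]])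
  show "lor (num w (gen h)) - num w (lor (gen h)) = 0" if "\<not> is_field h" for h
  proof -
   obtain d x e where "\<And>\<mu>. w (Dx \<mu>) = d" "\<And>\<mu>. w (Xi \<mu>) = x" "\<And>\<mu>. w (Eps \<mu>) = e"
    using assms(3-5) by metis
   thus ?thesis using that
    by (cases h) (simp_all add: N smult_sum_right mult.commute)
  qed
 qed (simp_all add: assms(1,2) lor_susy lor_tderiv N smult_dist sum.distrib smult_sum_right mult.commute)
 thus ?thesis by simp
qed

end

subsection \<open>The algebraic Poincare lemma\<close>

text \<open>Removes one derivative along mu, counted with multiplicity. Its commutator with
  \<open>tderiv\<close> is the number of fields (\<open>low_tderiv\<close>): a Heisenberg algebra
  with central element \<open>nfields\<close>.\<close>

definition low :: "'m \<Rightarrow> ('m, 'a) loc \<Rightarrow> ('m, 'a) loc"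
 where "low \<mu> = der (\<lambda>g. case g of Jet A a I S \<Rightarrow> of_nat (count I \<mu>) *: gen (Jet A a (I - {#\<mu>#}) S) | _ \<Rightarrow> 0)"

lemma drv_low: "drv False (low \<mu> :: ('m, 'a) loc \<Rightarrow> _)"
 unfolding low_def
 by (rule graded_values.drv_der, unfold_locales)
  (auto simp: mult.commute split: symb.split intro!: arg_cong[of _ _ sgo] is_odd_Jet_index)

lemma low_Jet: "low \<mu> (gen (Jet A a I S)) = of_nat (count I \<mu>) *: gen (Jet A a (I - {#\<mu>#}) S)"
 by (simp add: low_def)
lemma low_gen [simp]: "\<not> is_field g \<Longrightarrow> low \<mu> (gen g) = 0"
 by (cases g) (simp_all add: low_def)

lemmas low_lin [simp] = drv_simps[OF drv_low]

definition fldeg :: "('m, 'a) symb \<Rightarrow> int"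
 where "fldeg g = (if is_field g then 1 else 0)"

lemma fldeg_simps [simp]: "is_field g \<Longrightarrow> fldeg g = 1" "\<not> is_field g \<Longrightarrow> fldeg g = 0"
 by (simp_all add: fldeg_def)

abbreviation nfields :: "('m, 'a) loc \<Rightarrow> ('m, 'a) loc" where "nfields \<equiv> num fldeg"

lemma low_tderiv: "low \<mu> (tderiv \<nu> x) = tderiv \<nu> (low \<mu> x) + (if \<mu> = \<nu> then nfields x else (0 :: ('m, 'a) loc))"
proof -
 have d: "drv False (\<lambda>x :: ('m, 'a) loc. if \<mu> = \<nu> then nfields x else 0)"
  by (cases "\<mu> = \<nu>") (simp_all add: drv_num drv_zero)
 have "(low \<mu> (tderiv \<nu> x) - tderiv \<nu> (low \<mu> x)) - (if \<mu> = \<nu> then nfields x else 0) = 0"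
 proof (rule drv_zero_eq[OF drv_diff[OF drv_comm_even_even[OF drv_low drv_tderiv] d]])
  fix h :: "('m, 'a) symb"
  show "(low \<mu> (tderiv \<nu> (gen h)) - tderiv \<nu> (low \<mu> (gen h))) - (if \<mu> = \<nu> then nfields (gen h) else 0) = 0"
   by (cases h; (auto simp: low_Jet smult_dist))
 qed
 thus ?thesis by (simp add: algebra_simps)
qed

lemma nfields_tderiv: "nfields (tderiv \<mu> x) = tderiv \<mu> (nfields (x :: ('m, 'a) loc))"
proof -
 have "hom fldeg (fldeg g + 0) (tderiv \<mu> (gen g))" for g :: "('m, 'a) symb"
  by (cases g) (auto intro!: hom_gen')
 from drv_num_comm[OF drv_tderiv this] show ?thesis by simp
qed

lemma nfields_low: "nfields (low \<mu> x) = low \<mu> (nfields (x :: ('m, 'a) loc))"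
proof -
 have "hom fldeg (fldeg g + 0) (low \<mu> (gen g))" for g :: "('m, 'a) symb"
  by (cases g) (auto simp: low_Jet intro!: hom_smult hom_gen')
 from drv_num_comm[OF drv_low this] show ?thesis by simp
qed

lemma nfields_ix: "nfields (ix \<mu> x) = ix \<mu> (nfields (x :: ('m, 'a) loc))"
proof -
 have "hom fldeg (fldeg g + 0) (ix \<mu> (gen g))" for g :: "('m, 'a) symb"
  by (cases g) auto
 from drv_num_comm[OF drv_ix this] show ?thesis by simp
qed

lemma nfields_susy: "nfields (susy_comp \<mu> x) = susy_comp \<mu> (nfields (x :: ('m::finite, 'a::finite) loc))"
proof -
 have J: "hom fldeg 1 (susy_comp \<mu> (gen (Jet A a I S)) :: ('m, 'a) loc)" for A a I S
 proof (cases "\<mu> \<in> S")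
  case False
  then obtain t where "susy_comp \<mu> (gen (Jet A a I S)) = t *: (gen (Jet A a I (insert \<mu> S)) :: ('m, 'a) loc)"
   using susy_Jet by blast
  thus ?thesis by (auto intro!: hom_smult hom_gen')
 qed (simp add: susy_Jet_in)
 have "hom fldeg (fldeg g + 0) (susy_comp \<mu> (gen g))" for g :: "('m, 'a) symb"
  by (cases g) (simp_all add: J)
 from drv_num_comm[OF drv_susy this] show ?thesis by simp
qed

lemma nfields_Dx: "nfields (gen (Dx \<mu>) * x) = gen (Dx \<mu>) * nfields x"
 by (simp add: num_gen_mult)

lemma nfields_dext: "nfields (dext x) = dext (nfields (x :: ('m::finite, 'a) loc))"
 by (simp add: dext_def nfields_Dx nfields_tderiv)

definition khop :: "('m::finite, 'a) loc \<Rightarrow> ('m, 'a) loc"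
 where "khop x = (\<Sum>\<mu>. low \<mu> (ix \<mu> x))"

definition Theta :: "('m::finite, 'a) loc \<Rightarrow> ('m, 'a) loc"
 where "Theta x = (\<Sum>\<mu>. tderiv \<mu> (low \<mu> x))"

definition Xiop :: "('m::finite, 'a) loc \<Rightarrow> ('m, 'a) loc"
 where "Xiop x = dext (khop x) + khop (dext x)"

lemma lin_khop: "lin (khop :: ('m::finite, 'a) loc \<Rightarrow> _)"
 unfolding khop_def by (intro lin_summ lin_comp[OF drv_lin[OF drv_low] drv_lin[OF drv_ix]])
lemma lin_Theta: "lin (Theta :: ('m::finite, 'a) loc \<Rightarrow> _)"
 unfolding Theta_def by (intro lin_summ lin_comp[OF drv_lin[OF drv_tderiv] drv_lin[OF drv_low]])
lemma lin_Xiop: "lin (Xiop :: ('m::finite, 'a) loc \<Rightarrow> _)"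
 unfolding Xiop_def
 by (intro lin_plus lin_comp[OF drv_lin[OF drv_dext] lin_khop] lin_comp[OF lin_khop drv_lin[OF drv_dext]])
lemmas khop_lin [simp] = lin_simps[OF lin_khop]

lemma num_form: "num fdeg x = (\<Sum>\<mu>. gen (Dx \<mu>) * ix \<mu> (x :: ('m::finite, 'a) loc))"
proof (rule drv_eq[OF drv_num])
 show "drv False (\<lambda>x :: ('m, 'a) loc. \<Sum>\<mu>. gen (Dx \<mu>) * ix \<mu> x)"
  by (intro drv_sum drv_gen_odd[of True, simplified] drv_ix) simp
 show "num fdeg (gen h) = (\<Sum>\<mu>. gen (Dx \<mu>) * ix \<mu> (gen h))" for h :: "('m, 'a) symb"
  by (cases h) (simp_all add: if_distrib sum.delta' cong: if_cong)
qed

text \<open>On p-forms of degree N in the fields the Laplacian of d and \<open>khop\<close> is Theta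
  + N (D - p), where D is the dimension. The eigenvalues of \<open>Theta\<close> are nonnegative
  multiples of N, so for N > 0 zero is excluded below top degree, while on top forms only
  \<open>Theta\<close> remains.\<close>

lemma Xiop_eq: "Xiop x = Theta x + of_nat CARD('m) *: nfields x - nfields (num fdeg (x :: ('m::finite, 'a) loc))"
proof -
 have 1: "khop (gen (Dx \<mu>) * y) = low \<mu> y - gen (Dx \<mu>) * khop y" for \<mu> and y :: "('m, 'a) loc"
 proof -
  have "low \<nu> (ix \<nu> (gen (Dx \<mu>) * y)) = (if \<nu> = \<mu> then low \<mu> y else 0) - gen (Dx \<mu>) * low \<nu> (ix \<nu> y)" for \<nu>
   by (simp add: drv_odd_mult[OF drv_ix] drv_even_mult[OF drv_low] drv_one[OF drv_low])
  thus ?thesis by (simp add: khop_def sum_subtractf sum_distrib_left sum.delta)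
 qed
 have 2: "khop (tderiv \<mu> x) = tderiv \<mu> (khop x) + nfields (ix \<mu> x)" for \<mu>
 proof -
  have "low \<nu> (ix \<nu> (tderiv \<mu> x)) = tderiv \<mu> (low \<nu> (ix \<nu> x)) + (if \<nu> = \<mu> then nfields (ix \<mu> x) else 0)" for \<nu>
   by (simp add: ix_tderiv low_tderiv)
  thus ?thesis by (simp add: khop_def sum.distrib)
 qed
 have "khop (dext x) = (\<Sum>\<mu>. low \<mu> (tderiv \<mu> x)) - dext (khop x) - (\<Sum>\<mu>. gen (Dx \<mu>) * nfields (ix \<mu> x))"
  by (simp add: dext_def 1 2 sum_subtractf sum.distrib distrib_left diff_diff_eq)
 also have "(\<Sum>\<mu>. low \<mu> (tderiv \<mu> x)) = Theta x + of_nat CARD('m) *: nfields x"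
 proof -
  have "(\<Sum>\<mu>\<in>(UNIV :: 'm set). y) = of_nat CARD('m) *: y" for y :: "('m, 'a) loc"
   using smult_sum_left[of "\<lambda>_. 1" "UNIV :: 'm set" y] by simp
  thus ?thesis by (simp add: low_tderiv Theta_def sum.distrib)
 qed
 also have "(\<Sum>\<mu>. gen (Dx \<mu>) * nfields (ix \<mu> x)) = nfields (num fdeg x)"
  by (simp add: num_form nfields_Dx)
 finally show ?thesis by (simp add: Xiop_def)
qed

lemma low_low_Theta: "low \<mu> (Theta x) = Theta (low \<mu> x) + nfields (low \<mu> (x :: ('m::finite, 'a) loc))"
proof -
 have c: "low \<mu> (low \<nu> x) = low \<nu> (low \<mu> x)" for \<nu>
 proof -
  have "low \<mu> (low \<nu> x) - low \<nu> (low \<mu> x) = 0"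
  proof (rule drv_zero_eq[OF drv_comm_even_even[OF drv_low drv_low]])
   fix h :: "('m, 'a) symb"
   show "low \<mu> (low \<nu> (gen h)) - low \<nu> (low \<mu> (gen h)) = 0"
    by (cases h; cases "\<mu> = \<nu>") (simp_all add: low_Jet add.commute mult.commute)
  qed
  thus ?thesis by simp
 qed
 have "low \<mu> (tderiv \<nu> (low \<nu> x)) = tderiv \<nu> (low \<nu> (low \<mu> x)) + (if \<nu> = \<mu> then nfields (low \<mu> x) else 0)" for \<nu>
  by (simp add: low_tderiv c)
 thus ?thesis by (simp add: Theta_def sum.distrib)
qed

definition order_weight :: "('m, 'a) symb \<Rightarrow> int"
 where "order_weight g = (case g of Jet A a I S \<Rightarrow> int (size I) | _ \<Rightarrow> 0)"

lemma wt_nonneg: "(\<And>g. w g \<ge> 0) \<Longrightarrow> wt w m \<ge> 0"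
 by (induction m) (auto intro: add_nonneg_nonneg)

lemma hom_neg: "(\<And>g. w g \<ge> 0) \<Longrightarrow> k < 0 \<Longrightarrow> hom w k x \<Longrightarrow> x = 0"
proof -
 assume "\<And>g. w g \<ge> 0" "k < 0" "hom w k x"
 moreover from this(1) have "wt w m \<ge> 0" for m by (rule wt_nonneg)
 ultimately have "supp x = {}" unfolding hom_def by (metis all_not_in_conv not_le)
 thus "x = 0" by (intro salg_eqI) (auto simp: supp_iff)
qed

lemma hom_order_low: "hom order_weight k x \<Longrightarrow> hom order_weight (k - 1) (low \<mu> (x :: ('m, 'a) loc))"
proof (rule drv_hom[OF drv_low])
 show "hom order_weight (order_weight g + -1) (low \<mu> (gen g))" for g :: "('m, 'a) symb"
 proof (cases g)
  case (Jet A a I S)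
  thus ?thesis
   by (cases "\<mu> \<in># I") (auto simp: low_Jet order_weight_def size_Diff_singleton not_in_iff Suc_leI of_nat_diff nonempty_has_size[symmetric]
    intro!: hom_smult hom_gen' split: nat_diff_split)
 qed simp_all
qed auto

lemma hom_form_low: "hom fdeg k x \<Longrightarrow> hom fdeg k (low \<mu> (x :: ('m, 'a) loc))"
proof (rule drv_hom[OF drv_low])
 show "hom fdeg (fdeg g + 0) (low \<mu> (gen g))" for g :: "('m, 'a) symb"
  by (cases g) (auto simp: low_Jet intro!: hom_smult hom_gen')
qed auto

abbreviation "sshift \<equiv> salg.shift"
lemmas sshift_def = salg.shift_def

text \<open>Induction on the derivative order: \<open>low\<close> lowers it by one and satisfies low
  Theta = (Theta + N) low, which shifts all roots by N. The remaining root 0 is supplied by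
  \<open>Theta\<close> itself, which begins by applying \<open>low\<close>.\<close>

lemma Theta_annihilated:
 assumes "hom order_weight (int k) x" "hom fldeg N (x :: ('m::finite, 'a) loc)"
 shows "salg.prodop Theta (map (\<lambda>j. of_int N * of_nat j) [0..<Suc k]) x = 0"
 using assms
proof (induction k arbitrary: x)
 case 0
 have "low \<mu> x = 0" for \<mu>
  using hom_order_low[OF 0(1), of \<mu>] by (intro hom_neg[of order_weight "-1"]) (auto simp: order_weight_def split: symb.split)
 thus ?case by (simp add: sshift_def Theta_def)
next
 case (Suc k)
 have L: "salg.linop (Theta :: ('m, 'a) loc \<Rightarrow> _)" by (simp add: linop_lin lin_Theta)
 let ?c = "\<lambda>j. of_int N * of_nat j"
 have *: "low \<mu> (salg.prodop Theta (map (\<lambda>j. ?c (Suc j)) js) y) = salg.prodop Theta (map ?c js) (low \<mu> y)"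
  if "hom fldeg N y" for js \<mu> and y :: "('m, 'a) loc"
  using that
 proof (induction js arbitrary: y)
  case (Cons j js)
  have h: "nfields y = of_int N *: y" using Cons.prems by (simp add: hom_num)
  have "hom fldeg N (sshift Theta (?c (Suc j)) y)"
   using h by (simp add: hom_num sshift_def Theta_def nfields_tderiv nfields_low 
    smult_sum_right smult_dist mult.commute)
  moreover have "low \<mu> (sshift Theta (?c (Suc j)) y) = sshift Theta (?c j) (low \<mu> y)"
   by (simp add: sshift_def low_low_Theta nfields_low h smult_dist algebra_simps)
  ultimately show ?case using Cons.IH by simp
 qed simp
 have "hom order_weight (int k) (low \<mu> x)" for \<mu> using hom_order_low[OF Suc.prems(1), of \<mu>] by simp
 moreover have "hom fldeg N (low \<mu> x)" for \<mu> using Suc.prems(2) by (simp add: hom_num nfields_low)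
 ultimately have "low \<mu> (salg.prodop Theta (map (\<lambda>j. ?c (Suc j)) [0..<Suc k]) x) = 0" for \<mu>
  unfolding *[OF Suc.prems(2)] by (intro Suc.IH)
 hence "Theta (salg.prodop Theta (map (\<lambda>j. ?c (Suc j)) [0..<Suc k]) x) = 0"
  by (simp only: Theta_def tderiv_lin(3) sum.neutral_const)
 moreover have "Theta y = sshift Theta (?c 0) y" for y by (simp add: sshift_def)
 ultimately have "salg.prodop Theta (map (\<lambda>j. ?c (Suc j)) [0..<Suc k]) (sshift Theta (?c 0) x) = 0"
  by (metis salg.shift_prodop[OF L])
 moreover have "map ?c [0..<Suc (Suc k)] = ?c 0 # map (\<lambda>j. ?c (Suc j)) [0..<Suc k]"
  by (simp add: upt_conv_Cons map_Suc_upt[symmetric] del: upt_Suc)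
 ultimately show ?case by (metis salg.prodop.simps(2))
qed

lemma prodop_translate:
 assumes "\<And>y. y \<in> S \<Longrightarrow> A y = B y + c *: y" "\<And>y d. y \<in> S \<Longrightarrow> sshift B d y \<in> S" "x \<in> S"
 shows "salg.prodop A (map ((+) c) cs) x = salg.prodop B cs x"
 using assms(3)
 using assms(1) assms(2) by (induction cs arbitrary: x; (auto simp: sshift_def smult_dist))

definition fielded :: "('m, 'a) loc \<Rightarrow> bool"
 where "fielded x \<longleftrightarrow> gpart fldeg 0 x = 0"

text \<open>The roots are N (D - p + j) with N > 0 and j >= 0. Zero occurs only for p = D and j = 0,
  as a simple root on each homogeneous piece; applying \<open>Xiop\<close> once removes it, whence
  the case distinction.\<close>

lemma Xiop_annihilated:
 fixes x :: "('m::finite, 'a) loc"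
 assumes "fielded x" "hom fdeg (int p) x" "p \<le> CARD('m)"
 shows "\<exists>cs. 0 \<notin> set cs \<and> salg.prodop Xiop cs (if p = CARD('m) then Xiop x else x) = 0"
proof -
 have L: "salg.linop (Xiop :: ('m, 'a) loc \<Rightarrow> _)" by (simp add: linop_lin lin_Xiop)
 let ?y = "\<lambda>x :: ('m, 'a) loc. if p = CARD('m) then Xiop x else x"
 let ?Q = "\<lambda>x :: ('m, 'a) loc. \<exists>cs. 0 \<notin> set cs \<and> salg.prodop Xiop cs (?y x) = 0"
 have 0: "?Q 0" by (intro exI[of _ "[]"]) (simp add: lin_simps[OF lin_Xiop])
 have add: "?Q (x + y)" if Q: "?Q x" "?Q y" for x y
 proof -
  obtain cs ds where cs: "0 \<notin> set cs" "salg.prodop Xiop cs (?y x) = 0" and ds: "0 \<notin> set ds" "salg.prodop Xiop ds (?y y) = 0"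
   using Q by blast
  have "salg.prodop Xiop (cs @ ds) (?y x + ?y y) = 0" by (rule salg.prodop_add_kernel[OF L cs(2) ds(2)])
  moreover have "?y x + ?y y = ?y (x + y)" by (simp add: lin_simps[OF lin_Xiop])
  ultimately show ?thesis using cs(1) ds(1) by (intro exI[of _ "cs @ ds"]) auto
 qed
 have sum: "?Q (sum g I)" if "\<And>i. i \<in> I \<Longrightarrow> ?Q (g i)" for g :: "int \<Rightarrow> _" and I
  using that
 proof (induction I rule: infinite_finite_induct)
  case (insert i I)
  have "?Q (g i + sum g I)" by (rule add) (use insert in blast)+
  thus ?case unfolding sum.insert[OF insert.hyps] .
 next
  case (infinite I)
  show ?case unfolding sum.infinite[OF infinite.hyps] by (rule 0)
 next
  case empty
  show ?case unfolding sum.empty by (rule 0)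
 qed
 \<comment> \<open>On a piece homogeneous in the fields and in form degree, \<open>Xiop\<close> and
   \<open>Theta\<close> differ by the constant \<open>?c\<close>, so the roots of
   \<open>Theta\<close> are translated by it.\<close>
 have piece: "?Q z" if N: "N > 0" "hom fldeg N z" and k: "hom order_weight (int k) z" and p: "hom fdeg (int p) z" for N k z
 proof -
  let ?c = "of_int N * (of_nat CARD('m) - of_nat p) :: complex"
  let ?js = "map (\<lambda>j. of_int N * of_nat j) [0..<Suc k]"
  let ?S = "{y :: ('m, 'a) loc. hom fldeg N y \<and> hom fdeg (int p) y}"
  have T: "Theta y \<in> ?S" if "y \<in> ?S" for y
   using that unfolding Theta_def
   by (auto intro!: hom_sum hom_form_tderiv hom_form_low simp: hom_num[of fldeg] nfields_tderiv nfields_low smult_sum_right)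
  have sh: "sshift Theta d y \<in> ?S" if "y \<in> ?S" for d y
   using T[OF that] that by (auto simp: sshift_def intro: hom_diff hom_smult)
  have "Xiop y = Theta y + ?c *: y" if "y \<in> ?S" for y
   using that by (simp add: Xiop_eq hom_num algebra_simps)
  hence e: "salg.prodop Xiop (map ((+) ?c) ?js) y = salg.prodop Theta ?js y" if "y \<in> ?S" for y
   using that sh by (intro prodop_translate[of ?S]) auto
  have zS: "z \<in> ?S" using N p by simp
  have z: "salg.prodop Xiop (map ((+) ?c) ?js) z = 0"
   unfolding e[OF zS] by (rule Theta_annihilated[OF k N(2)])
  show ?thesis
  proof (cases "p = CARD('m)")
   case True
   have "map ((+) ?c) ?js = 0 # map ((+) ?c) (map (\<lambda>j. of_int N * of_nat (Suc j)) [0..<k])"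
    unfolding True by (simp add: upt_conv_Cons map_Suc_upt[symmetric] del: upt_Suc)
   hence "salg.prodop Xiop (map ((+) ?c) (map (\<lambda>j. of_int N * of_nat (Suc j)) [0..<k])) (Xiop z) = 0"
    using z by (simp add: sshift_def)
   moreover have "0 \<notin> set (map ((+) ?c) (map (\<lambda>j. of_int N * of_nat (Suc j)) [0..<k]))"
    using N(1) unfolding True by (auto simp del: of_nat_Suc)
   ultimately have "\<exists>cs. 0 \<notin> set cs \<and> salg.prodop Xiop cs (Xiop z) = 0" by blast
   thus ?thesis using True by simp
  next
   case False
   hence p': "p < CARD('m)" using assms(3) by simp
   have "?c + of_int N * of_nat j \<noteq> 0" for j
   proof -
    have "?c + of_int N * of_nat j = of_int (N * (int CARD('m) - int p + int j))"
     by (simp add: algebra_simps)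
    moreover have "N * (int CARD('m) - int p + int j) \<noteq> 0" using N(1) p' by simp
    ultimately show ?thesis by (metis of_int_eq_0_iff)
   qed
   hence "0 \<notin> set (map ((+) ?c) ?js)" by auto
   with z have "\<exists>cs. 0 \<notin> set cs \<and> salg.prodop Xiop cs z = 0" by blast
   thus ?thesis using False by simp
  qed
 qed
 have "?Q (gpart fldeg N x)" for N
 proof (cases "N > 0")
  case True
  let ?x = "gpart fldeg N x"
  let ?K = "wt order_weight ` supp ?x"
  have "?Q (gpart order_weight k ?x)" if "k \<in> ?K" for k
  proof -
   have "k \<ge> 0" using that by (auto intro!: wt_nonneg simp: order_weight_def split: symb.split)
   then obtain k' where k': "k = int k'" by (metis nonneg_int_cases)
   have "hom fldeg N (gpart order_weight k ?x)" "hom fdeg (int p) (gpart order_weight k ?x)"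
    using hom_comp[of fldeg N x] assms(2) unfolding gpart_def by (auto intro: hom_comp_other)
   thus ?thesis using hom_comp[of order_weight k ?x] True unfolding k' by (intro piece)
  qed
  hence "?Q (\<Sum>k\<in>?K. gpart order_weight k ?x)" by (rule sum)
  moreover have "(\<Sum>k\<in>?K. gpart order_weight k ?x) = ?x" by (rule sum_comp[symmetric]) auto
  ultimately show ?thesis by (simp only:)
 next
  case False
  have "gpart fldeg N x = 0"
  proof (cases "N = 0")
   case False
   thus ?thesis using \<open>\<not> N > 0\<close> by (intro hom_neg[OF _ _ hom_comp]) (auto simp: fldeg_def)
  qed (use assms(1) in \<open>simp add: fielded_def\<close>)
  show ?thesis unfolding \<open>gpart fldeg N x = 0\<close> by (rule 0)
 qed
 hence "?Q (\<Sum>N\<in>wt fldeg ` supp x. gpart fldeg N x)" by (rule sum)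
 moreover have "(\<Sum>N\<in>wt fldeg ` supp x. gpart fldeg N x) = x" by (rule sum_comp[symmetric]) auto
 ultimately show ?thesis by (simp only:)
qed

lemma self_neg: "x = - x \<Longrightarrow> x = (0 :: ('m, 'a) loc)"
proof (rule salg_eqI)
 fix m assume "x = - x"
 from arg_cong[OF this, of "\<lambda>z. coef z m"] show "coef x m = coef 0 m" by simp
qed

lemma dext_dext: "dext (dext x) = (0 :: ('m::finite, 'a) loc)"
proof (rule drv_zero_eq[OF drv_odd_square[OF drv_dext]])
 fix h :: "('m, 'a) symb"
 have "dext (dext (gen (Jet A a I S))) = (0 :: ('m, 'a) loc)" for A a I S
 proof -
  let ?t = "\<lambda>\<mu> \<nu>. gen (Dx \<mu>) * (gen (Dx \<nu>) * gen (Jet A a (add_mset \<mu> (add_mset \<nu> I)) S))"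
  have "dext (dext (gen (Jet A a I S))) = (\<Sum>\<mu> \<nu>. ?t \<mu> \<nu>)"
   by (simp add: dext_def drv_even_mult[OF drv_tderiv] sum_distrib_left)
  moreover have "?t \<mu> \<nu> = - ?t \<nu> \<mu>" for \<mu> \<nu>
  proof -
   have "gen (Dx \<mu>) * gen (Dx \<nu>) = - (gen (Dx \<nu>) * gen (Dx \<mu>) :: ('m, 'a) loc)"
    by (simp add: gen_odd_comm[of "Dx \<mu>" "gen _"])
   from arg_cong[OF this, of "\<lambda>z. z * gen (Jet A a (add_mset \<mu> (add_mset \<nu> I)) S)"]
   show ?thesis by (simp add: mult.assoc add_mset_commute)
  qed
  hence "(\<Sum>\<mu> \<nu>. ?t \<mu> \<nu>) = - (\<Sum>\<mu> \<nu>. ?t \<mu> \<nu>)"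
   unfolding sum_negf[symmetric] by (subst sum.swap) (intro sum.cong refl, metis)
  ultimately have "dext (dext (gen (Jet A a I S))) = - dext (dext (gen (Jet A a I S)))" by (simp only:)
  thus ?thesis by (rule self_neg)
 qed
 thus "dext (dext (gen h)) = 0" by (cases h) (simp_all add: dext_def[of "gen _"])
qed

lemma dext_Xiop: "dext (Xiop x) = Xiop (dext (x :: ('m::finite, 'a) loc))"
 by (simp add: Xiop_def dext_dext)

text \<open>On closed forms in \<open>S\<close> the operator \<open>Xiop\<close> is invertible and
  reduces to d after \<open>khop\<close>; the primitive inherits the properties that
  \<open>S\<close> encodes.\<close>

lemma poincare:
 fixes x :: "('m::finite, 'a) loc"
 assumes "fielded x" "hom fdeg (int p) x" "p < CARD('m)" "dext x = 0" "salg.inv_space Xiop S" "x \<in> S"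
 shows "\<exists>x'\<in>S. x = dext (khop x')"
proof -
 have L: "salg.linop (Xiop :: ('m, 'a) loc \<Rightarrow> _)" by (simp add: linop_lin lin_Xiop)
 obtain cs where cs: "0 \<notin> set cs" "salg.prodop Xiop cs x = 0" using Xiop_annihilated[OF assms(1,2)] assms(3) by auto
 have "salg.inv_space Xiop (S \<inter> {x. dext x = 0})"
  using assms(5) unfolding salg.inv_space_def by (auto simp: dext_Xiop lin_simps[OF lin_Xiop])
 from salg.shift_solve[OF L this cs(2,1)] assms(4,6) obtain x' where "x' \<in> S" "dext x' = 0" "Xiop x' = x"
  by (auto simp: sshift_def)
 thus ?thesis by (intro bexI[of _ x']) (auto simp: Xiop_def)
qed

lemma hom_form_top: "k > int CARD('m) \<Longrightarrow> hom fdeg k x \<Longrightarrow> x = (0 :: ('m::finite, 'a) loc)"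
proof -
 assume k: "k > int CARD('m)" and "hom fdeg k x"
 have "int (card S) \<noteq> k" for S :: "'m set"
  using k card_mono[of "UNIV :: 'm set" S] by auto
 hence "{S :: 'm set. int (card S) = k} = {}" by blast
 hence "gpart fdeg k x = 0" by (simp add: comp_form)
 thus "x = 0" using comp_hom[OF \<open>hom fdeg k x\<close>] by simp
qed

lemma dext_top: "hom fdeg (int CARD('m)) x \<Longrightarrow> dext x = (0 :: ('m::finite, 'a) loc)"
 using hom_form_dext[of "int CARD('m)" x] by (intro hom_form_top) auto

text \<open>Zero is at most a simple root in top degree, so the nilpotent part of the Fitting
  decomposition already lies in the kernel of \<open>Xiop\<close>. The other part is exact because
  top forms are closed.\<close>

lemma top_decomposition:
 fixes x :: "('m::finite, 'a) loc"
 assumes "fielded x" "hom fdeg (int CARD('m)) x" "salg.inv_space Xiop S" "x \<in> S"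
  and "\<And>y. y \<in> S \<Longrightarrow> hom fdeg (int CARD('m)) y"
 shows "\<exists>x0\<in>S. \<exists>x'\<in>S. x = x0 + dext (khop x') \<and> Xiop x0 = 0"
proof -
 have L: "salg.linop (Xiop :: ('m, 'a) loc \<Rightarrow> _)" by (simp add: linop_lin lin_Xiop)
 obtain cs where cs: "0 \<notin> set cs" "salg.prodop Xiop cs (Xiop x) = 0" using Xiop_annihilated[OF assms(1,2)] by auto
 hence "salg.prodop Xiop (0 # cs) x = 0" by (simp add: sshift_def)
 from salg.fitting[OF L assms(3) this assms(4)] obtain x0 x' where
  x: "x0 \<in> S" "x' \<in> S" "x = x0 + Xiop x'" "(Xiop ^^ count_list (0 # cs) 0) x0 = 0" by blast
 have "count_list (0 # cs) 0 = 1" using cs(1) by simp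
 hence "Xiop x0 = 0" using x(4) by simp
 moreover have "Xiop x' = dext (khop x')"
  using dext_top[OF assms(5)[OF x(2)]] by (simp add: Xiop_def)
 ultimately show ?thesis using x by metis
qed

lemma (in cvs) prodop_kernel:
 assumes "linop A" "prodop A cs x = 0" "0 \<notin> set cs" "A x = 0"
 shows "x = 0"
 using assms(2,3,4)
proof (induction cs arbitrary: x)
 case (Cons c cs)
 have "shift A c x = - (c *\<^sub>V x)" using Cons.prems by (simp add: shift_def)
 hence "prodop A cs (- (c *\<^sub>V x)) = 0" "A (- (c *\<^sub>V x)) = 0" "0 \<notin> set cs"
  using Cons.prems by (auto simp: linop_simps[OF assms(1)])
 from Cons.IH[OF this(1,3,2)] show ?case using Cons.prems by simp
qed simp

lemma fielded_gpart_dext: "gpart fldeg k (dext x) = dext (gpart fldeg k (x :: ('m::finite, 'a) loc))"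
proof -
 have "dext (gpart fldeg k x) = gpart fldeg (k + 0) (dext x)"
  by (rule lin_comp_comm[OF drv_lin[OF drv_dext]]; (auto simp: lin_comp_comm drv_lin drv_dext hom_num nfields_dext))
 thus ?thesis by simp
qed

lemma gpart_gpart_comm: "gpart w k (gpart v l x) = gpart v l (gpart w k x)"
 by (rule salg_eqI) simp

lemma fielded_compl [simp]: "fielded (x - gpart fldeg 0 x)"
 unfolding fielded_def by (rule salg_eqI) simp

text \<open>Complements \<open>top_decomposition\<close>: the kernel of \<open>Xiop\<close> meets
  the exact forms only in 0. A primitive of degree D - 1 is itself \<open>Xiop\<close> of some form,
  so an exact top form lies in the image of \<open>Xiop\<close>, which meets the kernel trivially as
  0 is a simple root.\<close>

lemma exact_top_zero:
 fixes x :: "('m::finite, 'a) loc"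
 assumes "fielded x" "hom fdeg (int CARD('m)) x" "Xiop x = 0" "x = dext \<eta>"
 shows "x = 0"
proof -
 have L: "salg.linop (Xiop :: ('m, 'a) loc \<Rightarrow> _)" by (simp add: linop_lin lin_Xiop)
 let ?p = "CARD('m) - 1"
 have p: "int CARD('m) = int ?p + 1" "?p < CARD('m)" using zero_less_card_finite[where 'a = 'm] by linarith+
 \<comment> \<open>The component of degree D - 1 without its field-independent part; as
   \<open>x\<close> is a top form without field-independent terms, its differential is still
   \<open>x\<close>.\<close>
 define \<zeta> where "\<zeta> = gpart fdeg (int ?p) (\<eta> - gpart fldeg 0 \<eta>)"
 have "fielded \<zeta>" using fielded_compl[of \<eta>] unfolding fielded_def \<zeta>_def
  by (subst gpart_gpart_comm) simp
 have h: "hom fdeg (int ?p) \<zeta>" unfolding \<zeta>_def by (rule hom_comp)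
 have "dext (\<eta> - gpart fldeg 0 \<eta>) = x"
  using assms(1,4) by (simp add: fielded_gpart_dext[symmetric] fielded_def)
 hence x: "dext \<zeta> = x"
  unfolding \<zeta>_def gpart_dext p(1)[symmetric] using comp_hom[OF assms(2)] by simp
 let ?S = "{y :: ('m, 'a) loc. fielded y \<and> hom fdeg (int ?p) y}"
 have hX: "hom fdeg k (Xiop y)" if "hom fdeg k y" for k and y :: "('m, 'a) loc"
 proof -
  have 1: "hom fdeg k (khop y)" if "hom fdeg (k + 1) y" for k and y :: "('m, 'a) loc"
  proof -
   have "hom fdeg (k + 1 - 1) (ix \<mu> y)" for \<mu> by (rule hom_form_ix[OF that])
   thus ?thesis unfolding khop_def by (intro hom_sum hom_form_low) simp
  qed
  have "hom fdeg (k - 1 + 1) (dext (khop y))" by (rule hom_form_dext, rule 1) (use that in simp)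
  thus ?thesis unfolding Xiop_def using 1[OF hom_form_dext[OF that]] by (auto intro: hom_add)
 qed
 have fX: "gpart fldeg 0 (Xiop y) = Xiop (gpart fldeg 0 y)" for y :: "('m, 'a) loc"
 proof -
  have "hom fldeg k (khop z)" if "hom fldeg k z" for k and z :: "('m, 'a) loc"
   using that by (simp add: khop_def hom_num nfields_low nfields_ix smult_sum_right)
  hence k: "gpart fldeg 0 (khop z) = khop (gpart fldeg 0 z)" for z :: "('m, 'a) loc"
   using lin_comp_comm[OF lin_khop, of fldeg 0 0 z] by simp
  show ?thesis by (simp add: Xiop_def k fielded_gpart_dext)
 qed
 have inv: "salg.inv_space Xiop ?S"
  unfolding salg.inv_space_def fielded_def
  by (auto simp: fX lin_simps[OF lin_Xiop] intro: hom_add hom_smult hX)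
 obtain cs where cs: "0 \<notin> set cs" "salg.prodop Xiop cs \<zeta> = 0"
  using Xiop_annihilated[OF \<open>fielded \<zeta>\<close> h] p(2) by (auto split: if_splits simp del: One_nat_def)
 from salg.shift_solve[OF L inv cs(2,1)] obtain \<zeta>' where z: "fielded \<zeta>'" "hom fdeg (int ?p) \<zeta>'" "Xiop \<zeta>' = \<zeta>"
  using \<open>fielded \<zeta>\<close> h by (auto simp: sshift_def)
 let ?y = "dext \<zeta>'"
 have xy: "x = Xiop ?y" unfolding dext_Xiop[symmetric] z(3) by (rule x[symmetric])
 have y: "fielded ?y" "hom fdeg (int CARD('m)) ?y"
  using z(1) hom_form_dext[OF z(2)] unfolding p(1)[symmetric] by (simp_all add: fielded_def fielded_gpart_dext)
 obtain ds where ds: "0 \<notin> set ds" "salg.prodop Xiop ds (Xiop ?y) = 0" using Xiop_annihilated[OF y] by auto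
 show ?thesis unfolding xy
  by (rule salg.prodop_kernel[OF L ds(2,1)]) (use assms(3) xy in simp)
qed

subsubsection \<open>Covariance of the homotopy\<close>

lemma low_susy: "low \<mu> (susy_comp \<nu> x) = susy_comp \<nu> (low \<mu> (x :: ('m::finite, 'a::finite) loc))"
proof -
 have "low \<mu> (susy_comp \<nu> x) - susy_comp \<nu> (low \<mu> x) = 0"
 proof (rule drv_zero_eq[OF drv_comm_even_odd[OF drv_low drv_susy]])
  fix h :: "('m, 'a) symb"
  have "low \<mu> (susy_comp \<nu> (gen (Jet A a I S))) = susy_comp \<nu> (low \<mu> (gen (Jet A a I S)))" for A and a :: 'a and I S
  proof (induction I)
   case empty
   show ?case
   proof (cases "\<nu> \<in> S")
    case False
    then obtain t where "susy_comp \<nu> (gen (Jet A a {#} S)) = t *: (gen (Jet A a {#} (insert \<nu> S)) :: ('m, 'a) loc)"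
     using susy_Jet by blast
    thus ?thesis by (simp add: low_Jet)
   qed (simp add: susy_Jet_in low_Jet)
  next
   case (add \<rho> I)
   have "low \<mu> (susy_comp \<nu> (tderiv \<rho> (gen (Jet A a I S)))) = susy_comp \<nu> (low \<mu> (tderiv \<rho> (gen (Jet A a I S))))"
    unfolding susy_tderiv low_tderiv by (simp add: add.IH susy_tderiv nfields_susy)
   thus ?case by simp
  qed
  thus "low \<mu> (susy_comp \<nu> (gen h)) - susy_comp \<nu> (low \<mu> (gen h)) = 0"
   by (cases h) simp_all
 qed
 thus ?thesis by simp
qed

lemma lor_nfields: "lorentz_op \<Lambda> (nfields x) = nfields (lorentz_op \<Lambda> (x :: ('m::finite, 'a::finite) loc))"
 by (rule lor_num[of _ 0 0]) (simp_all add: nfields_susy nfields_tderiv)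

lemma lor_low: "lorentz_op \<Lambda> (low \<mu> x) = low \<mu> (lorentz_op \<Lambda> x) + (\<Sum>\<nu>. of_real (\<Lambda> \<mu> \<nu>) *: low \<nu> (x :: ('m::finite, 'a::finite) loc))"
proof -
 have "(lorentz_op \<Lambda> (low \<mu> x) - low \<mu> (lorentz_op \<Lambda> x)) - (\<Sum>\<nu>. of_real (\<Lambda> \<mu> \<nu>) *: low \<nu> x) = 0"
 proof (rule drv_zero_jets[OF drv_diff[OF drv_comm_even_even[OF drv_lor drv_low] drv_sum[OF drv_smult[OF drv_low]]]])
  show "(lorentz_op \<Lambda> (low \<mu> (gen (Jet A a {#} {}))) - low \<mu> (lorentz_op \<Lambda> (gen (Jet A a {#} {})))) - (\<Sum>\<nu>. of_real (\<Lambda> \<mu> \<nu>) *: low \<nu> (gen (Jet A a {#} {}))) = (0 :: ('m, 'a) loc)" for A a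
   by (simp add: low_Jet)
  show "(lorentz_op \<Lambda> (low \<mu> (gen h)) - low \<mu> (lorentz_op \<Lambda> (gen h))) - (\<Sum>\<nu>. of_real (\<Lambda> \<mu> \<nu>) *: low \<nu> (gen h)) = 0" if "\<not> is_field h" for h :: "('m, 'a) symb"
   using that by (cases h) simp_all
 next
  fix \<rho> and x :: "('m, 'a) loc"
  assume "(lorentz_op \<Lambda> (low \<mu> x) - low \<mu> (lorentz_op \<Lambda> x)) - (\<Sum>\<nu>. of_real (\<Lambda> \<mu> \<nu>) *: low \<nu> x) = 0"
  from arg_cong[OF this, of "susy_comp \<rho>"]
  show "(lorentz_op \<Lambda> (low \<mu> (susy_comp \<rho> x)) - low \<mu> (lorentz_op \<Lambda> (susy_comp \<rho> x))) - (\<Sum>\<nu>. of_real (\<Lambda> \<mu> \<nu>) *: low \<nu> (susy_comp \<rho> x)) = 0"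
   by (simp add: low_susy lor_susy)
 next
  fix \<rho> and x :: "('m, 'a) loc"
  assume "(lorentz_op \<Lambda> (low \<mu> x) - low \<mu> (lorentz_op \<Lambda> x)) - (\<Sum>\<nu>. of_real (\<Lambda> \<mu> \<nu>) *: low \<nu> x) = 0"
  from arg_cong[OF this, of "tderiv \<rho>"]
  have e: "tderiv \<rho> (lorentz_op \<Lambda> (low \<mu> x)) = tderiv \<rho> (low \<mu> (lorentz_op \<Lambda> x)) + (\<Sum>\<nu>. of_real (\<Lambda> \<mu> \<nu>) *: tderiv \<rho> (low \<nu> x))"
   by (simp add: algebra_simps)
  have 1: "(\<Sum>\<nu>. of_real (\<Lambda> \<nu> \<rho>) *: low \<mu> (tderiv \<nu> x)) = (\<Sum>\<nu>. of_real (\<Lambda> \<nu> \<rho>) *: tderiv \<nu> (low \<mu> x)) + of_real (\<Lambda> \<mu> \<rho>) *: nfields x"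
  proof -
   have "of_real (\<Lambda> \<nu> \<rho>) *: low \<mu> (tderiv \<nu> x) = of_real (\<Lambda> \<nu> \<rho>) *: tderiv \<nu> (low \<mu> x) + (if \<nu> = \<mu> then of_real (\<Lambda> \<mu> \<rho>) *: nfields x else 0)" for \<nu>
    by (simp add: low_tderiv smult_dist)
   thus ?thesis by (simp add: sum.distrib sum.delta)
  qed
  have 2: "(\<Sum>\<nu>. of_real (\<Lambda> \<mu> \<nu>) *: low \<nu> (tderiv \<rho> x)) = (\<Sum>\<nu>. of_real (\<Lambda> \<mu> \<nu>) *: tderiv \<rho> (low \<nu> x)) + of_real (\<Lambda> \<mu> \<rho>) *: nfields x"
  proof -
   have "of_real (\<Lambda> \<mu> \<nu>) *: low \<nu> (tderiv \<rho> x) = of_real (\<Lambda> \<mu> \<nu>) *: tderiv \<rho> (low \<nu> x) + (if \<nu> = \<rho> then of_real (\<Lambda> \<mu> \<rho>) *: nfields x else 0)" for \<nu>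
    by (simp add: low_tderiv smult_dist)
   thus ?thesis by (simp add: sum.distrib sum.delta)
  qed
  have 3: "lorentz_op \<Lambda> (low \<mu> (tderiv \<rho> x)) = tderiv \<rho> (lorentz_op \<Lambda> (low \<mu> x)) - (\<Sum>\<nu>. of_real (\<Lambda> \<nu> \<rho>) *: tderiv \<nu> (low \<mu> x)) + (if \<mu> = \<rho> then nfields (lorentz_op \<Lambda> x) else 0)"
   by (simp add: low_tderiv lor_tderiv lor_nfields)
  have 4: "low \<mu> (lorentz_op \<Lambda> (tderiv \<rho> x)) = tderiv \<rho> (low \<mu> (lorentz_op \<Lambda> x)) + (if \<mu> = \<rho> then nfields (lorentz_op \<Lambda> x) else 0) - (\<Sum>\<nu>. of_real (\<Lambda> \<nu> \<rho>) *: low \<mu> (tderiv \<nu> x))"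
   unfolding lor_tderiv low_lin(5,6,2) low_tderiv[of \<mu> \<rho>] ..
  show "(lorentz_op \<Lambda> (low \<mu> (tderiv \<rho> x)) - low \<mu> (lorentz_op \<Lambda> (tderiv \<rho> x))) - (\<Sum>\<nu>. of_real (\<Lambda> \<mu> \<nu>) *: low \<nu> (tderiv \<rho> x)) = 0"
   unfolding 3 4 1 2 e by simp
 qed
 thus ?thesis by (simp add: algebra_simps)
qed

text \<open>The index of \<open>low\<close> transforms like that of \<open>dx\<close> and is
  contracted with the lower index of \<open>ix\<close>.\<close>

lemma lor_khop: "lorentz_op \<Lambda> (khop x) = khop (lorentz_op \<Lambda> (x :: ('m::finite, 'a::finite) loc))"
proof -
 have "(\<Sum>\<mu> \<nu>. of_real (\<Lambda> \<mu> \<nu>) *: low \<nu> (ix \<mu> x)) = (\<Sum>\<mu> \<nu>. of_real (\<Lambda> \<nu> \<mu>) *: low \<mu> (ix \<nu> x))"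
  by (rule sum.swap)
 thus ?thesis
  by (simp add: khop_def lor_low lor_ix sum.distrib sum_subtractf)
qed

lemma lor_Xiop: "lorentz_op \<Lambda> (Xiop x) = Xiop (lorentz_op \<Lambda> (x :: ('m::finite, 'a::finite) loc))"
 by (simp add: Xiop_def lor_dext lor_khop)

subsection \<open>Finitely supported matrices\<close>

text \<open>Operators on finite-dimensional spaces of polynomials become matrices indexed by
  monomials, which form an infinite type. Finite support takes the place of a finite index type; the
  price is a ring without unit, so local units are used (\<open>local_unit\<close>).\<close>

typedef 'k fmat = "{A :: 'k \<Rightarrow> 'k \<Rightarrow> complex. \<exists>K. finite K \<and> (\<forall>i j. A i j \<noteq> 0 \<longrightarrow> i \<in> K \<and> j \<in> K)}"
 by (rule exI[of _ "\<lambda>_ _. 0"]) auto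

setup_lifting type_definition_fmat

lift_definition ent :: "'k fmat \<Rightarrow> 'k \<Rightarrow> 'k \<Rightarrow> complex" is "\<lambda>A. A" .

lemma fmat_eqI: "(\<And>i j. ent A i j = ent B i j) \<Longrightarrow> A = B"
 by transfer auto

lemma ent_finite: "\<exists>K. finite K \<and> (\<forall>i j. ent A i j \<noteq> 0 \<longrightarrow> i \<in> K \<and> j \<in> K)"
 by transfer

definition dom_on :: "'k set \<Rightarrow> 'k fmat \<Rightarrow> bool"
 where "dom_on K A \<longleftrightarrow> finite K \<and> (\<forall>i j. ent A i j \<noteq> 0 \<longrightarrow> i \<in> K \<and> j \<in> K)"

lemma dom_on_ex: "\<exists>K. dom_on K A"
 using ent_finite[of A] unfolding dom_on_def .

lemma dom_on_mono: "dom_on K A \<Longrightarrow> K \<subseteq> M \<Longrightarrow> finite M \<Longrightarrow> dom_on M A"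
 unfolding dom_on_def by blast

lemma dom_on_ex2: "\<exists>K. dom_on K A \<and> dom_on K B"
 using dom_on_ex[of A] dom_on_ex[of B] by (metis dom_on_def dom_on_mono finite_UnI sup_ge1 sup_ge2)

instantiation fmat :: (type) ring
begin

lift_definition zero_fmat :: "'a fmat" is "\<lambda>_ _. 0" by auto

lift_definition plus_fmat :: "'a fmat \<Rightarrow> 'a fmat \<Rightarrow> 'a fmat" is "\<lambda>A B i j. A i j + B i j"
proof -
 fix A B :: "'a \<Rightarrow> 'a \<Rightarrow> complex"
 assume "\<exists>K. finite K \<and> (\<forall>i j. A i j \<noteq> 0 \<longrightarrow> i \<in> K \<and> j \<in> K)" "\<exists>K. finite K \<and> (\<forall>i j. B i j \<noteq> 0 \<longrightarrow> i \<in> K \<and> j \<in> K)"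
 then obtain K M where "finite K" "finite M" "\<forall>i j. A i j \<noteq> 0 \<longrightarrow> i \<in> K \<and> j \<in> K" "\<forall>i j. B i j \<noteq> 0 \<longrightarrow> i \<in> M \<and> j \<in> M"
  by blast
 thus "\<exists>K. finite K \<and> (\<forall>i j. A i j + B i j \<noteq> 0 \<longrightarrow> i \<in> K \<and> j \<in> K)"
  by (intro exI[of _ "K \<union> M"]) (metis Un_iff add.right_neutral finite_UnI)
qed

lift_definition uminus_fmat :: "'a fmat \<Rightarrow> 'a fmat" is "\<lambda>A i j. - A i j" by simp

definition minus_fmat :: "'a fmat \<Rightarrow> 'a fmat \<Rightarrow> 'a fmat" where "minus_fmat A B = A + - B"

lift_definition times_fmat :: "'a fmat \<Rightarrow> 'a fmat \<Rightarrow> 'a fmat" is "\<lambda>A B i j. \<Sum>k | A i k \<noteq> 0. A i k * B k j"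
proof -
 fix A B :: "'a \<Rightarrow> 'a \<Rightarrow> complex"
 assume "\<exists>K. finite K \<and> (\<forall>i j. A i j \<noteq> 0 \<longrightarrow> i \<in> K \<and> j \<in> K)" "\<exists>K. finite K \<and> (\<forall>i j. B i j \<noteq> 0 \<longrightarrow> i \<in> K \<and> j \<in> K)"
 then obtain K M where K: "finite K" "finite M" "\<forall>i j. A i j \<noteq> 0 \<longrightarrow> i \<in> K \<and> j \<in> K" "\<forall>i j. B i j \<noteq> 0 \<longrightarrow> i \<in> M \<and> j \<in> M"
  by blast
 have "i \<in> K \<and> j \<in> M" if "(\<Sum>k | A i k \<noteq> 0. A i k * B k j) \<noteq> 0" for i j
 proof -
  from that obtain k where "A i k * B k j \<noteq> 0" by (metis (mono_tags, lifting) sum.neutral)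
  thus ?thesis using K by auto
 qed
 thus "\<exists>K. finite K \<and> (\<forall>i j. (\<Sum>k | A i k \<noteq> 0. A i k * B k j) \<noteq> 0 \<longrightarrow> i \<in> K \<and> j \<in> K)"
  using K(1,2) by (intro exI[of _ "K \<union> M"]) auto
qed

lemma ent_mult: "dom_on K A \<or> dom_on K B \<Longrightarrow> ent (A * B) i j = (\<Sum>k\<in>K. ent A i k * ent B k j)"
proof -
 assume K: "dom_on K A \<or> dom_on K B"
 obtain M where M: "dom_on M A" using dom_on_ex by blast
 have "finite {k. ent A i k \<noteq> 0}" using M unfolding dom_on_def by (auto intro: finite_subset[of _ M])
 have "ent (A * B) i j = (\<Sum>k | ent A i k \<noteq> 0. ent A i k * ent B k j)" by transfer simp
 also have "\<dots> = (\<Sum>k\<in>M \<union> K. ent A i k * ent B k j)"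
  by (rule sum.mono_neutral_left) (use M K in \<open>auto simp: dom_on_def\<close>)
 also have "\<dots> = (\<Sum>k\<in>K. ent A i k * ent B k j)"
  by (rule sum.mono_neutral_right) (use M K in \<open>auto simp: dom_on_def\<close>)
 finally show ?thesis .
qed

lemma ent_simps [simp]: "ent (A + B) i j = ent A i j + ent B i j" "ent (- A) i j = - ent A i j"
 "ent (A - B) i j = ent A i j - ent B i j" "ent 0 i j = 0"
 unfolding minus_fmat_def by (transfer; simp)+

instance
proof
 fix A B C :: "'a fmat"
 obtain K where K: "dom_on K B" "dom_on K A" using dom_on_ex2 by blast
 obtain M where M: "dom_on M B" "dom_on M C" using dom_on_ex2 by blast
 show "A * B * C = A * (B * C)"
 proof (rule fmat_eqI)
  fix i j
  have "ent (A * B * C) i j = (\<Sum>l\<in>M. \<Sum>k\<in>K. ent A i k * ent B k l * ent C l j)"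
   using K M by (simp add: ent_mult[of M "A * B"] ent_mult[of K A] sum_distrib_right)
  also have "\<dots> = (\<Sum>k\<in>K. \<Sum>l\<in>M. ent A i k * ent B k l * ent C l j)" by (rule sum.swap)
  also have "\<dots> = ent (A * (B * C)) i j"
   using K M by (simp add: ent_mult[of K A] ent_mult[of M B] sum_distrib_left mult.assoc)
  finally show "ent (A * B * C) i j = ent (A * (B * C)) i j" .
 qed
 show "(A + B) * C = A * C + B * C"
  using M by (intro fmat_eqI) (simp add: ent_mult[of M] distrib_right sum.distrib)
 show "A * (B + C) = A * B + A * C"
  using K by (intro fmat_eqI) (simp add: ent_mult[of K A] distrib_left sum.distrib)
qed (auto intro!: fmat_eqI simp: minus_fmat_def)

end

lift_definition fscale :: "complex \<Rightarrow> 'k fmat \<Rightarrow> 'k fmat" (infixr "*\<^sub>F" 75) is "\<lambda>c A i j. c * A i j" by auto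

lemma ent_fscale [simp]: "ent (c *\<^sub>F A) i j = c * ent A i j" by transfer simp

lemma ent_sum: "ent (sum A I) i j = (\<Sum>x\<in>I. ent (A x) i j)"
 by (induction I rule: infinite_finite_induct) simp_all

lemma fscale_mult [simp]: "c *\<^sub>F A * B = c *\<^sub>F (A * B)" "A * c *\<^sub>F B = c *\<^sub>F (A * B)"
proof -
 obtain K where "dom_on K A" "dom_on K B" using dom_on_ex2 by blast
 thus "c *\<^sub>F A * B = c *\<^sub>F (A * B)" "A * c *\<^sub>F B = c *\<^sub>F (A * B)"
  by (auto intro!: fmat_eqI simp: ent_mult[of K] sum_distrib_left mult_ac)
qed

global_interpretation fm: cvs fscale
 by unfold_locales (auto intro!: fmat_eqI simp: algebra_simps)

definition tr :: "'k fmat \<Rightarrow> complex"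
 where "tr A = (\<Sum>i | ent A i i \<noteq> 0. ent A i i)"

lemma tr_on: "dom_on K A \<Longrightarrow> tr A = (\<Sum>i\<in>K. ent A i i)"
 unfolding tr_def by (rule sum.mono_neutral_left) (auto simp: dom_on_def)

lemma tr_simps [simp]: "tr (A + B) = tr A + tr B" "tr (c *\<^sub>F A) = c * tr A" "tr 0 = 0" "tr (- A) = - tr A" "tr (A - B) = tr A - tr B"
proof -
 have add: "tr (A + B) = tr A + tr B" for A B :: "'a fmat"
 proof -
  obtain K where K: "dom_on K A" "dom_on K B" using dom_on_ex2 by blast
  hence "dom_on K (A + B)" unfolding dom_on_def by (metis add.right_neutral ent_simps(1))
  thus ?thesis using K by (simp add: tr_on[of K] sum.distrib)
 qed
 have scale: "tr (c *\<^sub>F A) = c * tr A" for c and A :: "'a fmat"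
 proof -
  obtain K where K: "dom_on K A" using dom_on_ex by blast
  hence "dom_on K (c *\<^sub>F A)" unfolding dom_on_def by auto
  thus ?thesis using K by (simp add: tr_on[of K] sum_distrib_left)
 qed
 show "tr (A + B) = tr A + tr B" "tr (c *\<^sub>F A) = c * tr A" by (rule add scale)+
 show "tr 0 = 0" by (simp add: tr_def)
 show m: "tr (- A) = - tr A" for A :: "'a fmat" using add[of A "- A"] by (simp add: tr_def eq_neg_iff_add_eq_0 add.commute)
 show "tr (A - B) = tr A - tr B" using add[of A "- B"] m[of B] by simp
qed

lemma tr_sum: "tr (sum A I) = (\<Sum>i\<in>I. tr (A i))"
 by (induction I rule: infinite_finite_induct) simp_all

lemma dom_on_mult: "dom_on K A \<Longrightarrow> dom_on K B \<Longrightarrow> dom_on K (A * B)"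
 unfolding dom_on_def by (metis (no_types, lifting) dom_on_def ent_mult mult_eq_0_iff sum.neutral)

lemma tr_comm: "tr (A * B) = tr (B * A)"
proof -
 obtain K where K: "dom_on K A" "dom_on K B" using dom_on_ex2 by blast
 have "(\<Sum>i\<in>K. \<Sum>k\<in>K. ent A i k * ent B k i) = (\<Sum>k\<in>K. \<Sum>i\<in>K. ent A i k * ent B k i)" by (rule sum.swap)
 thus ?thesis
  using K by (simp add: tr_on[OF dom_on_mult[OF K]] tr_on[OF dom_on_mult[OF K(2,1)]] ent_mult[of K] mult.commute)
qed

section \<open>Matrix units, elimination and traces\<close>

lift_definition funit :: "'k \<Rightarrow> 'k \<Rightarrow> 'k fmat" is "\<lambda>p q i j. if i = p \<and> j = q then 1 else 0"
 by (metis finite.emptyI finite.insertI insertCI)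

lemma ent_funit: "ent (funit p q) i j = (if i = p \<and> j = q then 1 else 0)" by transfer simp

lemma ent_mult_funit: "ent (A * funit p q) i j = (if j = q then ent A i p else 0)"
  "ent (funit p q * A) i j = (if i = p then ent A q j else 0)"
proof -
 have "dom_on {p, q} (funit p q)" by (auto simp: dom_on_def ent_funit)
 thus "ent (A * funit p q) i j = (if j = q then ent A i p else 0)" "ent (funit p q * A) i j = (if i = p then ent A q j else 0)"
  by (auto simp: ent_mult[of "{p, q}"] ent_funit if_distrib if_distribR sum.delta cong: if_cong)
qed

lemma ent_sandwich: "ent (A * funit p q * B) i j = ent A i p * ent B q j"
proof -
 have d: "dom_on {p, q} (funit p q)" by (auto simp: dom_on_def ent_funit)
 have "ent (A * (funit p q * B)) i j = (\<Sum>k\<in>insert p (SOME K. dom_on K A). ent A i k * ent (funit p q * B) k j)"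
 proof (rule ent_mult, rule disjI1)
  have "dom_on (SOME K. dom_on K A) A" using dom_on_ex by (rule someI_ex)
  thus "dom_on (insert p (SOME K. dom_on K A)) A" by (auto simp: dom_on_def)
 qed
 moreover have "finite (SOME K. dom_on K A)" using someI_ex[OF dom_on_ex] unfolding dom_on_def by blast
 ultimately show ?thesis by (simp add: mult.assoc ent_mult_funit if_distrib cong: if_cong)
qed

lemma funit_sandwich: "funit p q * A * funit p q = ent A q p *\<^sub>F funit p q"
 by (rule fmat_eqI) (auto simp: ent_mult_funit ent_funit)

lemma tr_funit: "tr (funit p q * A) = ent A q p"
 by (auto simp: ent_mult_funit tr_def)

definition ncols :: "'k fmat \<Rightarrow> nat"
 where "ncols A = card {j. \<exists>i. ent A i j \<noteq> 0}"

text \<open>One step of Gaussian elimination with pivot (q, p): column p is cleared and no zero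
  column becomes nonzero. The number of nonzero columns is the measure in the two inductions
  below.\<close>

lemma ncols_eliminate:
 assumes "ent A q p \<noteq> 0"
 shows "ncols (A - (1 / ent A q p) *\<^sub>F (A * funit p q * A)) < ncols A"
proof -
 obtain K where K: "dom_on K A" using dom_on_ex by blast
 have fin: "finite {j. \<exists>i. ent A i j \<noteq> 0}" using K by (auto simp: dom_on_def intro: finite_subset[of _ K])
 let ?B = "A - (1 / ent A q p) *\<^sub>F (A * funit p q * A)"
 have B: "ent ?B i j = ent A i j - ent A i p * ent A q j / ent A q p" for i j
  by (simp add: ent_sandwich)
 have "{j. \<exists>i. ent ?B i j \<noteq> 0} \<subseteq> {j. \<exists>i. ent A i j \<noteq> 0} - {p}"
  unfolding B using assms by (auto; metis mult_zero_right div_0)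
 moreover have "p \<in> {j. \<exists>i. ent A i j \<noteq> 0}" using assms by auto
 ultimately show ?thesis unfolding ncols_def by (intro psubset_card_mono[OF fin]) blast
qed

lemma regular: "\<exists>Q. A * Q * A = (A :: 'k fmat)"
proof (induction "ncols A" arbitrary: A rule: less_induct)
 case less
 show ?case
 proof (cases "A = 0")
  case False
  then obtain q p where a: "ent A q p \<noteq> 0" by (metis ent_simps(4) fmat_eqI)
  let ?s = "1 / ent A q p" and ?u = "funit p q"
  let ?B = "A - ?s *\<^sub>F (A * ?u * A)"
  obtain Q where Q: "?B * Q * ?B = ?B" using less ncols_eliminate[OF a] by blast
  \<comment> \<open>With B = (1 - s A u) A = A (1 - s u A), this is the expansion of (1 - s u A) Q
    (1 - s A u) + s u, written out because there is no unit.\<close>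
  let ?P = "Q - ?s *\<^sub>F (?u * A * Q) - ?s *\<^sub>F (Q * A * ?u) + ?s *\<^sub>F (?s *\<^sub>F (?u * A * Q * A * ?u)) + ?s *\<^sub>F ?u"
  have "A * ?P * A = ?B * Q * ?B + ?s *\<^sub>F (A * ?u * A)"
   by (simp add: distrib_left distrib_right left_diff_distrib right_diff_distrib mult.assoc fm.scale_right_diff_distrib fm.scale_right_distrib)
  hence "A * ?P * A = A" unfolding Q by simp
  thus ?thesis by blast
 qed simp
qed

text \<open>Each elimination step splits off an idempotent of trace 1, so the trace counts the
  steps: it is the rank.\<close>

lemma tr_idempotent: "E * E = (E :: 'k fmat) \<Longrightarrow> \<exists>r. tr E = of_nat r \<and> (E \<noteq> 0 \<longrightarrow> r > 0)"
proof (induction "ncols E" arbitrary: E rule: less_induct)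
 case less
 show ?case
 proof (cases "E = 0")
  case False
  then obtain q p where a: "ent E q p \<noteq> 0" by (metis ent_simps(4) fmat_eqI)
  let ?s = "1 / ent E q p" and ?u = "funit p q"
  define P where "P = ?s *\<^sub>F (E * ?u * E)"
  have EP: "E * P = P" "P * E = P"
   using arg_cong[OF less(2), of "\<lambda>Z. ?s *\<^sub>F (Z * ?u * E)"] arg_cong[OF less(2), of "\<lambda>Z. ?s *\<^sub>F (E * ?u * Z)"]
   by (simp_all add: P_def mult.assoc)
  have "E * ?u * E * (E * ?u * E) = E * (?u * E * ?u) * E" using less(2) by (metis mult.assoc)
  hence "P * P = P" using a by (simp add: P_def funit_sandwich)
  hence "(E - P) * (E - P) = E - P" using EP less(2) by (simp add: left_diff_distrib right_diff_distrib)
  then obtain r where r: "tr (E - P) = of_nat r" using less(1) ncols_eliminate[OF a] unfolding P_def by blast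
  have "tr (E * (?u * E)) = tr (?u * E * E)" by (rule tr_comm)
  hence "tr P = 1" using a less(2) by (simp add: P_def mult.assoc tr_funit)
  hence "tr E = of_nat (Suc r)" using r by (simp add: algebra_simps)
  thus ?thesis by blast
 qed simp
qed

lemma fpow_mult: "((*) A ^^ k) (Y * Z) = ((*) A ^^ k) Y * (Z :: 'k fmat)"
 by (induction k) (simp_all add: mult.assoc)

text \<open>With A Q A = A, the matrix B = A A Q has the same trace as A by cyclicity, and its order
  of nilpotency is lower by one.\<close>

lemma tr_nilpotent: "((*) A ^^ k) A = 0 \<Longrightarrow> tr (A :: 'k fmat) = 0"
proof (induction k arbitrary: A)
 case (Suc k)
 obtain Q where Q: "A * Q * A = A" using regular by blast
 let ?B = "A * (A * Q)"
 have "((*) ?B ^^ j) (A * Y) = ((*) A ^^ j) (A * Y)" for j Y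
 proof (induction j)
  case (Suc j)
  have "\<exists>Z. ((*) A ^^ j) (A * Y) = A * Z" by (cases j) auto
  then obtain Z where Z: "((*) A ^^ j) (A * Y) = A * Z" by blast
  have "?B * (A * Z) = A * (A * Z)" using Q by (metis mult.assoc)
  thus ?case using Suc Z by simp
 qed simp
 hence "((*) ?B ^^ k) ?B = ((*) A ^^ k) (A * (A * Q))" by blast
 also have "\<dots> = ((*) A ^^ Suc k) A * Q" by (simp add: fpow_mult[symmetric] mult.assoc funpow_swap1)
 finally have "tr ?B = 0" using Suc by simp
 thus ?case using tr_comm[of A "A * Q"] Q by simp
qed simp

lemma dom_on_expand: "dom_on K A \<Longrightarrow> A = (\<Sum>p\<in>K. \<Sum>q\<in>K. ent A p q *\<^sub>F funit p q)"
proof (rule fmat_eqI)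
 fix i j assume K: "dom_on K A"
 have "ent (\<Sum>p\<in>K. \<Sum>q\<in>K. ent A p q *\<^sub>F funit p q) i j = (\<Sum>p\<in>K. \<Sum>q\<in>K. if p = i then if q = j then ent A p q else 0 else 0)"
  unfolding ent_sum by (intro sum.cong refl) (auto simp: ent_funit)
 also have "\<dots> = (\<Sum>p\<in>K. if p = i then (\<Sum>q\<in>K. if q = j then ent A p q else 0) else 0)"
  by (intro sum.cong refl) auto
 finally show "ent A i j = ent (\<Sum>p\<in>K. \<Sum>q\<in>K. ent A p q *\<^sub>F funit p q) i j"
  using K by (auto simp: dom_on_def)
qed

lemma local_unit: "\<exists>e K. e * e = e \<and> dom_on K e \<and> (\<forall>a. dom_on K (\<rho> a) \<and> e * \<rho> a = \<rho> a \<and> \<rho> a * e = (\<rho> a :: 'k fmat))"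
 for \<rho> :: "'a::finite \<Rightarrow> _"
proof -
 have "\<forall>a. \<exists>K. dom_on K (\<rho> a)" using dom_on_ex by blast
 then obtain K where K: "\<And>a. dom_on (K a) (\<rho> a)" by metis
 let ?K = "\<Union>a. K a" and ?e = "\<Sum>i\<in>(\<Union>a. K a). funit i i"
 have fin: "finite ?K" using K by (auto simp: dom_on_def)
 have d: "dom_on ?K (\<rho> a)" for a by (rule dom_on_mono[OF K _ fin]) blast
 have e: "ent ?e i j = (if i = j \<and> i \<in> ?K then 1 else 0)" for i j
 proof -
  have "ent ?e i j = (\<Sum>k\<in>?K. if k = i then if i = j then 1 else 0 else 0)"
   unfolding ent_sum by (intro sum.cong refl) (auto simp: ent_funit)
  thus ?thesis using fin by auto
 qed
 have de: "dom_on ?K ?e" unfolding dom_on_def e using fin by auto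
 have l: "?e * A = A" "A * ?e = A" if "dom_on ?K A" for A
 proof -
  have z: "i \<notin> ?K \<or> j \<notin> ?K \<Longrightarrow> ent A i j = 0" for i j using that unfolding dom_on_def by blast
  have "ent (?e * A) i j = (\<Sum>k\<in>?K. if k = i then ent A i j else 0)" for i j
   unfolding ent_mult[OF disjI1[OF de]] e by (intro sum.cong refl) auto
  thus "?e * A = A" using z by (intro fmat_eqI) (simp add: fin)
  have "ent (A * ?e) i j = (\<Sum>k\<in>?K. if k = j then ent A i j else 0)" for i j
   unfolding ent_mult[OF disjI2[OF de]] e by (intro sum.cong refl) auto
  thus "A * ?e = A" using z by (intro fmat_eqI) (simp add: fin)
 qed
 show ?thesis by (rule exI[of _ ?e], rule exI[of _ ?K]) (use de d l in blast)
qed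

section \<open>Spectral projections of a matrix\<close>

abbreviation "fshift \<equiv> fm.shift"
lemmas fshift_def = fm.shift_def

lemma linop_mult: "fm.linop ((*) X)" "fm.linop (\<lambda>Y. Y * X)" "fm.linop (\<lambda>Y. X * Y - Y * X)"
 by (auto simp: fm.linop_def algebra_simps)

lemma fshift_mult: "(fshift ((*) X) c ^^ k) (Y * Z) = (fshift ((*) X) c ^^ k) Y * Z"
 by (induction k) (simp_all add: fshift_def left_diff_distrib mult.assoc)

lemma fshift_mult_right: "(fshift (\<lambda>Y. Y * X) c ^^ k) (Y * Z) = Y * (fshift (\<lambda>Y. Y * X) c ^^ k) Z"
 by (induction k) (simp_all add: fshift_def right_diff_distrib mult.assoc)

lemma fshift_commute: "X * Y = Y * X \<Longrightarrow> (fshift (\<lambda>Y. Y * X) c ^^ k) Y = (fshift ((*) X) c ^^ k) Y"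
proof -
 assume 1: "X * Y = Y * X"
 have 2: "X * (fshift ((*) X) c ^^ k) Y = (fshift ((*) X) c ^^ k) Y * X" for k
 proof (induction k)
  case (Suc k)
  thus ?case
   by (simp add: fshift_def left_diff_distrib right_diff_distrib) (simp add: mult.assoc[symmetric])
 qed (simp add: 1)
 show ?thesis
 proof (induction k)
  case (Suc k)
  let ?Z = "(fshift ((*) X) c ^^ k) Y"
  have "fshift (\<lambda>Y. Y * X) c ?Z = fshift ((*) X) c ?Z" by (simp only: fshift_def[of _ _ ?Z] 2)
  thus ?case by (simp only: funpow.simps o_apply Suc)
 qed simp
qed

text \<open>Spectral decomposition of the local unit \<open>e\<close> under left multiplication by
  \<open>X\<close>. Components to different eigenvalues commute, so their product lies in two
  generalised eigenspaces and vanishes; multiplying the sum \<open>e\<close> by one component then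
  shows that it is idempotent.\<close>

lemma spectral_projections:
 fixes X e :: "'k fmat"
 assumes "e * e = e" "e * X = X" "X * e = X" "dom_on K e" "dom_on K X"
 shows "\<exists>E C k. finite C \<and> e = (\<Sum>c\<in>C. E c) \<and> (\<forall>c. (fshift ((*) X) c ^^ k c) (E c) = 0) \<and>
  (\<forall>c d. E c * E d = (if c = d then E c else 0)) \<and> (\<forall>c. e * E c = E c \<and> E c * e = E c) \<and>
  (\<forall>c Z. X * Z = Z * X \<longrightarrow> e * Z = Z * e \<longrightarrow> E c * Z = Z * E c)"
proof -
 \<comment> \<open>Polynomials in \<open>X\<close> commute with everything that commutes with
   \<open>X\<close> and \<open>e\<close>; stated as an invariant subspace, this property passes to
   the spectral components.\<close>
 let ?S = "{Y. e * Y = Y \<and> Y * e = Y \<and> (\<forall>Z. X * Z = Z * X \<longrightarrow> e * Z = Z * e \<longrightarrow> Y * Z = Z * Y)}"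
 have "e * (X * Y) = X * Y" for Y using assms(2) by (metis mult.assoc)
 moreover have "X * Y * Z = Z * (X * Y)" if "X * Z = Z * X" "Y * Z = Z * Y" for Y Z
  using that by (metis mult.assoc)
 ultimately have S: "fm.inv_space ((*) X) ?S"
  unfolding fm.inv_space_def by (auto simp: distrib_left distrib_right mult.assoc)
 have "((*) X ^^ i) e \<in> fm.span ((\<lambda>(p, q). funit p q) ` (K \<times> K))" for i
 proof -
  have "dom_on K (((*) X ^^ i) e)" by (induction i) (use assms in \<open>auto intro: dom_on_mult\<close>)
  from dom_on_expand[OF this] show ?thesis
   by (rule ssubst) (intro fm.span_sum fm.span_scale fm.span_base, auto)
 qed
 moreover have "finite K" using assms(4) by (simp add: dom_on_def)
 ultimately obtain cs where cs: "fm.prodop ((*) X) cs e = 0"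
  using fm.locally_finite_annihilated[OF linop_mult(1), of "(\<lambda>(p, q). funit p q) ` (K \<times> K)"] by blast
 have "e \<in> ?S" using assms(1) by auto
 from fm.spectral_decomposition[OF linop_mult(1) S cs this]
 obtain E where E: "\<And>c. E c \<in> ?S" "e = (\<Sum>c\<in>set cs. E c)" "\<And>c. (fshift ((*) X) c ^^ count_list cs c) (E c) = 0"
  by blast
 have X: "E c * X = X * E c" for c using E(1)[of c] assms(2,3) by simp
 have o: "E c * E d = 0" if "c \<noteq> d" for c d
 proof (rule fm.coprime_kernels[OF linop_mult(1) _ _ that])
  show "(fshift ((*) X) c ^^ count_list cs c) (E c * E d) = 0" by (simp add: fshift_mult E(3))
  have "E c * E d = E d * E c" using E(1)[of c] E(1)[of d] X[of d] by simp
  thus "(fshift ((*) X) d ^^ count_list cs d) (E c * E d) = 0" by (simp add: fshift_mult E(3))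
 qed
 have "E c * E c = E c" for c
 proof (cases "c \<in> set cs")
  case True
  have "E c = E c * e" using E(1)[of c] by simp
  also have "\<dots> = (\<Sum>d\<in>set cs. if d = c then E c * E c else 0)"
   unfolding E(2) sum_distrib_left by (intro sum.cong refl) (auto simp: o)
  finally show ?thesis using True by simp
 next
  case False
  hence "E c = 0" using E(3)[of c] by simp
  thus ?thesis by simp
 qed
 with o E show ?thesis
  by (intro exI[of _ E] exI[of _ "set cs"] exI[of _ "count_list cs"]) auto
qed

text \<open>For commuting operators every term in the expansion of (A - B)^(p + q) contains A^p or
  B^q.\<close>

lemma (in cvs) diff_nilpotent:
 assumes "linop A" "linop B" "\<And>y. A (B y) = B (A y)" "(A ^^ p) y = 0" "(B ^^ q) y = 0"
 shows "((\<lambda>y. A y - B y) ^^ (p + q)) y = 0"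
 using assms(4,5)
proof (induction "p + q" arbitrary: p q y)
 case 0
 have "((\<lambda>y. A y - B y) ^^ n) 0 = 0" for n by (induction n) (simp_all add: linop_simps(3)[OF assms(1)] linop_simps(3)[OF assms(2)])
 with 0 show ?case by simp
next
 case (Suc n)
 let ?D = "\<lambda>y. A y - B y"
 have D: "linop ?D" using assms(1,2) by (auto simp: linop_def algebra_simps)
 note DL = linop_simps[OF linop_funpow[OF D]]
 have cA: "(B ^^ k) (A y) = A ((B ^^ k) y)" "(A ^^ k) (B y) = B ((A ^^ k) y)" for k y
  by (induction k) (simp_all add: assms(3))
 show ?case
 proof (cases "p = 0 \<or> q = 0")
  case True
  hence "y = 0" using Suc.prems by auto
  thus ?thesis by (simp add: DL)
 next
  case False
  then obtain p' q' where pq: "p = Suc p'" "q = Suc q'" by (metis not0_implies_Suc)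
  have n: "n = p' + q" "n = p + q'" using Suc.hyps(2) pq by simp_all
  have "(B ^^ q) (A y) = 0" "(A ^^ p) (B y) = 0"
   using Suc.prems by (simp_all add: cA linop_simps(3)[OF assms(1)] linop_simps(3)[OF assms(2)])
  moreover have "(A ^^ p') (A y) = 0" "(B ^^ q') (B y) = 0"
   using Suc.prems pq by (simp_all add: funpow_swap1)
  ultimately have "(?D ^^ (p' + q)) (A y) = 0" "(?D ^^ (p + q')) (B y) = 0" using Suc.hyps(1) n by blast+
  hence "(?D ^^ n) (A y) = 0" "(?D ^^ n) (B y) = 0" by (simp_all only: n(1)[symmetric] n(2)[symmetric])
  moreover have "(?D ^^ (p + q)) y = (?D ^^ n) (A y - B y)" unfolding Suc.hyps(2)[symmetric] by (simp only: funpow_Suc_right o_apply)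
  ultimately show ?thesis by (simp add: DL)
 qed
qed

global_interpretation cv: cvs "(*s) :: complex \<Rightarrow> complex^'a::finite \<Rightarrow> _"
 by unfold_locales

lemma (in cvs) eigenvector:
 assumes "linop A" "prodop A cs x = 0" "x \<noteq> 0"
 shows "\<exists>c y. y \<noteq> 0 \<and> A y = c *\<^sub>V y"
 using assms(2,3)
proof (induction cs arbitrary: x)
 case (Cons c cs)
 show ?case
 proof (cases "shift A c x = 0")
  case True
  thus ?thesis using Cons.prems by (intro exI[of _ c] exI[of _ x]) (simp add: shift_def)
 qed (use Cons in auto)
qed simp

lemma cv_annihilated: "cv.linop A \<Longrightarrow> \<exists>cs. cv.prodop A cs (x :: complex^'a::finite) = 0"
proof (rule cv.locally_finite_annihilated)
 fix i
 have "(A ^^ i) x = (\<Sum>j. ((A ^^ i) x $ j) *s axis j 1)" by (simp add: basis_expansion)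
 thus "(A ^^ i) x \<in> vec.span (range (\<lambda>j. axis j 1))"
  by (rule ssubst) (intro vec.span_sum vec.span_scale vec.span_base, auto)
qed auto

subsection \<open>Representations of the gauge algebra\<close>

context gauge_algebra
begin

definition ad :: "complex^'a \<Rightarrow> complex^'a \<Rightarrow> complex^'a"
 where "ad x z = (\<chi> e. \<Sum>a b. x $ a * z $ b * f a b e)"

lemma ad_nth: "ad x z $ e = (\<Sum>a b. x $ a * z $ b * f a b e)"
 by (simp add: ad_def)

lemma linop_ad: "cv.linop (ad x)"
 by (auto simp: cv.linop_def ad_def vec_eq_iff algebra_simps sum.distrib sum_distrib_left)

lemma commutator_lie_elem: "commutator (lie_elem T (($) x)) (lie_elem T (($) z)) = lie_elem T (($) (ad x z))"
proof -
 have c: "(\<Sum>k. T a $ i $ k * T b $ k $ j - T b $ i $ k * T a $ k $ j) = (\<Sum>e. f a b e * T e $ i $ j)" for a b i j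
 proof -
  have "commutator (T a) (T b) $ i $ j = lie_elem T (f a b) $ i $ j" by (simp only: commutator_T)
  thus ?thesis by (simp add: commutator_def lie_elem_eq matrix_matrix_mult_def sum_subtractf)
 qed
 have "commutator (lie_elem T (($) x)) (lie_elem T (($) z)) $ i $ j = lie_elem T (($) (ad x z)) $ i $ j" for i j
 proof -
  have p: "(\<Sum>k. (\<Sum>a. x $ a * T a $ i $ k) * (\<Sum>b. z $ b * T b $ k $ j)) =
    (\<Sum>a b. x $ a * z $ b * (\<Sum>k. T a $ i $ k * T b $ k $ j))" for x z :: "complex^'a"
  proof -
   have "(\<Sum>k. (\<Sum>a. x $ a * T a $ i $ k) * (\<Sum>b. z $ b * T b $ k $ j)) =
    (\<Sum>k a b. x $ a * z $ b * (T a $ i $ k * T b $ k $ j))"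
    by (simp add: sum_product mult_ac)
   also have "\<dots> = (\<Sum>a k b. x $ a * z $ b * (T a $ i $ k * T b $ k $ j))" by (rule sum.swap)
   also have "\<dots> = (\<Sum>a b k. x $ a * z $ b * (T a $ i $ k * T b $ k $ j))" by (intro sum.cong refl sum.swap)
   finally show ?thesis by (simp add: sum_distrib_left)
  qed
  have "commutator (lie_elem T (($) x)) (lie_elem T (($) z)) $ i $ j =
   (\<Sum>a b. x $ a * z $ b * (\<Sum>k. T a $ i $ k * T b $ k $ j)) -
   (\<Sum>b a. z $ b * x $ a * (\<Sum>k. T b $ i $ k * T a $ k $ j))"
   by (simp add: commutator_def matrix_matrix_mult_def lie_elem_eq p)
  also have "(\<Sum>b a. z $ b * x $ a * (\<Sum>k. T b $ i $ k * T a $ k $ j)) =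
   (\<Sum>a b. x $ a * z $ b * (\<Sum>k. T b $ i $ k * T a $ k $ j))"
   by (rule trans[OF sum.swap]) (simp add: mult_ac)
  also have "(\<Sum>a b. x $ a * z $ b * (\<Sum>k. T a $ i $ k * T b $ k $ j)) - \<dots> =
   (\<Sum>a b e. x $ a * z $ b * f a b e * T e $ i $ j)"
   by (simp only: sum_subtractf[symmetric] right_diff_distrib[symmetric] c) (simp add: sum_distrib_left mult.assoc)
  also have "\<dots> = (\<Sum>a e b. x $ a * z $ b * f a b e * T e $ i $ j)" by (intro sum.cong refl sum.swap)
  also have "\<dots> = (\<Sum>e a b. x $ a * z $ b * f a b e * T e $ i $ j)" by (rule sum.swap)
  finally show ?thesis by (simp add: lie_elem_eq ad_nth sum_distrib_right)
 qed
 thus ?thesis by (simp add: vec_eq_iff)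
qed

text \<open>Simplicity of the matrix algebra, carried over to coordinate vectors by the injective
  map \<open>lie_elem T\<close>. It is applied to the centre, to an eigenspace and to the kernel of
  a representation.\<close>

lemma ideal_trivial:
 assumes "0 \<in> Z" "\<And>y z. y \<in> Z \<Longrightarrow> z \<in> Z \<Longrightarrow> y + z \<in> Z" "\<And>c z. z \<in> Z \<Longrightarrow> c *s z \<in> Z" "\<And>x z. z \<in> Z \<Longrightarrow> ad x z \<in> Z"
 shows "Z = {0} \<or> Z = UNIV"
proof -
 let ?l = "\<lambda>z. lie_elem T (($) z)"
 have inj: "inj ?l"
  by (rule injI) (metis (no_types, lifting) trace_elem_T vec_eq_iff)
 have l: "?l 0 = 0" "?l (y + z) = ?l y + ?l z" "?l (c *s z) = (\<chi> i j. c * ?l z $ i $ j)" for y z c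
  by (auto simp: vec_eq_iff lie_elem_eq algebra_simps sum.distrib sum_distrib_left)
 have r: "range (lie_elem T) = range ?l"
 proof -
  have "lie_elem T z = ?l (\<chi> a. z a)" for z by (simp add: lie_elem_def)
  thus ?thesis by (metis (mono_tags, lifting) UNIV_I image_eqI image_subset_iff subset_antisym)
 qed
 have "lie_ideal (?l ` Z) (range (lie_elem T))"
  unfolding lie_ideal_def r
 proof (intro conjI ballI allI)
  show "0 \<in> ?l ` Z" using assms(1) l(1) by force
  show "X + Y \<in> ?l ` Z" if "X \<in> ?l ` Z" "Y \<in> ?l ` Z" for X Y
   using that by (auto simp flip: l(2) intro!: imageI[of _ _ ?l] assms(2))
  show "(\<chi> i j. c * X $ i $ j) \<in> ?l ` Z" if "X \<in> ?l ` Z" for c X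
   using that by (auto simp flip: l(3) intro!: imageI[of _ _ ?l] assms(3))
  show "commutator X Y \<in> ?l ` Z" if "X \<in> range ?l" "Y \<in> ?l ` Z" for X Y
   using that by (auto simp: commutator_lie_elem intro!: assms(4))
 qed auto
 hence "?l ` Z = {0} \<or> ?l ` Z = range ?l"
  using simple unfolding simple_lie_basis_def r by blast
 thus ?thesis
 proof
  assume "?l ` Z = {0}"
  hence "?l ` Z = ?l ` {0}" by (simp add: l(1))
  thus ?thesis using inj by (simp only: inj_image_eq_iff) simp
 next
  assume "?l ` Z = range ?l"
  thus ?thesis using inj by (simp only: inj_image_eq_iff) simp
 qed
qed

lemma ad_axis: "ad (axis a 1) (axis b 1) $ e = f a b e"
proof -
 have "ad (axis a 1) (axis b 1) $ e = (\<Sum>a' b'. if b' = b then if a' = a then f a b e else 0 else 0)"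
  unfolding ad_nth by (intro sum.cong refl) (simp add: axis_def)
 thus ?thesis by simp
qed

lemma center_trivial: assumes "\<And>a e. (\<Sum>b. f a b e * z b) = 0" shows "z b = 0"
proof -
 let ?Z = "{z. \<forall>x. ad x z = 0}"
 have "?Z = {0} \<or> ?Z = UNIV"
  by (rule ideal_trivial) (simp_all add: cv.linop_simps[OF linop_ad])
 moreover have "?Z \<noteq> UNIV"
 proof
  assume "?Z = UNIV"
  hence "ad (axis a 1) (axis b 1) = 0" for a b by blast
  hence "f a b e = 0" for a b e by (simp add: ad_axis[symmetric])
  hence "commutator (T a) (T b) = 0" for a b by (simp add: commutator_T lie_elem_def vec_eq_iff)
  thus False using simple by (simp add: simple_lie_basis_def)
 qed
 moreover have "ad x (\<chi> b. z b) $ e = (\<Sum>a. x $ a * (\<Sum>b. f a b e * z b))" for x e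
  by (simp add: ad_nth sum_distrib_left mult_ac)
 hence "(\<chi> b. z b) \<in> ?Z" by (simp add: vec_eq_iff assms)
 ultimately have "(\<chi> b. z b) = 0" by blast
 thus ?thesis by (simp add: vec_eq_iff)
qed

text \<open>Schur's lemma for the adjoint representation: total antisymmetry of the structure
  constants turns an invariant form into an operator commuting with \<open>ad\<close>, whose
  eigenspaces are ideals. Over the complex numbers an eigenvector exists.\<close>

lemma schur_form:
 assumes inv: "\<And>c a b. (\<Sum>e. f c a e * M e b) + (\<Sum>e. f c b e * M a e) = 0"
 shows "\<exists>\<mu>. \<forall>a b. M a b = (if a = b then \<mu> else 0)"
proof -
 define H where "H z = (\<chi> a. \<Sum>b. M a b * z $ b)" for z :: "complex^'a"
 have H: "cv.linop H"
  by (auto simp: cv.linop_def H_def vec_eq_iff algebra_simps sum.distrib sum_distrib_left)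
 have comm: "H (ad x z) = ad x (H z)" for x z
 proof -
  have "H (ad x z) $ a = ad x (H z) $ a" for a
  proof -
   have "H (ad x z) $ a = (\<Sum>e c b. x $ c * z $ b * (f c b e * M a e))"
    by (simp add: H_def ad_nth sum_distrib_left mult_ac)
   also have "\<dots> = (\<Sum>c e b. x $ c * z $ b * (f c b e * M a e))" by (rule sum.swap)
   also have "\<dots> = (\<Sum>c b e. x $ c * z $ b * (f c b e * M a e))" by (intro sum.cong refl sum.swap)
   also have "\<dots> = (\<Sum>c b. x $ c * z $ b * (\<Sum>e. f c e a * M e b))"
   proof (intro sum.cong refl)
    fix c b
    have "(\<Sum>e. f c b e * M a e) = (\<Sum>e. f c e a * M e b)"
     using inv[of c a b] by (simp add: f_antisym'[of c a] sum_negf)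
    thus "(\<Sum>e. x $ c * z $ b * (f c b e * M a e)) = x $ c * z $ b * (\<Sum>e. f c e a * M e b)"
     by (simp add: sum_distrib_left[symmetric])
   qed
   also have "\<dots> = (\<Sum>c b e. x $ c * z $ b * (f c e a * M e b))" by (simp add: sum_distrib_left)
   also have "\<dots> = (\<Sum>c e b. x $ c * z $ b * (f c e a * M e b))" by (intro sum.cong refl sum.swap)
   finally show ?thesis by (simp add: H_def ad_nth sum_distrib_left mult_ac)
  qed
  thus ?thesis by (simp add: vec_eq_iff)
 qed
 have "axis undefined 1 \<noteq> (0 :: complex^'a)" by (simp add: axis_def vec_eq_iff)
 then obtain \<mu> y where y: "y \<noteq> 0" "H y = \<mu> *s y"
  using cv.eigenvector[OF H] cv_annihilated[OF H] by metis
 have "{z. H z = \<mu> *s z} = {0} \<or> {z. H z = \<mu> *s z} = UNIV"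
  by (rule ideal_trivial) (simp_all add: cv.linop_simps[OF H] comm cv.linop_simps[OF linop_ad] mult.commute)
 hence "H z = \<mu> *s z" for z using y by blast
 hence "H (axis b 1) $ a = (\<mu> *s axis b 1) $ a" for a b by metis
 thus ?thesis by (intro exI[of _ \<mu>]) (auto simp: H_def axis_def if_distrib cong: if_cong)
qed

definition rep :: "('a \<Rightarrow> 'k fmat) \<Rightarrow> bool"
 where "rep \<rho> \<longleftrightarrow> (\<forall>a b. \<rho> a * \<rho> b - \<rho> b * \<rho> a = (\<Sum>e. f a b e *\<^sub>F \<rho> e))"

definition rp :: "('a \<Rightarrow> 'k fmat) \<Rightarrow> complex^'a \<Rightarrow> 'k fmat"
 where "rp \<rho> z = (\<Sum>a. z $ a *\<^sub>F \<rho> a)"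

lemma rp_lin: "rp \<rho> (y + z) = rp \<rho> y + rp \<rho> z" "rp \<rho> (c *s z) = c *\<^sub>F rp \<rho> z" "rp \<rho> 0 = 0" "rp \<rho> (y - z) = rp \<rho> y - rp \<rho> z"
 by (simp_all add: rp_def fm.scale_left_distrib fm.scale_left_diff_distrib sum.distrib sum_subtractf fm.scale_sum_right)

lemma rp_axis [simp]: "rp \<rho> (axis a 1) = \<rho> a"
 by (simp add: rp_def axis_def if_distrib[of "\<lambda>c. c *\<^sub>F _"] cong: if_cong)

lemma rp_ad:
 assumes "rep \<rho>"
 shows "rp \<rho> (ad x z) = rp \<rho> x * rp \<rho> z - rp \<rho> z * rp \<rho> x"
proof -
 have "rp \<rho> x * rp \<rho> z = (\<Sum>a b. (x $ a * z $ b) *\<^sub>F (\<rho> a * \<rho> b))"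
  by (simp add: rp_def sum_product mult.commute)
 moreover have "rp \<rho> z * rp \<rho> x = (\<Sum>a b. (x $ a * z $ b) *\<^sub>F (\<rho> b * \<rho> a))"
  unfolding rp_def sum_product by (rule trans[OF sum.swap]) (simp add: mult.commute)
 ultimately have "rp \<rho> x * rp \<rho> z - rp \<rho> z * rp \<rho> x =
   (\<Sum>a b. (x $ a * z $ b) *\<^sub>F (\<Sum>e. f a b e *\<^sub>F \<rho> e))"
  using assms by (simp add: sum_subtractf[symmetric] fm.scale_right_diff_distrib[symmetric] rep_def)
 also have "\<dots> = (\<Sum>a b e. (x $ a * z $ b * f a b e) *\<^sub>F \<rho> e)"
  by (simp add: fm.scale_sum_right)
 also have "\<dots> = (\<Sum>a e b. (x $ a * z $ b * f a b e) *\<^sub>F \<rho> e)" by (intro sum.cong refl sum.swap)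
 also have "\<dots> = (\<Sum>e a b. (x $ a * z $ b * f a b e) *\<^sub>F \<rho> e)" by (rule sum.swap)
 finally show ?thesis by (simp add: rp_def ad_nth fm.scale_sum_left)
qed

lemma rp_shift: "rep \<rho> \<Longrightarrow> rp \<rho> ((cv.shift (ad x) \<nu> ^^ k) z) = (fshift (\<lambda>Y. rp \<rho> x * Y - Y * rp \<rho> x) \<nu> ^^ k) (rp \<rho> z)"
 by (induction k) (simp_all add: cv.shift_def fshift_def rp_lin rp_ad)

text \<open>A variant of Cartan's criterion: \<open>t\<close> is the conjugate of the semisimple part of \<open>X\<close>, so that
 \<open>tr (t * X)\<close> is the sum of the squared moduli of the eigenvalues.\<close>

lemma nilpotent_criterion:
 fixes \<rho> :: "'a \<Rightarrow> 'k fmat"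
 assumes "rep \<rho>" and zero: "\<And>\<nu> k w z. \<nu> \<noteq> 0 \<Longrightarrow> (cv.shift (ad x) \<nu> ^^ k) w = 0 \<Longrightarrow> tr (rp \<rho> w * rp \<rho> z) = 0"
 shows "\<exists>k. ((*) (rp \<rho> x) ^^ k) (rp \<rho> x) = 0"
proof -
 let ?X = "rp \<rho> x"
 obtain e K where e: "e * e = e" "dom_on K e" "\<And>a. dom_on K (\<rho> a)" "\<And>a. e * \<rho> a = \<rho> a" "\<And>a. \<rho> a * e = \<rho> a"
  using local_unit[of \<rho>] by blast
 have eW: "e * rp \<rho> z = rp \<rho> z" "rp \<rho> z * e = rp \<rho> z" for z by (simp_all add: rp_def sum_distrib_left sum_distrib_right e)
 have dX: "dom_on K ?X" unfolding dom_on_def rp_def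
 proof (intro conjI allI impI)
  show "finite K" using e(2) by (simp add: dom_on_def)
  fix i j assume "ent (\<Sum>a. x $ a *\<^sub>F \<rho> a) i j \<noteq> 0"
  then obtain a where "ent (\<rho> a) i j \<noteq> 0" unfolding ent_sum by (metis (no_types, lifting) ent_fscale mult_eq_0_iff sum.neutral)
  thus "i \<in> K" "j \<in> K" using e(3)[of a] by (auto simp: dom_on_def)
 qed
 obtain E C k where E: "finite C" "e = (\<Sum>c\<in>C. E c)" "\<And>c. (fshift ((*) ?X) c ^^ k c) (E c) = 0"
  "\<And>c d. E c * E d = (if c = d then E c else 0)" "\<And>c. e * E c = E c" "\<And>c. E c * e = E c"
  "\<And>c Z. ?X * Z = Z * ?X \<Longrightarrow> e * Z = Z * e \<Longrightarrow> E c * Z = Z * E c"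
  using spectral_projections[OF e(1) eW(1,2) e(2) dX] by blast
 have EX: "E c * ?X = ?X * E c" for c by (rule E(7)) (simp_all add: eW)
 define t where "t = (\<Sum>c\<in>C. cnj c *\<^sub>F E c)"
 have t: "t * rp \<rho> w - rp \<rho> w * t = cnj \<nu> *\<^sub>F rp \<rho> w" if w: "(cv.shift (ad x) \<nu> ^^ m) w = 0" for \<nu> m w
 proof -
  let ?W = "rp \<rho> w"
  \<comment> \<open>The block of W between \<open>E c\<close> and \<open>E d\<close> has eigenvalue
    c - d under the commutator with X. If \<open>w\<close> has eigenvalue \<nu>, the block vanishes
    unless \<nu> = c - d, and then the conjugates agree as well.\<close>
  have P: "(cnj c - cnj d) *\<^sub>F (E c * ?W * E d) = cnj \<nu> *\<^sub>F (E c * ?W * E d)" for c d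
  proof (cases "\<nu> = c - d")
   case False
   let ?A = "\<lambda>Y. ?X * Y - Y * ?X"
   have "E c * ?W * E d = 0"
   proof (rule fm.coprime_kernels[OF linop_mult(3)[of ?X] _ _ False])
    have s: "fshift ?A \<nu> (E c * Y * E d) = E c * fshift ?A \<nu> Y * E d" for Y
    proof -
     have "?X * (E c * Y * E d) = E c * (?X * Y) * E d" using EX by (metis mult.assoc)
     moreover have "E c * Y * E d * ?X = E c * (Y * ?X) * E d" using EX by (metis mult.assoc)
     ultimately show ?thesis by (simp add: fshift_def left_diff_distrib right_diff_distrib)
    qed
    have "(fshift ?A \<nu> ^^ j) (E c * ?W * E d) = E c * (fshift ?A \<nu> ^^ j) ?W * E d" for j
     by (induction j) (simp_all add: s)
    thus "(fshift ?A \<nu> ^^ m) (E c * ?W * E d) = 0"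
     using rp_shift[OF assms(1), of m x \<nu> w] w by (simp add: rp_lin)
    have "((\<lambda>Y. fshift ((*) ?X) c Y - fshift (\<lambda>Y. Y * ?X) d Y) ^^ (k c + k d)) (E c * ?W * E d) = 0"
    proof (rule fm.diff_nilpotent)
     show "(fshift ((*) ?X) c ^^ k c) (E c * ?W * E d) = 0" by (simp add: fshift_mult E(3))
     show "(fshift (\<lambda>Y. Y * ?X) d ^^ k d) (E c * ?W * E d) = 0"
      by (simp only: fshift_mult_right fshift_commute[OF EX[symmetric]] E(3)) simp
     show "fm.linop (fshift ((*) ?X) c)" "fm.linop (fshift (\<lambda>Y. Y * ?X) d)" by (intro fm.linop_shift linop_mult)+
    qed (simp add: fshift_def algebra_simps fm.scale_right_diff_distrib)
    moreover have "(\<lambda>Y. fshift ((*) ?X) c Y - fshift (\<lambda>Y. Y * ?X) d Y) = fshift ?A (c - d)"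
     by (rule ext) (simp add: fshift_def algebra_simps)
    ultimately show "(fshift ?A (c - d) ^^ (k c + k d)) (E c * ?W * E d) = 0" by simp
   qed
   thus ?thesis by simp
  qed simp
  have "t * ?W = t * (?W * e)" by (simp add: eW)
  hence 1: "t * ?W = (\<Sum>c\<in>C. \<Sum>d\<in>C. cnj c *\<^sub>F (E c * ?W * E d))"
   unfolding E(2) t_def by (simp add: sum_distrib_left sum_distrib_right mult.assoc)
     (rule sum.swap)
  have "?W * t = e * ?W * t" by (simp add: eW)
  hence 2: "?W * t = (\<Sum>c\<in>C. \<Sum>d\<in>C. cnj d *\<^sub>F (E c * ?W * E d))"
   unfolding E(2) t_def
   by (simp add: sum_distrib_left sum_distrib_right fm.scale_sum_right) (subst sum.swap, simp)
  have "e * ?W * e = ?W" by (simp add: eW)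
  hence 3: "?W = (\<Sum>c\<in>C. \<Sum>d\<in>C. E c * ?W * E d)"
   unfolding E(2) by (simp add: sum_distrib_left sum_distrib_right) (subst (asm) sum.swap, simp)
  show ?thesis unfolding 1 2 by (subst 3)
   (simp add: sum_subtractf[symmetric] fm.scale_left_diff_distrib[symmetric] P fm.scale_sum_right)
 qed
 \<comment> \<open>Split \<open>y\<close> into generalised eigenvectors of \<open>ad x\<close>.
   Moving t across one of them yields the conjugate of its eigenvalue as a factor; if this factor is
   nonzero, the hypothesis makes the accompanying trace vanish.\<close>
 have br: "tr (t * rp \<rho> (ad y z)) = 0" for y z
 proof -
  let ?Y = "rp \<rho> y" and ?Z = "rp \<rho> z"
  obtain cs where "cv.prodop (ad x) cs y = 0" using cv_annihilated[OF linop_ad] by blast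
  moreover have "cv.inv_space (ad x) UNIV" by (simp add: cv.inv_space_def)
  ultimately obtain g where g: "y = (\<Sum>c\<in>set cs. g c)" "\<And>c. (cv.shift (ad x) c ^^ count_list cs c) (g c) = 0"
   using cv.spectral_decomposition[OF linop_ad, of x UNIV cs y] by auto
  have rg: "rp \<rho> (sum g I) = (\<Sum>c\<in>I. rp \<rho> (g c))" for I by (induction I rule: infinite_finite_induct) (simp_all add: rp_lin)
  have "tr (t * rp \<rho> (ad y z)) = tr (t * ?Y * ?Z) - tr (t * ?Z * ?Y)"
   by (simp add: rp_ad[OF assms(1)] right_diff_distrib mult.assoc)
  also have "tr (t * ?Z * ?Y) = tr (?Y * t * ?Z)" by (subst tr_comm) (simp add: mult.assoc)
  also have "tr (t * ?Y * ?Z) - tr (?Y * t * ?Z) = tr ((t * ?Y - ?Y * t) * ?Z)" by (simp add: left_diff_distrib)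
  also have "t * ?Y - ?Y * t = (\<Sum>c\<in>set cs. t * rp \<rho> (g c) - rp \<rho> (g c) * t)"
   unfolding g(1) rg by (simp add: sum_distrib_left sum_distrib_right sum_subtractf)
  also have "\<dots> = (\<Sum>c\<in>set cs. cnj c *\<^sub>F rp \<rho> (g c))" using t[OF g(2)] by simp
  also have "tr (\<dots> * ?Z) = (\<Sum>c\<in>set cs. cnj c * tr (rp \<rho> (g c) * ?Z))" by (simp add: sum_distrib_right tr_sum)
  also have "\<dots> = 0" using zero[OF _ g(2)] by (intro sum.neutral) auto
  finally show ?thesis .
 qed
 \<comment> \<open>A linear functional that vanishes on all commutators is zero: by total
   antisymmetry its coefficients form a central element.\<close>
 have "tr (t * \<rho> a) = 0" for a
 proof (rule center_trivial[where z = "\<lambda>a. tr (t * \<rho> a)"])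
  fix a b
  have "rp \<rho> (ad (axis a 1) (axis b 1)) = (\<Sum>e. f a b e *\<^sub>F \<rho> e)"
   using assms(1) by (simp add: rp_ad rep_def)
  with br[of "axis a 1" "axis b 1"] have "(\<Sum>e. f a b e * tr (t * \<rho> e)) = 0"
   by (simp add: sum_distrib_left tr_sum)
  thus "(\<Sum>e. f a e b * tr (t * \<rho> e)) = 0"
   by (simp add: f_antisym'[of a _ b] sum_negf)
 qed
 hence "tr (t * ?X) = 0" by (simp add: rp_def sum_distrib_left tr_sum)
 moreover have "tr (E c * ?X) = c * tr (E c)" for c
 proof -
  \<comment> \<open>On the range of \<open>E c\<close> the matrix X is c plus the nilpotent
    \<open>?N\<close>, whose trace is zero.\<close>
  let ?N = "fshift ((*) ?X) c (E c)"
  have "E c * (fshift ((*) ?X) c ^^ j) (E c) = (fshift ((*) ?X) c ^^ j) (E c)" for j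
  proof -
   have "E c * fshift ((*) ?X) c Y = fshift ((*) ?X) c (E c * Y)" for Y
    by (simp add: fshift_def right_diff_distrib mult.assoc[symmetric] EX)
   hence "E c * (fshift ((*) ?X) c ^^ j) Y = (fshift ((*) ?X) c ^^ j) (E c * Y)" for Y
    by (induction j) simp_all
   thus ?thesis by (simp add: E(4))
  qed
  hence N: "?N * (fshift ((*) ?X) c ^^ j) (E c) = fshift ((*) ?X) c ((fshift ((*) ?X) c ^^ j) (E c))" for j
   using fshift_mult[of 1 ?X c "E c" "(fshift ((*) ?X) c ^^ j) (E c)"] by simp
  have "((*) ?N ^^ j) ?N = (fshift ((*) ?X) c ^^ Suc j) (E c)" for j
  proof (induction j)
   case (Suc j)
   thus ?case using N[of "Suc j"] by (simp only: funpow.simps o_apply)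
  qed simp
  moreover have "(fshift ((*) ?X) c ^^ Suc (k c)) (E c) = 0" by (simp add: E(3) fshift_def)
  ultimately have "tr ?N = 0" using tr_nilpotent[of "k c" ?N] by simp
  thus ?thesis by (simp add: fshift_def EX)
 qed
 moreover obtain r where r: "\<And>c. tr (E c) = of_nat (r c)" "\<And>c. E c \<noteq> 0 \<Longrightarrow> r c > 0"
  using tr_idempotent[of "E _"] E(4) by (metis (no_types, lifting))
 ultimately have "(\<Sum>c\<in>C. cnj c * (c * of_nat (r c))) = 0"
  by (simp add: t_def sum_distrib_right tr_sum)
 moreover have "cnj c * (c * of_nat (r c)) = complex_of_real ((cmod c)\<^sup>2 * real (r c))" for c
  by (simp only: of_real_mult complex_norm_square of_real_of_nat_eq mult_ac)
 ultimately have "(\<Sum>c\<in>C. (cmod c)\<^sup>2 * real (r c)) = 0"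
  by (simp only: of_real_sum[symmetric] of_real_eq_0_iff)
 hence "\<forall>c\<in>C. (cmod c)\<^sup>2 * real (r c) = 0" using E(1) by (subst (asm) sum_nonneg_eq_0_iff) auto
 hence "E c = 0" if "c \<in> C" "c \<noteq> 0" for c using r(2)[of c] that by fastforce
 hence "(\<Sum>c\<in>C. E c) = (\<Sum>c\<in>C. if c = 0 then E 0 else 0)" by (intro sum.cong) auto
 hence "e = (if 0 \<in> C then E 0 else 0)" unfolding E(2) using E(1) by simp
 hence "((*) ?X ^^ k 0) e = 0"
  using E(3)[of 0] by (auto simp: fshift_def[abs_def] fm.linop_simps(3)[OF fm.linop_funpow[OF linop_mult(1)]])
 hence "((*) ?X ^^ k 0) (e * ?X) = 0" by (simp add: fpow_mult)
 thus ?thesis by (auto simp: eW)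
qed

end

section \<open>Nilpotency and the Casimir operator\<close>

lemma nilpotent_commutator:
 fixes X W :: "'k fmat"
 assumes "((*) X ^^ k) X = 0"
 shows "((\<lambda>Y. X * Y - Y * X) ^^ (Suc k + Suc k)) W = 0"
proof (rule fm.diff_nilpotent)
 have "((*) X ^^ Suc k) W = ((*) X ^^ k) X * W" by (simp only: funpow_Suc_right o_apply fpow_mult)
 thus "((*) X ^^ Suc k) W = 0" using assms by simp
 have c: "((*) X ^^ j) X * X = X * ((*) X ^^ j) X" for j
  by (induction j) (simp_all add: mult.assoc)
 have "((\<lambda>Y. Y * X) ^^ Suc j) W = W * ((*) X ^^ j) X" for j
 proof (induction j)
  case (Suc j)
  thus ?case by (simp add: mult.assoc c)
 qed simp
 thus "((\<lambda>Y. Y * X) ^^ Suc k) W = 0" using assms by simp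
qed (auto simp: linop_mult mult.assoc)

context gauge_algebra
begin

definition matrix_fmat :: "complex^'n^'n \<Rightarrow> 'n::finite fmat"
 where "matrix_fmat M = (\<Sum>i j. M $ i $ j *\<^sub>F funit i j)"

lemma ent_matrix_fmat: "ent (matrix_fmat M) i j = M $ i $ j"
proof -
 have "ent (matrix_fmat M) i j = (\<Sum>p q. if q = j then if p = i then M $ p $ q else 0 else 0)"
  unfolding matrix_fmat_def ent_sum by (intro sum.cong refl) (auto simp: ent_funit)
 thus ?thesis by simp
qed

lemma matrix_fmat_mult: "matrix_fmat A * matrix_fmat B = matrix_fmat (A ** B)"
 by (rule fmat_eqI) (simp add: ent_mult[of UNIV] dom_on_def ent_matrix_fmat matrix_matrix_mult_def)

lemma tr_matrix_fmat: "tr (matrix_fmat A) = trace A"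
 by (simp add: tr_on[of UNIV] dom_on_def ent_matrix_fmat trace_def)

lemma rep_T: "rep (\<lambda>a. matrix_fmat (T a))"
proof -
 have "T a ** T b - T b ** T a = lie_elem T (f a b)" for a b
  using commutator_T[of a b] by (simp add: commutator_def)
 hence "(T a ** T b - T b ** T a) $ i $ j = lie_elem T (f a b) $ i $ j" for a b i j by (simp only:)
 hence "(T a ** T b) $ i $ j - (T b ** T a) $ i $ j = (\<Sum>e. f a b e * T e $ i $ j)" for a b i j
  by (simp add: lie_elem_eq)
 thus ?thesis
  unfolding rep_def matrix_fmat_mult by (auto intro!: fmat_eqI simp: ent_matrix_fmat ent_sum)
qed

text \<open>Otherwise the trace condition of \<open>nilpotent_criterion\<close> would hold trivially
  in the defining representation, each \<open>T a\<close> would be nilpotent, and the trace of its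
  square would be 0 instead of 1.\<close>

lemma ad_not_nilpotent: "\<exists>x \<nu> w k. \<nu> \<noteq> 0 \<and> (cv.shift (ad x) \<nu> ^^ k) w = 0 \<and> w \<noteq> 0"
proof (rule ccontr)
 let ?\<tau> = "\<lambda>a. matrix_fmat (T a)"
 fix a :: 'a
 let ?N = "?\<tau> a"
 assume n: "\<not> ?thesis"
 have "tr (rp ?\<tau> w * rp ?\<tau> z) = 0" if "\<nu> \<noteq> 0" "(cv.shift (ad x) \<nu> ^^ k) w = 0" for x \<nu> k w z
 proof -
  have "w = 0" using n that by blast
  thus ?thesis by (simp add: rp_lin)
 qed
 hence "\<exists>k. ((*) (rp ?\<tau> (axis a 1)) ^^ k) (rp ?\<tau> (axis a 1)) = 0"
  by (intro nilpotent_criterion[OF rep_T])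
 then obtain k where k: "((*) ?N ^^ k) ?N = 0" by auto
 have "((*) (?N * ?N) ^^ j) (?N * ?N) = ((*) ?N ^^ j) (((*) ?N ^^ j) ?N) * ?N" for j
 proof (induction j)
  case (Suc j)
  have "((*) ?N ^^ j) (?N * Y) = ?N * ((*) ?N ^^ j) Y" for Y by (simp add: funpow_swap1)
  thus ?case using Suc by (simp add: mult.assoc)
 qed (simp add: mult.assoc)
 hence "((*) (?N * ?N) ^^ k) (?N * ?N) = 0"
  using k by (simp add: fm.linop_simps(3)[OF fm.linop_funpow[OF linop_mult(1)]])
 hence "tr (?N * ?N) = 0" by (rule tr_nilpotent)
 thus False by (simp add: matrix_fmat_mult tr_matrix_fmat trace_TT)
qed

abbreviation casimir :: "('a \<Rightarrow> 'k fmat) \<Rightarrow> 'k fmat" where "casimir \<rho> \<equiv> \<Sum>a. \<rho> a * \<rho> a"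

text \<open>By \<open>schur_form\<close> the trace form of the representation is a multiple \<mu> of
  the standard form, and a nilpotent Casimir has trace 0, so \<mu> = 0. Then all representing
  matrices are nilpotent by \<open>nilpotent_criterion\<close>, while a faithful representation
  would exhibit a nonzero eigenvalue of some \<open>ad x\<close>. So the kernel, an ideal, is
  everything.\<close>

lemma nilpotent_casimir:
 fixes \<rho> :: "'a \<Rightarrow> 'k fmat"
 assumes "rep \<rho>" "((*) (casimir \<rho>) ^^ k) (casimir \<rho>) = 0"
 shows "\<rho> a = 0"
proof -
 have br: "\<rho> c * \<rho> a = \<rho> a * \<rho> c + (\<Sum>e. f c a e *\<^sub>F \<rho> e)" for a c
  using assms(1) unfolding rep_def by (metis add.commute diff_eq_eq)
 have "(\<Sum>e. f c a e * tr (\<rho> e * \<rho> b)) + (\<Sum>e. f c b e * tr (\<rho> a * \<rho> e)) = 0" for c a b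
 proof -
  have "tr (\<rho> c * \<rho> a * \<rho> b) = tr (\<rho> a * (\<rho> c * \<rho> b)) + (\<Sum>e. f c a e * tr (\<rho> e * \<rho> b))"
   by (simp add: br[of c a] distrib_right sum_distrib_right tr_sum mult.assoc)
  moreover have "tr (\<rho> a * (\<rho> c * \<rho> b)) = tr (\<rho> a * \<rho> b * \<rho> c) + (\<Sum>e. f c b e * tr (\<rho> a * \<rho> e))"
   by (simp add: br[of c b] distrib_left sum_distrib_left tr_sum mult.assoc)
  moreover have "tr (\<rho> a * \<rho> b * \<rho> c) = tr (\<rho> c * \<rho> a * \<rho> b)" by (subst tr_comm) (simp add: mult.assoc)
  ultimately show ?thesis by (simp add: add.commute)
 qed
 from schur_form[of "\<lambda>a b. tr (\<rho> a * \<rho> b)", OF this]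
 obtain \<mu> where \<mu>: "tr (\<rho> a * \<rho> b) = (if a = b then \<mu> else 0)" for a b by blast
 have "tr (casimir \<rho>) = 0" using assms(2) by (rule tr_nilpotent)
 hence "of_nat CARD('a) * \<mu> = 0" by (simp add: tr_sum \<mu>)
 hence "\<mu> = 0" by simp
 hence "tr (\<rho> a * \<rho> b) = 0" for a b by (simp add: \<mu>)
 hence z: "tr (rp \<rho> w * rp \<rho> z) = 0" for w z
  by (simp add: rp_def sum_product tr_sum)
 have nil: "\<exists>k. ((*) (rp \<rho> x) ^^ k) (rp \<rho> x) = 0" for x
  by (rule nilpotent_criterion[OF assms(1)]) (rule z)
 have "{z. rp \<rho> z = 0} = {0} \<or> {z. rp \<rho> z = 0} = UNIV"
  by (rule ideal_trivial) (simp_all add: rp_lin rp_ad[OF assms(1)])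
 moreover have "{z. rp \<rho> z = 0} \<noteq> {0}"
 proof
  assume inj: "{z. rp \<rho> z = 0} = {0}"
  obtain x \<nu> w k where w: "\<nu> \<noteq> 0" "(cv.shift (ad x) \<nu> ^^ k) w = 0" "w \<noteq> 0" using ad_not_nilpotent by blast
  let ?A = "\<lambda>Y. rp \<rho> x * Y - Y * rp \<rho> x"
  obtain j where "((*) (rp \<rho> x) ^^ j) (rp \<rho> x) = 0" using nil by blast
  from nilpotent_commutator[OF this] have "(?A ^^ (Suc j + Suc j)) (rp \<rho> w) = 0" .
  moreover have "fshift ?A 0 = ?A" by (simp add: fshift_def fun_eq_iff)
  ultimately have 1: "(fshift ?A 0 ^^ (Suc j + Suc j)) (rp \<rho> w) = 0" by (simp only:)
  have 2: "(fshift ?A \<nu> ^^ k) (rp \<rho> w) = 0" using rp_shift[OF assms(1), of k x \<nu> w] w(2) by (simp add: rp_lin)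
  have "rp \<rho> w = 0" by (rule fm.coprime_kernels[OF linop_mult(3) 1 2]) (use w(1) in simp)
  thus False using inj w(3) by blast
 qed
 ultimately have "rp \<rho> (axis a 1) = 0" by blast
 thus ?thesis by simp
qed

lemma casimir_comm: assumes "rep \<rho>" shows "casimir \<rho> * \<rho> b = \<rho> b * casimir \<rho>"
proof -
 have "\<rho> b * (\<rho> a * \<rho> a) - \<rho> a * \<rho> a * \<rho> b = (\<Sum>e. f b a e *\<^sub>F (\<rho> e * \<rho> a + \<rho> a * \<rho> e))" for a
 proof -
  have "\<rho> b * (\<rho> a * \<rho> a) - \<rho> a * \<rho> a * \<rho> b = (\<rho> b * \<rho> a - \<rho> a * \<rho> b) * \<rho> a + \<rho> a * (\<rho> b * \<rho> a - \<rho> a * \<rho> b)"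
   by (simp add: left_diff_distrib right_diff_distrib mult.assoc)
  also have "\<rho> b * \<rho> a - \<rho> a * \<rho> b = (\<Sum>e. f b a e *\<^sub>F \<rho> e)" using assms by (simp add: rep_def)
  finally show ?thesis by (simp add: sum_distrib_left sum_distrib_right sum.distrib[symmetric] fm.scale_right_distrib)
 qed
 hence "\<rho> b * casimir \<rho> - casimir \<rho> * \<rho> b = (\<Sum>a e. f b a e *\<^sub>F (\<rho> e * \<rho> a + \<rho> a * \<rho> e))"
  by (simp add: sum_distrib_left sum_distrib_right sum_subtractf[symmetric])
 also have "\<dots> = (\<Sum>a e. f b a e *\<^sub>F (\<rho> e * \<rho> a)) + (\<Sum>a e. f b a e *\<^sub>F (\<rho> a * \<rho> e))"
  by (simp add: fm.scale_right_distrib sum.distrib)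
 also have "(\<Sum>a e. f b a e *\<^sub>F (\<rho> a * \<rho> e)) = (\<Sum>a e. f b e a *\<^sub>F (\<rho> e * \<rho> a))"
  by (rule sum.swap)
 also have "\<dots> = - (\<Sum>a e. f b a e *\<^sub>F (\<rho> e * \<rho> a))"
 proof -
  have "f b e a *\<^sub>F Z = - (f b a e *\<^sub>F Z)" for e a Z by (subst f_antisym') simp
  thus ?thesis unfolding sum_negf[symmetric] by (intro sum.cong refl)
 qed
 finally show ?thesis by simp
qed

text \<open>The generalised null space of the Casimir is a subrepresentation on which the Casimir is
  nilpotent, so the action there is trivial by \<open>nilpotent_casimir\<close>. The projections to
  nonzero eigenvalues annihilate \<open>Y\<close>.\<close>

lemma casimir_kernel:
 fixes \<rho> :: "'a \<Rightarrow> 'k fmat"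
 assumes "rep \<rho>" "((*) (casimir \<rho>) ^^ n) Y = 0"
 shows "\<rho> a * Y = 0"
proof -
 let ?X = "casimir \<rho>"
 obtain e K where e: "e * e = e" "dom_on K e" "\<And>a. dom_on K (\<rho> a)" "\<And>a. e * \<rho> a = \<rho> a" "\<And>a. \<rho> a * e = \<rho> a"
  using local_unit[of \<rho>] by blast
 have ra: "e * (\<rho> a * Z) = \<rho> a * Z" for a Z by (simp add: mult.assoc[symmetric] e)
 have eX: "e * ?X = ?X" "?X * e = ?X"
  by (simp_all add: sum_distrib_left sum_distrib_right mult.assoc ra e)
 have "dom_on K (\<rho> a * \<rho> a)" for a by (rule dom_on_mult[OF e(3) e(3)])
 hence dX: "dom_on K ?X"
  unfolding dom_on_def ent_sum using e(2) by (metis (no_types, lifting) dom_on_def sum.neutral)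
 obtain E C k where E: "finite C" "e = (\<Sum>c\<in>C. E c)" "\<And>c. (fshift ((*) ?X) c ^^ k c) (E c) = 0"
  "\<And>c d. E c * E d = (if c = d then E c else 0)" "\<And>c. e * E c = E c" "\<And>c. E c * e = E c"
  "\<And>c Z. ?X * Z = Z * ?X \<Longrightarrow> e * Z = Z * e \<Longrightarrow> E c * Z = Z * E c"
  using spectral_projections[OF e(1) eX e(2) dX] by blast
 have Er: "E c * \<rho> a = \<rho> a * E c" for c a by (rule E(7)) (simp_all add: casimir_comm[OF assms(1)] e)
 have EX: "E c * ?X = ?X * E c" for c by (rule E(7)) (simp_all add: eX)
 have s0: "fshift ((*) Z) 0 = (*) Z" for Z by (simp add: fshift_def fun_eq_iff)
 have E0: "E 0 * \<rho> a = 0" for a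
 proof (rule nilpotent_casimir)
  have m: "E 0 * \<rho> a * (E 0 * \<rho> b) = E 0 * (\<rho> a * \<rho> b)" for a b
  proof -
   have "E 0 * \<rho> a * (E 0 * \<rho> b) = E 0 * (\<rho> a * E 0) * \<rho> b" by (simp add: mult.assoc)
   also have "\<dots> = E 0 * E 0 * \<rho> a * \<rho> b" by (simp add: Er[symmetric] mult.assoc)
   finally show ?thesis by (simp add: E(4) mult.assoc)
  qed
  show "rep (\<lambda>a. E 0 * \<rho> a)"
   using assms(1) unfolding rep_def m by (simp add: right_diff_distrib[symmetric] sum_distrib_left)
  have c: "casimir (\<lambda>a. E 0 * \<rho> a) = E 0 * ?X" by (simp add: m sum_distrib_left)
  have "((*) (E 0 * ?X) ^^ j) (E 0 * ?X) = ((*) ?X ^^ j) (E 0 * ?X)" for j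
  proof (induction j)
   case (Suc j)
   have e1: "E 0 * (?X * Z) = ?X * (E 0 * Z)" for Z by (simp only: mult.assoc[symmetric] EX)
   have "E 0 * ((*) ?X ^^ j) (E 0 * Y) = ((*) ?X ^^ j) (E 0 * Y)" for Y
   proof (induction j)
    case 0
    have "E 0 * (E 0 * Y) = E 0 * E 0 * Y" by (simp only: mult.assoc)
    thus ?case by (simp add: E(4))
   qed (simp add: e1)
   hence "E 0 * ?X * ((*) ?X ^^ j) (E 0 * ?X) = ?X * ((*) ?X ^^ j) (E 0 * ?X)" by (simp only: mult.assoc e1)
   thus ?case using Suc by simp
  qed simp
  moreover have "((*) ?X ^^ k 0) (E 0 * ?X) = 0" using E(3)[of 0] unfolding s0 by (simp add: fpow_mult)
  ultimately show "((*) (casimir (\<lambda>a. E 0 * \<rho> a)) ^^ k 0) (casimir (\<lambda>a. E 0 * \<rho> a)) = 0"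
   unfolding c by simp
 qed
 have "E c * Y = 0" if "c \<noteq> 0" for c
 proof (rule fm.coprime_kernels[OF linop_mult(1)[of ?X] _ _ that])
  show "(fshift ((*) ?X) c ^^ k c) (E c * Y) = 0" by (simp add: fshift_mult E(3))
  have "((*) ?X ^^ j) (E c * Z) = E c * ((*) ?X ^^ j) Z" for j Z
   by (induction j) (simp_all add: mult.assoc[symmetric] EX)
  thus "(fshift ((*) ?X) 0 ^^ n) (E c * Y) = 0" unfolding s0 by (simp add: assms(2))
 qed
 hence "\<rho> a * (E c * Y) = 0" for c
 proof (cases "c = 0")
  case True
  thus ?thesis using E0[of a] Er[of 0 a] by (metis mult.assoc mult_zero_left)
 qed simp
 moreover have "\<rho> a * Y = (\<Sum>c\<in>C. \<rho> a * (E c * Y))"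
 proof -
  have "\<rho> a * Y = \<rho> a * (e * Y)" by (simp add: mult.assoc[symmetric] e)
  thus ?thesis unfolding E(2) by (simp add: sum_distrib_left sum_distrib_right)
 qed
 ultimately show ?thesis by simp
qed

text \<open>Carries the matrix statement over to operators on polynomials: the finite set
  \<open>B\<close> of monomials spans a stable space, and the operators become matrices indexed by
  monomials.\<close>

lemma casimir_kernel_salg:
 fixes r :: "'a \<Rightarrow> 'g::graded_generator salg \<Rightarrow> 'g salg"
 assumes lin: "\<And>a. lin (r a)" and B: "finite B" "\<And>a x. supp x \<subseteq> B \<Longrightarrow> supp (r a x) \<subseteq> B"
  and rep: "\<And>a b x. supp x \<subseteq> B \<Longrightarrow> r a (r b x) - r b (r a x) = (\<Sum>e. f a b e *: r e x)"
  and x: "supp x \<subseteq> B" "((\<lambda>x. \<Sum>a. r a (r a x)) ^^ n) x = 0"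
 shows "r a x = 0"
proof -
 define M where "M A = (\<Sum>p\<in>B. \<Sum>q\<in>B. coef (A (mon q)) p *\<^sub>F funit p q)" for A :: "'g salg \<Rightarrow> 'g salg"
 have entM: "ent (M A) p q = (if p \<in> B \<and> q \<in> B then coef (A (mon q)) p else 0)" for A p q
 proof -
  have "ent (M A) p q = (\<Sum>p'\<in>B. \<Sum>q'\<in>B. if q' = q then if p' = p then coef (A (mon q)) p else 0 else 0)"
   unfolding M_def ent_sum by (intro sum.cong refl) (auto simp: ent_funit)
  thus ?thesis using B(1) by (cases "q \<in> B") simp_all
 qed
 have dM: "dom_on B (M A)" for A using B(1) by (auto simp: dom_on_def entM)
 have expand: "y = (\<Sum>m\<in>B. coef y m *: mon m)" if "supp y \<subseteq> B" for y :: "'g salg"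
 proof -
  have "(\<Sum>m\<in>supp y. coef y m *: mon m) = (\<Sum>m\<in>B. coef y m *: mon m)"
   using that B(1) by (intro sum.mono_neutral_left) (auto simp: supp_iff)
  thus ?thesis using salg_expand[of y] by simp
 qed
 have sm: "supp (mon m) \<subseteq> B" if "m \<in> B" for m :: "'g multiset" using that by (auto simp: supp_iff coef_mon split: if_splits)
 have comp: "M (\<lambda>x. A (A' x)) = M A * M A'" if "lin A" "\<And>x. supp x \<subseteq> B \<Longrightarrow> supp (A' x) \<subseteq> B" for A A'
 proof (rule fmat_eqI)
  fix p q
  show "ent (M (\<lambda>x. A (A' x))) p q = ent (M A * M A') p q"
  proof (cases "p \<in> B \<and> q \<in> B")
   case True
   have "coef (A (A' (mon q))) p = coef (A (\<Sum>m\<in>B. coef (A' (mon q)) m *: mon m)) p"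
    using expand[OF that(2)[OF sm]] True by metis
   thus ?thesis using True
    by (simp add: entM ent_mult[OF disjI1[OF dM]] lin_simps[OF that(1)] mult.commute)
  qed (auto simp: entM ent_mult[OF disjI1[OF dM]])
 qed
 have Msum: "M (\<lambda>x. \<Sum>i\<in>I. A i x) = (\<Sum>i\<in>I. M (A i))" for I :: "'a set" and A
  by (rule fmat_eqI) (auto simp: entM ent_sum)
 have "M (r a) * M (r b) - M (r b) * M (r a) = (\<Sum>e. f a b e *\<^sub>F M (r e))" for a b
 proof (rule fmat_eqI)
  fix p q
  have "M (r a) * M (r b) - M (r b) * M (r a) = M (\<lambda>x. r a (r b x)) - M (\<lambda>x. r b (r a x))"
   by (simp only: comp[OF lin B(2)])
  thus "ent (M (r a) * M (r b) - M (r b) * M (r a)) p q = ent (\<Sum>e. f a b e *\<^sub>F M (r e)) p q"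
   using arg_cong[OF rep[OF sm, of q a b], of "\<lambda>y. coef y p"] by (auto simp: entM ent_sum)
 qed
 hence rep: "rep (\<lambda>a. M (r a))" by (simp add: rep_def)
 let ?C = "\<lambda>x. \<Sum>a. r a (r a x)"
 have C: "M ?C = casimir (\<lambda>a. M (r a))" by (simp only: Msum comp[OF lin B(2)])
 let ?Y = "M (\<lambda>y. coef y {#} *: x)"
 have linC: "lin ?C" by (intro lin_summ lin_comp[OF lin lin])
 have BC: "supp (?C y) \<subseteq> B" if "supp y \<subseteq> B" for y
 proof
  fix m assume "m \<in> supp (?C y)"
  then obtain a where "m \<in> supp (r a (r a y))" unfolding supp_iff coef_sum by (rule sum.not_neutral_contains_not_neutral)
  thus "m \<in> B" using B(2)[OF B(2)[OF that]] by blast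
 qed
 \<comment> \<open>The vector is repeated in every column belonging to \<open>B\<close>, so that
   applying an operator to it becomes left multiplication of matrices.\<close>
 define Y where "Y z = (\<Sum>p\<in>B. \<Sum>q\<in>B. coef z p *\<^sub>F funit p q)" for z :: "'g salg"
 have entY: "ent (Y z) p q = (if p \<in> B \<and> q \<in> B then coef z p else 0)" for z p q
 proof -
  have "ent (Y z) p q = (\<Sum>p'\<in>B. \<Sum>q'\<in>B. if q' = q then if p' = p then coef z p else 0 else 0)"
   unfolding Y_def ent_sum by (intro sum.cong refl) (auto simp: ent_funit)
  thus ?thesis using B(1) by (cases "q \<in> B") simp_all
 qed
 have act: "M A * Y z = Y (A z)" if "lin A" "supp z \<subseteq> B" for A z
 proof (rule fmat_eqI)
  fix p q
  have "coef (A z) p = coef (A (\<Sum>m\<in>B. coef z m *: mon m)) p" using expand[OF that(2)] by metis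
  thus "ent (M A * Y z) p q = ent (Y (A z)) p q"
   by (auto simp: entM entY ent_mult[OF disjI1[OF dM]] lin_simps[OF that(1)] mult.commute)
 qed
 have "((*) (M ?C) ^^ j) (Y x) = Y ((?C ^^ j) x) \<and> supp ((?C ^^ j) x) \<subseteq> B" for j
  by (induction j) (use x(1) BC act[OF linC] in auto)
 hence "((*) (casimir (\<lambda>a. M (r a))) ^^ n) (Y x) = Y 0" using x(2) unfolding C by metis
 also have "Y 0 = 0" by (simp add: Y_def)
 finally have "M (r a) * Y x = 0" by (rule casimir_kernel[OF rep])
 hence "Y (r a x) = 0" by (simp only: act[OF lin x(1)])
 hence z: "ent (Y (r a x)) p q = 0" for p q by simp
 have "coef (r a x) p = 0" for p
 proof (cases "p \<in> B")
  case True
  thus ?thesis using z[of p p] by (simp add: entY)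
 next
  case False
  hence "p \<notin> supp (r a x)" using B(2)[OF x(1)] by blast
  thus ?thesis by (simp add: supp_iff)
 qed
 thus ?thesis by (intro salg_eqI) simp
qed

text \<open>The nilpotent part of the Fitting decomposition of the Casimir consists of invariants,
  by \<open>casimir_kernel_salg\<close>.\<close>

lemma casimir_fitting:
 fixes r :: "'a \<Rightarrow> 'g::graded_generator salg \<Rightarrow> 'g salg"
 assumes lin: "\<And>a. lin (r a)" and B: "finite B" "\<And>a x. supp x \<subseteq> B \<Longrightarrow> supp (r a x) \<subseteq> B"
  and rep: "\<And>a b x. supp x \<subseteq> B \<Longrightarrow> r a (r b x) - r b (r a x) = (\<Sum>e. f a b e *: r e x)"
  and S: "salg.inv_space (\<lambda>x. \<Sum>a. r a (r a x)) S" "x \<in> S" "supp x \<subseteq> B"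
 shows "\<exists>x0\<in>S. \<exists>x'\<in>S. x = x0 + (\<Sum>a. r a (r a x')) \<and> (\<forall>a. r a x0 = 0)"
proof -
 let ?C = "\<lambda>x. \<Sum>a. r a (r a x)"
 have lC: "lin ?C" by (intro lin_summ lin_comp[OF lin lin])
 have sum: "supp (\<Sum>i\<in>I. g i) \<subseteq> B" if "\<And>i. i \<in> I \<Longrightarrow> supp (g i) \<subseteq> B" for g :: "'a \<Rightarrow> 'g salg" and I
 proof
  fix m assume "m \<in> supp (\<Sum>i\<in>I. g i)"
  then obtain i where "i \<in> I" "m \<in> supp (g i)" unfolding supp_iff coef_sum by (rule sum.not_neutral_contains_not_neutral)
  thus "m \<in> B" using that by blast
 qed
 have BC: "supp (?C y) \<subseteq> B" if "supp y \<subseteq> B" for y by (intro sum B(2) that)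
 have "supp y \<subseteq> B \<Longrightarrow> y \<in> salg.span (mon ` B)" for y
  by (subst salg_expand) (intro salg.span_sum salg.span_scale salg.span_base, auto)
 moreover have "supp ((?C ^^ i) x) \<subseteq> B" for i by (induction i) (use S(3) BC in auto)
 ultimately obtain cs where cs: "salg.prodop ?C cs x = 0"
  using salg.locally_finite_annihilated[of ?C "mon ` B" x] lC B(1) by (auto simp: linop_lin)
 have "supp (y + z) \<subseteq> supp y \<union> supp z" "supp (c *: y) \<subseteq> supp y" for c and y z :: "'g salg"
  by (auto simp: supp_iff)
 hence "supp (c *: y) \<subseteq> B" "supp z \<subseteq> B \<Longrightarrow> supp (y + z) \<subseteq> B" if "supp y \<subseteq> B" for c and y z :: "'g salg"
  using that by blast+
 hence "salg.inv_space ?C (S \<inter> {y. supp y \<subseteq> B})"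
  using salg.inv_spaceD[OF S(1)] BC unfolding salg.inv_space_def by simp
 from salg.fitting[OF _ this cs] S(2,3) lC obtain x0 x' where
  x: "x0 \<in> S" "supp x0 \<subseteq> B" "x' \<in> S" "x = x0 + ?C x'" "(?C ^^ count_list cs 0) x0 = 0"
  by (auto simp: linop_lin)
 have "r a x0 = 0" for a by (rule casimir_kernel_salg[OF lin B rep x(2,5)])
 thus ?thesis using x by blast
qed

end

subsection \<open>Ghost polynomials\<close>

abbreviation fld :: "ladder \<Rightarrow> 'a \<Rightarrow> ('m, 'a) symb" where "fld A a \<equiv> Jet A a {#} {}"

definition fw :: "ladder \<Rightarrow> ('m, 'a) symb \<Rightarrow> int"
 where "fw A g = (if g \<in> range (fld A) then 1 else 0)"

lemma fw_fld [simp]: "fw A (fld B a) = (if A = B then 1 else 0)" by (auto simp: fw_def)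

lemma hom_partial: "hom w k x \<Longrightarrow> l = k - w g \<Longrightarrow> hom w l (partial g x)"
 by (rule drv_hom[OF drv_partial, where w = w and s = "- w g" and k = k]) auto

lemma ghost_alg_cases:
 fixes g :: "('m::finite, 'a) symb"
 assumes "jdeg g = 0" obtains \<mu> where "g = Dx \<mu>" | A a where "g = fld A a"
 using that assms by (cases g) (auto simp: jdeg_0)

lemma fw_simps [simp]: "fw A (Dx \<mu>) = 0" by (auto simp: fw_def)

lemma ghost_alg_partial: "ghost_alg x \<Longrightarrow> ghost_alg (partial g x :: ('m::finite, 'a::finite) loc)"
 by (rule drv_over[OF drv_partial]) auto

lemma ghost_alg_gen_mult: "ghost_alg x \<Longrightarrow> ghost_alg (gen (fld A a) * x :: ('m::finite, 'a::finite) loc)"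
 by (rule over_gen_mult) (auto simp: jdeg_def)

lemma partial_gen_mult:
 "partial g (gen h * x) = (if h = g then x else 0) + sgo (is_odd g \<and> is_odd h) *: (gen h * partial g x)"
 by (simp add: drv_gen_mult[OF drv_partial])

lemma ipar: "drv True (partial (fld One a) :: ('m::finite, 'a) loc \<Rightarrow> _)"
 using drv_partial[of "fld One a :: ('m, 'a) symb"] by simp

lemma fld_parity: "is_odd (fld A a :: ('m, 'a) symb) = is_odd (fld A b :: ('m, 'a) symb)"
 by (rule is_odd_Jet_index)

lemma drv_fld_partial: "drv False (\<lambda>x :: ('m, 'a) loc. gen (fld A q) * partial (fld A p) x)"
 using drv_gen[OF drv_partial[of "fld A p :: ('m, 'a) symb"], of "fld A q"] by (simp add: fld_parity[of A p q])

lemma num_fw: "num (fw A) x = (\<Sum>p. gen (fld A p) * partial (fld A p) (x :: ('m::finite, 'a::finite) loc))"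
proof (rule drv_eq[OF drv_num drv_sum[OF drv_fld_partial]])
 fix h :: "('m, 'a) symb"
 have "(\<Sum>p. gen (fld A p) * partial (fld A p) (gen h)) = (\<Sum>p. if h = fld A p then gen h else (0 :: ('m, 'a) loc))"
  by (intro sum.cong) auto
 also have "\<dots> = of_int (fw A h) *: gen h"
 proof (cases "h \<in> range (fld A)")
  case True
  then obtain a where "h = fld A a" by blast
  thus ?thesis by simp
 qed (auto simp: fw_def intro!: sum.neutral)
 finally show "num (fw A) (gen h) = (\<Sum>p. gen (fld A p) * partial (fld A p) (gen h))" by simp
qed

text \<open>The gauge rotation acting on the zero-form of one ladder only. Rotations of c and of B_0
  are kept apart because \<open>D0\<close> does not commute with the latter alone
  (\<open>D0_rot_Two\<close>); their sum appears in \<open>cartan_formula\<close>.\<close>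

definition rot :: "('a::finite \<Rightarrow> complex^'N^'N) \<Rightarrow> ladder \<Rightarrow> 'a \<Rightarrow> ('m, 'a) loc \<Rightarrow> ('m, 'a) loc"
 where "rot T A e x = (\<Sum>p q. struct_const T e q p *: (gen (fld A q) * partial (fld A p) x))"

lemma drv_rot: "drv False (rot T A e :: ('m::finite, 'a::finite) loc \<Rightarrow> _)"
 unfolding rot_def by (intro drv_sum drv_smult drv_fld_partial)

lemmas rot_lin [simp] = drv_simps[OF drv_rot]

lemma rot_fld [simp]: "rot T A e (gen (fld B x)) = (if A = B then \<Sum>q. struct_const T e q x *: gen (fld A q) else (0 :: ('m::finite, 'a::finite) loc))"
proof -
 have "rot T A e (gen (fld B x)) = (\<Sum>p. if p = x then if A = B then \<Sum>q. struct_const T e q x *: gen (fld A q) else 0 else (0 :: ('m, 'a) loc))"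
  unfolding rot_def by (intro sum.cong) auto
 thus ?thesis by simp
qed

lemma rot_other: "g \<notin> range (fld A) \<Longrightarrow> rot T A e (gen g) = (0 :: ('m::finite, 'a::finite) loc)"
 unfolding rot_def by (auto intro!: sum.neutral)

lemma rot_Dx [simp]: "rot T A e (gen (Dx \<mu>)) = (0 :: ('m::finite, 'a::finite) loc)" by (rule rot_other) auto

lemma ghost_alg_rot: "ghost_alg x \<Longrightarrow> ghost_alg (rot T A e x :: ('m::finite, 'a::finite) loc)"
 unfolding rot_def by (intro over_sum over_smult ghost_alg_gen_mult ghost_alg_partial)

lemma hom_rot: "(\<And>p q. w (fld A p) = w (fld A q)) \<Longrightarrow> hom w k x \<Longrightarrow> hom w k (rot T A e (x :: ('m::finite, 'a::finite) loc))"
 unfolding rot_def by (intro hom_sum hom_smult) (rule hom_gen_mult[OF hom_partial[OF _ refl]], auto)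

lemma rot_hom_0: "hom (fw A) 0 x \<Longrightarrow> rot T A e x = (0 :: ('m::finite, 'a::finite) loc)"
proof -
 assume "hom (fw A) 0 x"
 hence "hom (fw A) (-1) (partial (fld A p) x)" for p by (rule hom_partial) simp
 hence "partial (fld A p) x = 0" for p by (rule hom_neg[rotated 2]) (simp_all add: fw_def)
 thus ?thesis by (simp add: rot_def)
qed

context gauge_algebra
begin

text \<open>On the generators \<open>rot T A e\<close> is minus the adjoint action, whence the sign;
  its negative is a representation (\<open>rot_rep\<close>).\<close>

lemma rot_rot: "rot T A a (rot T A b x) - rot T A b (rot T A a x) = - (\<Sum>e. f a b e *: rot T A e (x :: ('m::finite, 'a) loc))"
proof (rule drv_eq[OF drv_comm_even_even[OF drv_rot drv_rot] drv_neg[OF drv_sum[OF drv_smult[OF drv_rot]]]])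
 fix h :: "('m, 'a) symb"
 show "rot T A a (rot T A b (gen h)) - rot T A b (rot T A a (gen h)) = - (\<Sum>e. f a b e *: rot T A e (gen h))"
 proof (cases "h \<in> range (fld A)")
  case True
  then obtain d where h: "h = fld A d" by blast
  have 1: "rot T A a (rot T A b (gen h)) = (\<Sum>z. (\<Sum>y. f b y d * f a z y) *: gen (fld A z))" for a b
   unfolding h by (simp add: smult_sum_right smult_sum_left) (rule sum.swap)
  have 2: "(\<Sum>e. f a b e *: rot T A e (gen h)) = (\<Sum>z. (\<Sum>e. f a b e * f e z d) *: gen (fld A z))"
   unfolding h by (simp add: smult_sum_right smult_sum_left) (rule sum.swap)
  have "(\<Sum>y. f b y d * f a z y) = (\<Sum>y. f a y d * f b z y) - (\<Sum>e. f a b e * f e z d)" for z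
   using f_jacobi[of a b z d] by (simp add: mult.commute)
  thus ?thesis unfolding 1 2 by (simp add: smult_dist sum_subtractf)
 qed (simp add: rot_other)
qed

lemma rot_commute: "rot T One a (rot T Two b x) = rot T Two b (rot T One a (x :: ('m::finite, 'a) loc))"
proof -
 have "rot T One a (rot T Two b x) - rot T Two b (rot T One a x) = 0"
 proof (rule drv_zero_eq[OF drv_comm_even_even[OF drv_rot drv_rot]])
  fix h :: "('m, 'a) symb"
  show "rot T One a (rot T Two b (gen h)) - rot T Two b (rot T One a (gen h)) = 0"
   by (cases "h \<in> range (fld One) \<union> range (fld Two)") (auto simp: rot_other)
 qed
 thus ?thesis by simp
qed

text \<open>Cartan's formula of the Chevalley-Eilenberg complex with coefficients in the polynomials
  in B_0 and dx: contraction with a basis vector of the algebra is the derivative with respect to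
  c.\<close>

lemma cartan_formula:
 assumes "ghost_alg (x :: ('m::finite, 'a) loc)"
 shows "D0 T (partial (fld One e) x) + partial (fld One e) (D0 T x) = rot T One e x + rot T Two e x"
proof (rule drv_eq_over[OF drv_comm_odd_odd[OF drv_D0 ipar] drv_add[OF drv_rot drv_rot] _ assms])
 fix h :: "('m, 'a) symb"
 assume "h \<in> {g. jdeg g = 0}"
 hence "jdeg h = 0" by simp
 thus "D0 T (partial (fld One e) (gen h)) + partial (fld One e) (D0 T (gen h)) = rot T One e (gen h) + rot T Two e (gen h)"
 proof (cases rule: ghost_alg_cases)
  case (1 \<mu>)
  thus ?thesis by (simp add: D0_gen drv_simps[OF ipar])
 next
  case (2 A x)
  have c: "D0 T (partial (fld One e) (gen h)) = 0" by (simp add: drv_one[OF drv_D0])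
  have p: "partial (fld One e) (ghost a * gen (fld A b)) = (if a = e then gen (fld A b) else 0) - (if A = One \<and> b = e then ghost a else (0 :: ('m, 'a) loc))" for a b
   by (simp add: partial_gen_mult)
  have "partial (fld One e) (bracket T ghost (\<lambda>b. gen (fld A b)) x) =
   (\<Sum>a b. f a b x *: (if a = e then gen (fld A b) else 0)) - (\<Sum>a b. f a b x *: (if A = One \<and> b = e then ghost a else (0 :: ('m, 'a) loc)))"
   by (simp add: bracket_eq drv_simps[OF ipar] p smult_dist sum_subtractf)
  also have "(\<Sum>a b. f a b x *: (if a = e then gen (fld A b) else 0)) = (\<Sum>b. f e b x *: (gen (fld A b) :: ('m, 'a) loc))"
   by (rule trans[OF sum.swap]) (simp add: if_distrib[of "\<lambda>z. _ *: z"] cong: if_cong)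
  also have "(\<Sum>a b. f a b x *: (if A = One \<and> b = e then ghost a else 0)) = (if A = One then - (\<Sum>a. f e a x *: (ghost a :: ('m, 'a) loc)) else 0)"
  proof -
   have "(\<Sum>b. f a b x *: (if A = One \<and> b = e then ghost a else 0)) = (if A = One then - (f e a x *: (ghost a :: ('m, 'a) loc)) else 0)" for a
    using f_antisym[of a e x] by (simp add: if_distrib[of "\<lambda>z. _ *: z"] cong: if_cong)
   thus ?thesis by (simp add: sum_negf)
  qed
  finally have b: "partial (fld One e) (bracket T ghost (\<lambda>b. gen (fld A b)) x) = (\<Sum>b. f e b x *: (gen (fld A b) :: ('m, 'a) loc)) -
    (if A = One then - (\<Sum>a. f e a x *: ghost a) else 0)" .
  show ?thesis unfolding c unfolding 2 using b by (cases A) (simp_all add: drv_simps[OF ipar] two_smult)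
 qed
qed

lemma D0_rot_Two:
 assumes "ghost_alg (x :: ('m::finite, 'a) loc)"
 shows "D0 T (rot T Two e x) - rot T Two e (D0 T x) = - (\<Sum>a d. f a e d *: (ghost a * rot T Two d x))"
proof (rule drv_eq_over[OF drv_comm_odd_even[OF drv_D0 drv_rot] _ _ assms])
 have "drv True (\<lambda>x :: ('m, 'a) loc. ghost a * rot T Two d x)" for a d
  using drv_gen_odd[OF drv_rot, of "fld One a :: ('m, 'a) symb"] by simp
 thus "drv True (\<lambda>x :: ('m, 'a) loc. - (\<Sum>a d. f a e d *: (ghost a * rot T Two d x)))"
  by (intro drv_neg drv_sum drv_smult)
 fix h :: "('m, 'a) symb"
 assume "h \<in> {g. jdeg g = 0}"
 hence "jdeg h = 0" by simp
 thus "D0 T (rot T Two e (gen h)) - rot T Two e (D0 T (gen h)) = - (\<Sum>a d. f a e d *: (ghost a * rot T Two d (gen h)))"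
 proof (cases rule: ghost_alg_cases)
  case (1 \<mu>)
  thus ?thesis by (simp add: D0_gen)
 next
  case (2 A x)
  show ?thesis
  proof (cases A)
   case One
   have "rot T Two e (bracket T ghost ghost x) = (0 :: ('m, 'a) loc)"
    by (simp add: bracket_eq drv_even_mult[OF drv_rot])
   thus ?thesis unfolding 2 One by simp
  next
   case Two
   have 1: "D0 T (rot T Two e (gen h)) = (\<Sum>a y. (\<Sum>q. f e q x * f a y q) *: (ghost a * bfield y))"
   proof -
    have "D0 T (rot T Two e (gen h)) = (\<Sum>q a y. (f e q x * f a y q) *: (ghost a * bfield y))"
     unfolding 2 Two by (simp add: bracket_eq smult_sum_right)
    also have "\<dots> = (\<Sum>a q y. (f e q x * f a y q) *: (ghost a * bfield y))" by (rule sum.swap)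
    also have "\<dots> = (\<Sum>a y q. (f e q x * f a y q) *: (ghost a * bfield y))"
     by (rule sum.cong[OF refl], rule sum.swap)
    finally show ?thesis by (simp add: smult_sum_left)
   qed
   have 2: "rot T Two e (D0 T (gen h)) = (\<Sum>a y. (\<Sum>q. f a q x * f e y q) *: (ghost a * bfield y))"
   proof -
    have "rot T Two e (D0 T (gen h)) = (\<Sum>a q y. (f a q x * f e y q) *: (ghost a * bfield y))"
     unfolding 2 Two by (simp add: bracket_eq smult_sum_right drv_even_mult[OF drv_rot] sum_distrib_left)
    also have "\<dots> = (\<Sum>a y q. (f a q x * f e y q) *: (ghost a * bfield y))"
     by (rule sum.cong[OF refl], rule sum.swap)
    finally show ?thesis by (simp add: smult_sum_left)
   qed
   have 3: "(\<Sum>a d. f a e d *: (ghost a * rot T Two d (gen h))) = (\<Sum>a y. (\<Sum>d. f a e d * f d y x) *: (ghost a * bfield y))"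
   proof -
    have "(\<Sum>d. f a e d *: (ghost a * rot T Two d (gen h))) = (\<Sum>d y. (f a e d * f d y x) *: (ghost a * bfield y))" for a
     unfolding \<open>h = fld A x\<close> Two by (simp add: sum_distrib_left smult_sum_right)
    thus ?thesis by (simp add: smult_sum_left) (rule sum.cong[OF refl], rule sum.swap)
   qed
   have "(\<Sum>q. f e q x * f a y q) = (\<Sum>q. f a q x * f e y q) - (\<Sum>d. f a e d * f d y x)" for a y
    using f_jacobi[of a e y x] by (simp add: mult.commute)
   thus ?thesis unfolding 1 2 3 by (simp add: smult_dist sum_subtractf)
  qed
 qed
qed

text \<open>The failure of \<open>rot T Two e\<close> to commute with \<open>D0\<close> contributes
  terms that, by cyclicity of the structure constants, sum to the mixed product of the two rotations
  and cancel the one from Cartan's formula. Only the Casimir of B_0 is left.\<close>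

lemma casimir_homotopy_Two:
 assumes "ghost_alg (x :: ('m::finite, 'a) loc)" "D0 T x = 0"
 shows "D0 T (\<Sum>e. partial (fld One e) (rot T Two e x)) = (\<Sum>e. rot T Two e (rot T Two e x))"
proof -
 let ?\<iota> = "\<lambda>e. partial (fld One e) :: ('m, 'a) loc \<Rightarrow> _"
 note I = drv_simps[OF ipar]
 have "D0 T (?\<iota> e (rot T Two e x)) = rot T One e (rot T Two e x) + rot T Two e (rot T Two e x) - (\<Sum>a d. f a e d *: (ghost a * ?\<iota> e (rot T Two d x)))" for e
 proof -
  have "?\<iota> e (ghost a * y) = (if a = e then y else 0) - ghost a * ?\<iota> e y" for a y by (simp add: partial_gen_mult)
  hence "?\<iota> e (\<Sum>a d. f a e d *: (ghost a * rot T Two d x)) =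
    (\<Sum>a d. f a e d *: (if a = e then rot T Two d x else 0)) - (\<Sum>a d. f a e d *: (ghost a * ?\<iota> e (rot T Two d x)))"
   by (simp add: I smult_dist sum_subtractf)
  moreover have "(\<Sum>a d. f a e d *: (if a = e then rot T Two d x else 0)) = 0" by (intro sum.neutral ballI) auto
  moreover have "D0 T (rot T Two e x) = - (\<Sum>a d. f a e d *: (ghost a * rot T Two d x))"
   using D0_rot_Two[OF assms(1), of e] assms(2) by simp
  ultimately show ?thesis using cartan_formula[OF ghost_alg_rot[OF assms(1), of T Two e], of e] by (simp add: I eq_diff_eq)
 qed
 moreover have "(\<Sum>e a d. f a e d *: (ghost a * ?\<iota> e (rot T Two d x))) = (\<Sum>e. rot T One e (rot T Two e x))"
 proof -
  have "(\<Sum>e a d. f a e d *: (ghost a * ?\<iota> e (rot T Two d x))) = (\<Sum>e d a. f a e d *: (ghost a * ?\<iota> e (rot T Two d x)))"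
   by (rule sum.cong[OF refl], rule sum.swap)
  also have "\<dots> = (\<Sum>d e a. f a e d *: (ghost a * ?\<iota> e (rot T Two d x)))" by (rule sum.swap)
  finally show ?thesis by (simp add: rot_def[of _ One] f_cyclic[symmetric])
 qed
 ultimately show ?thesis by (simp add: sum.distrib sum_subtractf)
qed

text \<open>When B_0 is rotated trivially, Cartan's formula makes the rotation of c exact on
  cocycles; a second application gives the Casimir.\<close>

lemma casimir_homotopy_One:
 assumes "ghost_alg (x :: ('m::finite, 'a) loc)" "D0 T x = 0" "\<And>e. rot T Two e x = 0"
 shows "D0 T (\<Sum>e. partial (fld One e) (rot T One e x)) = (\<Sum>e. rot T One e (rot T One e x))"
proof -
 have "D0 T (rot T One e x) = 0" for e
 proof -
  have "rot T One e x = D0 T (partial (fld One e) x)" using cartan_formula[OF assms(1), of e] assms(2,3) by (simp add: drv_simps[OF ipar])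
  thus ?thesis by (simp add: D0_D0)
 qed
 hence "D0 T (partial (fld One e) (rot T One e x)) = rot T One e (rot T One e x)" for e
  using cartan_formula[OF ghost_alg_rot[OF assms(1), of T One e], of e] assms(3) by (simp add: rot_commute[symmetric] drv_simps[OF ipar])
 thus ?thesis by simp
qed

lemma wt_one: "wt (\<lambda>_. 1) m = int (size m)" by (induction m) simp_all

text \<open>A finite set of monomials whose span is stable under rotations; it serves as the
  \<open>B\<close> of \<open>casimir_fitting\<close>.\<close>

definition bounded_monomials :: "nat \<Rightarrow> ('m::finite, 'a) symb multiset set"
 where "bounded_monomials n = {m. set_mset m \<subseteq> {g. jdeg g = 0} \<and> size m \<le> n}"

lemma finite_bounded_monomials: "finite (bounded_monomials n :: ('m::finite, 'a) symb multiset set)"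
proof -
 let ?G = "{g :: ('m, 'a) symb. jdeg g = 0}"
 have "?G \<subseteq> range Dx \<union> range (fld One) \<union> range (fld Two)"
 proof
  fix g assume "g \<in> ?G"
  hence "jdeg g = 0" by simp
  thus "g \<in> range Dx \<union> range (fld One) \<union> range (fld Two)"
  proof (cases rule: ghost_alg_cases)
   case (2 A a)
   thus ?thesis by (cases A) auto
  qed auto
 qed
 hence "finite ?G" by (rule finite_subset) auto
 moreover have "bounded_monomials n \<subseteq> mset ` {xs. set xs \<subseteq> ?G \<and> length xs \<le> n}"
 proof
  fix m :: "('m, 'a) symb multiset" assume m: "m \<in> bounded_monomials n"
  obtain xs where "m = mset xs" using ex_mset by metis
  thus "m \<in> mset ` {xs. set xs \<subseteq> ?G \<and> length xs \<le> n}" using m by (auto simp: bounded_monomials_def)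
 qed
 ultimately show ?thesis using finite_lists_length_le finite_subset by blast
qed

lemma rot_bounded:
 assumes "supp (x :: ('m::finite, 'a) loc) \<subseteq> bounded_monomials n" shows "supp (rot T A e x) \<subseteq> bounded_monomials n"
proof
 fix m assume m: "m \<in> supp (rot T A e x)"
 have "ghost_alg x" using assms by (auto simp: over_def bounded_monomials_def)
 hence 1: "set_mset m \<subseteq> {g. jdeg g = 0}" using m ghost_alg_rot[of x T A e] by (auto simp: over_def)
 have "rot T A e (gpart (\<lambda>_. 1) (int (size m)) x) = gpart (\<lambda>_. 1) (int (size m)) (rot T A e x)"
  using lin_comp_comm[OF drv_lin[OF drv_rot[of T A e]], of "\<lambda>_. 1" 0 "int (size m)" x] by (simp add: hom_rot)
 moreover have "coef (gpart (\<lambda>_. 1) (int (size m)) (rot T A e x)) m \<noteq> 0" using m by (simp add: supp_iff wt_one)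
 ultimately have "gpart (\<lambda>_. 1) (int (size m)) x \<noteq> 0" by (metis coef_zero rot_lin(3))
 then obtain m' where "coef (gpart (\<lambda>_. 1) (int (size m)) x) m' \<noteq> 0" using salg_eqI[of "gpart (\<lambda>_. 1) (int (size m)) x" 0] by auto
 hence "m' \<in> supp x" "size m' = size m" by (auto simp: supp_iff wt_one split: if_splits)
 thus "m \<in> bounded_monomials n" using 1 assms by (auto simp: bounded_monomials_def)
qed

lemma ghost_alg_bounded: "ghost_alg x \<Longrightarrow> \<exists>n. supp (x :: ('m::finite, 'a) loc) \<subseteq> bounded_monomials n"
proof (intro exI subsetI)
 fix m assume "ghost_alg x" "m \<in> supp x"
 moreover have "size m \<le> Max (size ` supp x)" using \<open>m \<in> supp x\<close> by (intro Max_ge) auto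
 ultimately show "m \<in> bounded_monomials (Max (size ` supp x))" by (auto simp: over_def bounded_monomials_def)
qed

lemma rot_rep:
 "- rot T A a (- rot T A b x) - - rot T A b (- rot T A a x) = (\<Sum>e. f a b e *: - rot T A e (x :: ('m::finite, 'a) loc))"
 using rot_rot[of A a b x] by (simp add: sum_negf)

lemma neg_supp: "supp (- x) = supp x" by (auto simp: supp_iff)

lemma rot_fitting:
 assumes "ghost_alg (x :: ('m::finite, 'a) loc)" "salg.inv_space (\<lambda>x. \<Sum>a. rot T A a (rot T A a x)) S" "x \<in> S"
 shows "\<exists>x0\<in>S. \<exists>x'\<in>S. x = x0 + (\<Sum>a. rot T A a (rot T A a x')) \<and> (\<forall>a. rot T A a x0 = 0)"
proof -
 obtain n where n: "supp x \<subseteq> bounded_monomials n" using ghost_alg_bounded[OF assms(1)] by blast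
 have "\<exists>x0\<in>S. \<exists>x'\<in>S. x = x0 + (\<Sum>a. - rot T A a (- rot T A a x')) \<and> (\<forall>a. - rot T A a x0 = 0)"
  by (rule casimir_fitting[OF lin_neg[OF drv_lin[OF drv_rot]] finite_bounded_monomials[of n] _ rot_rep])
   (use n assms(2,3) rot_bounded in \<open>simp_all add: rot_lin neg_supp\<close>)
 thus ?thesis by simp
qed

lemma rot_kernel:
 assumes "ghost_alg (x :: ('m::finite, 'a) loc)" "((\<lambda>x. \<Sum>a. rot T A a (rot T A a x)) ^^ k) x = 0"
 shows "rot T A a x = 0"
proof -
 obtain n where n: "supp x \<subseteq> bounded_monomials n" using ghost_alg_bounded[OF assms(1)] by blast
 have "- rot T A a x = 0"
  by (rule casimir_kernel_salg[OF lin_neg[OF drv_lin[OF drv_rot]] finite_bounded_monomials[of n] _ rot_rep n, of A k])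
   (use assms(2) rot_bounded in \<open>simp_all add: rot_lin neg_supp\<close>)
 thus ?thesis by simp
qed

end

section \<open>Total degree and strict Lorentz invariance\<close>

definition tdeg :: "('m, 'a) symb \<Rightarrow> int"
 where "tdeg g = gh g + fdeg g"

text \<open>Invariance is strict here, not modulo total derivatives. With the empty set for
  \<open>\<Lambda>s\<close> only the degree is recorded.\<close>

definition good :: "('m::finite \<Rightarrow> 'm \<Rightarrow> real) set \<Rightarrow> int \<Rightarrow> ('m, 'a::finite) loc \<Rightarrow> bool"
 where "good \<Lambda>s k x \<longleftrightarrow> hom tdeg k x \<and> (\<forall>\<Lambda>\<in>\<Lambda>s. lorentz_op \<Lambda> x = 0)"

lemma good_lin:
 "good \<Lambda>s k 0" "good \<Lambda>s k x \<Longrightarrow> good \<Lambda>s k y \<Longrightarrow> good \<Lambda>s k (x + y)" "good \<Lambda>s k x \<Longrightarrow> good \<Lambda>s k y \<Longrightarrow> good \<Lambda>s k (x - y)"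
 "good \<Lambda>s k x \<Longrightarrow> good \<Lambda>s k (c *: x)" "good \<Lambda>s k x \<Longrightarrow> good \<Lambda>s k (- x)" "(\<And>i. i \<in> I \<Longrightarrow> good \<Lambda>s k (h i)) \<Longrightarrow> good \<Lambda>s k (\<Sum>i\<in>I. h i)"
 by (auto simp: good_def intro: hom_add hom_diff hom_smult hom_uminus hom_sum)

lemma lor_ghost_alg:
 assumes "ghost_alg (x :: ('m::finite, 'a::finite) loc)"
 shows "lorentz_op \<Lambda> x = (\<Sum>\<mu> \<nu>. of_real (\<Lambda> \<mu> \<nu>) *: (gen (Dx \<nu>) * ix \<mu> x))"
proof (rule drv_eq_over[OF drv_lor _ _ assms])
 show "drv False (\<lambda>x :: ('m, 'a) loc. \<Sum>\<mu> \<nu>. of_real (\<Lambda> \<mu> \<nu>) *: (gen (Dx \<nu>) * ix \<mu> x))"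
  by (intro drv_sum drv_smult drv_gen_odd[OF drv_ix, simplified]) simp
 fix h :: "('m, 'a) symb"
 assume "h \<in> {g. jdeg g = 0}"
 hence "jdeg h = 0" by simp
 thus "lorentz_op \<Lambda> (gen h) = (\<Sum>\<mu> \<nu>. of_real (\<Lambda> \<mu> \<nu>) *: (gen (Dx \<nu>) * ix \<mu> (gen h)))"
 proof (cases rule: ghost_alg_cases)
  case (1 \<rho>)
  have "(\<Sum>\<mu> \<nu>. of_real (\<Lambda> \<mu> \<nu>) *: (gen (Dx \<nu>) * ix \<mu> (gen h))) =
   (\<Sum>\<mu>. if \<mu> = \<rho> then \<Sum>\<nu>. of_real (\<Lambda> \<rho> \<nu>) *: gen (Dx \<nu>) else (0 :: ('m, 'a) loc))"
   unfolding 1 by (intro sum.cong refl) auto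
  thus ?thesis by (simp add: 1)
 qed simp
qed

lemma partial_comm_lor:
 assumes "ghost_alg (x :: ('m::finite, 'a::finite) loc)"
 shows "lorentz_op \<Lambda> (partial (fld A a) x) = partial (fld A a) (lorentz_op \<Lambda> x)"
proof -
 have "lorentz_op \<Lambda> (partial (fld A a) x) - partial (fld A a) (lorentz_op \<Lambda> x) = 0"
 proof (rule drv_zero_over[OF drv_comm_even[OF drv_lor drv_partial] _ assms])
  fix h :: "('m, 'a) symb"
  assume "h \<in> {g. jdeg g = 0}"
  hence "jdeg h = 0" by simp
  thus "lorentz_op \<Lambda> (partial (fld A a) (gen h)) - partial (fld A a) (lorentz_op \<Lambda> (gen h)) = 0"
   by (cases rule: ghost_alg_cases) (simp_all add: drv_one[OF drv_lor])
 qed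
 thus ?thesis by simp
qed

lemma lor_rot: "ghost_alg x \<Longrightarrow> lorentz_op \<Lambda> (rot T A e x) = rot T A e (lorentz_op \<Lambda> (x :: ('m::finite, 'a::finite) loc))"
 unfolding rot_def by (simp add: drv_even_mult[OF drv_lor] partial_comm_lor)

lemma good_rot: "ghost_alg x \<Longrightarrow> good \<Lambda>s k x \<Longrightarrow> good \<Lambda>s k (rot T A e (x :: ('m::finite, 'a::finite) loc))"
proof -
 have "tdeg (fld A p :: ('m, 'a) symb) = tdeg (fld A q :: ('m, 'a) symb)" for p q by (cases A) (simp_all add: tdeg_def)
 thus "ghost_alg x \<Longrightarrow> good \<Lambda>s k x \<Longrightarrow> good \<Lambda>s k (rot T A e x)"
  by (auto simp: good_def lor_rot intro: hom_rot)
qed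

lemma good_iota: "ghost_alg x \<Longrightarrow> good \<Lambda>s k x \<Longrightarrow> good \<Lambda>s (k - 1) (partial (fld One e) (x :: ('m::finite, 'a::finite) loc))"
 by (auto simp: good_def partial_comm_lor tdeg_def intro: hom_partial)

subsubsection \<open>Invariants of low degree\<close>

lemma euler_fw: "hom (fw A) k x \<Longrightarrow> (\<And>p. partial (fld A p) x = 0) \<Longrightarrow> k \<noteq> 0 \<Longrightarrow> x = (0 :: ('m::finite, 'a::finite) loc)"
 using num_fw[of A x] by (simp add: hom_num)

lemma fw_nonneg: "fw A g \<ge> 0" by (simp add: fw_def)
lemma fdeg_nonneg: "fdeg g \<ge> 0" by (simp add: fdeg_def)

lemma ghost_only:
 assumes "ghost_alg (x :: ('m::finite, 'a::finite) loc)" "hom (fw Two) 0 x" "hom fdeg 0 x"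
 shows "over (range (fld One)) x"
 unfolding over_def
proof (intro ballI subsetI)
 fix m g assume m: "m \<in> supp x" and g: "g \<in># m"
 have "over {g. fw Two g = 0} x" "over {g. fdeg g = 0} x"
  using assms(2,3) hom_nonneg_over[of "fw Two" x, OF fw_nonneg] hom_nonneg_over[of fdeg x, OF fdeg_nonneg] by simp_all
 hence "fw Two g = 0" "fdeg g = 0" "jdeg g = 0" using m g assms(1) by (auto simp: over_def)
 from this(3) this(1,2) show "g \<in> range (fld One)"
 proof (cases rule: ghost_alg_cases)
  case (2 A a)
  with \<open>fw Two g = 0\<close> show ?thesis by (cases A) auto
 qed simp
qed

context gauge_algebra
begin

lemma partial_rot: "partial (fld A x) (rot T A e y) = rot T A e (partial (fld A x) y) + (\<Sum>d. f e x d *: partial (fld A d) (y :: ('m::finite, 'a) loc))"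
proof -
 have "rot T A e (partial (fld A x) y) - partial (fld A x) (rot T A e y) = - (\<Sum>d. f e x d *: partial (fld A d) y)"
 proof (rule drv_eq[OF drv_comm_even[OF drv_rot drv_partial]])
  have "drv (is_odd (fld A x :: ('m, 'a) symb)) (partial (fld A d) :: ('m, 'a) loc \<Rightarrow> _)" for d
   unfolding fld_parity[of A x d] by (rule drv_partial)
  thus "drv (is_odd (fld A x :: ('m, 'a) symb)) (\<lambda>y :: ('m, 'a) loc. - (\<Sum>d. f e x d *: partial (fld A d) y))"
   by (intro drv_neg drv_sum drv_smult)
  fix h :: "('m, 'a) symb"
  show "rot T A e (partial (fld A x) (gen h)) - partial (fld A x) (rot T A e (gen h)) = - (\<Sum>d. f e x d *: partial (fld A d) (gen h))"
  proof (cases "h \<in> range (fld A)")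
   case True
   then obtain b where h: "h = fld A b" by blast
   have "(\<Sum>q. f e q b *: (if fld A q = fld A x then 1 else 0)) = (\<Sum>q. if q = x then f e x b *: (1 :: ('m, 'a) loc) else 0)"
    by (intro sum.cong) auto
   moreover have "(\<Sum>d. f e x d *: (if fld A b = fld A d then 1 else 0)) = (\<Sum>d. if d = b then f e x b *: (1 :: ('m, 'a) loc) else 0)"
    by (intro sum.cong) auto
   ultimately show ?thesis unfolding h by (simp add: drv_one[OF drv_rot])
  next
   case False
   hence "(if h = fld A d then 1 else 0) = (0 :: ('m, 'a) loc)" for d by auto
   with False show ?thesis by (simp add: rot_other)
  qed
 qed
 thus ?thesis by (simp add: algebra_simps)
qed

text \<open>The coefficients of a linear invariant form a central element of the algebra.\<close>

lemma degree_one_invariant: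
 assumes "hom (fw A) 1 (y :: ('m::finite, 'a) loc)" "\<And>e. rot T A e y = 0"
 shows "y = 0"
proof (rule euler_fw[OF assms(1)])
 have "rot T A e (partial (fld A x) y) = 0" for e x by (intro rot_hom_0 hom_partial[OF assms(1)]) simp
 hence s: "(\<Sum>d. f e x d *: partial (fld A d) y) = 0" for e x
  using partial_rot[of A x e y] assms(2)[of e] by simp
 show "partial (fld A p) y = 0" for p
 proof (rule salg_eqI)
  fix m
  have "(\<Sum>d. f a d e * coef (partial (fld A d) y) m) = 0" for a e
   using arg_cong[OF s[of a e], of "\<lambda>z. coef z m"] by (simp add: f_antisym'[of a _ e] sum_negf)
  thus "coef (partial (fld A p) y) m = coef 0 m"
   using center_trivial[of "\<lambda>d. coef (partial (fld A d) y) m"] by simp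
 qed
qed simp

text \<open>The second derivatives form an invariant bilinear form, hence a multiple of the standard
  one by \<open>schur_form\<close>; for odd variables they are antisymmetric as well.\<close>

lemma degree_two_invariant:
 assumes "is_odd (fld A undefined :: ('m::finite, 'a) symb)" "hom (fw A) 2 (y :: ('m::finite, 'a) loc)" "\<And>e. rot T A e y = 0"
 shows "y = 0"
proof (rule euler_fw[OF assms(2)])
 let ?P = "\<lambda>x. partial (fld A x) :: ('m, 'a) loc \<Rightarrow> _"
 have odd: "drv True (?P x)" for x
  using drv_partial[of "fld A x :: ('m, 'a) symb"] assms(1) unfolding fld_parity[of A x undefined] by simp
 have anti: "?P x (?P w z) = - ?P w (?P x z)" for x w z
 proof -
  have "?P x (?P w z) + ?P w (?P x z) = 0"
   by (rule drv_zero_eq[OF drv_comm_odd_odd[OF odd odd]]) (simp add: drv_one[OF odd] drv_simps[OF odd])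
  thus ?thesis by (simp add: add_eq_0_iff2)
 qed
 have s1: "rot T A e (?P w y) + (\<Sum>d. f e w d *: ?P d y) = 0" for e w
  using partial_rot[of A w e y] assms(3)[of e] by (simp add: drv_simps[OF odd])
 have h: "hom (fw A) 1 (?P w y)" for w by (rule hom_partial[OF assms(2)]) simp
 have s: "(\<Sum>d. f e x d *: ?P d (?P w y)) + (\<Sum>d. f e w d *: ?P x (?P d y)) = 0" for e x w
 proof -
  have "rot T A e (?P x (?P w y)) = 0" by (intro rot_hom_0 hom_partial[OF h]) simp
  moreover have "?P x (rot T A e (?P w y)) + (\<Sum>d. f e w d *: ?P x (?P d y)) = 0"
   using arg_cong[OF s1[of e w], of "?P x"] by (simp add: drv_simps[OF odd])
  ultimately show ?thesis by (simp add: partial_rot)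
 qed
 have "?P x (?P w y) = 0" for x w
 proof (rule salg_eqI)
  fix m
  let ?M = "\<lambda>x w. coef (?P x (?P w y)) m"
  have "(\<Sum>d. f e a d * ?M d b) + (\<Sum>d. f e b d * ?M a d) = 0" for e a b
   using arg_cong[OF s[of e a b], of "\<lambda>z. coef z m"] by simp
  from schur_form[OF this] obtain \<mu> where \<mu>: "?M x w = (if x = w then \<mu> else 0)" for x w by blast
  have "?M x w = - ?M w x" for x w by (subst anti) simp
  hence "\<mu> = - \<mu>" using \<mu>[of x x] by metis
  thus "?M x w = coef 0 m" by (simp add: \<mu>)
 qed
 thus "?P p y = 0" for p by (intro euler_fw[OF h]) simp_all
qed simp

text \<open>For odd \<open>b\<close> the even derivations \<open>b \<mapsto> c\<close> and \<open>c \<mapsto> b\<close> generate an \<open>sl(2)\<close>, which moves a polynomial of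
 degree 4 in \<open>b\<close> to one in \<open>c\<close> injectively.\<close>

definition swap :: "ladder \<Rightarrow> ladder \<Rightarrow> ('m::finite, 'a) loc \<Rightarrow> ('m, 'a) loc"
 where "swap A B x = (\<Sum>p. gen (fld B p) * partial (fld A p) x)"

lemma swap_fld: "swap A B (gen (fld C p)) = (if A = C then gen (fld B p) else (0 :: ('m::finite, 'a) loc))"
proof -
 have "swap A B (gen (fld C p)) = (\<Sum>q. if q = p then if A = C then gen (fld B p) else 0 else (0))"
  unfolding swap_def by (intro sum.cong) auto
 thus ?thesis by simp
qed

lemma swap_other: "g \<notin> range (fld A) \<Longrightarrow> swap A B (gen g) = (0 :: ('m::finite, 'a) loc)"
 unfolding swap_def by (auto intro!: sum.neutral)

lemma degree_four_invariant:
 fixes y :: "('m::finite, 'a) loc"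
 assumes "odd CARD('m)" "hom (fw Two) 4 y" "hom (fw One) 0 y" "hom fdeg 0 y" "ghost_alg y" "\<And>A e. rot T A e y = 0"
  and zero: "\<And>z :: ('m, 'a) loc. over (range (fld One)) z \<Longrightarrow> hom (fw One) 4 z \<Longrightarrow> (\<And>e. rot T One e z = 0) \<Longrightarrow> z = 0"
 shows "y = 0"
proof -
 let ?\<tau> = "swap Two One :: ('m, 'a) loc \<Rightarrow> _" and ?\<sigma> = "swap One Two :: ('m, 'a) loc \<Rightarrow> _"
 have par: "is_odd (fld A p :: ('m, 'a) symb)" for A p using assms(1) by (cases A) simp_all
 have drv_swap: "drv False (swap A B :: ('m, 'a) loc \<Rightarrow> _)" for A B
 proof -
  have "drv False (\<lambda>x :: ('m, 'a) loc. gen (fld B p) * partial (fld A p) x)" for p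
   using drv_gen[OF drv_partial[of "fld A p :: ('m, 'a) symb"], of "fld B p"] par by simp
  thus ?thesis unfolding swap_def by (intro drv_sum)
 qed
 note swap_lin = drv_simps[OF drv_swap]
 have sl2: "?\<sigma> (?\<tau> x) - ?\<tau> (?\<sigma> x) = num (fw Two) x - num (fw One) x" for x
 proof (rule drv_eq[OF drv_comm_even_even[OF drv_swap drv_swap] drv_diff[OF drv_num drv_num]])
  fix h :: "('m, 'a) symb"
  show "?\<sigma> (?\<tau> (gen h)) - ?\<tau> (?\<sigma> (gen h)) = num (fw Two) (gen h) - num (fw One) (gen h)"
  proof (cases "h \<in> range (fld One) \<union> range (fld Two)")
   case False
   thus ?thesis by (simp add: swap_other swap_lin fw_def)
  qed (auto simp: swap_fld swap_lin)
 qed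
 have swap_rot: "?\<tau> (rot T One e x + rot T Two e x) = rot T One e (?\<tau> x) + rot T Two e (?\<tau> x)" for e x
 proof -
  have "?\<tau> (rot T One e x + rot T Two e x) - (rot T One e (?\<tau> x) + rot T Two e (?\<tau> x)) = 0"
  proof (rule drv_zero_eq[OF drv_comm_even_even[OF drv_swap drv_add[OF drv_rot drv_rot]]])
   fix h :: "('m, 'a) symb"
   show "?\<tau> (rot T One e (gen h) + rot T Two e (gen h)) - (rot T One e (?\<tau> (gen h)) + rot T Two e (?\<tau> (gen h))) = 0"
    by (cases "h \<in> range (fld One) \<union> range (fld Two)") (auto simp: swap_other swap_lin swap_fld rot_other)
  qed
  thus ?thesis by simp
 qed
 have swap_hom: "hom (fw A) (k - 1) (swap A B x)" "hom (fw B) (k' + 1) (swap A B x)"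
   "hom fdeg l (swap A B x)" "ghost_alg (swap A B x)"
  if "A \<noteq> B" "hom (fw A) k x" "hom (fw B) k' x" "hom fdeg l x" "ghost_alg x" for A B k k' l and x :: "('m, 'a) loc"
 proof -
  show "hom (fw A) (k - 1) (swap A B x)" unfolding swap_def using that(1)
   by (intro hom_sum, rule_tac hom_gen_mult[OF hom_partial[OF that(2) refl]]) simp
  show "hom (fw B) (k' + 1) (swap A B x)" unfolding swap_def using that(1)
   by (intro hom_sum, rule_tac hom_gen_mult[OF hom_partial[OF that(3) refl]]) simp
  show "hom fdeg l (swap A B x)" unfolding swap_def
   by (intro hom_sum, rule_tac hom_gen_mult[OF hom_partial[OF that(4) refl]]) simp
  show "ghost_alg (swap A B x)" unfolding swap_def by (intro over_sum ghost_alg_gen_mult ghost_alg_partial that)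
 qed
 let ?y = "\<lambda>k. (?\<tau> ^^ k) y"
 have h: "hom (fw Two) (4 - int k) (?y k) \<and> hom (fw One) (int k) (?y k) \<and> hom fdeg 0 (?y k) \<and> ghost_alg (?y k) \<and>
   (\<forall>e. rot T One e (?y k) + rot T Two e (?y k) = 0)" for k
 proof (induction k)
  case (Suc k)
  let ?z = "?y k"
  from Suc have z: "hom (fw Two) (4 - int k) ?z" "hom (fw One) (int k) ?z" "hom fdeg 0 ?z" "ghost_alg ?z"
   "\<And>e. rot T One e ?z + rot T Two e ?z = 0" by auto
  have "rot T One e (?\<tau> ?z) + rot T Two e (?\<tau> ?z) = 0" for e
   using swap_rot[of e ?z] by (simp add: z(5) swap_lin)
  moreover have "4 - int (Suc k) = 4 - int k - 1" "int (Suc k) = int k + 1" by simp_all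
  ultimately show ?case using swap_hom[of Two One "4 - int k" ?z "int k" 0] z(1-4) by (simp only: funpow.simps o_apply) auto
 qed (use assms in auto)
 \<comment> \<open>The usual sl(2) coefficients for a vector of weight 4 annihilated by
   \<open>swap One Two\<close>. They are nonzero for k < 4, so vanishing at k = 4 descends to k =
   0.\<close>
 have down: "?\<sigma> (?y (Suc k)) = of_int ((int k + 1) * (4 - int k)) *: ?y k" for k
 proof (induction k)
  case 0
  have "?\<sigma> y = 0" unfolding swap_def
  proof (rule sum.neutral, rule ballI)
   fix p
   have "hom (fw One) (-1) (partial (fld One p) y)" by (rule hom_partial[OF assms(3)]) simp
   hence "partial (fld One p) y = 0" by (rule hom_neg[rotated 2]) (simp_all add: fw_def)
   thus "gen (fld Two p) * partial (fld One p) y = 0" by simp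
  qed
  thus ?case using sl2[of y] assms(2,3) by (simp add: hom_num swap_lin)
 next
  case (Suc k)
  have "?\<sigma> (?\<tau> (?y (Suc k))) = ?\<tau> (?\<sigma> (?y (Suc k))) + (of_int (4 - int (Suc k)) *: ?y (Suc k) - of_int (int (Suc k)) *: ?y (Suc k))"
   using sl2[of "?y (Suc k)"] h[of "Suc k"] unfolding hom_num by (metis diff_eq_eq add.commute)
  also have "?\<tau> (?\<sigma> (?y (Suc k))) = of_int ((int k + 1) * (4 - int k)) *: ?y (Suc k)" using Suc by (simp add: swap_lin)
  finally have "?\<sigma> (?\<tau> (?y (Suc k))) = (of_int ((int k + 1) * (4 - int k)) + of_int (4 - int (Suc k)) - of_int (int (Suc k))) *: ?y (Suc k)"
   by (simp only: smult_dist add_diff_eq)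
  also have "(of_int ((int k + 1) * (4 - int k)) + of_int (4 - int (Suc k)) - of_int (int (Suc k)) :: complex) = of_int ((int (Suc k) + 1) * (4 - int (Suc k)))"
   by (simp add: algebra_simps)
  finally show ?case by simp
 qed
 have "?y 4 = 0"
 \<comment> \<open>After four steps only c is left, so rotations of B_0 act trivially and invariance
   under the sum becomes invariance under rotations of c.\<close>
 proof (rule zero)
  have w: "hom (fw Two) 0 (?y 4)" "hom (fw One) 4 (?y 4)" "hom fdeg 0 (?y 4)" "ghost_alg (?y 4)" using h[of 4] by simp_all
  thus "hom (fw One) 4 (?y 4)" by simp
  show "over (range (fld One)) (?y 4)" using w by (intro ghost_only)
  show "rot T One e (?y 4) = 0" for e using h[of 4] rot_hom_0[OF w(1), of T e] by (metis add.right_neutral)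
 qed
 hence "?y 3 = 0" using down[of 3] by (simp add: swap_lin)
 hence "?y 2 = 0" using down[of 2] by (simp add: swap_lin numeral_eq_Suc)
 hence "?y 1 = 0" using down[of 1] by (simp add: swap_lin numeral_eq_Suc)
 thus ?thesis using down[of 0] by (simp add: swap_lin)
qed

end

subsubsection \<open>Classification of the invariants\<close>

text \<open>Any two axes are mixed by a rotation or boost, so an invariant cannot single out some of
  the \<open>dx\<close>: only form degree 0 and the top degree remain.\<close>

lemma lorentz_all_dx:
 fixes x :: "('m::finite, 'a::finite) loc"
 assumes "ghost_alg x" "\<And>\<Lambda>. \<Lambda> \<in> lorentz_algebra \<eta> \<Longrightarrow> lorentz_op \<Lambda> x = 0" "\<And>\<mu>. \<eta> \<mu> \<in> {-1, 1}"
  and m: "m \<in> supp x" "Dx \<nu> \<in># m"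
 shows "Dx \<mu> \<in># m"
proof (cases "\<mu> = \<nu>")
 case False
 let ?w = "\<lambda>\<mu> g. if g = Dx \<mu> then 1 else 0 :: int"
 have num: "num (?w \<mu>) y = gen (Dx \<mu>) * ix \<mu> y" for \<mu> and y :: "('m, 'a) loc"
  by (rule drv_eq[OF drv_num drv_gen_odd[OF drv_ix, simplified]]) simp_all
 \<comment> \<open>The generator of the rotation or boost in the plane of \<mu> and \<nu>; the
   factors \<open>\<eta>\<close> put it into the algebra for every choice of signs of the
   metric.\<close>
 define \<Lambda> where "\<Lambda> i j = (if i = \<mu> \<and> j = \<nu> then \<eta> \<mu> else if i = \<nu> \<and> j = \<mu> then - \<eta> \<nu> else 0)" for i j
 have sq: "\<eta> i * \<eta> i = 1" for i using assms(3)[of i] by auto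
 have "\<Lambda> \<in> lorentz_algebra \<eta>" using False by (auto simp: lorentz_algebra_def \<Lambda>_def sq)
 hence "(\<Sum>i j. of_real (\<Lambda> i j) *: (gen (Dx j) * ix i x)) = 0"
  using assms(1,2) lor_ghost_alg[of x \<Lambda>] by simp
 moreover have "(\<Sum>j. of_real (\<Lambda> i j) *: (gen (Dx j) * ix i x)) =
   (if i = \<mu> then of_real (\<eta> \<mu>) *: (gen (Dx \<nu>) * ix \<mu> x) else 0) - (if i = \<nu> then of_real (\<eta> \<nu>) *: (gen (Dx \<mu>) * ix \<nu> x) else 0)" for i
 proof -
  have "of_real (\<Lambda> i j) *: (gen (Dx j) * ix i x) = (if j = \<nu> then if i = \<mu> then of_real (\<eta> \<mu>) *: (gen (Dx \<nu>) * ix \<mu> x) else 0 else 0)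
    - (if j = \<mu> then if i = \<nu> then of_real (\<eta> \<nu>) *: (gen (Dx \<mu>) * ix \<nu> x) else 0 else 0)" for j
   using False by (simp add: \<Lambda>_def)
  thus ?thesis by (simp add: sum_subtractf)
 qed
 ultimately have "of_real (\<eta> \<mu>) *: (gen (Dx \<nu>) * ix \<mu> x) - of_real (\<eta> \<nu>) *: (gen (Dx \<mu>) * ix \<nu> x) = 0"
  by (simp add: sum_subtractf)
 \<comment> \<open>Multiplication by dx^\<nu> removes the first term; the second becomes, up to a
   factor, dx^\<mu> times the operator counting dx^\<nu>.\<close>
 from arg_cong[OF this, of "\<lambda>z. gen (Dx \<nu>) * z"]
 have "of_real (\<eta> \<nu>) *: (gen (Dx \<nu>) * (gen (Dx \<mu>) * ix \<nu> x)) = 0" by (simp add: right_diff_distrib gen_odd_sq)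
 moreover have "\<eta> \<nu> \<noteq> 0" using assms(3)[of \<nu>] by auto
 ultimately have "gen (Dx \<nu>) * (gen (Dx \<mu>) * ix \<nu> x) = 0" by simp
 moreover have "gen (Dx \<nu>) * gen (Dx \<mu>) = - (gen (Dx \<mu>) * (gen (Dx \<nu>) :: ('m, 'a) loc))"
  by (simp add: gen_odd_comm[of "Dx \<nu> :: ('m, 'a) symb" "gen _"])
 ultimately have z: "gen (Dx \<mu>) * num (?w \<nu>) x = 0" unfolding num by (simp add: mult.assoc[symmetric])
 have "num (?w \<nu>) x = num (?w \<mu>) (num (?w \<nu>) x)"
  using arg_cong[OF z, of "ix \<mu>"] unfolding num[of \<mu> "num _ _"]
  by (simp add: drv_odd_mult[OF drv_ix])
 from arg_cong[OF this, of "\<lambda>z. coef z m"]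
 have "wt (?w \<nu>) m = 0 \<or> wt (?w \<mu>) m = 1" using m(1) by (simp add: num_def supp_iff)
 moreover have w: "wt (?w \<mu>) m = int (count m (Dx \<mu>))" for \<mu> by (induction m) simp_all
 ultimately show ?thesis using m(2) by (metis count_eq_zero_iff of_nat_eq_0_iff zero_neq_one)
qed (use m in simp)

lemma gpart_rot: "(\<And>p q. w (fld A p) = w (fld A q)) \<Longrightarrow> rot T A e (gpart w k x) = gpart w k (rot T A e (x :: ('m::finite, 'a::finite) loc))"
 using lin_comp_comm[OF drv_lin[OF drv_rot[of T A e]], of w 0 k x] by (simp add: hom_rot)

context gauge_algebra
begin

text \<open>Let p, j, k be the numbers of dx, c and B_0 in a monomial. The total degree gives p + j
  + n k = n + 2 + G, Lorentz invariance gives p = 0 or p = n + 2, and neither j nor k can be 1. For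
  p = n + 2 the presence of a field forces j = 1 or k = 1. For p = 0 and k >= 2 it follows that G =
  1 and n <= 3; what remains is k = 2 with odd n and, for n = 1, k = 4.\<close>

lemma invariants_are_ghosts:
 fixes x :: "('m::finite, 'a) loc"
 assumes dim: "CARD('m) = n + 2" "n \<ge> 1" and G: "G \<in> {0, 1 :: nat}" "G = 0 \<longrightarrow> n \<ge> 3" and \<eta>: "\<And>\<mu>. \<eta> \<mu> \<in> {-1, 1}"
  and x: "ghost_alg x" "good (lorentz_algebra \<eta>) (int (n + 2 + G)) x" "\<And>A e. rot T A e x = 0" "fielded x"
  and zero: "\<And>z :: ('m, 'a) loc. n = 1 \<Longrightarrow> over (range (fld One)) z \<Longrightarrow> hom (fw One) 4 z \<Longrightarrow> (\<And>e. rot T One e z = 0) \<Longrightarrow> z = 0"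
 shows "over (range (fld One)) x" "hom (fw One) (int (n + 2 + G)) x"
proof -
 have "wt (fw Two) m = 0 \<and> wt fdeg m = 0 \<and> wt (fw One) m = int (n + 2 + G)" if m: "m \<in> supp x" for m
 proof -
  let ?j = "wt (fw One) m" and ?k = "wt (fw Two) m" and ?p = "wt fdeg m"
  let ?y = "gpart fdeg ?p (gpart (fw Two) ?k (gpart (fw One) ?j x))"
  have "coef ?y m \<noteq> 0" using m by (simp add: supp_iff)
  hence y0: "?y \<noteq> 0" by (metis coef_zero)
  have rot: "rot T A e ?y = 0" for A e by (simp add: gpart_rot x(3))
  have "?y = gpart (fw Two) ?k (gpart fdeg ?p (gpart (fw One) ?j x))" by (rule gpart_gpart_comm)
  moreover have "?y = gpart (fw One) ?j (gpart fdeg ?p (gpart (fw Two) ?k x))" by (rule salg_eqI) simp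
  ultimately have hy: "hom fdeg ?p ?y" "hom (fw Two) ?k ?y" "hom (fw One) ?j ?y" by (metis hom_comp)+
  have gy: "ghost_alg ?y" using x(1) unfolding gpart_def by (intro over_flt)
  have 1: "?j \<noteq> 1" "?k \<noteq> 1" using degree_one_invariant[of One ?y] degree_one_invariant[of Two ?y] hy rot y0 by metis+
  have 2: "?k \<noteq> 2" if "odd n" using degree_two_invariant[of Two ?y] hy(2) rot y0 that dim(1) by auto
  have 4: "\<not> (n = 1 \<and> ?k = 4 \<and> ?j = 0 \<and> ?p = 0)"
   using degree_four_invariant[of ?y] hy rot y0 gy zero dim by auto
  have nn: "?j \<ge> 0" "?k \<ge> 0" by (intro wt_nonneg fw_nonneg)+
  have sub: "set_mset m \<subseteq> {g. jdeg g = 0}" using x(1) m by (auto simp: over_def)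
  have "wt tdeg m = int (n + 2 + G)" using x(2) m by (simp add: good_def hom_def)
  moreover have "wt tdeg m = ?p + ?j + int n * ?k" using sub
  proof (induction m)
   case (add g m)
   hence "jdeg g = 0" by simp
   hence "tdeg g = fdeg g + fw One g + int n * fw Two g"
   proof (cases rule: ghost_alg_cases)
    case (2 A a)
    thus ?thesis using dim(1) by (cases A) (simp_all add: tdeg_def)
   qed (simp add: tdeg_def)
   thus ?case using add by (simp add: algebra_simps)
  qed simp
  ultimately have deg: "?p + ?j + int n * ?k = int n + 2 + int G" by simp
  have p: "?p = 0 \<or> ?p = int n + 2"
  proof (cases "\<exists>\<nu>. Dx \<nu> \<in># m")
   case True
   then obtain \<nu> where \<nu>: "Dx \<nu> \<in># m" by blast
   have all: "Dx \<mu> \<in># m" for \<mu>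
    by (rule lorentz_all_dx[of x \<eta>, OF x(1) _ \<eta> m \<nu>]) (use x(2) in \<open>simp add: good_def\<close>)
   have "filter_mset is_dx m = dxm UNIV"
   proof (rule multiset_eqI)
    fix g
    have "count m g \<le> 1" if "is_dx g" using supp_admissible[OF m] that by (cases g) (auto simp: admissible_def)
    moreover have "count m g \<ge> 1" if "is_dx g" using all that by (cases g) auto
    moreover have "is_dx g \<longleftrightarrow> g \<in> range Dx" by (cases g) auto
    ultimately show "count (filter_mset is_dx m) g = count (dxm UNIV) g" by (auto simp: count_dxm le_antisym)
   qed
   thus ?thesis by (simp add: wt_form dim(1))
  next
   case False
   hence "g \<notin># m" if "is_dx g" for g using that by (cases g) auto
   hence "filter_mset is_dx m = {#}" by (auto simp: multiset_eq_iff count_eq_zero_iff)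
   thus ?thesis by (simp add: wt_form)
  qed
  have fl: "?j \<noteq> 0 \<or> ?k \<noteq> 0"
  proof (rule ccontr)
   assume "\<not> ?thesis"
   moreover have "wt fldeg m = ?j + ?k" using sub
   proof (induction m)
    case (add g m)
    hence "jdeg g = 0" by simp
    hence "fldeg g = fw One g + fw Two g"
    proof (cases rule: ghost_alg_cases)
     case (2 A a)
     thus ?thesis by (cases A) simp_all
    qed simp
    thus ?case using add by simp
   qed simp
   ultimately have "coef (gpart fldeg 0 x) m \<noteq> 0" using m by (simp add: supp_iff)
   thus False using x(4) unfolding fielded_def by (metis coef_zero)
  qed
  obtain j k where jk: "?j = int j" "?k = int k" using nn by (metis nonneg_int_cases)
  from p show ?thesis
  proof
   assume p0: "?p = 0"
   have "k = 0"
   proof (rule ccontr)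
    assume "k \<noteq> 0"
    have d: "int j + int n * int k = int n + 2 + int G" using deg unfolding p0 jk by simp
    hence "int (j + n * k) = int (n + 2 + G)" by simp
    hence d: "j + n * k = n + 2 + G" by (simp only: of_nat_eq_iff)
    have k1: "k \<noteq> 1" "j \<noteq> 1" using 1 jk by auto
    then obtain k' where k': "k = k' + 2" using \<open>k \<noteq> 0\<close> by (metis One_nat_def add_2_eq_Suc' nat_neq_iff not0_implies_Suc)
    have e: "j + n * k' + n = 2 + G" using d unfolding k' by simp
    moreover have "n * k' \<ge> k'" using dim(2) by simp
    moreover have "G = 1" "n \<le> 3" using e G dim(2) by auto
    ultimately have "G = 1" "n \<le> 3" "k' \<le> 2" using dim(2) by linarith+
    hence "n \<in> {1, 2, 3}" "k' \<in> {0, 1, 2}" using dim(2) by auto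
    thus False using \<open>j + n * k' + n = 2 + G\<close> \<open>G = 1\<close> k1(2) 2 4 unfolding jk k' p0 by auto
   qed
   thus ?thesis using deg jk p0 by simp
  next
   assume "?p = int n + 2"
   hence "int j + int n * int k = int G" using deg unfolding jk by simp
   hence "int (j + n * k) = int G" by simp
   hence "j + n * k = G" by (simp only: of_nat_eq_iff)
   moreover have "n * k \<ge> k" using dim(2) by simp
   ultimately have "j \<le> G" "k \<le> G" by linarith+
   moreover have "j \<noteq> 0 \<or> k \<noteq> 0" using fl jk by simp
   ultimately have "j = 1 \<or> k = 1" using G(1) by auto
   thus ?thesis using 1 jk by auto
  qed
 qed
 hence "hom (fw Two) 0 x" "hom fdeg 0 x" "hom (fw One) (int (n + 2 + G)) x" by (auto simp: hom_def)
 thus "over (range (fld One)) x" "hom (fw One) (int (n + 2 + G)) x" using ghost_only[OF x(1)] by auto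
qed

text \<open>Two Fitting decompositions in succession, first for the Casimir of B_0 and then for that
  of c, because \<open>casimir_homotopy_One\<close> presupposes invariance under rotations of B_0.
  The image parts are exact by the homotopies.\<close>

lemma closed_invariant:
 fixes x :: "('m::finite, 'a) loc"
 assumes "ghost_alg x" "good \<Lambda>s k x" "D0 T x = 0"
 shows "\<exists>\<omega> y. x = \<omega> + D0 T y \<and> ghost_alg \<omega> \<and> good \<Lambda>s k \<omega> \<and> good \<Lambda>s (k - 1) y \<and> (\<forall>A e. rot T A e \<omega> = 0)"
proof -
 let ?C = "\<lambda>A x. \<Sum>a. rot T A a (rot T A a (x :: ('m, 'a) loc))"
 let ?h = "\<lambda>A x. \<Sum>a. partial (fld One a) (rot T A a (x))"
 let ?S = "{x :: ('m, 'a) loc. ghost_alg x \<and> good \<Lambda>s k x \<and> D0 T x = 0}"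
 let ?S' = "{x \<in> ?S. \<forall>e. rot T Two e x = 0}"
 have C: "ghost_alg (?C A y) \<and> good \<Lambda>s k (?C A y)" if "y \<in> ?S" for A y
  using that by (auto intro!: over_sum ghost_alg_rot good_lin(6) good_rot)
 have h: "good \<Lambda>s (k - 1) (?h A y)" if "y \<in> ?S" for A y
  using that by (intro good_lin(6) good_iota ghost_alg_rot good_rot) auto
 have "D0 T (?C Two y) = 0" if "y \<in> ?S" for y
  using that casimir_homotopy_Two[of y] D0_D0[of "?h Two y"] by simp
 hence "salg.inv_space (?C Two) ?S"
  using C unfolding salg.inv_space_def by (auto simp: good_lin over_add over_smult)
 from rot_fitting[OF assms(1) this] assms obtain x0 x1 where
  x: "x0 \<in> ?S" "x1 \<in> ?S" "x = x0 + ?C Two x1" "\<And>a. rot T Two a x0 = 0" by blast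
 have "D0 T (?C One y) = 0" if "y \<in> ?S'" for y
  using that casimir_homotopy_One[of y] D0_D0[of "?h One y"] by simp
 moreover have "rot T Two e (?C One y) = 0" if "y \<in> ?S'" for e y
  using that by (simp add: rot_commute[symmetric])
 ultimately have "salg.inv_space (?C One) ?S'"
  using C unfolding salg.inv_space_def by (auto simp: good_lin over_add over_smult)
 from rot_fitting[OF _ this, of x0] x(1,4) obtain \<omega> x2 where
  w: "\<omega> \<in> ?S'" "x2 \<in> ?S'" "x0 = \<omega> + ?C One x2" "\<And>a. rot T One a \<omega> = 0" by blast
 have "x = \<omega> + D0 T (?h One x2 + ?h Two x1)"
  using x(2,3) w(2,3) casimir_homotopy_One[of x2] casimir_homotopy_Two[of x1] by simp
 moreover have "good \<Lambda>s (k - 1) (?h One x2 + ?h Two x1)" using h w(2) x(2) by (intro good_lin(2)) auto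
 moreover have "rot T A e \<omega> = 0" for A e using w(1,4) by (cases A) auto
 ultimately show ?thesis using w(1) by blast
qed

text \<open>By this formula invariant polynomials in c alone are closed.\<close>

lemma D0_ghosts:
 assumes "over (range (fld One)) (x :: ('m::finite, 'a) loc)"
 shows "D0 T x = (1/2) *: (\<Sum>a. ghost a * rot T One a x)"
proof (rule drv_eq_over[OF drv_D0 _ _ assms])
 have "drv True (\<lambda>x :: ('m, 'a) loc. ghost a * rot T One a x)" for a
  using drv_gen_odd[OF drv_rot, of "fld One a"] by simp
 thus "drv True (\<lambda>x :: ('m, 'a) loc. (1/2) *: (\<Sum>a. ghost a * rot T One a x))"
  by (intro drv_smult drv_sum)
 fix h :: "('m, 'a) symb" assume "h \<in> range (fld One)"
 then obtain b where h: "h = fld One b" by blast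
 show "D0 T (gen h) = (1/2) *: (\<Sum>a. ghost a * rot T One a (gen h))"
  unfolding h by (simp add: bracket_eq sum_distrib_left)
qed

lemma over_fld_ghost_alg: "over (range (fld One)) x \<Longrightarrow> ghost_alg (x :: ('m::finite, 'a) loc)"
 by (rule over_mono) (auto simp: jdeg_def)

text \<open>On polynomials in dx, c and B_0 the differential only adds factors c, so the numbers of
  B_0 and of dx are preserved. A primitive can thus be projected to polynomials in c.\<close>

lemma D0_gpart_ghost_alg:
 assumes "ghost_alg (z :: ('m::finite, 'a) loc)" and w: "\<And>a b A. w (fld One a) = 0" "\<And>a b A. w (fld A a) = w (fld A b)"
 shows "D0 T (gpart w k z) = gpart w k (D0 T z)"
proof -
 have "num w (D0 T z) - D0 T (num w z) = 0" if "ghost_alg z" for z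
 proof (rule drv_zero_over[OF drv_comm_even[OF drv_num drv_D0] _ that])
  fix h :: "('m, 'a) symb"
  assume "h \<in> {g. jdeg g = 0}"
  hence "jdeg h = 0" by simp
  thus "num w (D0 T (gen h)) - D0 T (num w (gen h)) = 0"
  proof (cases rule: ghost_alg_cases)
   case (2 A a)
   have "hom w (w (fld A a)) (bracket T ghost (\<lambda>b. gen (fld A b)) a)"
    unfolding bracket_eq by (intro hom_sum hom_smult hom_gen_mult[OF hom_gen']) (use w in auto)
   thus ?thesis unfolding 2 by (simp add: hom_num mult.commute)
  qed (simp add: D0_gen)
 qed
 note N = this
 have "hom w (k + 0) (D0 T (gpart jdeg 0 x))" if "hom w k x" for k x
 proof -
  have "ghost_alg (gpart jdeg 0 x)" using hom_comp[of jdeg 0 x] by (simp add: hom_jet_weight_0)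
  moreover have "hom w k (gpart jdeg 0 x)" using that unfolding gpart_def by (rule hom_comp_other)
  ultimately show ?thesis using N by (simp add: hom_num)
 qed
 from lin_comp_comm[OF lin_comp[OF drv_lin[OF drv_D0] lin_comp'] this, of k z]
 have "D0 T (gpart jdeg 0 (gpart w k z)) = gpart w k (D0 T (gpart jdeg 0 z))" by simp
 moreover have "gpart jdeg 0 z = z" using assms(1) by (simp add: comp_hom hom_jet_weight_0)
 moreover have "gpart jdeg 0 (gpart w k z) = gpart w k z"
  unfolding gpart_gpart_comm[of jdeg] by (simp add: calculation)
 ultimately show ?thesis by simp
qed

text \<open>Reduce the primitive to a polynomial in c and write it as an invariant plus C z1, with
  the Casimir C. The invariant is closed, so P = C (D0 z1). As P is invariant, C^2 annihilates D0
  z1, which is then itself invariant by \<open>rot_kernel\<close>; hence P = 0.\<close>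

lemma exact_invariant_zero:
 fixes P :: "('m::finite, 'a) loc"
 assumes P: "over (range (fld One)) P" "\<And>e. rot T One e P = 0" and y: "ghost_alg y" "P = D0 T y"
 shows "P = 0"
proof -
 let ?C = "\<lambda>x. \<Sum>a. rot T One a (rot T One a (x :: ('m, 'a) loc))"
 have hP: "hom (fw Two) 0 P" "hom fdeg 0 P"
  using P(1) hom_nonneg_over[of "fw Two" P, OF fw_nonneg] hom_nonneg_over[of fdeg P, OF fdeg_nonneg]
  by (auto elim!: over_mono)
 have D: "D0 T (gpart w 0 z) = gpart w 0 (D0 T z)" if z: "ghost_alg z" and w: "w = fw Two \<or> w = fdeg" for w and z :: "('m, 'a) loc"
  by (rule D0_gpart_ghost_alg[OF z]) (use w in auto)
 define z where "z = gpart fdeg 0 (gpart (fw Two) 0 y)"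
 have gz: "ghost_alg (gpart (fw Two) 0 y)" "ghost_alg z" using y(1) unfolding z_def gpart_def by (auto intro!: over_flt)
 have "z = gpart (fw Two) 0 (gpart fdeg 0 y)" unfolding z_def by (rule gpart_gpart_comm)
 hence "hom (fw Two) 0 z" by (metis hom_comp)
 moreover have "hom fdeg 0 z" unfolding z_def by (rule hom_comp)
 ultimately have z: "over (range (fld One)) z" using gz(2) by (intro ghost_only)
 have "D0 T z = P" unfolding z_def using D gz(1) y hP by (simp add: comp_hom)
 have ov: "over (range (fld One)) (rot T One e x)" if "over (range (fld One)) x" for e and x :: "('m, 'a) loc"
  unfolding rot_def by (intro over_sum over_smult over_gen_mult drv_over[OF drv_partial _ that]) auto
 have t: "rot T Two e x = 0" if "over (range (fld One)) x" for e and x :: "('m, 'a) loc"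
  by (rule drv_zero_over[OF drv_rot _ that]) auto
 let ?S = "{x :: ('m, 'a) loc. over (range (fld One)) x}"
 have "salg.inv_space ?C ?S" unfolding salg.inv_space_def by (auto intro!: over_add over_smult over_sum ov)
 from rot_fitting[OF gz(2) this] z obtain z0 z1 where
  zz: "over (range (fld One)) z0" "over (range (fld One)) z1" "z = z0 + ?C z1" "\<And>a. rot T One a z0 = 0" by blast
 have DL: "D0 T (rot T One e x) = rot T One e (D0 T x)" if x: "over (range (fld One)) x" for e and x :: "('m, 'a) loc"
 proof -
  have g: "ghost_alg x" by (rule over_fld_ghost_alg[OF x])
  have "ghost_alg (D0 T x)" unfolding D0_ghosts[OF x]
   by (intro over_smult over_sum ghost_alg_gen_mult ghost_alg_rot g)
  have "rot T One e x = D0 T (partial (fld One e) x) + partial (fld One e) (D0 T x)"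
   using cartan_formula[OF g, of e] t[OF x] by simp
  moreover have "rot T Two e (D0 T x) = 0"
  proof (rule t)
   show "over (range (fld One)) (D0 T x)" unfolding D0_ghosts[OF x] by (intro over_smult over_sum over_gen_mult ov x) auto
  qed
  hence "rot T One e (D0 T x) = D0 T (partial (fld One e) (D0 T x))"
   using cartan_formula[OF \<open>ghost_alg (D0 T x)\<close>, of e] by (simp add: D0_D0 drv_simps[OF ipar])
  ultimately show ?thesis by (simp add: D0_D0)
 qed
 have "D0 T z0 = 0" unfolding D0_ghosts[OF zz(1)] by (simp add: zz(4))
 hence PC: "P = ?C (D0 T z1)"
  using \<open>D0 T z = P\<close> zz(3) DL[OF ov[OF zz(2)]] DL[OF zz(2)] by simp
 have "(?C ^^ 2) (D0 T z1) = 0" using PC P(2) by (simp add: numeral_2_eq_2)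
 moreover have "ghost_alg (D0 T z1)" unfolding D0_ghosts[OF zz(2)]
  by (intro over_smult over_sum ghost_alg_gen_mult ghost_alg_rot over_fld_ghost_alg zz(2))
 ultimately have "rot T One a (D0 T z1) = 0" for a by (intro rot_kernel[where k = 2])
 thus ?thesis unfolding PC by simp
qed

end

subsection \<open>Gradings of the differentials\<close>

lemma hom_gpart: "hom v k x \<Longrightarrow> hom v k (gpart w l x)"
 unfolding gpart_def by (rule hom_comp_other)

lemma gh_Jet: "gh (Jet A a I S :: ('m, 'a) symb) = (case A of One \<Rightarrow> 1 | Two \<Rightarrow> int CARD('m) - 2) - int (card S)"
 by (cases A) simp_all

text \<open>The parameters \<open>s\<close>, \<open>r\<close> and \<open>\<delta>\<close> are the
  weights of \<open>susy_comp\<close>, of the differential and of \<open>dx\<close>; a total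
  derivative has weight s + r, as it is the anticommutator of the first two. Ghost number, form
  degree and total degree are the instances.\<close>

locale grading =
 fixes w :: "('m::finite, 'a::finite) symb \<Rightarrow> int" and s r \<delta> :: int
 assumes w_insert: "\<mu> \<notin> S \<Longrightarrow> w (Jet A a I (insert \<mu> S)) = w (Jet A a I S) + s"
  and w_add: "w (Jet A a (add_mset \<mu> I) S) = w (Jet A a I S) + (s + r)"
  and w_fld: "w (fld One a) = r" "w (fld Two a) = w (fld Two b)"
  and w_ghosts: "w (Eps \<mu>) = - s" "w (Xi \<mu>) = r - s" "w (V a) = w (fld Two a)" "w (U a) = w (fld Two a) + r" "w (Dx \<mu>) = \<delta>"
begin

lemma hom_gen_susy: "hom w (w g + s) (susy_comp \<mu> (gen g))"
proof (cases g)
 case (Jet A a I S)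
 show ?thesis
 proof (cases "\<mu> \<in> S")
  case False
  then obtain t where "susy_comp \<mu> (gen (Jet A a I S)) = t *: (gen (Jet A a I (insert \<mu> S)) :: ('m, 'a) loc)"
   using susy_Jet by blast
  thus ?thesis using False by (auto simp: Jet w_insert intro!: hom_smult hom_gen')
 qed (simp add: Jet susy_Jet_in)
qed simp_all

lemma num_w_susy: "num w (susy_comp \<mu> x) = susy_comp \<mu> (num w x) + of_int s *: susy_comp \<mu> x"
 by (rule drv_num_comm[OF drv_susy hom_gen_susy])

lemma hom_susy: "hom w k x \<Longrightarrow> hom w (k + s) (susy_comp \<mu> x)"
 by (rule drv_hom[OF drv_susy hom_gen_susy]) auto

lemma num_w_tderiv: "num w (tderiv \<mu> x) = tderiv \<mu> (num w x) + of_int (s + r) *: tderiv \<mu> x"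
proof (rule drv_num_comm[OF drv_tderiv])
 show "hom w (w g + (s + r)) (tderiv \<mu> (gen g))" for g by (cases g) (auto simp: w_add intro!: hom_gen')
qed

lemma hom_tderiv: "hom w k x \<Longrightarrow> hom w (k + (s + r)) (tderiv \<mu> x)"
 by (simp add: hom_num num_w_tderiv smult_dist)

lemma hom_b_shift: "hom w k x \<Longrightarrow> hom w k (b_shift x)"
proof (rule drv_hom[OF drv_b_shift])
 show "hom w (w g + 0) (b_shift (gen g))" for g
  by (auto simp: b_shift_def w_ghosts split: symb.split ladder.split intro!: hom_gen')
qed auto

lemma hom_D0: assumes "hom w k x" shows "hom w (k + r) (D0 T x)"
proof -
 have "num w (D0 T x) - D0 T (num w x) - of_int r *: D0 T x = 0"
 proof (rule drv_zero_jets[OF drv_diff[OF drv_comm_even[OF drv_num drv_D0] drv_smult[OF drv_D0]]])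
  fix h :: "('m, 'a) symb" assume "\<not> is_field h"
  thus "num w (D0 T (gen h)) - D0 T (num w (gen h)) - of_int r *: D0 T (gen h) = 0"
   by (cases h) (simp_all add: D0_gen w_ghosts smult_dist)
 next
  fix A and a :: 'a
  have e: "w (fld A b) = w (fld A a)" for b using w_fld by (cases A) auto
  have "hom w (r + w (fld A a)) (bracket T ghost (\<lambda>b. gen (fld A b)) a)"
   unfolding bracket_eq by (intro hom_sum hom_smult hom_gen_mult[OF hom_gen']) (auto simp: w_fld intro: e[symmetric])
  thus "num w (D0 T (gen (fld A a))) - D0 T (num w (gen (fld A a))) - of_int r *: D0 T (gen (fld A a)) = 0"
   by (simp add: hom_num smult_dist algebra_simps)
 next
  fix \<mu> and x :: "('m, 'a) loc" assume "num w (D0 T x) - D0 T (num w x) - of_int r *: D0 T x = 0"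
  hence e: "num w (D0 T x) = D0 T (num w x) + of_int r *: D0 T x" by (simp add: algebra_simps)
  show "num w (D0 T (susy_comp \<mu> x)) - D0 T (num w (susy_comp \<mu> x)) - of_int r *: D0 T (susy_comp \<mu> x) = 0"
   by (simp add: D0_susy num_w_susy num_w_tderiv e smult_dist algebra_simps)
  show "num w (D0 T (tderiv \<mu> x)) - D0 T (num w (tderiv \<mu> x)) - of_int r *: D0 T (tderiv \<mu> x) = 0"
   by (simp add: D0_tderiv num_w_tderiv e smult_dist algebra_simps)
 qed
 thus ?thesis using assms by (simp add: hom_num algebra_simps)
qed

lemma hom_coboundary: assumes "hom w k x" shows "hom w (k + r) (coboundary T x)"
proof -
 have "shift_op T x = D0 T (b_shift x) - b_shift (D0 T x)" by (simp add: D0_b_shift)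
 hence "hom w (k + r) (shift_op T x)" using assms by (auto intro!: hom_diff hom_D0 hom_b_shift)
 moreover have "hom w (k + r) (susy_op x)" unfolding susy_op_def
  by (intro hom_sum hom_gen_mult[OF hom_susy[OF assms]]) (simp add: w_ghosts)
 moreover have "hom w (k + r) (transl_op x)" unfolding transl_op_eq
  by (intro hom_uminus hom_sum hom_gen_mult[OF hom_tderiv[OF assms]]) (simp add: w_ghosts)
 moreover have "coboundary T x = D0 T x + susy_op x + transl_op x + shift_op T x"
  by (simp add: coboundary_def D0_def ghost_der_def)
 ultimately show ?thesis by (auto intro!: hom_add hom_D0 assms)
qed

lemma hom_dext: "hom w k x \<Longrightarrow> l = k + \<delta> + (s + r) \<Longrightarrow> hom w l (dext x)"
 unfolding dext_def by (intro hom_sum hom_gen_mult[OF hom_tderiv]) (auto simp: w_ghosts)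

lemma hom_climb: "hom w k x \<Longrightarrow> l = k + \<delta> + s \<Longrightarrow> hom w l (climb x)"
 unfolding climb_def by (intro hom_uminus hom_sum hom_gen_mult[OF hom_susy]) (auto simp: w_ghosts)

lemma hom_khop: assumes "s + r = 0" "hom w k x" shows "hom w (k - \<delta>) (khop x)"
proof -
 have l: "hom w (w g + 0) (low \<mu> (gen g))" for g \<mu>
 proof (cases g)
  case (Jet A a I S)
  thus ?thesis using w_add[of A a \<mu> "I - {#\<mu>#}" S] assms(1)
   by (cases "\<mu> \<in># I") (auto simp: low_Jet intro!: hom_smult hom_gen')
 qed simp_all
 show ?thesis unfolding khop_def
  by (intro hom_sum drv_hom[OF drv_low l] hom_partial[OF assms(2)]) (auto simp: w_ghosts)
qed

lemma hom_Zop: assumes "\<delta> = - s" "hom w k x" shows "hom w k (Zop x)"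
proof -
 have "hom w k (gen (Eps \<mu>) * susy_comp \<mu> x)" "hom w k (gen (Dx \<mu>) * susy_comp \<mu> x)" for \<mu>
  using assms(1) by (auto intro!: hom_gen_mult[OF hom_susy[OF assms(2)]] simp: w_ghosts)
 thus ?thesis unfolding Zop_def left_diff_distrib by (intro hom_add hom_sum hom_diff hom_b_shift assms(2)) auto
qed

lemma hom_expZ: assumes "\<delta> = - s" "hom w k x" shows "hom w k (expZ t x)"
proof -
 have "hom w k ((Zop ^^ j) x)" for j by (induction j) (simp_all add: assms hom_Zop)
 thus ?thesis unfolding expo_def by (intro hom_sum hom_smult)
qed

lemma hom_hop: assumes "s + r = 0" "hom w k x" shows "hom w (k + s) (hop x)"
proof -
 have "hom w (w g + s) (hop (gen g))" for g
 proof (cases g)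
  case (Jet A a I S)
  have "hom w (w g + s) (susy_comp \<mu> (gen (Jet A a (I - {#\<mu>#}) S)))" if "\<mu> \<in># I" for \<mu>
   using hom_gen_susy[of "Jet A a (I - {#\<mu>#}) S" \<mu>] w_add[of A a \<mu> "I - {#\<mu>#}" S] assms(1) that by (simp add: Jet)
  hence "hom w (w g + s) (sum_mset (image_mset (\<lambda>\<mu>. susy_comp \<mu> (gen (Jet A a (I - {#\<mu>#}) S))) J))" if "set_mset J \<subseteq> set_mset I" for J
   using that by (induction J) (auto intro!: hom_add)
  thus ?thesis by (simp add: Jet hop_Jet)
 qed (use assms(1) in \<open>auto simp: hop_gen w_ghosts intro!: hom_gen'\<close>)
 from drv_hom[OF drv_hop this assms(2) refl] show ?thesis .
qed

lemma lor_num_w: "lorentz_op \<Lambda> (num w x) = num w (lorentz_op \<Lambda> x)"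
 by (rule lor_num[OF num_w_susy num_w_tderiv]) (simp_all add: w_ghosts)

lemma lor_gpart: "lorentz_op \<Lambda> (gpart w k x) = gpart w k (lorentz_op \<Lambda> x)"
proof -
 have "hom w (k + 0) (lorentz_op \<Lambda> x)" if "hom w k x" for k and x :: "('m, 'a) loc"
  using that by (simp add: hom_num lor_num_w[symmetric])
 from lin_comp_comm[OF drv_lin[OF drv_lor] this, of k x] show ?thesis by simp
qed

lemma good_gpart: "good \<Lambda>s k x \<Longrightarrow> good \<Lambda>s k (gpart w l x)"
 by (auto simp: good_def lor_gpart intro: hom_gpart)

end

global_interpretation gh: grading "gh :: ('m::finite, 'a::finite) symb \<Rightarrow> int" "-1" 1 0
 by unfold_locales (auto simp: gh_Jet split: ladder.split)

global_interpretation form: grading "fdeg :: ('m::finite, 'a::finite) symb \<Rightarrow> int" 0 0 1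
 by unfold_locales auto

global_interpretation tdeg: grading "tdeg :: ('m::finite, 'a::finite) symb \<Rightarrow> int" "-1" 1 1
 by unfold_locales (auto simp: tdeg_def gh_Jet split: ladder.split)

lemma wt_tdeg: "wt tdeg m = wt gh m + wt fdeg m" by (induction m) (simp_all add: tdeg_def)

lemma good_tdeg: "good \<Lambda>s k x \<Longrightarrow> good \<Lambda>s k (expZ t x)" "good \<Lambda>s k x \<Longrightarrow> good \<Lambda>s (k - 1) (hop x)"
 "good \<Lambda>s k x \<Longrightarrow> good \<Lambda>s (k - 1) (khop x)" "good \<Lambda>s k x \<Longrightarrow> good \<Lambda>s (k + 1) (dext x)" "good \<Lambda>s k x \<Longrightarrow> good \<Lambda>s (k + 1) (D0 T x)"
 "good \<Lambda>s k x \<Longrightarrow> good \<Lambda>s (k + 1) (coboundary T x)" "good \<Lambda>s k x \<Longrightarrow> good \<Lambda>s (k + 1) (Dtot T x)"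
 for x :: "('m::finite, 'a::finite) loc"
proof -
 show d: "good \<Lambda>s k x \<Longrightarrow> good \<Lambda>s (k + 1) (dext x)"
  by (auto simp: good_def lor_dext intro!: tdeg.hom_dext)
 have l: "lorentz_op \<Lambda> (coboundary T x) = coboundary T (lorentz_op \<Lambda> x)" for \<Lambda>
  using lor_Dtot[of \<Lambda> T x] by (simp add: Dtot_def lor_dext)
 show c: "good \<Lambda>s k x \<Longrightarrow> good \<Lambda>s (k + 1) (coboundary T x)"
  by (auto simp: good_def l intro: tdeg.hom_coboundary)
 show "good \<Lambda>s k x \<Longrightarrow> good \<Lambda>s (k + 1) (Dtot T x)" unfolding Dtot_def by (intro good_lin d c)
 show "good \<Lambda>s k x \<Longrightarrow> good \<Lambda>s k (expZ t x)"
  by (auto simp: good_def lor_expZ intro: tdeg.hom_expZ)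
 show "good \<Lambda>s k x \<Longrightarrow> good \<Lambda>s (k - 1) (hop x)"
  using tdeg.hom_hop[of k x] by (auto simp: good_def lor_hop)
 show "good \<Lambda>s k x \<Longrightarrow> good \<Lambda>s (k - 1) (khop x)"
  using tdeg.hom_khop[of k x] by (auto simp: good_def lor_khop)
 show "good \<Lambda>s k x \<Longrightarrow> good \<Lambda>s (k + 1) (D0 T x)"
  by (auto simp: good_def lor_D0 intro: tdeg.hom_D0)
qed

subsubsection \<open>Field-independent terms\<close>

lemma field_free_over: "field_free x \<longleftrightarrow> over {g. \<not> is_field g} x"
 by (auto simp: field_free_def over_def)

lemma field_free_hom: "field_free x \<longleftrightarrow> hom fldeg 0 (x :: ('m, 'a) loc)"
 by (auto simp: fldeg_def hom_nonneg_over field_free_over)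

lemma field_free_lin: "field_free 0" "field_free x \<Longrightarrow> field_free y \<Longrightarrow> field_free (x + y)"
 "field_free x \<Longrightarrow> field_free y \<Longrightarrow> field_free (x - y)" "field_free x \<Longrightarrow> field_free (- x)" "field_free x \<Longrightarrow> field_free (c *: x)"
 "field_free x \<Longrightarrow> field_free (flt P x)"
 by (auto simp: field_free_hom intro: hom_add hom_diff hom_uminus hom_smult hom_comp_other)

lemma field_free_drv: "drv p h \<Longrightarrow> (\<And>g. \<not> is_field g \<Longrightarrow> field_free (h (gen g))) \<Longrightarrow> field_free x \<Longrightarrow> field_free (h x)"
 unfolding field_free_over by (rule drv_over) auto

lemma field_free_gen: "\<not> is_field g \<Longrightarrow> field_free (gen g)"
 by (simp add: field_free_over over_gen)

lemma field_free_ops: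
 fixes x :: "('m::finite, 'a::finite) loc"
 assumes "field_free x"
 shows "dext x = 0" "field_free (D0 T x)" "field_free (coboundary T x)" "expZ t x = x" "field_free (hop x)"
proof -
 have t: "tderiv \<mu> x = 0" for \<mu>
  by (rule drv_zero_over[OF drv_tderiv _ assms[unfolded field_free_over]]) simp
 show d: "dext x = 0" by (simp add: dext_def t)
 show D: "field_free (D0 T x)"
  by (rule field_free_drv[OF drv_D0 _ assms]) (auto simp: D0_gen field_free_lin field_free_gen split: symb.split)
 have "susy_comp \<mu> x = 0" for \<mu>
  by (rule drv_zero_over[OF drv_susy _ assms[unfolded field_free_over]]) simp
 moreover have "shift_op T x = 0"
  by (rule drv_zero_over[OF vder_drv[OF vder_shift] _ assms[unfolded field_free_over]]) simp
 ultimately have "coboundary T x = D0 T x"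
  by (simp add: coboundary_def D0_def ghost_der_def susy_op_def transl_op_eq t)
 thus "field_free (coboundary T x)" using D by simp
 have "Zop x = 0" by (rule drv_zero_over[OF drv_Zop _ assms[unfolded field_free_over]]) (simp add: Zop_gen)
 thus "expZ t x = x" by (rule expo_kernel[OF drv_lin[OF drv_Zop] lnil_Zop])
 show "field_free (hop x)"
  by (rule field_free_drv[OF drv_hop _ assms]) (auto simp: hop_gen field_free_lin field_free_gen split: symb.split)
qed

abbreviation free_part :: "('m, 'a) loc \<Rightarrow> ('m, 'a) loc" where "free_part \<equiv> gpart fldeg 0"

lemma field_free_part [simp]: "field_free (free_part x)" by (simp add: field_free_hom hom_comp)

lemma fielded_free: "fielded x \<Longrightarrow> field_free x \<Longrightarrow> x = 0"
 by (simp add: fielded_def field_free_hom comp_hom)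

lemma fielded_lin: "fielded 0" "fielded x \<Longrightarrow> fielded y \<Longrightarrow> fielded (x + y)" "fielded x \<Longrightarrow> fielded y \<Longrightarrow> fielded (x - y)"
 "fielded x \<Longrightarrow> fielded (- x)" "fielded x \<Longrightarrow> fielded (c *: x)" "fielded x \<Longrightarrow> fielded (flt P x)"
proof -
 have "gpart fldeg 0 (flt P x) = flt P (gpart fldeg 0 x)" by (rule salg_eqI) simp
 thus "fielded x \<Longrightarrow> fielded (flt P x)" by (simp add: fielded_def)
qed (simp_all add: fielded_def)

lemma fielded_dext: "fielded x \<Longrightarrow> fielded (dext (x :: ('m::finite, 'a) loc))"
 by (simp add: fielded_def fielded_gpart_dext)

lemma fielded_khop: "fielded x \<Longrightarrow> fielded (khop (x :: ('m::finite, 'a) loc))"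
proof -
 have "hom fldeg (k + 0) (khop z)" if "hom fldeg k z" for k and z :: "('m, 'a) loc"
  using that by (simp add: khop_def hom_num nfields_low nfields_ix smult_sum_right)
 from lin_comp_comm[OF lin_khop this, of 0 x] show "fielded x \<Longrightarrow> fielded (khop x)"
  by (simp add: fielded_def)
qed

lemma lor_free_part: "lorentz_op \<Lambda> (free_part x) = free_part (lorentz_op \<Lambda> (x :: ('m::finite, 'a::finite) loc))"
proof -
 have "hom fldeg (k + 0) (lorentz_op \<Lambda> x)" if "hom fldeg k x" for k and x :: "('m, 'a) loc"
  using that by (simp add: hom_num lor_nfields[symmetric])
 from lin_comp_comm[OF drv_lin[OF drv_lor] this, of 0 x] show ?thesis by simp
qed

lemma good_free_part: "good \<Lambda>s k x \<Longrightarrow> good \<Lambda>s k (free_part (x :: ('m::finite, 'a::finite) loc))"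
 by (auto simp: good_def lor_free_part intro: hom_gpart)

text \<open>Setting all fields to zero is a homomorphism of algebras.\<close>

lemma free_part_mult: "free_part (x * y) = free_part x * free_part (y :: ('m, 'a) loc)"
proof (induction x rule: mon_induct)
 case (mult g x)
 have "free_part (gen g * z) = (if is_field g then 0 else gen g * free_part z)" for z :: "('m, 'a) loc"
 proof -
  have "hom fldeg (k + fldeg g) (gen g * z)" if "hom fldeg k z" for k and z :: "('m, 'a) loc"
   by (rule hom_gen_mult[OF that]) simp
  from lin_comp_comm[OF lin_multl[OF lin_ident] this, of "- fldeg g" z]
  have "gen g * gpart fldeg (- fldeg g) z = free_part (gen g * z)" by simp
  moreover have "gpart fldeg (-1) z = 0"
   by (rule hom_neg[OF _ _ hom_comp]) (simp_all add: fldeg_def)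
  ultimately show ?thesis by (auto simp: fldeg_def)
 qed
 thus ?case using mult by (simp add: mult.assoc)
qed (simp_all add: distrib_right comp_hom[OF hom_one])

text \<open>Unlike \<open>coboundary\<close>, whose shift sends B_0 to u, \<open>D0\<close> maps
  every field to a polynomial without field-independent term. In the conjugated picture the
  field-independent parts therefore separate.\<close>

lemma fielded_D0: assumes "fielded (x :: ('m::finite, 'a::finite) loc)" shows "fielded (D0 T x)"
proof -
 have J: "fielded (D0 T (gen (Jet A a I S)))" for A and a :: 'a and I and S :: "'m set"
 proof (rule jet_induct)
  show "fielded (D0 T (gen (Jet A a {#} {})))"
   by (simp add: bracket_eq fielded_def free_part_mult comp_hom_if[OF hom_gen])
  show "fielded (D0 T (tderiv \<mu> (gen (Jet A a I S))))" if "fielded (D0 T (gen (Jet A a I S)))" for \<mu> and S :: "'m set" and I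
  proof -
   have "hom fldeg (k + 0) (tderiv \<mu> x)" if "hom fldeg k x" for k and x :: "('m, 'a) loc"
    using that by (simp add: hom_num nfields_tderiv)
   from lin_comp_comm[OF drv_lin[OF drv_tderiv] this, of 0 "D0 T (gen (Jet A a I S))"] that
   show ?thesis by (simp add: fielded_def D0_tderiv del: tderiv_Jet)
  qed
  show "fielded (D0 T (susy_comp \<mu> (gen (Jet A a I S))))" if "fielded (D0 T (gen (Jet A a I S)))" for \<mu> and S :: "'m set" and I
  proof -
   have "hom fldeg (k + 0) (susy_comp \<mu> x)" if "hom fldeg k x" for k and x :: "('m, 'a) loc"
    using that by (simp add: hom_num nfields_susy)
   from lin_comp_comm[OF drv_lin[OF drv_susy] this, of 0 "D0 T (gen (Jet A a I S))"] that
   show ?thesis by (simp add: fielded_def D0_susy comp_hom_if[OF hom_gen])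
  qed
 qed (simp add: fielded_def)
 have "free_part (D0 T x) = D0 T (free_part x)" for x :: "('m, 'a) loc"
 proof (induction x rule: mon_induct)
  case (mult g x)
  show ?case
  proof (cases "is_field g")
   case True
   hence "free_part (gen g) = 0" "free_part (D0 T (gen g)) = 0"
    using J by (cases g; simp add: comp_hom_if[OF hom_gen] fielded_def)+
   thus ?thesis by (simp add: drv_gen_mult[OF drv_D0] free_part_mult)
  next
   case False
   hence "free_part (gen g) = gen g" "free_part (D0 T (gen g)) = D0 T (gen g)"
    using field_free_ops(2)[OF field_free_gen[OF False], of T] by (simp_all add: comp_hom_if[OF hom_gen] comp_hom field_free_hom)
   thus ?thesis using mult by (simp add: drv_gen_mult[OF drv_D0] free_part_mult)
  qed
 qed (simp_all add: drv_one[OF drv_D0] comp_hom[OF hom_one])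
 thus ?thesis using assms by (simp add: fielded_def)
qed

subsection \<open>Traces of the ghost\<close>

lemma ladder_form_0: "ladder_form A 0 a = (gen (fld A a) :: ('m::finite, 'a) loc)"
 using ladder_form_gpart[of A 0 a] by (simp add: gpart_superfield_0)

lemma c_matrix_nth: "c_matrix T $ i $ j = (\<Sum>a. T a $ i $ j *: (ghost a :: ('m::finite, 'a::finite) loc))"
 by (simp add: c_matrix_def ladder_form_0)

abbreviation c_power :: "('a::finite \<Rightarrow> complex^'N^'N) \<Rightarrow> nat \<Rightarrow> ('m::finite, 'a) loc^'N^'N"
 where "c_power T k \<equiv> ((\<lambda>X. c_matrix T ** X) ^^ k) (mat 1)"

context gauge_algebra
begin

text \<open>The invariants of \<open>c_invariant\<close> in terms of \<open>rot\<close> and the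
  gradings (\<open>c_invariant_ghost\<close>).\<close>

definition ghost_invariant :: "nat \<Rightarrow> ('m::finite, 'a) loc \<Rightarrow> bool"
 where "ghost_invariant k x \<longleftrightarrow> over (range (fld One)) x \<and> hom (fw One) (int k) x \<and> (\<forall>e. rot T One e x = 0)"

text \<open>The rotation acts on the matrix c as the commutator with \<open>T e\<close>. This
  persists for powers, and the trace of such a commutator vanishes.\<close>

lemma rot_c_matrix:
 "rot T One e (c_matrix T $ i $ j) = (\<Sum>l. T e $ i $ l *: c_matrix T $ l $ j) - (\<Sum>l. T e $ l $ j *: (c_matrix T $ i $ l :: ('m::finite, 'a) loc))"
proof -
 have c: "(\<Sum>a. f e b a * T a $ i $ j) = (\<Sum>l. T e $ i $ l * T b $ l $ j) - (\<Sum>l. T b $ i $ l * T e $ l $ j)" for b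
 proof -
  have "commutator (T e) (T b) $ i $ j = lie_elem T (f e b) $ i $ j" by (simp only: commutator_T)
  thus ?thesis by (simp add: commutator_def lie_elem_eq matrix_matrix_mult_def)
 qed
 have "rot T One e (c_matrix T $ i $ j) = (\<Sum>b. (\<Sum>a. f e b a * T a $ i $ j) *: (ghost b))"
  unfolding c_matrix_nth by (simp add: smult_sum_right smult_sum_left mult.commute) (rule sum.swap)
 also have "\<dots> = (\<Sum>b l. (T e $ i $ l * T b $ l $ j) *: ghost b) - (\<Sum>b l. (T e $ l $ j * T b $ i $ l) *: (ghost b))"
  unfolding c by (simp add: smult_dist smult_sum_left sum_subtractf mult.commute)
 also have "\<dots> = (\<Sum>l. T e $ i $ l *: c_matrix T $ l $ j) - (\<Sum>l. T e $ l $ j *: c_matrix T $ i $ l)"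
  unfolding c_matrix_nth smult_sum_right by (subst (1 2) sum.swap) simp
 finally show ?thesis .
qed

lemma rot_c_power:
 "rot T One e (c_power T k $ i $ j) = (\<Sum>l. T e $ i $ l *: c_power T k $ l $ j) - (\<Sum>l. T e $ l $ j *: (c_power T k $ i $ l :: ('m::finite, 'a) loc))"
proof (induction k arbitrary: i j)
 case 0
 have "(\<Sum>l. T e $ i $ l *: (if l = j then 1 else 0)) = T e $ i $ j *: (1 :: ('m, 'a) loc)"
  "(\<Sum>l. T e $ l $ j *: (if i = l then 1 else 0)) = T e $ i $ j *: (1 :: ('m, 'a) loc)"
  by (simp_all add: if_distrib[of "\<lambda>z. _ *: z"] cong: if_cong)
 thus ?case by (simp add: mat_def drv_one[OF drv_rot])
next
 case (Suc k)
 let ?X = "c_matrix T :: ('m, 'a) loc^'N^'N" and ?M = "c_power T k :: ('m, 'a) loc^'N^'N"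
 have M: "c_power T (Suc k) $ i $ j = (\<Sum>p. ?X $ i $ p * ?M $ p $ j)" for i j
  by (simp add: matrix_matrix_mult_def)
 have "rot T One e (c_power T (Suc k) $ i $ j) =
  ((\<Sum>p l. T e $ i $ l *: (?X $ l $ p * ?M $ p $ j)) - (\<Sum>p l. T e $ l $ p *: (?X $ i $ l * ?M $ p $ j))) +
  ((\<Sum>p l. T e $ p $ l *: (?X $ i $ p * ?M $ l $ j)) - (\<Sum>p l. T e $ l $ j *: (?X $ i $ p * ?M $ p $ l)))"
  unfolding M by (simp add: drv_even_mult[OF drv_rot] rot_c_matrix Suc.IH left_diff_distrib right_diff_distrib
   sum_distrib_left sum_distrib_right sum.distrib sum_subtractf)
 also have "(\<Sum>p l. T e $ l $ p *: (?X $ i $ l * ?M $ p $ j)) = (\<Sum>p l. T e $ p $ l *: (?X $ i $ p * ?M $ l $ j))"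
  by (rule sum.swap)
 also have "(\<Sum>p l. T e $ i $ l *: (?X $ l $ p * ?M $ p $ j)) = (\<Sum>l. T e $ i $ l *: c_power T (Suc k) $ l $ j)"
  unfolding M smult_sum_right by (rule sum.swap)
 also have "(\<Sum>p l. T e $ l $ j *: (?X $ i $ p * ?M $ p $ l)) = (\<Sum>l. T e $ l $ j *: c_power T (Suc k) $ i $ l)"
  unfolding M smult_sum_right by (rule sum.swap)
 finally show ?case by simp
qed

lemma ghost_invariant_trace_power: "ghost_invariant k (trace_power T k :: ('m::finite, 'a) loc)"
proof -
 have m: "over (range (fld One)) (c_power T k $ i $ j :: ('m, 'a) loc) \<and> hom (fw One) (int k) (c_power T k $ i $ j :: ('m, 'a) loc)" for k i j
 proof (induction k arbitrary: i j)
  case (Suc k)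
  have x: "over (range (fld One)) (c_matrix T $ i $ p :: ('m, 'a) loc)" "hom (fw One) 1 (c_matrix T $ i $ p :: ('m, 'a) loc)" for p
   unfolding c_matrix_nth by (auto intro!: over_sum over_smult over_gen hom_sum hom_smult hom_gen')
  have "hom (fw One) (1 + int k) (c_matrix T $ i $ p * c_power T k $ p $ j :: ('m, 'a) loc)" for p
   by (rule hom_mult[OF x(2)]) (simp add: Suc)
  thus ?case using x(1) Suc by (auto simp: matrix_matrix_mult_def intro!: over_sum over_mult hom_sum)
 qed (simp add: mat_def)
 have "rot T One e (trace_power T k) = (0 :: ('m, 'a) loc)" for e
 proof -
  have "rot T One e (trace_power T k) = (\<Sum>i l. T e $ i $ l *: c_power T k $ l $ i) - (\<Sum>i l. T e $ l $ i *: (c_power T k $ i $ l :: ('m, 'a) loc))"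
   by (simp add: trace_power_def trace_def rot_c_power sum_subtractf)
  also have "(\<Sum>i l. T e $ i $ l *: (c_power T k $ l $ i :: ('m, 'a) loc)) = (\<Sum>i l. T e $ l $ i *: c_power T k $ i $ l)"
   by (rule sum.swap)
  finally show ?thesis by simp
 qed
 thus ?thesis unfolding ghost_invariant_def using m
  by (auto simp: trace_power_def trace_def intro!: over_sum hom_sum)
qed

lemma ghost_invariant_superposition: "ghost_invariant k (trace_superposition T k \<alpha> :: ('m::finite, 'a) loc)"
proof -
 have "ghost_invariant (sum_list ns) (trace_product T ns :: ('m, 'a) loc)" for ns
 proof (induction ns)
  case Nil
  thus ?case by (simp add: ghost_invariant_def trace_product_def drv_one[OF drv_rot])
 next
  case (Cons k ns)
  have "hom (fw One) (int k + int (sum_list ns)) (trace_power T k * trace_product T ns :: ('m, 'a) loc)"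
   using Cons ghost_invariant_trace_power[of k] by (intro hom_mult) (auto simp: ghost_invariant_def)
  thus ?case using Cons ghost_invariant_trace_power[of k]
   by (auto simp: ghost_invariant_def trace_product_def drv_even_mult[OF drv_rot] intro: over_mult)
 qed
 thus ?thesis
  unfolding trace_superposition_def ghost_invariant_def cst_mult_conv
  by (auto simp: odd_compositions_def intro!: over_sum over_smult hom_sum hom_smult)
qed

text \<open>The trace vanishes on commutators; as the algebra has no centre, this makes it vanish on
  each \<open>T a\<close>.\<close>

lemma trace_power_1: "trace_power T 1 = (0 :: ('m::finite, 'a) loc)"
proof -
 have "(\<Sum>i. T a $ i $ i) = 0" for a
 proof -
  have "(\<Sum>e. f b c e * trace (T e)) = 0" for b c
  proof -
   have "trace (commutator (T b) (T c)) = 0" by (simp add: commutator_def trace_sub trace_mul_sym[of "T b"])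
   moreover have "trace (lie_elem T z) = (\<Sum>e. z e * trace (T e))" for z
    using trace_lie_elem[of T z "mat 1"] by simp
   ultimately show ?thesis by (simp add: commutator_T)
  qed
  hence "(\<Sum>e. f b e c * trace (T e)) = 0" for b c by (simp add: f_antisym'[of b _ c] sum_negf)
  thus ?thesis using center_trivial[of "\<lambda>e. trace (T e)"] by (simp add: trace_def)
 qed
 moreover have "trace_power T 1 = (\<Sum>a. (\<Sum>i. T a $ i $ i) *: (ghost a :: ('m, 'a) loc))"
  by (simp add: trace_power_def trace_def c_matrix_nth smult_sum_left) (rule sum.swap)
 ultimately show ?thesis by simp
qed

text \<open>Odd numbers with sum 4 include a 1, because two parts of size at least 3 exceed 4; and
  Tr c = 0.\<close>

lemma trace_superposition_4: "trace_superposition T 4 \<alpha> = (0 :: ('m::finite, 'a) loc)"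
 unfolding trace_superposition_def
proof (rule sum.neutral, rule ballI)
 fix ns assume ns: "ns \<in> odd_compositions 4"
 have "1 \<in> set ns"
 proof (rule ccontr)
  assume n: "1 \<notin> set ns"
  have g: "i \<ge> 3 \<and> i \<noteq> 4" if "i \<in> set ns" for i
  proof -
   have "odd i" "i \<noteq> 1" using that n ns by (auto simp: odd_compositions_def)
   thus ?thesis by presburger
  qed
  have s: "sum_list ns = 4" using ns by (simp add: odd_compositions_def)
  then obtain a l where a: "ns = a # l" by (cases ns) auto
  then obtain b l' where "l = b # l'" using g[of a] s by (cases l) auto
  thus False using g[of a] g[of b] s a by simp
 qed
 moreover have "prod_list xs = (0 :: ('m, 'a) loc)" if "0 \<in> set xs" for xs using that by (induction xs) auto
 ultimately have "trace_product T ns = (0 :: ('m, 'a) loc)"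
  unfolding trace_product_def by (metis image_eqI list.set_map trace_power_1)
 thus "cst (\<alpha> ns) * trace_product T ns = (0 :: ('m, 'a) loc)" by simp
qed

lemma c_invariant_ghost: assumes "ghost_invariant k (x :: ('m::finite, 'a) loc)" shows "c_invariant T k x"
 unfolding c_invariant_def
proof (intro conjI ballI allI)
 have x: "over (range (fld One)) x" "hom (fw One) (int k) x" "rot T One e x = 0" for e
  using assms by (auto simp: ghost_invariant_def)
 fix m assume m: "m \<in> supp x"
 hence s: "set_mset m \<subseteq> range (fld One)" using x(1) by (auto simp: over_def)
 thus "\<exists>a. g = fld One a" if "g \<in># m" for g using that by auto
 have "wt (fw One) m = int (size m)" using s by (induction m) auto
 thus "size m = k" using x(2) m by (auto simp: hom_def)
next
 fix e
 let ?D = "der (\<lambda>g. case g of Jet One a I S \<Rightarrow> \<Sum>b. cst (f e b a) * gen (Jet One b I S) | _ \<Rightarrow> 0) :: ('m, 'a) loc \<Rightarrow> _"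
 have "drv False ?D"
  by (rule graded_values.drv_der, unfold_locales)
   (auto simp: smult_sum_right mult.commute split: symb.split ladder.split)
 hence "?D x = rot T One e x"
  by (rule drv_eq_over[OF _ drv_rot, where G = "range (fld One)"]) (use assms in \<open>auto simp: ghost_invariant_def cst_mult_conv\<close>)
 also have "\<dots> = 0" using assms by (simp add: ghost_invariant_def)
 finally show "?D x = 0" .
qed

end

subsection \<open>The ladder\<close>

lemma lin_climb: "lin (climb :: ('m::finite, 'a::finite) loc \<Rightarrow> _)"
 unfolding climb_def by (intro lin_neg lin_summ lin_multl drv_lin[OF drv_susy])

lemmas climb_lin [simp] = lin_simps[OF lin_climb]

lemma susy_climb: "susy_comp \<mu> (climb x) = climb (susy_comp \<mu> (x :: ('m::finite, 'a::finite) loc))"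
proof -
 have "susy_comp \<mu> (susy_comp \<nu> x) = - susy_comp \<nu> (susy_comp \<mu> x)" for \<nu>
  using susy_anticomm[of \<mu> \<nu> x] by (simp add: add_eq_0_iff2)
 thus ?thesis by (simp add: climb_def drv_odd_mult[OF drv_susy] sum_negf)
qed

lemma ix_climb: "ix \<mu> (climb x) = climb (ix \<mu> x) - susy_comp \<mu> (x :: ('m::finite, 'a::finite) loc)"
proof -
 have i: "ix \<mu> (susy_comp \<nu> x) = - susy_comp \<nu> (ix \<mu> x)" for \<nu>
  using vder_ix[OF vder_susy, of \<nu> \<mu> x] by simp
 have "ix \<mu> (gen (Dx \<nu>) * susy_comp \<nu> x) = (if \<nu> = \<mu> then susy_comp \<mu> x else 0) + gen (Dx \<nu>) * susy_comp \<nu> (ix \<mu> x)" for \<nu>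
  by (simp add: drv_odd_mult[OF drv_ix] i)
 thus ?thesis by (simp add: climb_def sum.distrib)
qed

lemma climb_funpow: "susy_comp \<mu> ((climb ^^ k) x) = (climb ^^ k) (susy_comp \<mu> (x :: ('m::finite, 'a::finite) loc))"
 by (induction k) (simp_all add: susy_climb)

text \<open>One climb beyond the top degree gives zero. Contracting this with \<open>ix\<close>
  produces a nonzero multiple of the claim by \<open>ix_climb\<close>.\<close>

lemma susy_climb_top:
 assumes "hom fdeg 0 (x :: ('m::finite, 'a::finite) loc)"
 shows "susy_comp \<mu> ((climb ^^ CARD('m)) x) = 0"
proof -
 have "hom fdeg (int k) ((climb ^^ k) x)" for k
  by (induction k) (auto simp: assms intro: form.hom_climb)
 hence z: "(climb ^^ Suc CARD('m)) x = 0" by (rule hom_form_top[rotated]) simp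
 have "hom fdeg (0 - 1) (ix \<mu> x)" by (rule hom_form_ix[OF assms])
 hence "ix \<mu> x = 0" by (intro hom_neg[of fdeg "- 1"]) (simp_all add: fdeg_def)
 hence "ix \<mu> ((climb ^^ Suc j) x) = - (of_nat (Suc j) *: (climb ^^ j) (susy_comp \<mu> x))" for j
 proof (induction j)
  case (Suc j)
  let ?W = "climb ((climb ^^ j) (susy_comp \<mu> x))"
  have 1: "ix \<mu> ((climb ^^ Suc (Suc j)) x) = climb (ix \<mu> ((climb ^^ Suc j) x)) - susy_comp \<mu> ((climb ^^ Suc j) x)"
   by (simp add: ix_climb)
  have 2: "climb (ix \<mu> ((climb ^^ Suc j) x)) = - (of_nat (Suc j) *: ?W)" by (simp only: Suc climb_lin)
  have 3: "susy_comp \<mu> ((climb ^^ Suc j) x) = ?W" by (simp add: susy_climb climb_funpow)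
  have "- (of_nat (Suc j) *: ?W) - ?W = - (of_nat (Suc (Suc j)) *: ?W)" by (rule salg_eqI) (simp add: algebra_simps)
  thus ?case unfolding 1 2 3 by simp
 qed (simp add: ix_climb)
 from this[of "CARD('m)"] show ?thesis unfolding z by (simp add: climb_funpow del: of_nat_Suc)
qed

text \<open>Split \<open>Zop\<close> into \<open>climb\<close>, which raises the form degree by one,
  and \<open>E\<close>, which preserves it and commutes with \<open>climb\<close>. With D the
  dimension, the top form of Z^k P is a binomial multiple of climb^D E^(k - D) P; since
  \<open>E\<close> annihilates climb^D P by \<open>susy_climb_top\<close>, only k = D
  contributes.\<close>

lemma ladder_top:
 assumes P: "hom fdeg 0 (P :: ('m::finite, 'a::finite) loc)" "b_shift P = 0"
 shows "gpart fdeg (int CARD('m)) (expZ (-1) P) = ((-1) ^ CARD('m) / fact CARD('m)) *: (climb ^^ CARD('m)) P"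
proof -
 let ?D = "CARD('m)"
 define E where "E y = Zop y - climb y" for y :: "('m, 'a) loc"
 have E: "E y = (\<Sum>\<mu>. gen (Eps \<mu>) * susy_comp \<mu> y) + b_shift y" for y
  by (simp add: E_def Zop_def climb_def left_diff_distrib sum_subtractf)
 have linE: "lin E" unfolding E_def by (intro lin_minus drv_lin[OF drv_Zop] lin_climb)
 have hE: "hom fdeg (k + 0) (E y)" if "hom fdeg k y" for k y
  unfolding E using form.hom_susy[OF that] that
  by (intro hom_add hom_sum hom_gen_mult) (auto intro: form.hom_b_shift)
 have "Zop (climb y) = climb (Zop y)" for y :: "('m, 'a) loc"
  by (simp add: climb_def drv_even_mult[OF drv_Zop] Zop_gen Zop_susy)
 hence c: "E (climb y) = climb (E y)" for y by (simp add: E_def)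
 have cp: "E ((climb ^^ j) y) = (climb ^^ j) (E y)" for j y by (induction j) (simp_all add: c)
 have gE: "gpart fdeg k (E y) = E (gpart fdeg k y)" for k y
  using lin_comp_comm[OF linE hE, of k y] by simp
 have gc: "gpart fdeg k (climb y) = climb (gpart fdeg (k - 1) y)" for k and y :: "('m, 'a) loc"
 proof -
  have "climb (gpart fdeg (k - 1) y) = gpart fdeg (k - 1 + 1) (climb y)"
   by (rule lin_comp_comm[OF lin_climb]) (auto intro: form.hom_climb)
  thus ?thesis by simp
 qed
 have Z: "Zop y = climb y + E y" for y by (simp add: E_def)
 have binom: "gpart fdeg (int j) ((Zop ^^ k) P) = of_nat (k choose j) *: (climb ^^ j) ((E ^^ (k - j)) P)" for j k
 proof (induction k arbitrary: j)
  case 0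
  thus ?case by (cases j) (auto simp: comp_hom_if[OF P(1)])
 next
  case (Suc k)
  show ?case
  proof (cases j)
   case 0
   have "gpart fdeg 0 ((Zop ^^ k) P) = (E ^^ k) P" using Suc[of 0] by simp
   thus ?thesis by (simp add: 0 Z[of "(Zop ^^ k) P"] gc gE comp_form_neg)
  next
   case (Suc i)
   have "of_nat (k choose Suc i) *: (climb ^^ Suc i) (E ((E ^^ (k - Suc i)) P)) = of_nat (k choose Suc i) *: (climb ^^ Suc i) ((E ^^ (k - i)) P)"
   proof (cases "Suc i \<le> k")
    case True
    hence "k - i = Suc (k - Suc i)" by simp
    thus ?thesis by simp
   qed simp
   thus ?thesis using Suc.IH[of i] Suc.IH[of "Suc i"]
    by (simp add: Suc Z[of "(Zop ^^ k) P"] gc gE lin_simps[OF linE] c cp smult_dist)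
  qed
 qed
 have "b_shift ((climb ^^ j) P) = 0" for j
 proof (induction j)
  case (Suc j)
  thus ?case by (simp add: climb_def drv_even_mult[OF drv_b_shift] b_shift_susy)
 qed (simp add: P)
 hence E0: "E ((climb ^^ ?D) P) = 0" unfolding E by (simp add: susy_climb_top[OF P(1)])
 have van: "(climb ^^ ?D) ((E ^^ Suc m) P) = 0" for m
 proof -
  have "(climb ^^ ?D) ((E ^^ i) y) = (E ^^ i) ((climb ^^ ?D) y)" for i y by (induction i) (simp_all add: cp[symmetric])
  moreover have "(climb ^^ ?D) (E P) = 0" using cp[of ?D P] E0 by simp
  ultimately show ?thesis by (simp add: funpow_Suc_right lin_simps[OF lin_funpow[OF linE]] del: funpow.simps)
 qed
 obtain n0 where "(Zop ^^ n0) P = 0" using lnil_Zop unfolding lnil_def by blast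
 hence n: "(Zop ^^ (max n0 (Suc ?D))) P = 0" by (rule funpow_zero_mono[OF drv_lin[OF drv_Zop]]) simp
 let ?n = "max n0 (Suc ?D)"
 have "gpart fdeg (int ?D) (expZ (-1) P) = (\<Sum>k<?n. ((-1) ^ k / fact k) *: (of_nat (k choose ?D) *: (climb ^^ ?D) ((E ^^ (k - ?D)) P)))"
  unfolding expo_eq[OF drv_lin[OF drv_Zop] n] by (simp only: comp_simps binom)
 also have "\<dots> = (\<Sum>k<?n. if k = ?D then ((-1) ^ ?D / fact ?D) *: (climb ^^ ?D) P else 0)"
 proof (rule sum.cong[OF refl])
  fix k
  consider "k < ?D" | "k = ?D" | m where "k = ?D + Suc m" by (metis less_imp_Suc_add add_Suc_right nat_neq_iff)
  thus "((-1) ^ k / fact k) *: (of_nat (k choose ?D) *: (climb ^^ ?D) ((E ^^ (k - ?D)) P)) = (if k = ?D then ((-1) ^ ?D / fact ?D) *: (climb ^^ ?D) P else 0)"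
  proof cases
   case (3 m)
   hence "k - ?D = Suc m" by simp
   thus ?thesis using 3 by (simp only: van) simp
  qed simp_all
 qed
 finally show ?thesis by (simp add: less_max_iff_disj)
qed

lemma ladder_superposition_eq:
 "ladder_superposition T k \<alpha> = (1 / fact CARD('m)) *: (climb ^^ CARD('m)) (trace_superposition T k \<alpha> :: ('m::finite, 'a::finite) loc)"
 by (simp add: ladder_superposition_def trace_superposition_def lin_simps[OF lin_funpow[OF lin_climb]] smult_sum_right mult.commute)

lemma ladder_superposition_scale:
 "ladder_superposition T k (\<lambda>ns. c * \<alpha> ns) = c *: (ladder_superposition T k \<alpha>)"
 by (simp add: ladder_superposition_def smult_sum_right)

subsection \<open>Descent\<close>

lemma fielded_gpart: "fielded x \<Longrightarrow> fielded (gpart w k x)"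
 unfolding gpart_def[of w] by (rule fielded_lin)

lemma field_free_gpart: "field_free x \<Longrightarrow> field_free (gpart w k x)"
 unfolding gpart_def[of w] by (rule field_free_lin)

lemma gpart_all_zero: "(\<And>k. gpart w k x = 0) \<Longrightarrow> x = 0"
proof (rule salg_eqI)
 fix m assume "\<And>k. gpart w k x = 0"
 hence "coef (gpart w (wt w m) x) m = 0" by simp
 thus "coef x m = coef 0 m" by simp
qed

lemma gpart_top: "k > int CARD('m) \<Longrightarrow> gpart fdeg k x = (0 :: ('m::finite, 'a) loc)"
 by (rule hom_form_top[OF _ hom_comp])

text \<open>The descent equations in components: \<open>coboundary\<close> preserves the form degree
  and d raises it by one.\<close>

lemma gpart_Dtot: "gpart fdeg k (Dtot T x) = coboundary T (gpart fdeg k x) + dext (gpart fdeg (k - 1) (x :: ('m::finite, 'a::finite) loc))"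
proof -
 have "coboundary T (gpart fdeg k x) = gpart fdeg (k + 0) (coboundary T x)"
  using form.hom_coboundary[where 'a = 'a and 'm = 'm] by (intro lin_comp_comm[OF drv_lin[OF drv_coboundary]]) simp
 thus ?thesis by (simp add: Dtot_def gpart_dext)
qed

lemma free_part_dext: "free_part (dext x) = (0 :: ('m::finite, 'a::finite) loc)"
 by (simp add: fielded_gpart_dext field_free_ops(1))

lemma fielded_exact:
 assumes "fielded x" "x = dext \<eta> + z" "field_free (z :: ('m::finite, 'a::finite) loc)"
 shows "x = dext \<eta>"
 using assms(2) assms by (auto simp: free_part_dext fielded_def comp_hom field_free_hom)

abbreviation forms :: "('m::finite \<Rightarrow> 'm \<Rightarrow> real) set \<Rightarrow> int \<Rightarrow> int \<Rightarrow> ('m, 'a::finite) loc set"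
 where "forms \<Lambda>s p k \<equiv> {x. fielded x \<and> hom fdeg p x \<and> good \<Lambda>s k x}"

lemma inv_space_forms: "salg.inv_space Xiop (forms \<Lambda>s p k :: ('m::finite, 'a::finite) loc set)"
proof -
 have "Xiop x \<in> forms \<Lambda>s p k" if "x \<in> forms \<Lambda>s p k" for x :: "('m, 'a) loc"
 proof -
  have x: "fielded x" "hom fdeg p x" "good \<Lambda>s k x" using that by auto
  have "hom fdeg p (dext (khop x))"
   by (rule form.hom_dext[OF form.hom_khop[OF _ x(2)]]) simp_all
  moreover have "hom fdeg (p + 1 - 1) (khop (dext x))"
   by (rule form.hom_khop[OF _ form.hom_dext[OF x(2)]]) simp_all
  moreover have "good \<Lambda>s k (dext (khop x))" "good \<Lambda>s k (khop (dext x))"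
   using good_tdeg(4)[OF good_tdeg(3)[OF x(3)]] good_tdeg(3)[OF good_tdeg(4)[OF x(3)]] by simp_all
  ultimately show ?thesis unfolding Xiop_def using x(1) by (auto intro: fielded_lin fielded_dext fielded_khop hom_add good_lin)
 qed
 thus ?thesis unfolding salg.inv_space_def
  by (auto intro: fielded_lin hom_add hom_smult good_lin)
qed

text \<open>The primitive can be chosen with the degree and invariance of \<open>x\<close>, whatever
  \<open>\<eta>\<close> is: in the decomposition of \<open>x\<close> the part in the kernel of
  \<open>Xiop\<close> is exact as well, hence zero.\<close>

lemma top_exact:
 fixes x :: "('m::finite, 'a::finite) loc"
 assumes "x \<in> forms \<Lambda>s (int CARD('m)) k" "x = dext \<eta> + z" "field_free z"
 shows "\<exists>\<xi>\<in>forms \<Lambda>s (int CARD('m)) k. x = dext (khop \<xi>)"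
proof -
 let ?S = "forms \<Lambda>s (int CARD('m)) k :: ('m, 'a) loc set"
 have "\<exists>x0\<in>?S. \<exists>x1\<in>?S. x = x0 + dext (khop x1) \<and> Xiop x0 = 0"
  by (rule top_decomposition[OF _ _ inv_space_forms assms(1)]) (use assms(1) in auto)
 then obtain x0 x1 where x: "x0 \<in> ?S" "x1 \<in> ?S" "x = x0 + dext (khop x1)" "Xiop x0 = 0" by blast
 have "x0 = x - dext (khop x1)" using x(3) by simp
 hence "x0 = dext (\<eta> - khop x1) + z" unfolding assms(2) by simp
 hence "x0 = dext (\<eta> - khop x1)" using fielded_exact x(1) assms(3) by blast
 hence "x0 = 0" using exact_top_zero[of x0] x(1,4) by blast
 thus ?thesis using x(2,3) by auto
qed

lemma field_free_Dtot: "field_free x \<Longrightarrow> field_free (Dtot T (x :: ('m::finite, 'a::finite) loc))"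
 by (simp add: Dtot_def field_free_ops)

text \<open>Induction on a bound for the form degree. The highest component is closed, because its
  differential is the next component of \<open>Dtot T r\<close>, which is field-independent.
  Subtracting \<open>Dtot\<close> of a primitive removes it and changes only the component below;
  field-independent terms are collected in z.\<close>

lemma (in gauge_algebra) descent:
 fixes r :: "('m::finite, 'a) loc"
 assumes "fielded r" "\<And>k. k \<ge> int q \<Longrightarrow> gpart fdeg k r = 0" "q \<le> CARD('m)" "good \<Lambda>s k r" "field_free (Dtot T r)"
 shows "\<exists>y z. r = Dtot T y + z \<and> field_free z \<and> good \<Lambda>s (k - 1) y \<and> (\<forall>j\<ge>int CARD('m). gpart fdeg j y = 0)"
 using assms
proof (induction q arbitrary: r)
 case 0
 have "gpart fdeg k r = 0" for k using 0(2)[of k] comp_form_neg[of k r] by (cases "k \<ge> 0") auto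
 hence "r = 0" by (rule gpart_all_zero)
 thus ?case by (intro exI[of _ 0]) (simp add: field_free_lin good_lin)
next
 case (Suc q)
 let ?a = "gpart fdeg (int q) r"
 have q: "q < CARD('m)" using Suc.prems(3) by simp
 have a: "?a \<in> forms \<Lambda>s (int q) k"
  using Suc.prems(1,4) by (auto intro: hom_comp fielded_gpart form.good_gpart)
 have "dext ?a = gpart fdeg (int q + 1) (Dtot T r)"
  using Suc.prems(2)[of "int q + 1"] by (simp add: gpart_Dtot)
 hence "field_free (dext ?a)" using Suc.prems(5) by (simp add: field_free_gpart)
 hence "dext ?a = 0" using a by (intro fielded_free fielded_dext) auto
 then obtain x where x: "x \<in> forms \<Lambda>s (int q) k" "?a = dext (khop x)"
  using poincare[OF _ _ q _ inv_space_forms a] a by auto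
 let ?y = "khop x"
 have hy: "hom fdeg (int q - 1) ?y" using form.hom_khop[of "int q" x] x(1) by simp
 have gy: "good \<Lambda>s (k - 1) ?y" using x(1) by (auto intro: good_tdeg)
 let ?r = "r - Dtot T ?y"
 let ?s = "?r - free_part ?r"
 have gr: "good \<Lambda>s k ?r" using good_tdeg(7)[OF gy, of T] Suc.prems(4) by (simp add: good_lin)
 have "gpart fdeg j ?r = 0" if "j \<ge> int q" for j
 proof (cases "j = int q")
  case True
  thus ?thesis using hy x(2) by (simp add: gpart_Dtot comp_hom_if)
 next
  case False
  thus ?thesis using hy that Suc.prems(2)[of j]
   by (simp add: gpart_Dtot comp_hom_if)
 qed
 hence "gpart fdeg j ?s = 0" if "j \<ge> int q" for j
  using that by (simp add: gpart_gpart_comm[of fdeg j fldeg])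
 moreover have "field_free (Dtot T ?s)"
  using Suc.prems(5) field_free_Dtot[OF field_free_part, of T ?r]
  by (simp add: Dtot_Dtot field_free_lin)
 moreover have "good \<Lambda>s k ?s" using gr good_free_part[OF gr] by (simp add: good_lin)
 ultimately obtain y z where y: "?s = Dtot T y + z" "field_free z" "good \<Lambda>s (k - 1) y" "\<And>j. j \<ge> int CARD('m) \<Longrightarrow> gpart fdeg j y = 0"
  using Suc.IH[of ?s] fielded_compl[of ?r] q by auto
 have "r = ?s + Dtot T ?y + free_part ?r" by simp
 hence "r = Dtot T (?y + y) + (z + free_part ?r)" unfolding y(1) by (simp add: algebra_simps)
 moreover have "gpart fdeg j (?y + y) = 0" if "j \<ge> int CARD('m)" for j
  using y(4)[OF that] that hy q by (simp add: comp_hom_if)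
 ultimately show ?case using y(2,3) gy
  by (intro exI[of _ "?y + y"] exI[of _ "z + free_part ?r"]) (simp add: field_free_lin good_lin)
qed

subsection \<open>The cohomology\<close>

lemma eq_functional_iff: "x \<simeq> y \<longleftrightarrow> (\<exists>\<eta> z. field_free z \<and> x = y + dext \<eta> + z)"
 unfolding eq_functional_def by (metis (no_types, opaque_lifting) add.assoc add_diff_cancel_left' diff_add_cancel add.commute)

lemma local_functional_iff:
 "local_functional \<eta> (x :: ('m::finite, 'a::finite) loc) \<longleftrightarrow>
  hom fdeg (int CARD('m)) x \<and> fielded x \<and> (\<forall>\<Lambda>\<in>lorentz_algebra \<eta>. lorentz_op \<Lambda> x \<simeq> 0)"
proof -
 have w: "wt fldeg m = 0 \<longleftrightarrow> \<not> (\<exists>g\<in>#m. is_field g)" for m :: "('m, 'a) symb multiset"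
 proof (induction m)
  case (add g m)
  moreover have "wt fldeg m \<ge> 0" by (rule wt_nonneg) (simp add: fldeg_def)
  ultimately show ?case by (cases "is_field g") auto
 qed simp
 have "fielded x \<longleftrightarrow> (\<forall>m. wt fldeg m = 0 \<longrightarrow> coef x m = 0)"
  by (metis fielded_def coef_comp coef_zero salg_eqI)
 hence "fielded x \<longleftrightarrow> (\<forall>m\<in>supp x. \<exists>g\<in>#m. is_field g)" by (auto simp: supp_iff w)
 thus ?thesis unfolding local_functional_def by (auto simp: hom_def wt_form)
qed

lemma homogeneous_gh_iff: "homogeneous_gh k x \<longleftrightarrow> hom gh k x"
 by (simp add: homogeneous_gh_def hom_def wt_def)

lemma hom_gh_tdeg: "hom fdeg p x \<Longrightarrow> hom gh k x \<longleftrightarrow> hom tdeg (k + p) x"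
 by (auto simp: hom_def wt_tdeg)

context gauge_algebra
begin

lemma ghost_invariant_gradings:
 fixes P :: "('m::finite, 'a) loc"
 assumes "ghost_invariant k P"
 shows "hom fdeg 0 P" "hom gh (int k) P" "hom fldeg (int k) P" "lorentz_op \<Lambda> P = 0" "b_shift P = 0"
  "D0 T P = 0" "ghost_alg P" "rot T A e P = 0"
proof -
 have o: "over (range (fld One)) P" and h: "hom (fw One) (int k) P" and r: "\<And>e. rot T One e P = 0"
  using assms by (auto simp: ghost_invariant_def)
 have w: "wt fdeg m = 0 \<and> wt gh m = wt (fw One) m \<and> wt fldeg m = wt (fw One) m" if "set_mset m \<subseteq> range (fld One)" for m :: "('m, 'a) symb multiset"
  using that by (induction m) auto
 thus "hom fdeg 0 P" "hom gh (int k) P" "hom fldeg (int k) P"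
  using o h by (auto simp: hom_def over_def)
 show "lorentz_op \<Lambda> P = 0" by (rule drv_zero_over[OF drv_lor _ o]) auto
 show "b_shift P = 0" by (rule drv_zero_over[OF drv_b_shift _ o]) auto
 show "D0 T P = 0" by (simp add: D0_ghosts[OF o] r)
 show "ghost_alg P" by (rule over_fld_ghost_alg[OF o])
 show "rot T A e P = 0"
 proof (cases A)
  case Two
  show ?thesis unfolding Two by (rule drv_zero_over[OF drv_rot _ o]) auto
 qed (simp add: r)
qed

definition ladder :: "('m::finite, 'a) loc \<Rightarrow> ('m, 'a) loc"
 where "ladder P = (1 / fact CARD('m)) *: (climb ^^ CARD('m)) P"

lemma ladder_eq: "ghost_invariant k (P :: ('m::finite, 'a) loc) \<Longrightarrow> gpart fdeg (int CARD('m)) (expZ (-1) P) = (-1) ^ CARD('m) *: ladder P"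
 using ladder_top[of P] ghost_invariant_gradings(1,5)[of k P] by (simp add: ladder_def)

text \<open>\<open>Dtot\<close> annihilates e^(-Z) P because \<open>D0\<close> annihilates the
  invariant P; the component of top form degree of this equation says that \<open>coboundary\<close>
  of the ladder is a total derivative.\<close>

lemma ladder_cocycle:
 fixes P :: "('m::finite, 'a) loc"
 assumes P: "ghost_invariant k P"
 shows "hom fdeg (int CARD('m)) (ladder P)" "hom gh (int k - int CARD('m)) (ladder P)" "k > 0 \<Longrightarrow> fielded (ladder P)"
  "lorentz_op \<Lambda> (ladder P) = 0" "coboundary T (ladder P) \<simeq> 0"
proof -
 have "hom fdeg (int j) ((climb ^^ j) P)" "hom gh (int k - int j) ((climb ^^ j) P)" "hom fldeg (int k) ((climb ^^ j) P)"
  "lorentz_op \<Lambda> ((climb ^^ j) P) = 0" for j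
 proof (induction j)
  case (Suc j)
  show "hom fdeg (int (Suc j)) ((climb ^^ Suc j) P)" "hom gh (int k - int (Suc j)) ((climb ^^ Suc j) P)"
   by (auto intro!: form.hom_climb[OF Suc(1)] gh.hom_climb[OF Suc(2)])
  have "nfields (climb x) = climb (nfields x)" for x :: "('m, 'a) loc"
   by (simp add: climb_def nfields_Dx nfields_susy)
  thus "hom fldeg (int k) ((climb ^^ Suc j) P)" using Suc(3) by (simp add: hom_num)
  show "lorentz_op \<Lambda> ((climb ^^ Suc j) P) = 0" using Suc(4) by (simp add: lor_climb)
 qed (simp_all add: ghost_invariant_gradings[OF P])
 note h = this
 show "hom fdeg (int CARD('m)) (ladder P)" "hom gh (int k - int CARD('m)) (ladder P)" "lorentz_op \<Lambda> (ladder P) = 0"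
  unfolding ladder_def using h by (auto intro: hom_smult)
 have "hom fldeg (int k) (ladder P)" unfolding ladder_def using h by (intro hom_smult)
 thus "fielded (ladder P)" if "k > 0" unfolding fielded_def using that by (intro comp_hom_other) auto
 have "Dtot T (expZ (-1) P) = 0"
  by (simp add: Dtot_expZ ghost_invariant_gradings(6)[OF P])
 have "(-1) ^ CARD('m) *: coboundary T (ladder P) = - dext (gpart fdeg (int CARD('m) - 1) (expZ (-1) P))"
  using gpart_Dtot[of "int CARD('m)" T "expZ (-1) P"] \<open>Dtot T (expZ (-1) P) = 0\<close>
  by (simp add: ladder_eq[OF P] add_eq_0_iff2)
 from arg_cong[OF this, of "\<lambda>z. (-1) ^ CARD('m) *: z"]
 have "coboundary T (ladder P) = dext (- ((-1) ^ CARD('m) *: gpart fdeg (int CARD('m) - 1) (expZ (-1) P)))"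
  by (simp flip: mult_2)
 thus "coboundary T (ladder P) \<simeq> 0"
  unfolding eq_functional_def using field_free_lin(1) by (metis add.right_neutral diff_zero)
qed

text \<open>The field-independent part is split off before \<open>top_exact\<close> supplies a
  primitive of controlled degree and invariance.\<close>

lemma functional_exact:
 fixes W :: "('m::finite, 'a) loc"
 assumes "hom fdeg (int CARD('m)) W" "good \<Lambda>s k W" "W = dext \<eta> + z" "field_free z"
 shows "\<exists>\<xi>. hom fdeg (int CARD('m) - 1) \<xi> \<and> good \<Lambda>s (k - 1) \<xi> \<and> field_free (W - dext \<xi>)"
proof -
 let ?V = "W - free_part W"
 have "?V \<in> forms \<Lambda>s (int CARD('m)) k"
  using assms(1,2) good_free_part[OF assms(2)] by (auto simp: good_lin intro: hom_diff hom_gpart)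
 moreover have "?V = dext \<eta> + (z - free_part W)" using assms(3) by simp
 ultimately obtain \<xi> where \<xi>: "\<xi> \<in> forms \<Lambda>s (int CARD('m)) k" "?V = dext (khop \<xi>)"
  using top_exact[OF _ _ field_free_lin(3)[OF assms(4) field_free_part]] by blast
 have "W - dext (khop \<xi>) = free_part W" by (simp add: \<xi>(2)[symmetric])
 thus ?thesis using form.hom_khop[of "int CARD('m)" \<xi>] good_tdeg(3)[of \<Lambda>s k \<xi>] \<xi>(1)
  by (intro exI[of _ "khop \<xi>"]) simp
qed

lemma closed_descent:
 fixes R :: "('m::finite, 'a) loc"
 assumes "Dtot T R = 0" "good \<Lambda>s k R" "field_free (gpart fdeg (int CARD('m)) R)"
 shows "\<exists>y. field_free (R - Dtot T y) \<and> good \<Lambda>s (k - 1) y \<and> (\<forall>j\<ge>int CARD('m). gpart fdeg j y = 0)"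
proof -
 let ?R = "R - free_part R"
 have top: "gpart fdeg j ?R = 0" if "j \<ge> int CARD('m)" for j
 proof (cases "j = int CARD('m)")
  case True
  have "free_part (gpart fdeg (int CARD('m)) R) = gpart fdeg (int CARD('m)) R" using assms(3) by (simp add: field_free_hom comp_hom)
  thus ?thesis unfolding True by (simp add: gpart_gpart_comm[of fdeg _ fldeg])
 qed (use that in \<open>simp add: gpart_top\<close>)
 have "field_free (Dtot T ?R)"
  using field_free_Dtot[OF field_free_part, of T R] assms(1) by (simp add: field_free_lin)
 from descent[OF fielded_compl top order_refl _ this, of \<Lambda>s k] assms(2) good_free_part[OF assms(2)]
 obtain y z where y: "?R = Dtot T y + z" "field_free z" "good \<Lambda>s (k - 1) y" "\<And>j. j \<ge> int CARD('m) \<Longrightarrow> gpart fdeg j y = 0"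
  by (auto simp: good_lin)
 have "R - Dtot T y = z + free_part R" using y(1) by (simp add: algebra_simps)
 thus ?thesis using y(2-4) by (intro exI[of _ y]) (simp add: field_free_lin)
qed

text \<open>If the ladder over P were a coboundary, e^(-Z) P would agree in top degree with an image
  of \<open>Dtot\<close>, up to field-independent terms. Descent extends this to all form degrees,
  conjugation turns it into P being \<open>D0\<close> of something up to such terms, and
  \<open>exact_invariant_zero\<close> applies after restriction to weight 0.\<close>

lemma ladder_not_exact:
 fixes P \<Delta> :: "('m::finite, 'a) loc"
 assumes P: "ghost_invariant k P" "k > 0"
  and \<Delta>: "hom fdeg (int CARD('m)) \<Delta>" "fielded \<Delta>" "hom gh (int k - int CARD('m) - 1) \<Delta>"
  and ex: "coboundary T \<Delta> \<simeq> ladder P"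
 shows "P = 0"
proof -
 let ?D = "int CARD('m)" and ?c = "(-1) ^ CARD('m) :: complex" and ?L = "ladder P"
 obtain \<eta> z where z: "field_free z" "coboundary T \<Delta> = ?L + dext \<eta> + z" using ex unfolding eq_functional_iff by blast
 have cc: "?c * ?c = 1" by (simp add: power_add[symmetric])
 have gL: "good {} (int k) ?L" "good {} (int k - 1) \<Delta>"
  using ladder_cocycle(1,2)[OF P(1)] \<Delta>(1,3) hom_gh_tdeg[of ?D ?L] hom_gh_tdeg[of ?D \<Delta>] by (auto simp: good_def)
 let ?W = "coboundary T \<Delta> - ?L" and ?x = "expZ (-1) P"
 have "good {} (int k) ?W" using good_tdeg(6)[OF gL(2), of T] gL(1) by (simp add: good_lin)
 moreover have "hom fdeg ?D ?W"
  using form.hom_coboundary[OF \<Delta>(1), of T] ladder_cocycle(1)[OF P(1)] by (auto intro: hom_diff)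
 ultimately obtain e where e: "hom fdeg (?D - 1) e" "good {} (int k - 1) e" "field_free (?W - dext e)"
  using functional_exact[of ?W "{}" "int k" \<eta> z] z by auto
 \<comment> \<open>The factor \<open>?c\<close> matches the sign of the top form of
   \<open>expZ (-1) P\<close> in \<open>ladder_eq\<close>; with the correction \<open>e\<close> the
   top component of \<open>R\<close> is field-independent.\<close>
 define R where "R = ?x - ?c *: Dtot T (\<Delta> - e)"
 have x0: "Dtot T ?x = 0" by (simp add: Dtot_expZ ghost_invariant_gradings(6)[OF P(1)])
 have gx: "good {} (int k) ?x"
  using ghost_invariant_gradings(1,2)[OF P(1)] hom_gh_tdeg[of 0 P "int k"] by (intro good_tdeg) (simp add: good_def)
 have gR: "good {} (int k) R"
  unfolding R_def using gx good_tdeg(7)[of "{}" "int k - 1" "\<Delta> - e" T] gL(2) e(2) by (intro good_lin) (simp_all add: good_lin)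
 have "gpart fdeg ?D R = - (?c *: (?W - dext e))"
  unfolding R_def using \<Delta>(1) e(1)
  by (simp del: Dtot_lin add: gpart_Dtot comp_hom_if ladder_eq[OF P(1)] smult_dist algebra_simps)
 hence "field_free (gpart fdeg ?D R)" by (simp add: field_free_lin e(3))
 moreover have "Dtot T R = 0" unfolding R_def by (simp add: x0 Dtot_Dtot)
 ultimately obtain y where y: "field_free (R - Dtot T y)" using closed_descent[OF _ gR] by blast
 define Y where "Y = expZ 1 (y + ?c *: (\<Delta> - e))"
 have x: "?x = Dtot T (y + ?c *: (\<Delta> - e)) + (R - Dtot T y)" by (simp add: R_def)
 have "P = expZ 1 ?x" by (simp add: expZ_inverse)
 hence "P = D0 T Y + (R - Dtot T y)"
  unfolding Y_def D0_expZ x by (simp only: lin_add[OF lin_expZ] field_free_ops(4)[OF y])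
 from arg_cong[OF this, of "gpart jdeg 0"]
 have PY: "P = D0 T (gpart jdeg 0 Y) + gpart jdeg 0 (R - Dtot T y)"
  using ghost_invariant_gradings(7)[OF P(1)] by (simp add: D0_gpart comp_hom hom_jet_weight_0)
 let ?u = "gpart jdeg 0 Y"
 have fP: "fielded P" unfolding fielded_def using ghost_invariant_gradings(3)[OF P(1)] P(2) by (intro comp_hom_other) auto
 have "field_free (P - D0 T (?u - free_part ?u))"
 proof -
  have "P - D0 T (?u - free_part ?u) = gpart jdeg 0 (R - Dtot T y) + D0 T (free_part ?u)"
   using PY by (simp add: algebra_simps)
  moreover have "field_free (gpart jdeg 0 (R - Dtot T y))"
   by (intro field_free_gpart y)
  ultimately show ?thesis by (simp del: D0_lin add: field_free_lin field_free_ops)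
 qed
 moreover have "fielded (P - D0 T (?u - free_part ?u))" by (intro fielded_lin fP fielded_D0 fielded_compl)
 ultimately have "P - D0 T (?u - free_part ?u) = 0" by (intro fielded_free)
 hence "P = D0 T (?u - free_part ?u)" by simp
 moreover have "ghost_alg ?u" by (simp add: hom_jet_weight_0[symmetric] hom_comp)
 hence "ghost_alg (?u - free_part ?u)" by (intro over_diff) (auto simp: gpart_def[of fldeg] intro: over_flt)
 ultimately show ?thesis using exact_invariant_zero[of P "?u - free_part ?u"] P(1) by (auto simp: ghost_invariant_def)
qed

end

lemma coboundary_dext:
 assumes "gauge_algebra T" "hom fdeg p (x :: ('m::finite, 'a::finite) loc)"
 shows "coboundary T (dext x) = - dext (coboundary T x)"
proof -
 have "gpart fdeg (p + 1) (Dtot T (Dtot T x)) = coboundary T (dext x) + dext (coboundary T x)"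
  using assms(2) by (simp add: gpart_Dtot comp_hom_if)
 thus ?thesis by (simp add: gauge_algebra.Dtot_Dtot[OF assms(1)] add_eq_0_iff2)
qed

lemma hom_jet_lor: "hom jdeg k x \<Longrightarrow> hom jdeg k (lorentz_op \<Lambda> (x :: ('m::finite, 'a::finite) loc))"
proof -
 have "lorentz_op \<Lambda> (num jdeg x) = num jdeg (lorentz_op \<Lambda> x)"
  by (rule lor_num[of _ 1 1]) (simp_all add: num_susy num_tderiv jdeg_def)
 thus "hom jdeg k x \<Longrightarrow> hom jdeg k (lorentz_op \<Lambda> x)" by (simp add: hom_num)
qed

lemma good_inv_weight: "good \<Lambda>s k x \<Longrightarrow> good \<Lambda>s k (inv_weight (x :: ('m::finite, 'a::finite) loc))"
proof -
 assume g: "good \<Lambda>s k x"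
 from inv_weight_comm[OF drv_lin[OF drv_lor] hom_jet_lor] have "lorentz_op \<Lambda> (inv_weight x) = inv_weight (lorentz_op \<Lambda> x)" for \<Lambda> .
 moreover have "hom tdeg k (inv_weight x)" using g by (auto simp: good_def hom_def inv_weight_def supp_iff)
 ultimately show ?thesis using g by (auto simp: good_def inv_weight_def diag_simps)
qed

lemma good_jet_part: "good \<Lambda>s k x \<Longrightarrow> good \<Lambda>s k (gpart jdeg l (x :: ('m::finite, 'a::finite) loc))"
proof -
 assume g: "good \<Lambda>s k x"
 have "lorentz_op \<Lambda> (gpart jdeg l x) = gpart jdeg (l + 0) (lorentz_op \<Lambda> x)" for \<Lambda>
  by (rule lin_comp_comm[OF drv_lin[OF drv_lor]]) (simp add: hom_jet_lor)
 thus ?thesis using g by (auto simp: good_def intro: hom_gpart)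
qed

text \<open>The representative in the kernel of \<open>Xiop\<close> is strictly invariant, and
  descent completes it to a total form closed up to field-independent terms. Conjugated and
  contracted, it is a cocycle in dx, c and B_0, whose invariant part involves c alone up to
  field-independent terms. After the conjugation is undone, the top form shows the ladder with the
  sign of \<open>ladder_eq\<close>.\<close>

lemma (in gauge_algebra) cocycle_classification:
 fixes \<Delta> :: "('m::finite, 'a) loc"
 assumes dim: "CARD('m) = n + 2" "n \<ge> 1" and G: "G \<in> {0, 1 :: nat}" "G = 0 \<longrightarrow> n \<ge> 3" and \<eta>: "\<And>\<mu>. \<eta> \<mu> \<in> {-1, 1}"
  and inv: "\<And>\<omega> :: ('m, 'a) loc. c_invariant T (n + 2 + G) \<omega> \<Longrightarrow> \<exists>\<alpha>. \<omega> = trace_superposition T (n + 2 + G) \<alpha>"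
  and \<Delta>: "hom fdeg (int CARD('m)) \<Delta>" "fielded \<Delta>" "\<And>\<Lambda>. \<Lambda> \<in> lorentz_algebra \<eta> \<Longrightarrow> lorentz_op \<Lambda> \<Delta> \<simeq> 0"
   "hom gh (int G) \<Delta>" "coboundary T \<Delta> \<simeq> 0"
 shows "\<exists>\<alpha> \<Delta>'. hom fdeg (int CARD('m)) \<Delta>' \<and> fielded \<Delta>' \<and> hom gh (int G - 1) \<Delta>' \<and>
  (\<forall>\<Lambda>\<in>lorentz_algebra \<eta>. lorentz_op \<Lambda> \<Delta>' = 0) \<and>
  \<Delta> \<simeq> (-1) ^ CARD('m) *: ladder (trace_superposition T (n + 2 + G) \<alpha>) + coboundary T \<Delta>'"
proof -
 let ?D = "int CARD('m)" and ?K = "int (n + 2 + G)" and ?\<Lambda>s = "lorentz_algebra \<eta>"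
 note dl = dext_lin and cl = coboundary_lin and Dl = Dtot_lin
 \<comment> \<open>Only the degree is recorded at first: Lorentz invariance of
   \<open>\<Delta>\<close> is known merely modulo total derivatives.\<close>
 have "\<Delta> \<in> forms {} ?D ?K"
  using \<Delta>(1,2,4) hom_gh_tdeg[OF \<Delta>(1), of "int G"] dim(1) by (simp add: good_def algebra_simps)
 hence "\<exists>x0\<in>forms {} ?D ?K. \<exists>x1\<in>forms {} ?D ?K. \<Delta> = x0 + dext (khop x1) \<and> Xiop x0 = 0"
  by (intro top_decomposition[OF _ _ inv_space_forms]) auto
 then obtain x x1 where x: "x \<in> forms {} ?D ?K" "x1 \<in> forms {} ?D ?K" "\<Delta> = x + dext (khop x1)" "Xiop x = 0" by blast
 \<comment> \<open>The Lorentz variation of \<open>x\<close> is exact and lies in the kernel of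
   \<open>Xiop\<close>, which commutes with \<open>lorentz_op\<close>; such a top form is
   zero.\<close>
 have lor0: "lorentz_op \<Lambda> x = 0" if \<Lambda>: "\<Lambda> \<in> ?\<Lambda>s" for \<Lambda>
 proof -
  obtain \<eta>' z where z: "field_free z" "lorentz_op \<Lambda> \<Delta> = dext \<eta>' + z" using \<Delta>(3)[OF \<Lambda>] unfolding eq_functional_iff by auto
  have f: "fielded (lorentz_op \<Lambda> x)" using x(1) by (simp add: fielded_def lor_free_part[symmetric])
  have "lorentz_op \<Lambda> x = lorentz_op \<Lambda> \<Delta> - dext (lorentz_op \<Lambda> (khop x1))" using x(3) by (simp add: lor_dext)
  hence "lorentz_op \<Lambda> x = dext (\<eta>' - lorentz_op \<Lambda> (khop x1)) + z" unfolding z(2) by (simp add: dl)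
  from fielded_exact[OF f this z(1)] have e: "lorentz_op \<Lambda> x = dext (\<eta>' - lorentz_op \<Lambda> (khop x1))" .
  have "hom fdeg ?D (lorentz_op \<Lambda> x)" using x(1) by (simp add: hom_num form.lor_num_w[symmetric])
  thus ?thesis by (rule exact_top_zero[OF f _ _ e]) (simp add: lor_Xiop[symmetric] x(4))
 qed
 have hx: "hom fdeg ?D x" using x(1) by simp
 have gx: "good ?\<Lambda>s ?K x" using x(1) lor0 by (simp add: good_def)
 let ?c = "coboundary T x"
 have gc: "good ?\<Lambda>s (?K + 1) ?c" by (rule good_tdeg(6)[OF gx])
 obtain \<eta>' z where z: "field_free z" "coboundary T \<Delta> = dext \<eta>' + z" using \<Delta>(5) unfolding eq_functional_iff by auto
 have hx1: "hom fdeg (?D - 1) (khop x1)" using form.hom_khop[of ?D x1] x(2) by simp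
 have "?c = coboundary T \<Delta> - coboundary T (dext (khop x1))" using x(3) by (simp add: cl)
 hence "?c = dext (\<eta>' + coboundary T (khop x1)) + z"
  unfolding z(2) coboundary_dext[OF gauge_algebra_axioms hx1] by simp
 from functional_exact[OF _ gc this z(1)] form.hom_coboundary[OF hx, of T]
 obtain e where e: "hom fdeg (?D - 1) e" "good ?\<Lambda>s ?K e" "field_free (?c - dext e)" by auto
 \<comment> \<open>In top degree \<open>x - e\<close> is closed up to field-independent terms.
   Descent corrects the lower components by \<open>y\<close>, which has no top component, so that
   \<open>x\<close> is kept.\<close>
 define R where "R = Dtot T (x - e)"
 have gR: "good ?\<Lambda>s (?K + 1) R" unfolding R_def by (intro good_tdeg good_lin gx e(2))
 have "gpart fdeg ?D R = ?c - dext e"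
  unfolding R_def by (simp del: Dtot_lin add: gpart_Dtot comp_hom_if[OF hx] comp_hom_if[OF e(1)])
 moreover have "Dtot T R = 0" by (simp add: R_def Dtot_Dtot)
 ultimately obtain y where y: "field_free (R - Dtot T y)" "good ?\<Lambda>s ?K y" "\<And>j. j \<ge> ?D \<Longrightarrow> gpart fdeg j y = 0"
  using closed_descent[OF _ gR] e(3) by auto
 let ?x = "x - e - y"
 have fx: "field_free (Dtot T ?x)" using y(1) by (simp add: R_def)
 have top_x: "gpart fdeg ?D ?x = x" using y(3)[of ?D] by (simp add: comp_hom_if[OF hx] comp_hom_if[OF e(1)])
 define w where "w = expZ 1 ?x"
 have gw: "good ?\<Lambda>s ?K w" unfolding w_def by (intro good_tdeg good_lin gx e(2) y(2))
 have Dw: "field_free (D0 T w)" unfolding w_def D0_expZ using field_free_ops(4)[OF fx] fx by simp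
 let ?w0 = "gpart jdeg 0 w"
 \<comment> \<open>Removing the field-independent part turns closedness up to such terms into
   \<open>D0 T ?v = 0\<close>, since \<open>D0\<close> respects the separation.\<close>
 let ?v = "?w0 - free_part ?w0"
 have "ghost_alg ?w0" by (simp add: hom_jet_weight_0[symmetric] hom_comp)
 hence ga: "ghost_alg ?v" by (intro over_diff) (auto simp: gpart_def[of fldeg] intro: over_flt)
 have gv: "good ?\<Lambda>s ?K ?v" using good_jet_part[OF gw, of 0] good_free_part by (intro good_lin) auto
 have "field_free (D0 T ?v)"
  using Dw by (simp add: D0_gpart field_free_lin field_free_gpart field_free_ops(2)[OF ])
 hence Dv: "D0 T ?v = 0" by (intro fielded_free fielded_D0 fielded_compl)
 obtain \<omega> y0 where \<omega>: "?v = \<omega> + D0 T y0" "ghost_alg \<omega>" "good ?\<Lambda>s ?K \<omega>" "good ?\<Lambda>s (?K - 1) y0" "\<And>A e. rot T A e \<omega> = 0"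
  using closed_invariant[OF ga gv Dv] by blast
 let ?P = "\<omega> - free_part \<omega>"
 have r: "rot T A e ?P = 0" for A e by (simp add: \<omega>(5) gpart_rot)
 have gP: "ghost_alg ?P" using \<omega>(2) by (intro over_diff) (auto simp: gpart_def[of fldeg] intro: over_flt)
 have goodP: "good ?\<Lambda>s ?K ?P" using \<omega>(3) good_free_part by (intro good_lin) auto
 have zero: "z = 0" if "n = 1" "over (range (fld One)) z" "hom (fw One) 4 z" "\<And>e. rot T One e z = 0" for z :: "('m, 'a) loc"
 proof -
  have "G = 1" using that(1) G by auto
  have "c_invariant T 4 z" by (rule c_invariant_ghost) (use that in \<open>simp add: ghost_invariant_def\<close>)
  thus ?thesis using inv[of z] \<open>G = 1\<close> that(1) trace_superposition_4 by (auto simp: numeral_eq_Suc)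
 qed
 have "over (range (fld One)) ?P" "hom (fw One) ?K ?P"
  by (rule invariants_are_ghosts[OF dim G \<eta> gP goodP r fielded_compl zero], assumption+)+
 hence "ghost_invariant (n + 2 + G) ?P" using r unfolding ghost_invariant_def by blast
 note gi = this
 obtain \<alpha> where \<alpha>: "?P = trace_superposition T (n + 2 + G) \<alpha>" using inv[OF c_invariant_ghost[OF gi]] by blast
 let ?h = "hop (inv_weight w)"
 \<comment> \<open>All field-independent leftovers; they are fixed by \<open>expZ\<close> and
   disappear in the equality of functionals.\<close>
 define zz where "zz = free_part \<omega> + free_part ?w0 + hop (inv_weight (D0 T w))"
 have "field_free (inv_weight (D0 T w))" using Dw by (auto simp: field_free_def inv_weight_def supp_iff)
 hence zz: "field_free zz" unfolding zz_def by (intro field_free_lin field_free_part field_free_ops)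
 define Y where "Y = expZ (-1) (y0 + ?h)"
 have gY: "good ?\<Lambda>s (?K - 1) Y" unfolding Y_def by (intro good_tdeg good_lin \<omega>(4) good_inv_weight gw)
 have "w = ?w0 + D0 T ?h + hop (inv_weight (D0 T w))" by (rule contraction)
 also have "?w0 = ?P + free_part \<omega> + D0 T y0 + free_part ?w0" using \<omega>(1) by (simp add: algebra_simps)
 finally have we: "w = ?P + D0 T (y0 + ?h) + zz" by (simp add: zz_def algebra_simps)
 have "?x = expZ (-1) w" by (simp only: w_def expZ_inverse)
 also have "\<dots> = expZ (-1) (?P + D0 T (y0 + ?h) + zz)" by (rule arg_cong[OF we])
 also have "\<dots> = expZ (-1) ?P + expZ (-1) (D0 T (y0 + ?h)) + zz"
  by (simp only: lin_add[OF lin_expZ] field_free_ops(4)[OF zz])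
 also have "expZ (-1) (D0 T (y0 + ?h)) = Dtot T Y" unfolding Y_def by (rule Dtot_expZ[symmetric])
 finally have "?x = expZ (-1) ?P + Dtot T Y + zz" .
 from arg_cong[OF this, of "gpart fdeg ?D"]
 have xe: "x = (-1) ^ CARD('m) *: ladder ?P + coboundary T (gpart fdeg ?D Y) + dext (gpart fdeg (?D - 1) Y) + gpart fdeg ?D zz"
  by (simp only: top_x comp_simps(1) ladder_eq[OF gi] gpart_Dtot add.assoc)
 let ?u = "gpart fdeg ?D Y"
 let ?\<Delta> = "?u - free_part ?u"
 have gu: "good ?\<Lambda>s (?K - 1) ?\<Delta>" using form.good_gpart[OF gY, of ?D] good_free_part by (intro good_lin) auto
 have hu: "hom fdeg ?D ?\<Delta>" by (intro hom_diff hom_comp hom_gpart)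
 have "\<Delta> = ((-1) ^ CARD('m) *: ladder ?P + coboundary T ?\<Delta>) + dext (gpart fdeg (?D - 1) Y + khop x1) + (coboundary T (free_part ?u) + gpart fdeg ?D zz)"
  unfolding x(3) by (subst xe) (simp add: dl cl)
 moreover have "field_free (coboundary T (free_part ?u) + gpart fdeg ?D zz)"
  by (intro field_free_lin field_free_ops(3) field_free_part field_free_gpart zz)
 ultimately have "\<Delta> \<simeq> (-1) ^ CARD('m) *: ladder ?P + coboundary T ?\<Delta>" unfolding eq_functional_iff by blast
 moreover have "hom gh (int G - 1) ?\<Delta>" unfolding hom_gh_tdeg[OF hu] using gu dim(1) by (simp add: good_def algebra_simps)
 ultimately show ?thesis using gu hu unfolding \<alpha>[symmetric] good_def by (intro exI[of _ \<alpha>] exI[of _ ?\<Delta>]) (auto simp: \<alpha>)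
qed

theorem mainTheorem2:
  fixes T :: "'a::finite \<Rightarrow> complex^'N^'N"
    and \<eta> :: "'m::finite \<Rightarrow> real"
    and n G :: nat
  assumes dim: "CARD('m) = n + 2" "n \<ge> 1"
    and ghost: "G \<in> {0, 1}"
    and gauge: "simple_lie_basis T"
    and metric: "\<And>\<mu>. \<eta> \<mu> \<in> {-1, 1}"
  shows
    \<comment> \<open>every superposition is a cocycle of ghost number \<open>G\<close>\<close>
    "(\<forall>\<alpha>. let \<Delta> = (ladder_superposition T (n + 2 + G) \<alpha> :: ('m, 'a) loc) in
        local_functional \<eta> \<Delta> \<and> homogeneous_gh (int G) \<Delta> \<and> coboundary T \<Delta> \<simeq> 0) \<and>
    \<comment> \<open>and not a coboundary if the superposition of zero-forms does not vanish\<close>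
     (\<forall>\<alpha>. (trace_superposition T (n + 2 + G) \<alpha> :: ('m, 'a) loc) \<noteq> 0 \<longrightarrow>
        \<not> (\<exists>\<Delta>'' :: ('m, 'a) loc. local_functional \<eta> \<Delta>'' \<and> homogeneous_gh (int G - 1) \<Delta>'' \<and>
             coboundary T \<Delta>'' \<simeq> ladder_superposition T (n + 2 + G) \<alpha>)) \<and>
    \<comment> \<open>and every cocycle is such a superposition up to a coboundary, provided that the traces
      \<open>Tr c\<^sup>k\<close> generate the invariants of degree \<open>n + 2 + G\<close> (this fails e.g. in degree 7 for so(8)),
      and apart from the cases \<open>G = 0\<close>, \<open>n = 1, 2\<close>, where the top form in \<open>Tr (\<phi>\<^sup>(\<^sup>2\<^sup>) - v)\<^sup>4\<^sup>-\<^sup>n\<close>,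
      \<open>\<phi>\<^sup>(\<^sup>2\<^sup>)\<close> the sum of all \<open>\<phi>\<^sup>(\<^sup>2\<^sup>)\<^sub>p\<close>, is a further nontrivial cocycle\<close>
     ((\<forall>\<omega> :: ('m, 'a) loc. c_invariant T (n + 2 + G) \<omega> \<longrightarrow>
          (\<exists>\<alpha>. \<omega> = trace_superposition T (n + 2 + G) \<alpha>)) \<and>
      (G = 0 \<longrightarrow> n \<ge> 3) \<longrightarrow>
      (\<forall>\<Delta>' :: ('m, 'a) loc.
        local_functional \<eta> \<Delta>' \<and> homogeneous_gh (int G) \<Delta>' \<and> coboundary T \<Delta>' \<simeq> 0 \<longrightarrow>
        (\<exists>\<alpha> \<Delta>''. local_functional \<eta> \<Delta>'' \<and> homogeneous_gh (int G - 1) \<Delta>'' \<and>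
             \<Delta>' \<simeq> ladder_superposition T (n + 2 + G) \<alpha> + coboundary T \<Delta>'')))"
proof -
 interpret gauge_algebra T by unfold_locales (rule gauge)
 let ?k = "n + 2 + G"
 have k: "?k > 0" "int ?k - int CARD('m) = int G" using dim(1) by simp_all
 have inv: "ghost_invariant ?k (trace_superposition T ?k \<alpha> :: ('m, 'a) loc)" for \<alpha>
  by (rule ghost_invariant_superposition)
 have eq: "ladder_superposition T ?k \<alpha> = ladder (trace_superposition T ?k \<alpha> :: ('m, 'a) loc)" for \<alpha>
  by (simp add: ladder_superposition_eq ladder_def)
 have zero: "x \<simeq> 0" if "x = 0" for x :: "('m, 'a) loc"
  unfolding eq_functional_iff that by (intro exI[of _ 0]) (simp add: field_free_lin)
 have "local_functional \<eta> (ladder_superposition T ?k \<alpha> :: ('m, 'a) loc) \<and>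
   homogeneous_gh (int G) (ladder_superposition T ?k \<alpha> :: ('m, 'a) loc) \<and> coboundary T (ladder_superposition T ?k \<alpha> :: ('m, 'a) loc) \<simeq> 0" for \<alpha>
  unfolding eq local_functional_iff homogeneous_gh_iff
  by (intro conjI ballI zero ladder_cocycle[OF inv, unfolded k(2)] k(1))
 moreover have "\<not> (\<exists>\<Delta>'' :: ('m, 'a) loc. local_functional \<eta> \<Delta>'' \<and> homogeneous_gh (int G - 1) \<Delta>'' \<and>
   coboundary T \<Delta>'' \<simeq> ladder_superposition T ?k \<alpha>)"
  if "(trace_superposition T ?k \<alpha> :: ('m, 'a) loc) \<noteq> 0" for \<alpha>
  using ladder_not_exact[OF inv k(1), unfolded k(2)] that unfolding eq local_functional_iff homogeneous_gh_iff by blast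
 moreover have "\<exists>\<alpha> \<Delta>''. local_functional \<eta> \<Delta>'' \<and> homogeneous_gh (int G - 1) \<Delta>'' \<and>
   \<Delta>' \<simeq> ladder_superposition T ?k \<alpha> + coboundary T \<Delta>''"
  if hyp: "\<And>\<omega> :: ('m, 'a) loc. c_invariant T ?k \<omega> \<Longrightarrow> \<exists>\<alpha>. \<omega> = trace_superposition T ?k \<alpha>" "G = 0 \<longrightarrow> n \<ge> 3"
   and \<Delta>: "local_functional \<eta> \<Delta>'" "homogeneous_gh (int G) \<Delta>'" "coboundary T \<Delta>' \<simeq> 0" for \<Delta>' :: "('m, 'a) loc"
 proof -
  have D: "hom fdeg (int CARD('m)) \<Delta>'" "fielded \<Delta>'" "\<And>\<Lambda>. \<Lambda> \<in> lorentz_algebra \<eta> \<Longrightarrow> lorentz_op \<Lambda> \<Delta>' \<simeq> 0" "hom gh (int G) \<Delta>'"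
   using \<Delta>(1,2) unfolding local_functional_iff homogeneous_gh_iff by auto
  have "\<exists>\<alpha> \<Delta>''. hom fdeg (int CARD('m)) \<Delta>'' \<and> fielded \<Delta>'' \<and> hom gh (int G - 1) \<Delta>'' \<and>
    (\<forall>\<Lambda>\<in>lorentz_algebra \<eta>. lorentz_op \<Lambda> \<Delta>'' = 0) \<and>
    \<Delta>' \<simeq> (-1) ^ CARD('m) *: ladder (trace_superposition T ?k \<alpha>) + coboundary T \<Delta>''"
   by (rule cocycle_classification[OF dim ghost hyp(2) metric hyp(1) D(1,2) D(3) D(4) \<Delta>(3)], assumption+)
  then obtain \<alpha> \<Delta>'' where d: "hom fdeg (int CARD('m)) \<Delta>''" "fielded \<Delta>''" "hom gh (int G - 1) \<Delta>''"
   "\<And>\<Lambda>. \<Lambda> \<in> lorentz_algebra \<eta> \<Longrightarrow> lorentz_op \<Lambda> \<Delta>'' = 0"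
   "\<Delta>' \<simeq> (-1) ^ CARD('m) *: ladder (trace_superposition T ?k \<alpha>) + coboundary T \<Delta>''"
   by blast
  \<comment> \<open>The sign from \<open>ladder_eq\<close> is absorbed into the
    coefficients.\<close>
  have "\<Delta>' \<simeq> ladder_superposition T ?k (\<lambda>ns. (-1) ^ CARD('m) * \<alpha> ns) + coboundary T \<Delta>''"
   using d(5) unfolding ladder_superposition_scale eq .
  thus ?thesis using d(1-4) zero unfolding local_functional_iff homogeneous_gh_iff by blast
 qed
 ultimately show ?thesis unfolding Let_def by blast
qed

end
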